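(* In the setting described in the context, fix $0<\gamma<\sqrt{2d}$ and suppose that the exponential moment conditions (A1)–(A8) of the context hold for this $\gamma$ with some sequence $\epsilon_N\to0$. Then for any $f\in C_c(\Omega)$, the law of $\int_\Omega f(x)\frac{e^{\gamma X(x)}}{\mathbb E_Ne^{\gamma X(x)}}dx$ under $\mathbb P_N$ converges, as $N\to\infty$, to the law of $\int_\Omega f\,d\mu^\gamma$.
   Context: $\Omega\subset\mathbb R^d$ is a bounded, simply connected open set with smooth boundary. $\Sigma(x,y)=\log|x-y|^{-1}+g(x,y)$ on $\Omega\times\Omega$ is symmetric positive definite with $g$ continuous, bounded above and in $L^2(\Omega\times\Omega)$. $\mathbb P$ is the law of the centered Gaussian log-correlated field $X$ (a random element of $H^{-\epsilon}(\mathbb R^d)$) with covariance $\Sigma$. Fix a nonnegative radially symmetric compactly supported smooth $\varphi$ with $\int\varphi=1$, $\varphi_\epsilon(x)=\epsilon^{-d}\varphi(x/\epsilon)$, $X_\epsilon=X*\varphi_\epsilon$ for $\epsilon>0$ and $X_0:=X$; Gaussian covariances such as $\mathbb EX_\epsilon(x)X_{\epsilon'}(y)$ are computed from $\Sigma$ (e.g. $\mathbb EX(x)X(y)=\Sigma(x,y)$, $\mathbb EX(x)X_\eta(y)=\int\Sigma(x,u)\varphi_\eta(y-u)du$). For $|\gamma|<\sqrt{2d}$ and $f\in C_c(\Omega)$, $\int fe^{\gamma X_\epsilon-\frac{\gamma^2}2\mathbb EX_\epsilon^2}dx$ converges in $L^1(\mathbb P)$ as $\epsilon\to0$ to a limit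 independent of $\varphi$, and $\mu^\gamma$ is the random measure with $\int fd\mu^\gamma$ equal to this limit (Gaussian multiplicative chaos). For each $N$, $\mathbb P_N$ (expectation $\mathbb E_N$) is a probability measure under which the canonical process $X$ is a random function that is integrable, bounded above, upper semicontinuous on $\Omega$, with $\mathbb E_Ne^{\alpha X(x)}<\infty$ and $\mathbb E_Ne^{\int X f}<\infty$ for all $\alpha>0$, $x\in\Omega$, $f\in C_c^\infty(\Omega)$, and such that for each $f\in C_c^\infty(\Omega)$ the law of $\int fX$ under $\mathbb P_N$ converges to its law under $\mathbb P$; $X_\epsilon=X*\varphi_\epsilon$ under $\mathbb P_N$ as well. Write $W_N^{\epsilon,\epsilon'}(x,y)=\frac{\mathbb E_Ne^{\gamma X_\epsilon(x)+\gamma X_{\epsilon'}(y)}}{\mathbb E_Ne^{\gamma X_\epsilon(x)}\mathbb E_Ne^{\gamma X_{\epsilon'}(y)}}$. $A\ll B$ means $0\le A\le CB$ for a constant $C$ (which may depend on $\gamma,d$ and the fixed parameters). Conditions: (A1) for fixed $\epsilon,\epsilon'\ge0$, $W_N^{\epsilon,\epsilon'}(x,y)\to e^{\gamma^2\mathbb EX_\epsilon(x)X_{\epsilon'}(y)}$ uniformly on compact subsets of $\{(u,v)\in\Omega^2:u\ne v\}$. (A2) For fixed $\epsilon\ge0,\epsilon'>0$, compact $K\subset\Omega$: $\sup_N\sup_{x,y\in K}W_N^{\epsilon,\epsilon'}(x,y)<\infty$. (A3) $W_N^{0,0}(x,y)\ll|x-y|^{-\gamma^2}$ uniformly for $(x,y)$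 in a compact subset of $\Omega^2$ with $|x-y|\ge\epsilon_N$. (A4) For fixed $\rho>0$, $\epsilon,\epsilon'\ge0$, $n\in\mathbb N$, $t\in\mathbb R^n$: $\frac{\mathbb E_N[e^{\gamma X_\epsilon(x)+\gamma X_{\epsilon'}(y)}e^{\sum_kt_kX_{\eta_k}(z_k)}]}{\mathbb E_N[e^{\gamma X_\epsilon(x)+\gamma X_{\epsilon'}(y)}]}=(1+o(1))\exp\big(\sum_k\gamma t_k(\mathbb EX_\epsilon(x)X_{\eta_k}(z_k)+\mathbb EX_{\epsilon'}(y)X_{\eta_k}(z_k))+\frac12\mathbb E(\sum_kt_kX_{\eta_k}(z_k))^2\big)$ uniformly for $\eta\in(\epsilon_N,1]^n$, $z$ in a compact subset of $\Omega^n$, $(x,y)$ in a compact subset of $\{|u-v|\ge\rho\}$. (A5) For $\lambda\in\mathbb R$: $\mathbb E_N[e^{\gamma X(x)+\lambda X_\epsilon(x)}]/\mathbb E_N[e^{\gamma X(x)}]\ll\epsilon^{-\lambda(\lambda+2\gamma)/2}$ uniformly for $\epsilon\ge\epsilon_N$ and $x$ in compact subsets. (A6) For fixed $\epsilon\ge0$, $\epsilon'>0$ with $\epsilon'\ge\epsilon$, and $\lambda\in\mathbb R$: $\limsup_N\frac{\mathbb E_Ne^{\gamma X_\epsilon(x)+\gamma X_{\epsilon'}(y)+\lambda X_\eta(y)}}{\mathbb E_Ne^{\gamma X_\epsilon(x)+\gamma X_{\epsilon'}(y)}}\ll e^{\frac{\lambda^2}2\mathbb EX_\eta(y)^2+\lambda\gamma\mathbb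 EX_\epsilon(x)X_\eta(y)+\lambda\gamma\mathbb EX_{\epsilon'}(y)X_\eta(y)}$ uniformly for $\eta\ge\epsilon'$ and $(x,y)$ in a compact subset of $\Omega^2$, with constant independent of $\epsilon,\epsilon'$. (A7) For fixed $\lambda$: $\frac{\mathbb E_Ne^{\gamma X(x)+\gamma X(y)+\lambda X_\eta(x)}}{\mathbb E_Ne^{\gamma X(x)+\gamma X(y)}}\ll e^{\frac{\lambda^2}2\mathbb EX_\eta(x)^2+\lambda\gamma\mathbb EX(x)X_\eta(x)+\lambda\gamma\mathbb EX(y)X_\eta(x)}$ uniformly for $\eta\ge\epsilon_N$ and $(x,y)$ in compact subsets of $\Omega^2$. (A8) There is $0<\tau<\min\big(\frac{(d-\gamma^2/2)^2}{4d},\frac{\gamma^2}2\big)$ such that for every compact $A\subset\Omega^2$, $\iint_A\mathbf 1_{|x-y|\le\epsilon_N}W_N^{0,0}(x,y)dxdy\ll_A\epsilon_N^{-(\gamma^2-d)_+-\tau}$. *)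

theory Defs
  imports "HOL-Analysis.Analysis" "HOL-Probability.Probability"
begin

primrec Ck :: "nat \<Rightarrow> 'a::euclidean_space set \<Rightarrow> ('a \<Rightarrow> real) \<Rightarrow> bool" where
  "Ck 0 U f = continuous_on U f"
| "Ck (Suc k) U f = ((\<forall>x\<in>U. f differentiable (at x)) \<and>
      (\<forall>i\<in>Basis. Ck k U (\<lambda>x. frechet_derivative f (at x) i)))"

definition C_inf :: "'a::euclidean_space set \<Rightarrow> ('a \<Rightarrow> real) \<Rightarrow> bool" where
  "C_inf U f \<longleftrightarrow> (\<forall>k. Ck k U f)"

definition supp :: "('a::euclidean_space \<Rightarrow> real) \<Rightarrow> 'a set" where
  "supp f = closure {x. f x \<noteq> 0}"

definition Cc :: "'a::euclidean_space set \<Rightarrow> ('a \<Rightarrow> real) \<Rightarrow> bool" where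
  "Cc U f \<longleftrightarrow> continuous_on UNIV f \<and> compact (supp f) \<and> supp f \<subseteq> U"

definition Cc_inf :: "'a::euclidean_space set \<Rightarrow> ('a \<Rightarrow> real) \<Rightarrow> bool" where
  "Cc_inf U f \<longleftrightarrow> C_inf UNIV f \<and> compact (supp f) \<and> supp f \<subseteq> U"

definition smooth_boundary :: "'a::euclidean_space set \<Rightarrow> bool" where
  "smooth_boundary \<Omega> \<longleftrightarrow> (\<forall>p\<in>frontier \<Omega>. \<exists>r>0. \<exists>\<rho>. C_inf (ball p r) \<rho> \<and>
      (\<forall>x\<in>ball p r. frechet_derivative \<rho> (at x) \<noteq> (\<lambda>_. 0)) \<and>
      \<Omega> \<inter> ball p r = {x\<in>ball p r. \<rho> x < 0})"

definition usc_on :: "'a::euclidean_space set \<Rightarrow> ('a \<Rightarrow> real) \<Rightarrow> bool" where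
  "usc_on U f \<longleftrightarrow> (\<forall>x\<in>U. \<forall>c. f x < c \<longrightarrow> (\<exists>r>0. \<forall>y\<in>ball x r \<inter> U. f y < c))"

definition Sig :: "('a::euclidean_space \<Rightarrow> 'a \<Rightarrow> real) \<Rightarrow> 'a \<Rightarrow> 'a \<Rightarrow> real" where
  "Sig g x y = ln (1 / norm (x - y)) + g x y"

definition phi_eps :: "('a::euclidean_space \<Rightarrow> real) \<Rightarrow> real \<Rightarrow> 'a \<Rightarrow> real" where
  "phi_eps \<phi> \<epsilon> x = \<phi> (x /\<^sub>R \<epsilon>) / \<epsilon> ^ DIM('a)"

text \<open>E <f,X><h,X> for the Gaussian field (X supported in the closure of Omega).\<close>
definition field_cov :: "'a::euclidean_space set \<Rightarrow> ('a \<Rightarrow> 'a \<Rightarrow> real) \<Rightarrow> ('a \<Rightarrow> real) \<Rightarrow> ('a \<Rightarrow> real) \<Rightarrow> real" where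
  "field_cov \<Omega> g f h = (LINT u:\<Omega>|lborel. LINT v:\<Omega>|lborel. f u * Sig g u v * h v)"

text \<open>cov \<Omega> g \<phi> e x e' y = E X_e(x) X_e'(y), computed from Sigma (X_0 = X).\<close>
definition cov :: "'a::euclidean_space set \<Rightarrow> ('a \<Rightarrow> 'a \<Rightarrow> real) \<Rightarrow> ('a \<Rightarrow> real)
     \<Rightarrow> real \<Rightarrow> 'a \<Rightarrow> real \<Rightarrow> 'a \<Rightarrow> real" where
  "cov \<Omega> g \<phi> e x e' y =
     (if e = 0 \<and> e' = 0 then Sig g x y
      else if e = 0 then (LINT u:\<Omega>|lborel. Sig g x u * phi_eps \<phi> e' (y - u))
      else if e' = 0 then (LINT u:\<Omega>|lborel. phi_eps \<phi> e (x - u) * Sig g u y)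
      else field_cov \<Omega> g (\<lambda>u. phi_eps \<phi> e (x - u)) (\<lambda>v. phi_eps \<phi> e' (y - v)))"

definition mollify :: "'a::euclidean_space set \<Rightarrow> ('a \<Rightarrow> real) \<Rightarrow> real \<Rightarrow> ('a \<Rightarrow> real) \<Rightarrow> 'a \<Rightarrow> real" where
  "mollify \<Omega> \<phi> e h x = (if e = 0 then h x else (LINT u:\<Omega>|lborel. h u * phi_eps \<phi> e (x - u)))"

definition EN :: "(nat \<Rightarrow> 'b measure) \<Rightarrow> nat \<Rightarrow> ('b \<Rightarrow> real) \<Rightarrow> real" where
  "EN PN N F = integral\<^sup>L (PN N) F"

definition XNe :: "'a::euclidean_space set \<Rightarrow> ('a \<Rightarrow> real) \<Rightarrow> (nat \<Rightarrow> 'b \<Rightarrow> 'a \<Rightarrow> real)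
     \<Rightarrow> nat \<Rightarrow> real \<Rightarrow> 'b \<Rightarrow> 'a \<Rightarrow> real" where
  "XNe \<Omega> \<phi> XN N e \<omega> x = mollify \<Omega> \<phi> e (XN N \<omega>) x"

definition WN :: "'a::euclidean_space set \<Rightarrow> ('a \<Rightarrow> real) \<Rightarrow> (nat \<Rightarrow> 'b measure) \<Rightarrow> (nat \<Rightarrow> 'b \<Rightarrow> 'a \<Rightarrow> real)
     \<Rightarrow> real \<Rightarrow> nat \<Rightarrow> real \<Rightarrow> real \<Rightarrow> 'a \<Rightarrow> 'a \<Rightarrow> real" where
  "WN \<Omega> \<phi> PN XN \<gamma> N e e' x y =
     EN PN N (\<lambda>\<omega>. exp (\<gamma> * XNe \<Omega> \<phi> XN N e \<omega> x + \<gamma> * XNe \<Omega> \<phi> XN N e' \<omega> y)) /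
     (EN PN N (\<lambda>\<omega>. exp (\<gamma> * XNe \<Omega> \<phi> XN N e \<omega> x)) * EN PN N (\<lambda>\<omega>. exp (\<gamma> * XNe \<Omega> \<phi> XN N e' \<omega> y)))"

definition A1 where
  "A1 (\<Omega>::'a::euclidean_space set) g \<phi> PN XN \<gamma> \<longleftrightarrow> (\<forall>e\<ge>0. \<forall>e'\<ge>0. \<forall>K. compact K \<and> K \<subseteq> {(u,v). u \<in> \<Omega> \<and> v \<in> \<Omega> \<and> u \<noteq> v} \<longrightarrow>
     uniform_limit K (\<lambda>N (x,y). WN \<Omega> \<phi> PN XN \<gamma> N e e' x y)
       (\<lambda>(x,y). exp (\<gamma>^2 * cov \<Omega> g \<phi> e x e' y)) sequentially)"

definition A2 where
  "A2 (\<Omega>::'a::euclidean_space set) \<phi> PN XN \<gamma> \<longleftrightarrow> (\<forall>e\<ge>0. \<forall>e'>0. \<forall>K. compact K \<and> K \<subseteq> \<Omega> \<longrightarrow>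
     (\<exists>B. \<forall>N. \<forall>x\<in>K. \<forall>y\<in>K. WN \<Omega> \<phi> PN XN \<gamma> N e e' x y \<le> B))"

definition A3 where
  "A3 (\<Omega>::'a::euclidean_space set) \<phi> PN XN \<gamma> \<epsilon>N \<longleftrightarrow> (\<forall>K. compact K \<and> K \<subseteq> \<Omega> \<times> \<Omega> \<longrightarrow> (\<exists>C. \<forall>\<^sub>F N in sequentially.
     \<forall>(x,y)\<in>K. dist x y \<ge> \<epsilon>N N \<longrightarrow>
       0 \<le> WN \<Omega> \<phi> PN XN \<gamma> N 0 0 x y \<and> WN \<Omega> \<phi> PN XN \<gamma> N 0 0 x y \<le> C * dist x y powr (-(\<gamma>^2))))"

definition A4 where
  "A4 (\<Omega>::'a::euclidean_space set) g \<phi> PN XN \<gamma> \<epsilon>N \<longleftrightarrow> (\<forall>\<rho>>0. \<forall>e\<ge>0. \<forall>e'\<ge>0. \<forall>(n::nat) (t::nat \<Rightarrow> real).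
     \<forall>K L. compact K \<and> K \<subseteq> {(u,v). u \<in> \<Omega> \<and> v \<in> \<Omega> \<and> dist u v \<ge> \<rho>} \<and> compact L \<and> L \<subseteq> \<Omega> \<longrightarrow>
     (\<forall>\<delta>>0. \<forall>\<^sub>F N in sequentially. \<forall>x y (\<eta>::nat \<Rightarrow> real) (z::nat \<Rightarrow> 'a::euclidean_space).
        (x,y) \<in> K \<and> (\<forall>k<n. \<epsilon>N N < \<eta> k \<and> \<eta> k \<le> 1 \<and> z k \<in> L) \<longrightarrow>
        \<bar>(EN PN N (\<lambda>\<omega>. exp (\<gamma> * XNe \<Omega> \<phi> XN N e \<omega> x + \<gamma> * XNe \<Omega> \<phi> XN N e' \<omega> y) *
                         exp (\<Sum>k<n. t k * XNe \<Omega> \<phi> XN N (\<eta> k) \<omega> (z k)))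
          / EN PN N (\<lambda>\<omega>. exp (\<gamma> * XNe \<Omega> \<phi> XN N e \<omega> x + \<gamma> * XNe \<Omega> \<phi> XN N e' \<omega> y)))
         / exp ((\<Sum>k<n. \<gamma> * t k * (cov \<Omega> g \<phi> e x (\<eta> k) (z k) + cov \<Omega> g \<phi> e' y (\<eta> k) (z k)))
                + 1/2 * (\<Sum>j<n. \<Sum>k<n. t j * t k * cov \<Omega> g \<phi> (\<eta> j) (z j) (\<eta> k) (z k)))
         - 1\<bar> \<le> \<delta>))"

definition A5 where
  "A5 (\<Omega>::'a::euclidean_space set) \<phi> PN XN \<gamma> \<epsilon>N \<longleftrightarrow> (\<forall>lam::real. \<forall>K. compact K \<and> K \<subseteq> \<Omega> \<longrightarrow> (\<exists>C. \<forall>\<^sub>F N in sequentially.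
     \<forall>e x. \<epsilon>N N \<le> e \<and> e \<le> 1 \<and> x \<in> K \<longrightarrow>
       (let r = EN PN N (\<lambda>\<omega>. exp (\<gamma> * XN N \<omega> x + lam * XNe \<Omega> \<phi> XN N e \<omega> x))
                / EN PN N (\<lambda>\<omega>. exp (\<gamma> * XN N \<omega> x))
        in 0 \<le> r \<and> r \<le> C * e powr (-(lam * (lam + 2 * \<gamma>) / 2)))))"

definition A6 where
  "A6 (\<Omega>::'a::euclidean_space set) g \<phi> PN XN \<gamma> \<longleftrightarrow> (\<forall>lam::real. \<forall>K. compact K \<and> K \<subseteq> \<Omega> \<times> \<Omega> \<longrightarrow> (\<exists>C.
     \<forall>e e' \<eta> x y. 0 \<le> e \<and> 0 < e' \<and> e \<le> e' \<and> e' \<le> \<eta> \<and> (x,y) \<in> K \<longrightarrow>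
       limsup (\<lambda>N. ereal
         (EN PN N (\<lambda>\<omega>. exp (\<gamma> * XNe \<Omega> \<phi> XN N e \<omega> x + \<gamma> * XNe \<Omega> \<phi> XN N e' \<omega> y + lam * XNe \<Omega> \<phi> XN N \<eta> \<omega> y))
          / EN PN N (\<lambda>\<omega>. exp (\<gamma> * XNe \<Omega> \<phi> XN N e \<omega> x + \<gamma> * XNe \<Omega> \<phi> XN N e' \<omega> y))))
       \<le> ereal (C * exp (lam^2 / 2 * cov \<Omega> g \<phi> \<eta> y \<eta> y + lam * \<gamma> * cov \<Omega> g \<phi> e x \<eta> y
                          + lam * \<gamma> * cov \<Omega> g \<phi> e' y \<eta> y))))"

definition A7 where
  "A7 (\<Omega>::'a::euclidean_space set) g \<phi> PN XN \<gamma> \<epsilon>N \<longleftrightarrow> (\<forall>lam::real. \<forall>K. compact K \<and> K \<subseteq> \<Omega> \<times> \<Omega> \<longrightarrow> (\<exists>C. \<forall>\<^sub>F N in sequentially.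
     \<forall>\<eta> x y. \<epsilon>N N \<le> \<eta> \<and> (x,y) \<in> K \<longrightarrow>
       (let r = EN PN N (\<lambda>\<omega>. exp (\<gamma> * XN N \<omega> x + \<gamma> * XN N \<omega> y + lam * XNe \<Omega> \<phi> XN N \<eta> \<omega> x))
                / EN PN N (\<lambda>\<omega>. exp (\<gamma> * XN N \<omega> x + \<gamma> * XN N \<omega> y))
        in 0 \<le> r \<and> r \<le> C * exp (lam^2 / 2 * cov \<Omega> g \<phi> \<eta> x \<eta> x + lam * \<gamma> * cov \<Omega> g \<phi> 0 x \<eta> x
                                  + lam * \<gamma> * cov \<Omega> g \<phi> 0 y \<eta> x))))"

definition A8 where
  "A8 (\<Omega>::'a::euclidean_space set) \<phi> PN XN \<gamma> \<epsilon>N \<longleftrightarrow> (\<exists>\<tau>::real. 0 < \<tau> \<and>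
     \<tau> < min ((real DIM('a) - \<gamma>^2 / 2)^2 / (4 * real DIM('a))) (\<gamma>^2 / 2) \<and>
     (\<forall>A::('a \<times> 'a) set. compact A \<and> A \<subseteq> \<Omega> \<times> \<Omega> \<longrightarrow> (\<exists>C. \<forall>\<^sub>F N in sequentially.
        (\<integral>\<^sup>+ p. indicator A p * indicator {p. dist (fst p) (snd p) \<le> \<epsilon>N N} p *
                 ennreal (WN \<Omega> \<phi> PN XN \<gamma> N 0 0 (fst p) (snd p)) \<partial>lborel)
        \<le> ennreal (C * \<epsilon>N N powr (- max (\<gamma>^2 - real DIM('a)) 0 - \<tau>)))))"

end

(* Let I_N be the integral in question and I_N^e its analogue with X replaced by X_e. For fixed e > 0 the
   exponential moments of X_e under P_N converge to Gaussian ones, so I_N^e converges in law to the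
   mollified chaos I^e, and I^e -> Z in L^1 by definition of Z. It remains to see that
   E_N |I_N - I_N^e| is small, for N large depending on e. When gamma^2 >= d the second moments diverge,
   so both densities are first multiplied by a factor G which suppresses the points where X exceeds
   alpha log(1/r) at some dyadic scale r, with alpha slightly above gamma. Girsanov tilting by gamma X makes
   alpha-thick points rare, so the truncation costs little in L^1 by (A5). The second moment of the
   truncated difference is a double integral over (x,y). Near the diagonal G yields the integrable bound
   |x-y|^(-s) with s = gamma^2 - (2 gamma - alpha)^2 / 2 < d, using (A3), (A6), (A7), and (A8) below the
   scale epsilon_N. Away from the diagonal (A4) says that the field under the law tilted by
   exp(gamma X(x) + gamma X(y)) is asymptotically Gaussian with a mean that is continuous in e,
   so that the four terms of the expanded square cancel as N -> infinity and then e -> 0.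
   Characteristic functions at finitely many scales are recovered from exponential moments
   (moment generating functions determine convergence in law). *)
theory Submission
  imports Defs
begin

section \<open>Characteristic functions and exponential moments\<close>

text \<open>The hypotheses control exponential moments only, never probabilities of events. Hence
  the truncation is soft: \<open>G\<close> is a product of factors \<open>exp (- sk)\<close>, where
  \<open>sk\<close> is itself an exponential of the field, so that its cost and its gain are both
  exponential moments, with tilts \<open>la\<close> = \<alpha> - \<gamma> and \<open>be\<close> =
  2\<gamma> - \<alpha>. The cost is summable over scales as soon as \<open>la\<close> > 0. The gain
  \<open>be\<close>^2 / 2 in the exponent has to bring \<gamma>^2 below d and to beat the exponent
  \<theta> of (A8), which is the positive part of \<gamma>^2 - d plus \<tau>. The bound on \<tau>
  gives \<theta> < \<gamma>^2 / 2, so \<open>be\<close>^2 can be the midpoint of 2\<theta> and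
  \<gamma>^2, which serves both purposes and fixes \<alpha>. Uniformity decides the rest. Bounds
  from (A3), (A5), (A7) are uniform in the points; limits and the limsup of (A6) are used one point
  or pair at a time. The latter enter integrals through a reverse Fatou lemma, which needs a
  majorant free of N. None is available where |x - y| < \<epsilon>N, so the unmollified term is
  split off there.\<close>

lemma power_div_fact_le_exp:
  fixes x :: real
  assumes "0 \<le> x"
  shows "x ^ k / fact k \<le> exp x"
proof -
  have "(\<lambda>n. x ^ n /\<^sub>R fact n) sums exp x" by (rule exp_converges)
  then have s: "(\<lambda>n. x ^ n / fact n) sums exp x" by (simp add: divide_inverse mult.commute)
  have "(\<Sum>n\<in>{k}. x ^ n / fact n) \<le> (\<Sum>n. x ^ n / fact n)"
    using assms by (intro sum_le_suminf sums_summable[OF s]) auto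
  also have "\<dots> = exp x" using s by (simp add: sums_iff)
  finally show ?thesis by simp
qed

text \<open>Strong induction on k: once the lower coefficients are negligible, divide the series by
  \<open>t ^ k\<close>; by the geometric bound the remaining tail is at most
  \<open>2 * C * t\<close>, uniformly in N, and t may be taken small. Only positive real arguments
  enter.\<close>

lemma power_series_tendsto_zero_imp_coeffs:
  fixes c :: "nat \<Rightarrow> nat \<Rightarrow> real"
  assumes bd: "\<forall>\<^sub>F N in sequentially. \<forall>k. \<bar>c N k\<bar> \<le> C / 2 ^ k"
    and S: "\<And>t. 0 < t \<Longrightarrow> t \<le> 1 \<Longrightarrow> (\<lambda>N. \<Sum>k. c N k * t ^ k) \<longlonglongrightarrow> 0"
  shows "(\<lambda>N. c N k) \<longlonglongrightarrow> 0"
proof (induction k rule: less_induct)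
  case (less k)
  obtain N0 where "\<forall>k. \<bar>c N0 k\<bar> \<le> C / 2 ^ k" using bd eventually_happens'[OF sequentially_bot] by blast
  from this[rule_format, of 0] have C0: "0 \<le> C" by simp
  show ?case
  proof (rule LIMSEQ_I)
    fix r :: real assume r: "0 < r"
    \<comment> \<open>Small enough for the tail \<open>2 * C * t\<close> to stay below r, and in the
      range where the series is known to converge to 0.\<close>
    define t where "t = min 1 (r / (4 * C + 4))"
    have t: "0 < t" "t \<le> 1" using r C0 by (auto simp: t_def)
    have "2 * C * t \<le> 2 * C * (r / (4 * C + 4))" using C0 by (intro mult_left_mono) (auto simp: t_def)
    also have "\<dots> < r" using r C0 by (simp add: field_simps) (metis add_nonneg_pos mult_nonneg_nonneg less_imp_le zero_less_numeral mult_pos_pos add.commute)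
    finally have tr: "2 * C * t < r" .
    have "(\<lambda>N. (\<bar>\<Sum>k. c N k * t ^ k\<bar> + (\<Sum>j<k. \<bar>c N j\<bar>)) / t ^ k + 2 * C * t) \<longlonglongrightarrow> (\<bar>0\<bar> + (\<Sum>j<k. \<bar>0\<bar>)) / t ^ k + 2 * C * t"
      using t by (intro tendsto_intros S less) auto
    then have "\<forall>\<^sub>F N in sequentially. (\<bar>\<Sum>k. c N k * t ^ k\<bar> + (\<Sum>j<k. \<bar>c N j\<bar>)) / t ^ k + 2 * C * t < r"
      using tr by (intro order_tendstoD) auto
    then have "\<forall>\<^sub>F N in sequentially. norm (c N k - 0) < r"
      using bd
    proof eventually_elim
      case (elim N)
      have geo: "summable (\<lambda>j. C * (1/2) ^ j :: real)" by (intro summable_mult summable_geometric) auto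
      have b: "\<bar>c N j * t ^ j\<bar> \<le> C * (1/2) ^ j" for j
      proof -
        have "\<bar>c N j * t ^ j\<bar> = \<bar>c N j\<bar> * t ^ j" using t by (simp add: abs_mult)
        also have "\<dots> \<le> (C / 2 ^ j) * 1" using elim(2) t C0 by (intro mult_mono) (auto simp: power_le_one)
        finally show ?thesis by (simp add: power_divide)
      qed
      have sm: "summable (\<lambda>j. c N j * t ^ j)"
        by (rule summable_comparison_test'[OF geo, of 0]) (use b in auto)
      have split: "(\<Sum>j. c N j * t ^ j) = (\<Sum>j. c N (j + Suc k) * t ^ (j + Suc k)) + (\<Sum>j<Suc k. c N j * t ^ j)"
        by (rule suminf_split_initial_segment[OF sm])
      have sg: "(\<lambda>j. C * t ^ Suc k * (1/2) ^ j) sums (C * t ^ Suc k * (1 / (1 - 1/2)))"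
        by (intro sums_mult geometric_sums) auto
      have b2: "norm (c N (j + Suc k) * t ^ (j + Suc k)) \<le> C * t ^ Suc k * (1/2) ^ j" for j
      proof -
        have "norm (c N (j + Suc k) * t ^ (j + Suc k)) = \<bar>c N (j + Suc k)\<bar> * (t ^ j * t ^ Suc k)"
          using t by (simp add: abs_mult power_add)
        also have "\<dots> \<le> (C / 2 ^ (j + Suc k)) * (1 * t ^ Suc k)"
          using elim(2) t C0 by (intro mult_mono) (auto simp: power_le_one simp del: power_Suc)
        also have "\<dots> \<le> (C / 2 ^ j) * (1 * t ^ Suc k)"
          using t C0 by (intro mult_right_mono divide_left_mono power_increasing) auto
        finally show ?thesis by (simp add: power_divide field_simps)
      qed
      have "norm (\<Sum>j. c N (j + Suc k) * t ^ (j + Suc k)) \<le> (\<Sum>j. C * t ^ Suc k * (1/2) ^ j)"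
        by (rule norm_suminf_le[OF b2 sums_summable[OF sg]])
      also have "\<dots> = 2 * C * t * t ^ k" using sums_unique[OF sg] by simp
      finally have tail: "\<bar>\<Sum>j. c N (j + Suc k) * t ^ (j + Suc k)\<bar> \<le> 2 * C * t * t ^ k" by simp
      have "\<bar>\<Sum>j<k. c N j * t ^ j\<bar> \<le> (\<Sum>j<k. \<bar>c N j * t ^ j\<bar>)" by (rule sum_abs)
      also have "\<dots> \<le> (\<Sum>j<k. \<bar>c N j\<bar>)"
        using t by (intro sum_mono) (auto simp: abs_mult power_le_one mult_left_le)
      finally have hd: "\<bar>\<Sum>j<k. c N j * t ^ j\<bar> \<le> (\<Sum>j<k. \<bar>c N j\<bar>)" .
      have "\<bar>c N k\<bar> * t ^ k = \<bar>c N k * t ^ k\<bar>" using t by (simp add: abs_mult)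
      also have "c N k * t ^ k = (\<Sum>j. c N j * t ^ j) - (\<Sum>j<k. c N j * t ^ j) - (\<Sum>j. c N (j + Suc k) * t ^ (j + Suc k))"
        using split by simp
      finally have "\<bar>c N k\<bar> * t ^ k \<le> \<bar>\<Sum>j. c N j * t ^ j\<bar> + (\<Sum>j<k. \<bar>c N j\<bar>) + 2 * C * t * t ^ k"
        using hd tail by linarith
      then have "\<bar>c N k\<bar> \<le> (\<bar>\<Sum>j. c N j * t ^ j\<bar> + (\<Sum>j<k. \<bar>c N j\<bar>)) / t ^ k + 2 * C * t"
        using t by (simp add: field_simps)
      then show ?case using elim(1) by simp
    qed
    then show "\<exists>no. \<forall>n\<ge>no. norm (c n k - 0) < r" by (simp add: eventually_sequentially)
  qed
qed

context prob_space
begin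

text \<open>Comparing with \<open>exp (2 * \<bar>Y\<bar>)\<close> makes the Taylor coefficients of
  the moment generating function O(2^(-k)). The series then converges on the closed unit disc, which
  contains both the real arguments in (0, 1] and the point \<i>, where the characteristic function
  is read off.\<close>

lemma exp_moment_series:
  fixes Y :: "'a \<Rightarrow> real"
  assumes [measurable]: "Y \<in> borel_measurable M"
    and i: "integrable M (\<lambda>w. exp (2 * Y w))" "integrable M (\<lambda>w. exp (- 2 * Y w))"
  shows "\<bar>(\<integral>w. Y w ^ k / fact k \<partial>M)\<bar> \<le> ((\<integral>w. exp (2 * Y w) \<partial>M) + (\<integral>w. exp (- 2 * Y w) \<partial>M)) / 2 ^ k"
    and "\<And>z::complex. norm z \<le> 1 \<Longrightarrow>
        (\<lambda>k. z ^ k * complex_of_real (\<integral>w. Y w ^ k / fact k \<partial>M)) sums (\<integral>w. exp (z * complex_of_real (Y w)) \<partial>M)"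
    and "\<And>t::real. 0 < t \<Longrightarrow> t \<le> 1 \<Longrightarrow>
        (\<lambda>k. (\<integral>w. Y w ^ k / fact k \<partial>M) * t ^ k) sums (\<integral>w. exp (t * Y w) \<partial>M)"
proof -
  let ?D = "\<lambda>w. exp (2 * Y w) + exp (- 2 * Y w)"
  have iD: "integrable M ?D" using i by (intro Bochner_Integration.integrable_add)
  have pt: "\<bar>Y w ^ k / fact k\<bar> \<le> ?D w / 2 ^ k" for w k
  proof -
    have "2 ^ k * \<bar>Y w ^ k / fact k\<bar> = (2 * \<bar>Y w\<bar>) ^ k / fact k" by (simp add: power_mult_distrib power_abs)
    also have "\<dots> \<le> exp (2 * \<bar>Y w\<bar>)" by (rule power_div_fact_le_exp) auto
    also have "\<dots> \<le> ?D w" by (cases "Y w \<ge> 0") auto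
    finally show ?thesis by (simp add: field_simps)
  qed
  have iD2: "integrable M (\<lambda>w. ?D w / 2 ^ k)" for k using iD by (rule integrable_divide_zero[rotated])
  have ik: "integrable M (\<lambda>w. Y w ^ k / fact k)" for k
    by (rule Bochner_Integration.integrable_bound[OF iD2[of k]]) (use pt in \<open>auto simp: abs_mult\<close>)
  have ID: "(\<integral>w. ?D w / 2 ^ k \<partial>M) = ((\<integral>w. exp (2 * Y w) \<partial>M) + (\<integral>w. exp (- 2 * Y w) \<partial>M)) / 2 ^ k" for k
    using i by simp
  have nk: "(\<integral>w. \<bar>Y w ^ k / fact k\<bar> \<partial>M) \<le> ((\<integral>w. exp (2 * Y w) \<partial>M) + (\<integral>w. exp (- 2 * Y w) \<partial>M)) / 2 ^ k" for k
    unfolding ID[symmetric] by (rule integral_mono[OF integrable_abs[OF ik] iD2 pt])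
  show "\<bar>(\<integral>w. Y w ^ k / fact k \<partial>M)\<bar> \<le> ((\<integral>w. exp (2 * Y w) \<partial>M) + (\<integral>w. exp (- 2 * Y w) \<partial>M)) / 2 ^ k"
    using nk[of k] integral_abs_bound[of M "\<lambda>w. Y w ^ k / fact k"] by linarith
  let ?C = "(\<integral>w. exp (2 * Y w) \<partial>M) + (\<integral>w. exp (- 2 * Y w) \<partial>M)"
  show c: "(\<lambda>k. z ^ k * complex_of_real (\<integral>w. Y w ^ k / fact k \<partial>M)) sums (\<integral>w. exp (z * complex_of_real (Y w)) \<partial>M)"
    if z: "norm z \<le> 1" for z :: complex
  proof -
    let ?f = "\<lambda>k w. z ^ k * complex_of_real (Y w ^ k / fact k)"
    have ser: "(\<lambda>k. ?f k w) sums exp (z * complex_of_real (Y w))" for w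
      using exp_converges[of "z * complex_of_real (Y w)"]
      by (simp add: power_mult_distrib scaleR_conv_of_real divide_inverse mult_ac)
    have "(\<lambda>k. integral\<^sup>L M (?f k)) sums (\<integral>w. (\<Sum>k. ?f k w) \<partial>M)"
    proof (rule sums_integral)
      show "integrable M (?f k)" for k using ik[of k] by (intro integrable_mult_right integrable_of_real) auto
      show "AE w in M. summable (\<lambda>k. norm (?f k w))"
      proof (rule AE_I2)
        fix w
        have "summable (\<lambda>k. norm ((z * complex_of_real (Y w)) ^ k /\<^sub>R fact k))" by (rule summable_norm_exp)
        then show "summable (\<lambda>k. norm (?f k w))"
          by (simp add: power_mult_distrib norm_mult norm_power norm_divide norm_inverse divide_inverse mult_ac)
      qed
      show "summable (\<lambda>k. \<integral>w. norm (?f k w) \<partial>M)"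
      proof (rule summable_comparison_test'[of "\<lambda>k. ?C * (1/2)^k" 0])
        show "summable (\<lambda>k. ?C * (1/2)^k)" by (intro summable_mult summable_geometric) auto
        fix k
        have e: "norm (?f k w) = norm z ^ k * \<bar>Y w ^ k / fact k\<bar>" for w
          by (simp add: norm_mult norm_power norm_divide power_abs)
        have "(\<integral>w. norm (?f k w) \<partial>M) = norm z ^ k * (\<integral>w. \<bar>Y w ^ k / fact k\<bar> \<partial>M)" unfolding e by simp
        also have "\<dots> \<le> 1 * (?C / 2 ^ k)" by (rule mult_mono) (use nk[of k] z in \<open>auto intro: power_le_one\<close>)
        finally show "norm (\<integral>w. norm (?f k w) \<partial>M) \<le> ?C * (1/2)^k" by (simp add: power_divide)
      qed
    qed
    moreover have "integral\<^sup>L M (?f k) = z ^ k * complex_of_real (\<integral>w. Y w ^ k / fact k \<partial>M)" for k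
      using ik[of k] by (simp only: integral_mult_right_zero integral_complex_of_real)
    moreover have "(\<Sum>k. ?f k w) = exp (z * complex_of_real (Y w))" for w using ser[of w] by (simp add: sums_iff)
    ultimately show ?thesis by (simp only:)
  qed
  show "(\<lambda>k. (\<integral>w. Y w ^ k / fact k \<partial>M) * t ^ k) sums (\<integral>w. exp (t * Y w) \<partial>M)"
    if t: "0 < t" "t \<le> 1" for t :: real
  proof -
    have "(\<lambda>k. complex_of_real (t ^ k * (\<integral>w. Y w ^ k / fact k \<partial>M))) sums complex_of_real (\<integral>w. exp (t * Y w) \<partial>M)"
      using c[of "complex_of_real t"] t
      by (simp add: exp_of_real flip: of_real_mult of_real_power)
    then show ?thesis by (simp only: sums_of_real_iff mult.commute)
  qed
qed

end

text \<open>Arguments in (0, 1] determine the limits of the Taylor coefficients, arguments 2 and -2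
  supply a summable majorant, and Tannery's theorem sums the series at \<i>. Only the argument 1 of
  the characteristic function is reached; other arguments follow by rescaling Y.\<close>

theorem mgf_tendsto_imp_iexp_tendsto:
  fixes M :: "nat \<Rightarrow> 'b measure" and M' :: "'c measure"
  assumes p: "\<And>N. prob_space (M N)" "prob_space M'"
    and Y: "\<And>N. Y N \<in> borel_measurable (M N)" "Y' \<in> borel_measurable M'"
    and int: "\<And>N t. integrable (M N) (\<lambda>w. exp (t * Y N w))" "\<And>t. integrable M' (\<lambda>w. exp (t * Y' w))"
    and conv: "\<And>t::real. (\<lambda>N. \<integral>w. exp (t * Y N w) \<partial>M N) \<longlonglongrightarrow> (\<integral>w. exp (t * Y' w) \<partial>M')"
  shows "(\<lambda>N. \<integral>w. iexp (Y N w) \<partial>M N) \<longlonglongrightarrow> (\<integral>w. iexp (Y' w) \<partial>M')"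
proof -
  define a where "a N k = (\<integral>w. Y N w ^ k / fact k \<partial>M N)" for N k
  define b where "b k = (\<integral>w. Y' w ^ k / fact k \<partial>M')" for k
  define CN where "CN N = (\<integral>w. exp (2 * Y N w) \<partial>M N) + (\<integral>w. exp (- 2 * Y N w) \<partial>M N)" for N
  define C' where "C' = (\<integral>w. exp (2 * Y' w) \<partial>M') + (\<integral>w. exp (- 2 * Y' w) \<partial>M')"
  note serN = prob_space.exp_moment_series[OF p(1) Y(1) int(1) int(1), folded a_def CN_def]
  note ser' = prob_space.exp_moment_series[OF p(2) Y(2) int(2) int(2), folded b_def C'_def]
  have CN: "CN \<longlonglongrightarrow> C'" unfolding CN_def C'_def by (intro tendsto_add conv)
  have "\<forall>\<^sub>F N in sequentially. CN N < C' + 1" by (rule order_tendstoD[OF CN]) simp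
  then have aev: "\<forall>\<^sub>F N in sequentially. \<forall>k. \<bar>a N k\<bar> \<le> (C' + 1) / 2 ^ k"
  proof eventually_elim
    case (elim N)
    show ?case
    proof
      fix k
      have "\<bar>a N k\<bar> \<le> CN N / 2 ^ k" by (rule serN(1))
      also have "\<dots> \<le> (C' + 1) / 2 ^ k" using elim by (intro divide_right_mono) auto
      finally show "\<bar>a N k\<bar> \<le> (C' + 1) / 2 ^ k" .
    qed
  qed
  have "(\<lambda>N. a N k - b k) \<longlonglongrightarrow> 0" for k
  proof (rule power_series_tendsto_zero_imp_coeffs[of "\<lambda>N k. a N k - b k" "2 * C' + 1"])
    show "\<forall>\<^sub>F N in sequentially. \<forall>k. \<bar>a N k - b k\<bar> \<le> (2 * C' + 1) / 2 ^ k"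
      using aev
    proof eventually_elim
      case (elim N)
      show ?case
      proof
        fix k
        have "\<bar>a N k - b k\<bar> \<le> (C' + 1) / 2 ^ k + C' / 2 ^ k" using elim ser'(1)[of k] by (smt (verit))
        then show "\<bar>a N k - b k\<bar> \<le> (2 * C' + 1) / 2 ^ k" by (simp add: add_divide_distrib[symmetric])
      qed
    qed
    fix t :: real assume t: "0 < t" "t \<le> 1"
    have "(\<lambda>k. (a N k - b k) * t ^ k) sums ((\<integral>w. exp (t * Y N w) \<partial>M N) - (\<integral>w. exp (t * Y' w) \<partial>M'))" for N
      using sums_diff[OF serN(3)[OF t, of N] ser'(3)[OF t]] by (simp add: left_diff_distrib)
    then have "(\<Sum>k. (a N k - b k) * t ^ k) = (\<integral>w. exp (t * Y N w) \<partial>M N) - (\<integral>w. exp (t * Y' w) \<partial>M')" for N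
      by (simp add: sums_iff)
    then show "(\<lambda>N. \<Sum>k. (a N k - b k) * t ^ k) \<longlonglongrightarrow> 0"
      using conv[of t] by (simp add: LIM_zero_iff)
  qed
  then have ab: "(\<lambda>N. a N k) \<longlonglongrightarrow> b k" for k by (simp add: LIM_zero_iff)
  have "((\<lambda>N. \<Sum>k. \<i> ^ k * complex_of_real (a N k)) \<longlongrightarrow> (\<Sum>k. \<i> ^ k * complex_of_real (b k))) sequentially"
  proof (rule tannerys_theorem[THEN conjunct2, THEN conjunct2])
    show "((\<lambda>N. \<i> ^ k * complex_of_real (a N k)) \<longlongrightarrow> \<i> ^ k * complex_of_real (b k)) sequentially" for k
      by (intro tendsto_intros ab)
    show "\<forall>\<^sub>F (k, N) in sequentially \<times>\<^sub>F sequentially. norm (\<i> ^ k * complex_of_real (a N k)) \<le> (C' + 1) * (1/2) ^ k"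
      unfolding eventually_prod_filter
      by (intro exI[of _ "\<lambda>_. True"] exI[of _ "\<lambda>N. \<forall>k. \<bar>a N k\<bar> \<le> (C' + 1) / 2 ^ k"])
         (auto simp: aev norm_mult norm_power power_divide)
    show "summable (\<lambda>k. (C' + 1) * (1/2) ^ k)" by (intro summable_mult summable_geometric) auto
  qed auto
  moreover have "(\<Sum>k. \<i> ^ k * complex_of_real (a N k)) = (\<integral>w. iexp (Y N w) \<partial>M N)" for N
    using serN(2)[of \<i> N] by (simp add: sums_iff)
  moreover have "(\<Sum>k. \<i> ^ k * complex_of_real (b k)) = (\<integral>w. iexp (Y' w) \<partial>M')"
    using ser'(2)[of \<i>] by (simp add: sums_iff)
  ultimately show ?thesis by simp
qed

section \<open>Convergence in law in the presence of bounded weights\<close>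

lemma iexp_tendsto_imp_bdd_continuous_tendsto:
  fixes M :: "nat \<Rightarrow> 'b measure" and M' :: "'c measure" and \<psi> :: "real \<Rightarrow> complex"
  assumes p: "\<And>N. prob_space (M N)" "prob_space M'"
    and Y: "\<And>N. Y N \<in> borel_measurable (M N)" "Y' \<in> borel_measurable M'"
    and c: "\<And>s::real. (\<lambda>N. \<integral>z. iexp (s * Y N z) \<partial>M N) \<longlonglongrightarrow> (\<integral>z. iexp (s * Y' z) \<partial>M')"
    and \<psi>: "\<And>x. isCont \<psi> x" "\<And>x. norm (\<psi> x) \<le> B"
  shows "(\<lambda>N. \<integral>z. \<psi> (Y N z) \<partial>M N) \<longlonglongrightarrow> (\<integral>z. \<psi> (Y' z) \<partial>M')"
proof -
  note [measurable] = Y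
  have [measurable]: "\<psi> \<in> borel_measurable borel"
    using \<psi>(1) by (auto intro!: borel_measurable_continuous_onI continuous_at_imp_continuous_on)
  have r: "real_distribution (distr (M N) borel (Y N))" "real_distribution (distr M' borel Y')" for N
    using p Y by (auto intro!: prob_space.real_distribution_distr)
  have ch: "char (distr (M N) borel (Y N)) t = (\<integral>z. iexp (t * Y N z) \<partial>M N)"
    "char (distr M' borel Y') t = (\<integral>z. iexp (t * Y' z) \<partial>M')" for N t
    unfolding char_def by (subst integral_distr; simp)+
  have "weak_conv_m (\<lambda>N. distr (M N) borel (Y N)) (distr M' borel Y')"
    by (rule levy_continuity[OF r]) (use c ch in simp)
  from weak_conv_imp_integral_bdd_continuous_conv[OF r this \<psi>]
  show ?thesis by (simp add: integral_distr)
qed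

lemma prob_space_density_of_integral:
  assumes [measurable]: "u \<in> borel_measurable M" and i: "integrable M u" and nn: "\<And>x. 0 \<le> (u x::real)"
    and one: "integral\<^sup>L M u = 1"
  shows "prob_space (density M (\<lambda>x. ennreal (u x)))"
proof (rule prob_spaceI)
  have "emeasure (density M (\<lambda>x. ennreal (u x))) (space M) = (\<integral>\<^sup>+x. ennreal (u x) \<partial>M)"
    by (simp add: emeasure_density cong: nn_integral_cong)
  also have "\<dots> = ennreal (integral\<^sup>L M u)" by (rule nn_integral_eq_integral) (use i nn in auto)
  finally show "emeasure (density M (\<lambda>x. ennreal (u x))) (space (density M (\<lambda>x. ennreal (u x)))) = 1"
    using one by simp
qed

text \<open>Adding \<open>C + 1\<close> makes the weight at least 1, so that after normalisation it
  is a probability density and the continuity theorem applies to the reweighted laws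
  \<open>Q N\<close>. Subtracting the unweighted limit undoes the shift.\<close>

lemma real_weighted_bdd_continuous_tendsto:
  fixes M :: "nat \<Rightarrow> 'b measure" and M' :: "'c measure" and \<psi> :: "real \<Rightarrow> complex"
    and w :: "nat \<Rightarrow> 'b \<Rightarrow> real"
  assumes p: "\<And>N. prob_space (M N)" "prob_space M'"
    and Y: "\<And>N. Y N \<in> borel_measurable (M N)" "Y' \<in> borel_measurable M'"
    and w: "\<And>N. w N \<in> borel_measurable (M N)" "w' \<in> borel_measurable M'"
    and wb: "\<And>N z. \<bar>w N z\<bar> \<le> C" "\<And>z. \<bar>w' z\<bar> \<le> C"
    and c: "\<And>s::real. (\<lambda>N. \<integral>z. iexp (s * Y N z) \<partial>M N) \<longlonglongrightarrow> (\<integral>z. iexp (s * Y' z) \<partial>M')"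
    and cw: "\<And>s::real. (\<lambda>N. \<integral>z. of_real (w N z) * iexp (s * Y N z) \<partial>M N)
        \<longlonglongrightarrow> (\<integral>z. of_real (w' z) * iexp (s * Y' z) \<partial>M')"
    and \<psi>: "\<And>x. isCont \<psi> x" "\<And>x. norm (\<psi> x) \<le> B"
  shows "(\<lambda>N. \<integral>z. of_real (w N z) * \<psi> (Y N z) \<partial>M N) \<longlonglongrightarrow> (\<integral>z. of_real (w' z) * \<psi> (Y' z) \<partial>M')"
proof -
  note [measurable] = Y w
  have psim [measurable]: "\<psi> \<in> borel_measurable borel"
    using \<psi>(1) by (auto intro!: borel_measurable_continuous_onI continuous_at_imp_continuous_on)
  interpret MN: prob_space "M N" for N by fact
  interpret M': prob_space M' by fact
  have C0: "0 \<le> C" using wb(2) abs_ge_zero order_trans by blast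
  have B0: "0 \<le> B" using \<psi>(2) norm_ge_zero order_trans by blast
  define u where "u N z = w N z + (C + 1)" for N z
  define u' where "u' z = w' z + (C + 1)" for z
  have u1: "1 \<le> u N z" "1 \<le> u' z'" for N z z'
    using wb(1)[of N z] wb(2)[of z'] by (auto simp: u_def u'_def abs_le_iff)
  have [measurable]: "u N \<in> borel_measurable (M N)" "u' \<in> borel_measurable M'" for N
    unfolding u_def u'_def by measurable
  have wi: "integrable (M N) (w N)" "integrable M' w'" for N
    by (rule MN.integrable_const_bound[of _ C] M'.integrable_const_bound[of _ C]; use wb in simp)+
  have ui: "integrable (M N) (u N)" "integrable M' u'" for N
    unfolding u_def u'_def using wi by auto
  define m where "m N = (\<integral>z. u N z \<partial>M N)" for N
  define m' where "m' = (\<integral>z. u' z \<partial>M')"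
  have m: "m N = (\<integral>z. w N z \<partial>M N) + (C + 1)" "m' = (\<integral>z. w' z \<partial>M') + (C + 1)" for N
    unfolding m_def m'_def u_def u'_def using wi by (simp_all add: MN.prob_space M'.prob_space)
  have m1: "1 \<le> m N" "1 \<le> m'" for N
    unfolding m_def m'_def
    using integral_mono[of "M N" "\<lambda>_. 1" "u N"] integral_mono[of "M'" "\<lambda>_. 1" "u'"] ui u1
    by (auto simp: MN.prob_space M'.prob_space)
  have mc: "m \<longlonglongrightarrow> m'"
  proof -
    have "(\<lambda>N. complex_of_real (\<integral>z. w N z \<partial>M N)) \<longlonglongrightarrow> complex_of_real (\<integral>z. w' z \<partial>M')"
      using cw[of 0] by simp
    then have "(\<lambda>N. (\<integral>z. w N z \<partial>M N)) \<longlonglongrightarrow> (\<integral>z. w' z \<partial>M')" by (simp only: tendsto_of_real_iff)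
    then show ?thesis unfolding m by (intro tendsto_intros)
  qed
  define Q where "Q N = density (M N) (\<lambda>z. ennreal (u N z / m N))" for N
  define Q' where "Q' = density M' (\<lambda>z. ennreal (u' z / m'))"
  have nn: "0 \<le> u N z / m N" "0 \<le> u' z' / m'" for N z z'
    using u1(1)[of N z] u1(2)[of z'] m1(1)[of N] m1(2) by auto
  have pQ: "prob_space (Q N)" "prob_space Q'" for N
    unfolding Q_def Q'_def
    by (rule prob_space_density_of_integral; use ui nn m1(1)[of N] m1(2) in \<open>simp add: m_def[symmetric] m'_def[symmetric]\<close>)+
  have IQ: "(\<integral>z. F (Y N z) \<partial>Q N) = ((\<integral>z. of_real (w N z) * F (Y N z) \<partial>M N) + of_real (C + 1) * (\<integral>z. F (Y N z) \<partial>M N)) / of_real (m N)"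
    if F[measurable]: "F \<in> borel_measurable borel" and Fb: "\<And>x. norm (F x) \<le> D" for F :: "real \<Rightarrow> complex" and D N
  proof -
    have D0: "0 \<le> D" using Fb norm_ge_zero order_trans by blast
    have i1: "integrable (M N) (\<lambda>z. of_real (w N z) * F (Y N z))"
      by (rule MN.integrable_const_bound[of _ "C * D"]) (use wb(1) Fb C0 D0 in \<open>auto simp: norm_mult intro!: mult_mono\<close>)
    have i2: "integrable (M N) (\<lambda>z. F (Y N z))"
      by (rule MN.integrable_const_bound[of _ "D"]) (use Fb in auto)
    have "(\<integral>z. F (Y N z) \<partial>Q N) = (\<integral>z. (u N z / m N) *\<^sub>R F (Y N z) \<partial>M N)"
      unfolding Q_def by (subst integral_density) (use nn in auto)
    also have "\<dots> = (\<integral>z. (of_real (w N z) * F (Y N z) + of_real (C + 1) * F (Y N z)) / of_real (m N) \<partial>M N)"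
      by (rule Bochner_Integration.integral_cong) (auto simp: u_def scaleR_conv_of_real field_simps)
    also have "\<dots> = ((\<integral>z. of_real (w N z) * F (Y N z) \<partial>M N) + of_real (C + 1) * (\<integral>z. F (Y N z) \<partial>M N)) / of_real (m N)"
      using i1 i2 by (simp del: of_real_add)
    finally show ?thesis .
  qed
  have IQ': "(\<integral>z. F (Y' z) \<partial>Q') = ((\<integral>z. of_real (w' z) * F (Y' z) \<partial>M') + of_real (C + 1) * (\<integral>z. F (Y' z) \<partial>M')) / of_real m'"
    if F[measurable]: "F \<in> borel_measurable borel" and Fb: "\<And>x. norm (F x) \<le> D" for F :: "real \<Rightarrow> complex" and D
  proof -
    have D0: "0 \<le> D" using Fb norm_ge_zero order_trans by blast
    have i1: "integrable (M') (\<lambda>z. of_real (w' z) * F (Y' z))"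
      by (rule M'.integrable_const_bound[of _ "C * D"]) (use wb(2) Fb C0 D0 in \<open>auto simp: norm_mult intro!: mult_mono\<close>)
    have i2: "integrable (M') (\<lambda>z. F (Y' z))"
      by (rule M'.integrable_const_bound[of _ "D"]) (use Fb in auto)
    have "(\<integral>z. F (Y' z) \<partial>Q') = (\<integral>z. (u' z / m') *\<^sub>R F (Y' z) \<partial>M')"
      unfolding Q'_def by (subst integral_density) (use nn in auto)
    also have "\<dots> = (\<integral>z. (of_real (w' z) * F (Y' z) + of_real (C + 1) * F (Y' z)) / of_real m' \<partial>M')"
      by (rule Bochner_Integration.integral_cong) (auto simp: u'_def scaleR_conv_of_real field_simps)
    also have "\<dots> = ((\<integral>z. of_real (w' z) * F (Y' z) \<partial>M') + of_real (C + 1) * (\<integral>z. F (Y' z) \<partial>M')) / of_real m'"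
      using i1 i2 by (simp del: of_real_add)
    finally show ?thesis .
  qed
  have mz: "complex_of_real m' \<noteq> 0" "complex_of_real (m N) \<noteq> 0" for N
    using m1(1)[of N] m1(2) by auto
  have cQ: "(\<lambda>N. \<integral>z. iexp (s * Y N z) \<partial>Q N) \<longlonglongrightarrow> (\<integral>z. iexp (s * Y' z) \<partial>Q')" for s :: real
  proof -
    have e: "(\<lambda>x. iexp (s * x)) \<in> borel_measurable borel" "\<And>x. norm (iexp (s * x)) \<le> 1" by auto
    show ?thesis
      unfolding IQ[OF e] IQ'[OF e]
      by (intro tendsto_intros cw c mc mz)
  qed
  have YQ: "Y N \<in> borel_measurable (Q N)" "Y' \<in> borel_measurable Q'" for N
    unfolding Q_def Q'_def by auto
  have res: "(\<lambda>N. \<integral>z. \<psi> (Y N z) \<partial>Q N) \<longlonglongrightarrow> (\<integral>z. \<psi> (Y' z) \<partial>Q')"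
    by (rule iexp_tendsto_imp_bdd_continuous_tendsto[OF pQ YQ cQ \<psi>])
  have plain: "(\<lambda>N. \<integral>z. \<psi> (Y N z) \<partial>M N) \<longlonglongrightarrow> (\<integral>z. \<psi> (Y' z) \<partial>M')"
    by (rule iexp_tendsto_imp_bdd_continuous_tendsto[OF p Y c \<psi>])
  have "(\<lambda>N. of_real (m N) * (\<integral>z. \<psi> (Y N z) \<partial>Q N) - of_real (C + 1) * (\<integral>z. \<psi> (Y N z) \<partial>M N))
     \<longlonglongrightarrow> of_real m' * (\<integral>z. \<psi> (Y' z) \<partial>Q') - of_real (C + 1) * (\<integral>z. \<psi> (Y' z) \<partial>M')"
    by (intro tendsto_intros res plain mc)
  then show ?thesis
    unfolding IQ[OF psim \<psi>(2)] IQ'[OF psim \<psi>(2)] using mz by simp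
qed

text \<open>The weight is split into real and imaginary part. Conjugation reverses the sign of s, so
  the hypothesis at s and at -s gives the weighted characteristic functions of both parts.\<close>

lemma weighted_bdd_continuous_tendsto:
  fixes M :: "nat \<Rightarrow> 'b measure" and M' :: "'c measure" and \<psi> :: "real \<Rightarrow> complex"
    and w :: "nat \<Rightarrow> 'b \<Rightarrow> complex"
  assumes p: "\<And>N. prob_space (M N)" "prob_space M'"
    and Y: "\<And>N. Y N \<in> borel_measurable (M N)" "Y' \<in> borel_measurable M'"
    and w: "\<And>N. w N \<in> borel_measurable (M N)" "w' \<in> borel_measurable M'"
    and wb: "\<And>N z. norm (w N z) \<le> C" "\<And>z. norm (w' z) \<le> C"
    and c: "\<And>s::real. (\<lambda>N. \<integral>z. iexp (s * Y N z) \<partial>M N) \<longlonglongrightarrow> (\<integral>z. iexp (s * Y' z) \<partial>M')"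
    and cw: "\<And>s::real. (\<lambda>N. \<integral>z. w N z * iexp (s * Y N z) \<partial>M N)
        \<longlonglongrightarrow> (\<integral>z. w' z * iexp (s * Y' z) \<partial>M')"
    and \<psi>: "\<And>x. isCont \<psi> x" "\<And>x. norm (\<psi> x) \<le> B"
  shows "(\<lambda>N. \<integral>z. w N z * \<psi> (Y N z) \<partial>M N) \<longlonglongrightarrow> (\<integral>z. w' z * \<psi> (Y' z) \<partial>M')"
proof -
  note [measurable] = Y w
  have psim [measurable]: "\<psi> \<in> borel_measurable borel"
    using \<psi>(1) by (auto intro!: borel_measurable_continuous_onI continuous_at_imp_continuous_on)
  have C0: "0 \<le> C" using wb(2) norm_ge_zero order_trans by blast
  have B0: "0 \<le> B" using \<psi>(2) norm_ge_zero order_trans by blast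
  have split: "integrable P (\<lambda>z. v z * F (Z z))"
      "(\<integral>z. cnj (v z) * iexp (s * Z z) \<partial>P) = cnj (\<integral>z. v z * iexp (- s * Z z) \<partial>P)"
      "(\<integral>z. of_real (Re (v z)) * iexp (s * Z z) \<partial>P) = ((\<integral>z. v z * iexp (s * Z z) \<partial>P) + cnj (\<integral>z. v z * iexp (- s * Z z) \<partial>P)) / 2"
      "(\<integral>z. of_real (Im (v z)) * iexp (s * Z z) \<partial>P) = ((\<integral>z. v z * iexp (s * Z z) \<partial>P) - cnj (\<integral>z. v z * iexp (- s * Z z) \<partial>P)) / (2 * \<i>)"
      "(\<integral>z. v z * \<psi> (Z z) \<partial>P) = (\<integral>z. of_real (Re (v z)) * \<psi> (Z z) \<partial>P) + \<i> * (\<integral>z. of_real (Im (v z)) * \<psi> (Z z) \<partial>P)"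
    if P: "prob_space P" and vm[measurable]: "v \<in> borel_measurable P" and Zm[measurable]: "Z \<in> borel_measurable P"
      and Fm[measurable]: "F \<in> borel_measurable borel" and Fb: "\<And>x. norm (F x) \<le> D" and vb: "\<And>z. norm (v z) \<le> C"
    for P :: "'e measure" and v :: "'e \<Rightarrow> complex" and Z :: "'e \<Rightarrow> real" and F :: "real \<Rightarrow> complex" and D s
  proof -
    interpret P: prob_space P by fact
    have int: "integrable P (\<lambda>z. v z * G (Z z))"
      if G[measurable]: "G \<in> borel_measurable borel" and Gb: "\<And>x. norm (G x) \<le> D'" and vm[measurable]: "v \<in> borel_measurable P"
        and vb: "\<And>z. norm (v z) \<le> C"  for G :: "real \<Rightarrow> complex" and D' v
    proof (rule P.integrable_const_bound[of _ "C * D'"])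
      have "0 \<le> D'" using Gb norm_ge_zero order_trans by blast
      then show "AE z in P. norm (v z * G (Z z)) \<le> C * D'"
        using vb Gb C0 by (auto simp: norm_mult intro!: mult_mono)
    qed auto
    show "integrable P (\<lambda>z. v z * F (Z z))" by (rule int[OF Fm Fb vm vb])
    have e: "(\<lambda>x. iexp (t * x)) \<in> borel_measurable borel" "\<And>x. norm (iexp (t * x)) \<le> 1" for t by auto
    have i1: "integrable P (\<lambda>z. v z * iexp (t * Z z))" for t
      using int[OF e vm vb] by simp
    have cm: "(\<lambda>z. cnj (v z)) \<in> borel_measurable P"
      by (rule measurable_compose[OF vm]) (intro borel_measurable_continuous_onI continuous_intros)
    have i2: "integrable P (\<lambda>z. cnj (v z) * iexp (t * Z z))" for t
      using int[OF e cm, of t] vb by simp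
    show cn: "(\<integral>z. cnj (v z) * iexp (s * Z z) \<partial>P) = cnj (\<integral>z. v z * iexp (- s * Z z) \<partial>P)" for s
      by (subst Bochner_Integration.integral_cnj[symmetric]) (simp add: exp_cnj)
    have "(\<integral>z. of_real (Re (v z)) * iexp (s * Z z) \<partial>P) = (\<integral>z. (v z * iexp (s * Z z) + cnj (v z) * iexp (s * Z z)) / 2 \<partial>P)"
      by (intro Bochner_Integration.integral_cong refl) (simp add: complex_eq_iff)
    also have "\<dots> = ((\<integral>z. v z * iexp (s * Z z) \<partial>P) + (\<integral>z. cnj (v z) * iexp (s * Z z) \<partial>P)) / 2"
      using i1 i2 by simp
    finally show "(\<integral>z. of_real (Re (v z)) * iexp (s * Z z) \<partial>P) = ((\<integral>z. v z * iexp (s * Z z) \<partial>P) + cnj (\<integral>z. v z * iexp (- s * Z z) \<partial>P)) / 2"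
      unfolding cn .
    have "(\<integral>z. of_real (Im (v z)) * iexp (s * Z z) \<partial>P) = (\<integral>z. (v z * iexp (s * Z z) - cnj (v z) * iexp (s * Z z)) / (2 * \<i>) \<partial>P)"
      proof (intro Bochner_Integration.integral_cong refl)
      fix z
      have "complex_of_real (Im (v z)) = (v z - cnj (v z)) / (2 * \<i>)" by (simp add: complex_eq_iff)
      then show "of_real (Im (v z)) * iexp (s * Z z) = (v z * iexp (s * Z z) - cnj (v z) * iexp (s * Z z)) / (2 * \<i>)"
        by (simp only: left_diff_distrib times_divide_eq_left)
    qed
    also have "\<dots> = ((\<integral>z. v z * iexp (s * Z z) \<partial>P) - (\<integral>z. cnj (v z) * iexp (s * Z z) \<partial>P)) / (2 * \<i>)"
      using i1 i2 by simp
    finally show "(\<integral>z. of_real (Im (v z)) * iexp (s * Z z) \<partial>P) = ((\<integral>z. v z * iexp (s * Z z) \<partial>P) - cnj (\<integral>z. v z * iexp (- s * Z z) \<partial>P)) / (2 * \<i>)"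
      unfolding cn .
    have r: "(\<lambda>z. complex_of_real (Re (v z))) \<in> borel_measurable P" "(\<lambda>z. complex_of_real (Im (v z))) \<in> borel_measurable P" by measurable
    have rb: "norm (complex_of_real (Re (v z))) \<le> C" "norm (complex_of_real (Im (v z))) \<le> C" for z
      using vb[of z] abs_Re_le_cmod[of "v z"] abs_Im_le_cmod[of "v z"] by auto
    have "(\<integral>z. v z * \<psi> (Z z) \<partial>P) = (\<integral>z. of_real (Re (v z)) * \<psi> (Z z) + \<i> * (of_real (Im (v z)) * \<psi> (Z z)) \<partial>P)"
      by (intro Bochner_Integration.integral_cong refl) (subst complex_eq, simp add: ring_distribs)
    also have "\<dots> = (\<integral>z. of_real (Re (v z)) * \<psi> (Z z) \<partial>P) + \<i> * (\<integral>z. of_real (Im (v z)) * \<psi> (Z z) \<partial>P)"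
      using int[OF psim \<psi>(2) r(1) rb(1)] int[OF psim \<psi>(2) r(2) rb(2)] by simp
    finally show "(\<integral>z. v z * \<psi> (Z z) \<partial>P) = (\<integral>z. of_real (Re (v z)) * \<psi> (Z z) \<partial>P) + \<i> * (\<integral>z. of_real (Im (v z)) * \<psi> (Z z) \<partial>P)" .
  qed
  note sN = split[OF p(1) w(1) Y(1) psim \<psi>(2) wb(1)]
  note s' = split[OF p(2) w(2) Y(2) psim \<psi>(2) wb(2)]
  have reb: "\<bar>Re (w N z)\<bar> \<le> C" "\<bar>Im (w N z)\<bar> \<le> C" for N z
    using wb(1)[of N z] abs_Re_le_cmod[of "w N z"] abs_Im_le_cmod[of "w N z"] by auto
  have reb': "\<bar>Re (w' z)\<bar> \<le> C" "\<bar>Im (w' z)\<bar> \<le> C" for z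
    using wb(2)[of z] abs_Re_le_cmod[of "w' z"] abs_Im_le_cmod[of "w' z"] by auto
  have R: "(\<lambda>N. \<integral>z. of_real (Re (w N z)) * \<psi> (Y N z) \<partial>M N) \<longlonglongrightarrow> (\<integral>z. of_real (Re (w' z)) * \<psi> (Y' z) \<partial>M')"
    by (rule real_weighted_bdd_continuous_tendsto[OF p Y _ _ reb(1) reb'(1) c _ \<psi>], measurable)
       (unfold sN(3) s'(3), intro tendsto_intros cw, simp)
  have I: "(\<lambda>N. \<integral>z. of_real (Im (w N z)) * \<psi> (Y N z) \<partial>M N) \<longlonglongrightarrow> (\<integral>z. of_real (Im (w' z)) * \<psi> (Y' z) \<partial>M')"
    by (rule real_weighted_bdd_continuous_tendsto[OF p Y _ _ reb(2) reb'(2) c _ \<psi>], measurable)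
       (unfold sN(4) s'(4), intro tendsto_intros cw, simp)
  show ?thesis unfolding sN(5) s'(5) by (intro tendsto_intros R I)
qed

text \<open>Replacing one exponential at a time by a general function avoids the
  multidimensional continuity theorem.\<close>

theorem iexp_tendsto_imp_product_tendsto:
  fixes M :: "nat \<Rightarrow> 'b measure" and M' :: "'c measure" and \<psi> :: "nat \<Rightarrow> real \<Rightarrow> complex"
  assumes p: "\<And>N. prob_space (M N)" "prob_space M'"
    and Y: "\<And>N j. j < n \<Longrightarrow> Y N j \<in> borel_measurable (M N)" "\<And>j. j < n \<Longrightarrow> Y' j \<in> borel_measurable M'"
    and c: "\<And>t::nat \<Rightarrow> real. (\<lambda>N. \<integral>z. iexp (\<Sum>j<n. t j * Y N j z) \<partial>M N) \<longlonglongrightarrow> (\<integral>z. iexp (\<Sum>j<n. t j * Y' j z) \<partial>M')"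
    and \<psi>: "\<And>j x. isCont (\<psi> j) x" "\<And>j x. norm (\<psi> j x) \<le> 1"
  shows "(\<lambda>N. \<integral>z. (\<Prod>j<n. \<psi> j (Y N j z)) \<partial>M N) \<longlonglongrightarrow> (\<integral>z. (\<Prod>j<n. \<psi> j (Y' j z)) \<partial>M')"
proof -
  have [measurable]: "\<psi> j \<in> borel_measurable borel" for j
    using \<psi>(1) by (auto intro!: borel_measurable_continuous_onI continuous_at_imp_continuous_on)
  have "(\<lambda>N. \<integral>z. (\<Prod>j<k. \<psi> j (Y N j z)) * iexp (\<Sum>j\<in>{k..<n}. t j * Y N j z) \<partial>M N)
      \<longlonglongrightarrow> (\<integral>z. (\<Prod>j<k. \<psi> j (Y' j z)) * iexp (\<Sum>j\<in>{k..<n}. t j * Y' j z) \<partial>M')" if "k \<le> n" for k t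
    using that
  proof (induction k arbitrary: t)
    case 0
    then show ?case using c[of t] by (simp add: atLeast0LessThan)
  next
    case (Suc k)
    then have k: "k < n" by simp
    have ins: "{k..<n} = insert k {Suc k..<n}" using k by auto
    let ?w = "\<lambda>N z. (\<Prod>j<k. \<psi> j (Y N j z)) * iexp (\<Sum>j\<in>{Suc k..<n}. t j * Y N j z)"
    let ?w' = "\<lambda>z. (\<Prod>j<k. \<psi> j (Y' j z)) * iexp (\<Sum>j\<in>{Suc k..<n}. t j * Y' j z)"
    have pb: "norm (\<Prod>j<k. \<psi> j (a j)) \<le> 1" for a
      unfolding prod_norm[symmetric] by (rule prod_le_1) (use \<psi>(2) in auto)
    have "(\<lambda>N. \<integral>z. ?w N z * \<psi> k (Y N k z) \<partial>M N) \<longlonglongrightarrow> (\<integral>z. ?w' z * \<psi> k (Y' k z) \<partial>M')"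
    proof (rule weighted_bdd_continuous_tendsto[OF p, where C=1 and B=1])
      show "Y N k \<in> borel_measurable (M N)" "Y' k \<in> borel_measurable M'" for N using Y k by auto
      have m1: "(\<lambda>z. \<psi> j (Y N j z)) \<in> borel_measurable (M N)" "(\<lambda>z. \<psi> j (Y' j z)) \<in> borel_measurable M'" if "j < n" for j N
        using Y(1)[OF that, of N] Y(2)[OF that] by measurable
      have m2: "(\<lambda>z. t j * Y N j z) \<in> borel_measurable (M N)" "(\<lambda>z. t j * Y' j z) \<in> borel_measurable M'" if "j < n" for j N
        using Y(1)[OF that, of N] Y(2)[OF that] by measurable
      have m3: "(\<lambda>z. \<Prod>j<k. \<psi> j (Y N j z)) \<in> borel_measurable (M N)" "(\<lambda>z. \<Prod>j<k. \<psi> j (Y' j z)) \<in> borel_measurable M'" for N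
        by (intro borel_measurable_prod m1; use k in simp)+
      have m4: "(\<lambda>z. \<Sum>j\<in>{Suc k..<n}. t j * Y N j z) \<in> borel_measurable (M N)"
         "(\<lambda>z. \<Sum>j\<in>{Suc k..<n}. t j * Y' j z) \<in> borel_measurable M'" for N
        by (intro borel_measurable_sum m2; simp)+
      note [measurable] = m3 m4
      show "?w N \<in> borel_measurable (M N)" "?w' \<in> borel_measurable M'" for N by measurable
      show "norm (?w N z) \<le> 1" for N z using pb[of "\<lambda>j. Y N j z"] by (simp add: norm_mult)
      show "norm (?w' z) \<le> 1" for z using pb[of "\<lambda>j. Y' j z"] by (simp add: norm_mult)
      show "isCont (\<psi> k) x" "norm (\<psi> k x) \<le> 1" for x using \<psi> by auto
      fix s :: real
      have "(\<Sum>j<n. (if j = k then s else 0) * y j) = s * y k" for y :: "nat \<Rightarrow> real"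
        using k by (simp add: if_distrib[of "\<lambda>z. z * _"] cong: if_cong)
      with c[of "\<lambda>j. if j = k then s else 0"]
      show "(\<lambda>N. \<integral>z. iexp (s * Y N k z) \<partial>M N) \<longlonglongrightarrow> (\<integral>z. iexp (s * Y' k z) \<partial>M')" by simp
      have e: "iexp (\<Sum>j\<in>{k..<n}. (t(k := s)) j * y j) = iexp (\<Sum>j\<in>{Suc k..<n}. t j * y j) * iexp (s * y k)" for y :: "nat \<Rightarrow> real"
      proof -
        have "(\<Sum>j\<in>{k..<n}. (t(k := s)) j * y j) = s * y k + (\<Sum>j\<in>{Suc k..<n}. t j * y j)"
          unfolding ins by (subst sum.insert) (auto intro!: sum.cong)
        then show ?thesis by (simp only: of_real_add ring_distribs exp_add mult.commute)
      qed
      have "k \<le> n" using k by simp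
      \<comment> \<open>The induction is over all t, so the argument at index k is free to run
        through every s, as the weighted continuity lemma demands.\<close>
      from Suc.IH[OF this, of "t(k := s)"]
      show "(\<lambda>N. \<integral>z. ?w N z * iexp (s * Y N k z) \<partial>M N) \<longlonglongrightarrow> (\<integral>z. ?w' z * iexp (s * Y' k z) \<partial>M')"
        unfolding e by (simp only: mult.assoc)
    qed
    then show ?case by (simp add: mult_ac)
  qed
  from this[of n] show ?thesis by simp
qed

section \<open>Exponential moments of Gaussian variables and along weakly convergent
  sequences\<close>

lemma (in prob_space) expectation_exp_pos:
  fixes Y :: "'a \<Rightarrow> real"
  assumes "integrable M (\<lambda>z. exp (Y z))"
  shows "0 < (\<integral>z. exp (Y z) \<partial>M)"
  using expectation_greater[OF assms, of 0] by simp

lemma mgf_std_normal: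
  "integrable std_normal_distribution (\<lambda>x. exp (t * x))"
  "(\<integral>x. exp (t * x) \<partial>std_normal_distribution) = exp (t\<^sup>2 / 2)"
proof -
  have e: "std_normal_density x * exp (t * x) = exp (t\<^sup>2 / 2) * normal_density t 1 x" for x
    unfolding normal_density_def by (simp add: exp_add[symmetric] power2_eq_square field_simps)
  have i: "integrable lborel (\<lambda>x. exp (t\<^sup>2 / 2) * normal_density t 1 x)"
    by (intro integrable_mult_right integrable_normal_density) auto
  show "integrable std_normal_distribution (\<lambda>x. exp (t * x))"
    by (subst integrable_density) (use i e in \<open>auto simp: normal_density_nonneg\<close>)
  have "(\<integral>x. exp (t * x) \<partial>std_normal_distribution) = (\<integral>x. exp (t\<^sup>2 / 2) * normal_density t 1 x \<partial>lborel)"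
    by (subst integral_density) (use e in \<open>auto simp: normal_density_nonneg\<close>)
  then show "(\<integral>x. exp (t * x) \<partial>std_normal_distribution) = exp (t\<^sup>2 / 2)"
    by (simp add: integral_normal_density)
qed

text \<open>The characteristic function identifies the law as that of \<open>sqrt v\<close> times a
  standard normal variable (a point mass if v = 0), whose exponential moments are explicit.\<close>

lemma (in prob_space) gaussian_char_imp_exp_moment:
  fixes Y :: "'a \<Rightarrow> real"
  assumes Y[measurable]: "Y \<in> borel_measurable M" and v: "0 \<le> v"
    and ch: "\<And>t. char (distr M borel Y) t = complex_of_real (exp (- (t\<^sup>2 * v) / 2))"
  shows "integrable M (\<lambda>z. exp (t * Y z))" "(\<integral>z. exp (t * Y z) \<partial>M) = exp (t\<^sup>2 * v / 2)"
proof -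
  let ?S = "distr std_normal_distribution borel (\<lambda>x. sqrt v * x)"
  interpret S: prob_space std_normal_distribution by (rule prob_space_normal_density) simp
  have r: "real_distribution ?S" by (rule S.real_distribution_distr) auto
  have "char ?S = char (distr M borel Y)"
  proof
    fix t
    have "char ?S t = char std_normal_distribution (t * sqrt v)"
      unfolding char_def by (subst integral_distr) (auto simp: mult_ac)
    also have "\<dots> = complex_of_real (exp (- (t\<^sup>2 * v) / 2))"
      unfolding char_std_normal_distribution using v by (simp add: power_mult_distrib)
    finally show "char ?S t = char (distr M borel Y) t" using ch by simp
  qed
  then have eq: "distr M borel Y = ?S"
    using Levy_uniqueness[OF r real_distribution_distr[OF Y]] by simp
  have "integrable (distr M borel Y) (\<lambda>x. exp (t * x))"
    unfolding eq by (subst integrable_distr_eq) (use mgf_std_normal(1)[of "t * sqrt v"] in \<open>auto simp: mult_ac\<close>)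
  then show "integrable M (\<lambda>z. exp (t * Y z))" by (subst (asm) integrable_distr_eq) auto
  have "(\<integral>z. exp (t * Y z) \<partial>M) = (\<integral>x. exp (t * x) \<partial>distr M borel Y)" by (subst integral_distr) auto
  also have "\<dots> = (\<integral>x. exp ((t * sqrt v) * x) \<partial>std_normal_distribution)"
    unfolding eq by (subst integral_distr) (auto simp: mult_ac)
  also have "\<dots> = exp (t\<^sup>2 * v / 2)" unfolding mgf_std_normal(2) using v by (simp add: power_mult_distrib)
  finally show "(\<integral>z. exp (t * Y z) \<partial>M) = exp (t\<^sup>2 * v / 2)" .
qed

text \<open>The second exponential moment gives uniform integrability: cutting \<open>exp\<close> at
  height L costs at most \<open>exp (2 * y) / L\<close> pointwise, and the cut function is bounded
  and continuous.\<close>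

lemma weak_conv_m_imp_exp_moment_tendsto:
  fixes M :: "nat \<Rightarrow> 'b measure" and M' :: "'c measure"
  assumes p: "\<And>N. prob_space (M N)" "prob_space M'"
    and Y: "\<And>N. Y N \<in> borel_measurable (M N)" "Y' \<in> borel_measurable M'"
    and wc: "weak_conv_m (\<lambda>N. distr (M N) borel (Y N)) (distr M' borel Y')"
    and i1: "\<And>N. integrable (M N) (\<lambda>z. exp (Y N z))" "integrable M' (\<lambda>z. exp (Y' z))"
    and i2: "\<And>N. integrable (M N) (\<lambda>z. exp (2 * Y N z))" "integrable M' (\<lambda>z. exp (2 * Y' z))"
    and bd: "\<forall>\<^sub>F N in sequentially. (\<integral>z. exp (2 * Y N z) \<partial>M N) \<le> B"
  shows "(\<lambda>N. \<integral>z. exp (Y N z) \<partial>M N) \<longlonglongrightarrow> (\<integral>z. exp (Y' z) \<partial>M')"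
proof (rule LIMSEQ_I)
  note [measurable] = Y
  interpret MN: prob_space "M N" for N by fact
  interpret M': prob_space M' by fact
  fix r :: real assume r: "0 < r"
  define B' where "B' = max 0 (max B (\<integral>z. exp (2 * Y' z) \<partial>M'))"
  define L where "L = 3 * (B' + 1) / r"
  have B': "0 \<le> B'" "B \<le> B'" "(\<integral>z. exp (2 * Y' z) \<partial>M') \<le> B'" by (auto simp: B'_def)
  have L: "0 < L" "B' / L < r / 3" using B'(1) r by (auto simp: L_def field_simps)
  let ?h = "\<lambda>y::real. min (exp y) L"
  have rd: "real_distribution (distr (M N) borel (Y N))" "real_distribution (distr M' borel Y')" for N
    using Y by auto
  have "(\<lambda>N. integral\<^sup>L (distr (M N) borel (Y N)) ?h) \<longlonglongrightarrow> integral\<^sup>L (distr M' borel Y') ?h"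
    by (rule weak_conv_imp_integral_bdd_continuous_conv[OF rd wc, where B=L]) (use L in \<open>auto intro!: continuous_intros\<close>)
  then have hc: "(\<lambda>N. \<integral>z. ?h (Y N z) \<partial>M N) \<longlonglongrightarrow> (\<integral>z. ?h (Y' z) \<partial>M')" by (simp add: integral_distr)
  have pt: "exp y - ?h y \<le> exp (2 * y) / L" "0 \<le> exp y - ?h y" for y :: real
  proof -
    show "exp y - ?h y \<le> exp (2 * y) / L"
    proof (cases "exp y \<le> L")
      case False
      then have "exp y * L \<le> exp y * exp y" by (intro mult_left_mono) auto
      then have "exp y \<le> exp (2 * y) / L" using L by (simp add: field_simps exp_add[symmetric])
      then show ?thesis using L by (simp add: min_def)
    qed (use L in auto)
  qed auto
  have trunc: "\<bar>(\<integral>z. exp (Z z) \<partial>P) - (\<integral>z. ?h (Z z) \<partial>P)\<bar> \<le> (\<integral>z. exp (2 * Z z) \<partial>P) / L"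
    if P: "prob_space P" and [measurable]: "Z \<in> borel_measurable P" and i1: "integrable P (\<lambda>z. exp (Z z))"
      and i2: "integrable P (\<lambda>z. exp (2 * Z z))" for P :: "'e measure" and Z
  proof -
    interpret P: prob_space P by fact
    have ih: "integrable P (\<lambda>z. ?h (Z z))" by (rule P.integrable_const_bound[of _ L]) (use L in auto)
    have "(\<integral>z. exp (Z z) \<partial>P) - (\<integral>z. ?h (Z z) \<partial>P) = (\<integral>z. exp (Z z) - ?h (Z z) \<partial>P)" using i1 ih by simp
    moreover have "(\<integral>z. exp (Z z) - ?h (Z z) \<partial>P) \<le> (\<integral>z. exp (2 * Z z) / L \<partial>P)"
      by (rule integral_mono) (use i1 ih i2 pt in auto)
    moreover have "0 \<le> (\<integral>z. exp (Z z) - ?h (Z z) \<partial>P)" by (rule integral_nonneg_AE) auto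
    ultimately show ?thesis by simp
  qed
  have "\<forall>\<^sub>F N in sequentially. norm ((\<integral>z. ?h (Y N z) \<partial>M N) - (\<integral>z. ?h (Y' z) \<partial>M')) < r / 3"
    using tendstoD[OF hc, of "r / 3"] r by (simp add: dist_real_def)
  then have "\<forall>\<^sub>F N in sequentially. norm ((\<integral>z. exp (Y N z) \<partial>M N) - (\<integral>z. exp (Y' z) \<partial>M')) < r"
    using bd
  proof eventually_elim
    case (elim N)
    have "(\<integral>z. exp (2 * Y N z) \<partial>M N) / L \<le> B' / L" using elim(2) B' L by (intro divide_right_mono) auto
    moreover have "(\<integral>z. exp (2 * Y' z) \<partial>M') / L \<le> B' / L" using B' L by (intro divide_right_mono) auto
    ultimately show ?case
      using trunc[OF p(1) Y(1) i1(1) i2(1), of N] trunc[OF p(2) Y(2) i1(2) i2(2)] elim(1) L(2)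
      unfolding real_norm_def by linarith
  qed
  then show "\<exists>no. \<forall>N\<ge>no. norm ((\<integral>z. exp (Y N z) \<partial>M N) - (\<integral>z. exp (Y' z) \<partial>M')) < r"
    by (simp add: eventually_sequentially)
qed

text \<open>A Paley--Zygmund argument: a normalised second moment bound prevents the mean
  from running away while the law stays tight.\<close>

lemma weak_conv_m_imp_exp_moment_bounded:
  fixes M :: "nat \<Rightarrow> 'b measure" and M' :: "'c measure"
  assumes p: "\<And>N. prob_space (M N)" "prob_space M'"
    and Y: "\<And>N. Y N \<in> borel_measurable (M N)" "Y' \<in> borel_measurable M'"
    and wc: "weak_conv_m (\<lambda>N. distr (M N) borel (Y N)) (distr M' borel Y')"
    and i1: "\<And>N. integrable (M N) (\<lambda>z. exp (Y N z))"
    and i2: "\<And>N. integrable (M N) (\<lambda>z. exp (2 * Y N z))"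
    and bd: "\<And>N. (\<integral>z. exp (2 * Y N z) \<partial>M N) \<le> B * (\<integral>z. exp (Y N z) \<partial>M N)\<^sup>2" and B: "0 \<le> B"
  shows "\<exists>C. \<forall>\<^sub>F N in sequentially. (\<integral>z. exp (Y N z) \<partial>M N) \<le> C"
proof -
  note [measurable] = Y
  interpret MN: prob_space "M N" for N by fact
  interpret M': prob_space M' by fact
  define q where "q = 1 / (4 * (B + 1))"
  have q: "0 < q" using B by (simp add: q_def)
  \<comment> \<open>A continuous stand-in for the indicator of y > l, so that smallness of the tail
    passes from the limit law to the laws for large N.\<close>
  define h where "h l y = min 1 (max 0 (y - real l))" for l and y :: real
  have h01: "0 \<le> h l y" "h l y \<le> 1" for l y by (auto simp: h_def)
  have hcont: "isCont (h l) y" for l y unfolding h_def by (intro continuous_intros)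
  have [measurable]: "h l \<in> borel_measurable borel" for l
    using hcont by (auto intro!: borel_measurable_continuous_onI continuous_at_imp_continuous_on)
  have "(\<lambda>l. \<integral>z. h l (Y' z) \<partial>M') \<longlonglongrightarrow> (\<integral>z. 0 \<partial>M')"
  proof (rule integral_dominated_convergence[where w="\<lambda>_. 1"])
    show "AE z in M'. (\<lambda>l. h l (Y' z)) \<longlonglongrightarrow> 0"
    proof (rule AE_I2)
      fix z
      have "\<forall>\<^sub>F l in sequentially. h l (Y' z) = 0"
        using eventually_ge_at_top[of "nat \<lceil>Y' z\<rceil>"] by eventually_elim (simp add: h_def max_def nat_ceiling_le_eq)
      then show "(\<lambda>l. h l (Y' z)) \<longlonglongrightarrow> 0" by (rule tendsto_eventually)
    qed
  qed (use h01 in auto)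
  then have "\<forall>\<^sub>F l in sequentially. (\<integral>z. h l (Y' z) \<partial>M') < q" using q by (intro order_tendstoD) auto
  then obtain l where l: "(\<integral>z. h l (Y' z) \<partial>M') < q" using eventually_happens'[OF sequentially_bot] by blast
  have rd: "real_distribution (distr (M N) borel (Y N))" "real_distribution (distr M' borel Y')" for N
    using Y by auto
  have "(\<lambda>N. integral\<^sup>L (distr (M N) borel (Y N)) (h l)) \<longlonglongrightarrow> integral\<^sup>L (distr M' borel Y') (h l)"
    by (rule weak_conv_imp_integral_bdd_continuous_conv[OF rd wc, where B=1]) (use h01 hcont in auto)
  then have hc: "(\<lambda>N. \<integral>z. h l (Y N z) \<partial>M N) \<longlonglongrightarrow> (\<integral>z. h l (Y' z) \<partial>M')" by (simp add: integral_distr)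
  have "\<forall>\<^sub>F N in sequentially. (\<integral>z. h l (Y N z) \<partial>M N) < q" using l by (intro order_tendstoD[OF hc])
  then have "\<forall>\<^sub>F N in sequentially. (\<integral>z. exp (Y N z) \<partial>M N) \<le> 2 * exp (real l + 1)"
  proof eventually_elim
    case (elim N)
    define E where "E = (\<integral>z. exp (Y N z) \<partial>M N)"
    have E: "0 < E" unfolding E_def by (rule MN.expectation_exp_pos[OF i1])
    \<comment> \<open>The weight in 2ab <= c a^2 + b^2 / c. With it the second-moment term is at
      most E / 2 and the tail term equals E / 2, so after halving E <= exp (l + 1) + E / 2, and E is
      absorbed on the left.\<close>
    define c where "c = 1 / (2 * (B + 1) * E)"
    have c: "0 < c" using E B by (simp add: c_def)
    have pt: "exp y \<le> exp (real l + 1) + (c * exp (2 * y) + h l y / c) / 2" for y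
    proof (cases "y \<le> real l + 1")
      case True
      then have "exp y \<le> exp (real l + 1)" by simp
      moreover have "0 \<le> (c * exp (2 * y) + h l y / c) / 2" using c h01[of l y] by simp
      ultimately show ?thesis by linarith
    next
      case False
      then have h: "h l y = 1" by (simp add: h_def)
      have "0 \<le> (c * exp y - 1)\<^sup>2 / c" using c by simp
      also have "\<dots> = c * exp (2 * y) + 1 / c - 2 * exp y"
        using c by (simp add: power2_eq_square field_simps exp_double[symmetric] exp_add[symmetric])
      finally have "2 * exp y \<le> c * exp (2 * y) + 1 / c" by linarith
      then have "exp y \<le> (c * exp (2 * y) + h l y / c) / 2"
        unfolding h by (subst pos_le_divide_eq) (simp_all add: mult.commute)
      then show ?thesis by (smt (verit) exp_gt_zero)
    qed
    have ih: "integrable (M N) (\<lambda>z. h l (Y N z))" by (rule MN.integrable_const_bound[of _ 1]) (use h01 in auto)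
    have "E \<le> (\<integral>z. exp (real l + 1) + (c * exp (2 * Y N z) + h l (Y N z) / c) / 2 \<partial>M N)"
      unfolding E_def by (rule integral_mono) (use i1 i2 ih pt in auto)
    also have "\<dots> = exp (real l + 1) + (c * (\<integral>z. exp (2 * Y N z) \<partial>M N) + (\<integral>z. h l (Y N z) \<partial>M N) / c) / 2"
      using i2 ih by (simp add: MN.prob_space)
    also have "\<dots> \<le> exp (real l + 1) + (c * (B * E\<^sup>2) + q / c) / 2"
      using bd[of N] elim c unfolding E_def
      by (intro add_left_mono divide_right_mono add_mono mult_left_mono) auto
    also have "c * (B * E\<^sup>2) \<le> E / 2"
    proof -
      have "c * (B * E\<^sup>2) = (B / (B + 1)) * (E / 2)" using E B by (simp add: c_def power2_eq_square)
      also have "\<dots> \<le> 1 * (E / 2)" using E B by (intro mult_right_mono) auto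
      finally show ?thesis by simp
    qed
    also have "q / c = E / 2" using E B by (simp add: c_def q_def field_simps)
    finally show ?case unfolding E_def by simp
  qed
  then show ?thesis by blast
qed

section \<open>Dyadic scales and integrable powers of the norm\<close>

lemma dyadic_scale:
  fixes r :: real
  assumes "0 < r" "r \<le> 1"
  obtains k where "(1/2) ^ Suc k < r" "r \<le> (1/2) ^ k"
proof -
  obtain n where "(1/2 :: real) ^ n < r" using real_arch_pow_inv[of r "1/2"] assms by auto
  then have ex: "\<exists>n. (1/2 :: real) ^ n < r" by blast
  define m where "m = (LEAST n. (1/2 :: real) ^ n < r)"
  have m: "(1/2 :: real) ^ m < r" unfolding m_def using ex by (rule LeastI_ex)
  then have "m \<noteq> 0" using assms(2) by (intro notI) simp
  then obtain k where k: "m = Suc k" by (cases m) auto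
  have "\<not> (1/2 :: real) ^ k < r" using k unfolding m_def by (metis lessI not_less_Least)
  then show ?thesis using that[of k] m k by simp
qed

text \<open>On the dyadic shell number k the integrand is at most \<open>c k\<close>. Together with
  the volume of the enclosing ball this gives a geometric series of ratio 2^(s - d).\<close>

lemma nn_integral_norm_powr_finite:
  assumes s: "0 \<le> s" "s < real DIM('a)"
  shows "(\<integral>\<^sup>+x. indicator (ball (0::'a::euclidean_space) 1) x * ennreal (norm x powr (- s)) \<partial>lborel) < \<infinity>"
proof -
  define d where "d = real DIM('a)"
  define V where "V = unit_ball_vol d"
  define A where "A k = cball (0::'a) ((1/2) ^ k)" for k :: nat
  define c where "c k = 2 powr (real (Suc k) * s)" for k :: nat
  have V: "0 \<le> V" unfolding V_def by (rule unit_ball_vol_nonneg) (simp add: d_def)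
  have [measurable]: "A k \<in> sets borel" for k by (simp add: A_def)
  have eA: "emeasure lborel (A k) = ennreal (V * (1/2) powr (real k * d))" for k
    unfolding A_def V_def d_def by (subst emeasure_cball) (auto simp: powr_realpow[symmetric] powr_powr)
  have pt: "indicator (ball 0 1) x * ennreal (norm x powr (- s)) \<le> (\<Sum>k. ennreal (c k) * indicator (A k) x)" for x :: 'a
  proof (cases "0 < norm x \<and> norm x < 1")
    case True
    then obtain k where k: "(1/2) ^ Suc k < norm x" "norm x \<le> (1/2) ^ k" using dyadic_scale[of "norm x"] by (metis less_imp_le)
    have "norm x powr (- s) \<le> ((1/2) ^ Suc k) powr (- s)" using k True s by (intro powr_mono2') auto
    also have "\<dots> = c k"
      unfolding c_def by (subst powr_realpow[symmetric]) (auto simp: powr_powr powr_minus_divide powr_divide simp del: power_Suc)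
    finally have "indicator (ball 0 1) x * ennreal (norm x powr (- s)) \<le> ennreal (c k) * indicator (A k) x"
      using True k by (simp add: A_def ennreal_leI)
    also have "\<dots> \<le> (\<Sum>k. ennreal (c k) * indicator (A k) x)"
      using sum_le_suminf[of "\<lambda>k. ennreal (c k) * indicator (A k) x" "{k}"]
      by (simp only: sum.insert finite.emptyI finite_insert empty_iff not_False_eq_True sum.empty add_0_right) auto
    finally show ?thesis .
  next
    case False
    then have "x = 0 \<or> x \<notin> ball 0 1" by auto
    then have "indicator (ball 0 1) x * ennreal (norm x powr (- s)) = 0" by auto
    then show ?thesis by (simp only: zero_le)
  qed
  have "(\<integral>\<^sup>+x. indicator (ball (0::'a) 1) x * ennreal (norm x powr (- s)) \<partial>lborel)
      \<le> (\<integral>\<^sup>+x. (\<Sum>k. ennreal (c k) * indicator (A k) x) \<partial>lborel)"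
    by (rule nn_integral_mono) (rule pt)
  also have "\<dots> = (\<Sum>k. ennreal (c k) * emeasure lborel (A k))"
    by (subst nn_integral_suminf) (simp_all add: nn_integral_cmult_indicator)
  also have "\<dots> = (\<Sum>k. ennreal (2 powr s * V * (2 powr (s - d)) ^ k))"
  proof -
    have "c k * (V * (1/2) powr (real k * d)) = 2 powr s * V * (2 powr (s - d)) ^ k" for k
      by (subst powr_realpow[symmetric]) (auto simp: c_def powr_powr powr_add[symmetric] powr_divide powr_diff[symmetric] algebra_simps powr_minus_divide[symmetric] divide_powr_uminus)
    note eq = this
    have "ennreal (c k) * emeasure lborel (A k) = ennreal (2 powr s * V * (2 powr (s - d)) ^ k)" for k
      unfolding eA eq[of k, symmetric] by (rule ennreal_mult[symmetric]) (use V in \<open>auto simp: c_def\<close>)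
    then show ?thesis by simp
  qed
  also have "\<dots> = ennreal (\<Sum>k. 2 powr s * V * (2 powr (s - d)) ^ k)"
  proof (rule suminf_ennreal2)
    have "2 powr (s - d) < 1" using s by (simp add: d_def powr_less_one)
    then show "summable (\<lambda>k. 2 powr s * V * (2 powr (s - d)) ^ k)"
      by (intro summable_mult summable_geometric) auto
  qed (use V in auto)
  also have "\<dots> < \<infinity>" by simp
  finally show ?thesis .
qed

section \<open>Mollifiers and the logarithmic kernel\<close>

lemma sets_ball[measurable]:
  "ball c r \<in> sets borel" "cball c r \<in> sets borel" for c :: "'a::metric_space"
  by auto

lemma borel_measurable_ln_norm[measurable]:
  "(\<lambda>v::'a::euclidean_space. ln (1 / norm v)) \<in> borel_measurable borel"
  "(\<lambda>v::'a. norm v powr s) \<in> borel_measurable borel"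
  by measurable

lemma compact_closed_subset: "compact A \<Longrightarrow> closed B \<Longrightarrow> B \<subseteq> A \<Longrightarrow> compact B"
  for A B :: "'a::t2_space set"
  using compact_Int_closed[of A B] by (simp add: Int_absorb1)

section \<open>Smooth test functions are closed under linear combination and affine
  substitution\<close>

lemma Ck_lincomb:
  assumes "Ck k UNIV f" "Ck k UNIV h"
  shows "Ck k UNIV (\<lambda>x. a * f x + b * h x)"
  using assms
proof (induction k arbitrary: f h)
  case 0
  then show ?case by (auto intro!: continuous_intros)
next
  case (Suc k)
  have d: "((\<lambda>x. a * f x + b * h x) has_derivative
      (\<lambda>i. a * frechet_derivative f (at x) i + b * frechet_derivative h (at x) i)) (at x)" for x
    using Suc.prems by (intro derivative_intros) (auto simp: frechet_derivative_works[symmetric])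
  have e: "frechet_derivative (\<lambda>x. a * f x + b * h x) (at x) i
      = a * frechet_derivative f (at x) i + b * frechet_derivative h (at x) i" for x i
    using frechet_derivative_at[OF d[of x]] by metis
  show ?case
    using Suc d by (auto simp: e differentiable_def)
qed

lemma Ck_affine:
  assumes "Ck k UNIV f"
  shows "Ck k UNIV (\<lambda>u. f (c *\<^sub>R u + t))"
  using assms
proof (induction k arbitrary: f)
  case 0
  then have "continuous_on UNIV f" by simp
  then show ?case by (auto intro!: continuous_intros continuous_on_compose2[of UNIV f])
next
  case (Suc k)
  have d: "((\<lambda>u. f (c *\<^sub>R u + t)) has_derivative
      (\<lambda>i. frechet_derivative f (at (c *\<^sub>R x + t)) (c *\<^sub>R i))) (at x)" for x
  proof -
    have "(f has_derivative frechet_derivative f (at (c *\<^sub>R x + t))) (at (c *\<^sub>R x + t))"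
      using Suc.prems by (auto simp: frechet_derivative_works[symmetric])
    moreover have "((\<lambda>u. c *\<^sub>R u + t) has_derivative (\<lambda>i. c *\<^sub>R i)) (at x)"
      by (auto intro!: derivative_eq_intros)
    ultimately show ?thesis by (rule has_derivative_compose[rotated])
  qed
  have e: "frechet_derivative (\<lambda>u. f (c *\<^sub>R u + t)) (at x) i = c * frechet_derivative f (at (c *\<^sub>R x + t)) i + 0 * 0" for x i
  proof -
    have "linear (frechet_derivative f (at (c *\<^sub>R x + t)))"
      using Suc.prems by (auto intro!: linear_frechet_derivative)
    then show ?thesis using frechet_derivative_at[OF d[of x]] by (metis add.right_neutral linear_scale mult_zero_left real_scaleR_def)
  qed
  have z: "Ck k UNIV (\<lambda>x::'a. 0::real)" for k by (induction k) auto
  show ?case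
    unfolding Ck.simps e using Suc.prems d
    by (auto simp: differentiable_def intro!: Ck_lincomb[OF Suc.IH z, simplified])
qed

lemma Cc_inf_lincomb:
  assumes "Cc_inf U f" "Cc_inf U h"
  shows "Cc_inf U (\<lambda>x. a * f x + b * h x)"
proof -
  have "supp (\<lambda>x. a * f x + b * h x) \<subseteq> supp f \<union> supp h"
    unfolding supp_def closure_Un[symmetric] by (rule closure_mono) auto
  moreover have "compact (supp f \<union> supp h)" using assms by (auto simp: Cc_inf_def)
  moreover have "closed (supp (\<lambda>x. a * f x + b * h x))" by (simp add: supp_def)
  ultimately have "compact (supp (\<lambda>x. a * f x + b * h x))" "supp (\<lambda>x. a * f x + b * h x) \<subseteq> U"
    using assms by (auto intro: compact_closed_subset simp: Cc_inf_def)
  then show ?thesis using assms by (auto simp: Cc_inf_def C_inf_def Ck_lincomb)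
qed

lemma Cc_inf_zero: "Cc_inf U (\<lambda>x::'a::euclidean_space. 0)"
proof -
  have "Ck k UNIV (\<lambda>x::'a. 0::real)" for k by (induction k) auto
  then show ?thesis by (simp add: Cc_inf_def C_inf_def supp_def)
qed

lemma Cc_inf_sum:
  assumes "finite A" "\<And>j. j \<in> A \<Longrightarrow> Cc_inf U (h j)"
  shows "Cc_inf U (\<lambda>x. \<Sum>j\<in>A. t j * h j x)"
  using assms
proof (induction A rule: finite_induct)
  case (insert j A)
  then show ?case using Cc_inf_lincomb[of U "h j" "\<lambda>x. \<Sum>j\<in>A. t j * h j x" "t j" 1] by simp
qed (simp add: Cc_inf_zero)

section \<open>Affine substitution and the logarithmic singularity\<close>

lemma
  fixes F :: "'a::euclidean_space \<Rightarrow> real"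
  assumes c: "c \<noteq> 0"
  shows lborel_integral_affine: "(\<integral>u. F u \<partial>lborel) = \<bar>c\<bar> ^ DIM('a) * (\<integral>w. F (t + c *\<^sub>R w) \<partial>lborel)"
    and lborel_integrable_affine: "F \<in> borel_measurable borel \<Longrightarrow> integrable lborel F \<longleftrightarrow> integrable lborel (\<lambda>w. F (t + c *\<^sub>R w))"
proof -
  show i: "integrable lborel F \<longleftrightarrow> integrable lborel (\<lambda>w. F (t + c *\<^sub>R w))" if [measurable]: "F \<in> borel_measurable borel" for F :: "'a \<Rightarrow> real"
  proof -
    have "integrable lborel F \<longleftrightarrow> integrable (density (distr lborel borel (\<lambda>x. t + c *\<^sub>R x)) (\<lambda>_. ennreal (\<bar>c\<bar> ^ DIM('a)))) F"
      using lborel_affine[OF c, of t] by simp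
    also have "\<dots> \<longleftrightarrow> integrable (distr lborel borel (\<lambda>x. t + c *\<^sub>R x)) (\<lambda>x. \<bar>c\<bar> ^ DIM('a) *\<^sub>R F x)"
      by (rule integrable_density) auto
    also have "\<dots> \<longleftrightarrow> integrable lborel (\<lambda>w. \<bar>c\<bar> ^ DIM('a) *\<^sub>R F (t + c *\<^sub>R w))"
      by (rule integrable_distr_eq) auto
    also have "\<dots> \<longleftrightarrow> integrable lborel (\<lambda>w. F (t + c *\<^sub>R w))"
      using c by simp
    finally show ?thesis .
  qed
  show "(\<integral>u. F u \<partial>lborel) = \<bar>c\<bar> ^ DIM('a) * (\<integral>w. F (t + c *\<^sub>R w) \<partial>lborel)"
  proof (cases "F \<in> borel_measurable borel")
    case [measurable]: True
    have "(\<integral>u. F u \<partial>lborel) = (\<integral>u. F u \<partial>density (distr lborel borel (\<lambda>x. t + c *\<^sub>R x)) (\<lambda>_. ennreal (\<bar>c\<bar> ^ DIM('a))))"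
      using lborel_affine[OF c, of t] by simp
    also have "\<dots> = (\<integral>w. \<bar>c\<bar> ^ DIM('a) *\<^sub>R F w \<partial>distr lborel borel (\<lambda>x. t + c *\<^sub>R x))"
      by (rule integral_density) auto
    also have "\<dots> = (\<integral>w. \<bar>c\<bar> ^ DIM('a) *\<^sub>R F (t + c *\<^sub>R w) \<partial>lborel)"
      by (rule integral_distr) auto
    finally show ?thesis by simp
  next
    \<comment> \<open>A function that is not measurable stays so after the substitution, and both
      integrals take the default value 0; the formula therefore holds for every F.\<close>
    case False
    have "(\<lambda>w. F (t + c *\<^sub>R w)) \<notin> borel_measurable borel"
    proof
      assume m: "(\<lambda>w. F (t + c *\<^sub>R w)) \<in> borel_measurable borel"
      have "(\<lambda>u. (1/c) *\<^sub>R (u - t)) \<in> borel_measurable borel" by measurable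
      from measurable_compose[OF this m] have "F \<in> borel_measurable borel" using c by simp
      with False show False by simp
    qed
    then have "\<not> integrable lborel F" "\<not> integrable lborel (\<lambda>w. F (t + c *\<^sub>R w))"
      using False by (auto dest: borel_measurable_integrable)
    then show ?thesis by (simp add: not_integrable_integral_eq)
  qed
qed

lemma integrable_norm_powr_ball:
  assumes s: "0 \<le> s" "s < real DIM('a)"
  shows "integrable lborel (\<lambda>x::'a::euclidean_space. indicator (ball 0 1) x * norm x powr (- s))"
proof (rule integrableI_nonneg)
  have "(\<integral>\<^sup>+x. ennreal (indicator (ball (0::'a) 1) x * norm x powr (- s)) \<partial>lborel)
     = (\<integral>\<^sup>+x. indicator (ball (0::'a) 1) x * ennreal (norm x powr (- s)) \<partial>lborel)"
    by (intro nn_integral_cong) (auto simp: indicator_def)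
  then show "(\<integral>\<^sup>+x. ennreal (indicator (ball (0::'a) 1) x * norm x powr (- s)) \<partial>lborel) < \<infinity>"
    using nn_integral_norm_powr_finite[OF s] by simp
qed auto

lemma ln_inverse_le_powr_half:
  fixes r :: real
  assumes "0 < r"
  shows "ln (1 / r) \<le> 2 * r powr (-(1/2))"
proof -
  have "ln (r powr (-(1/2))) \<le> r powr (-(1/2))"
    using assms ln_le_minus_one[of "r powr (-(1/2))"] by simp
  then show ?thesis using assms by (simp add: ln_powr ln_div)
qed

lemma abs_ln_norm_le:
  "\<bar>ln (1 / norm w)\<bar> \<le> 2 * (indicator (ball 0 1) w * norm w powr (-(1/2))) + norm w" for w :: "'a::euclidean_space"
proof (cases "w = 0")
  case False
  show ?thesis
  proof (cases "norm w < 1")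
    case True
    then have "0 \<le> ln (1 / norm w)" using False by simp
    then show ?thesis using True False ln_inverse_le_powr_half[of "norm w"] by (simp add: add_increasing2)
  next
    case g: False
    then have "ln (1 / norm w) \<le> 0" "- ln (1 / norm w) = ln (norm w)" using False by (auto simp: ln_div)
    then show ?thesis using g False ln_le_minus_one[of "norm w"] by simp
  qed
qed simp

lemma integrable_indicator_cball_ln:
  "integrable lborel (\<lambda>w::'a::euclidean_space. indicator (cball 0 r) w * ln (1 / norm w))"
proof (rule Bochner_Integration.integrable_bound)
  have h: "(1/2::real) < real DIM('a)" using DIM_positive[where 'a='a] by linarith
  show "integrable lborel (\<lambda>w::'a. 2 * (indicator (ball 0 1) w * norm w powr (-(1/2))) + indicator (cball 0 r) w *\<^sub>R \<bar>r\<bar>)"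
    using integrable_norm_powr_ball[of "1/2", where 'a='a] h
    by (intro Bochner_Integration.integrable_add integrable_mult_right integrable_scaleR_left integrable_real_indicator) (auto simp: emeasure_lborel_cball_finite[unfolded infinity_ennreal_def])
  show "AE w::'a in lborel. norm (indicator (cball 0 r) w * ln (1 / norm w))
      \<le> norm (2 * (indicator (ball 0 1) w * norm w powr (-(1/2))) + indicator (cball 0 r) w *\<^sub>R \<bar>r\<bar>)"
  proof (rule AE_I2)
    fix w :: 'a
    show "norm (indicator (cball 0 r) w * ln (1 / norm w))
      \<le> norm (2 * (indicator (ball 0 1) w * norm w powr (-(1/2))) + indicator (cball 0 r) w *\<^sub>R \<bar>r\<bar>)"
      using abs_ln_norm_le[of w] by (cases "norm w \<le> r") auto
  qed
qed auto

section \<open>Mollifiers and their logarithmic potentials\<close>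

locale mollifier =
  fixes \<phi> :: "'a::euclidean_space \<Rightarrow> real" and R :: real
  assumes phi_smooth: "C_inf UNIV \<phi>" and phi_nonneg: "\<And>x. 0 \<le> \<phi> x"
    and phi_supp: "supp \<phi> \<subseteq> cball 0 R" and R1: "1 \<le> R" and phi_int: "integral\<^sup>L lborel \<phi> = 1"
begin

lemma phi_cont: "continuous_on UNIV \<phi>"
  using phi_smooth unfolding C_inf_def by (metis Ck.simps(1))

lemma phi_meas[measurable]: "\<phi> \<in> borel_measurable borel"
  using phi_cont by (rule borel_measurable_continuous_onI)

lemma phi_zero: "R < norm x \<Longrightarrow> \<phi> x = 0"
  using phi_supp closure_subset[of "{x. \<phi> x \<noteq> 0}"] unfolding supp_def by force

lemma phi_bounded: obtains M where "0 < M" "\<And>x. \<phi> x \<le> M"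
proof -
  have "compact (\<phi> ` cball 0 R)" by (intro compact_continuous_image continuous_on_subset[OF phi_cont]) auto
  then obtain B where B: "\<And>x. x \<in> cball 0 R \<Longrightarrow> \<bar>\<phi> x\<bar> \<le> B" unfolding compact_eq_bounded_closed bounded_iff by force
  have "\<phi> x \<le> max B 0 + 1" for x using B[of x] phi_zero[of x] by (cases "norm x \<le> R") auto
  then show ?thesis using that[of "max B 0 + 1"] by simp
qed

lemma phi_integrable: "integrable lborel \<phi>"
  using phi_int not_integrable_integral_eq by fastforce

abbreviation (input) pe :: "real \<Rightarrow> 'a \<Rightarrow> 'a \<Rightarrow> real" where
  "pe e y u \<equiv> phi_eps \<phi> e (y - u)"

lemma phi_eps_meas[measurable]: "phi_eps \<phi> e \<in> borel_measurable borel"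
  unfolding phi_eps_def by measurable

lemma pe_nonneg: "0 < e \<Longrightarrow> 0 \<le> pe e y u"
  using phi_nonneg by (simp add: phi_eps_def)

lemma pe_zero: "0 < e \<Longrightarrow> u \<notin> cball y (R * e) \<Longrightarrow> pe e y u = 0"
proof -
  assume e: "0 < e" and u: "u \<notin> cball y (R * e)"
  then have "R < norm (y - u) / e" by (simp add: dist_norm pos_less_divide_eq)
  also have "\<dots> = norm ((y - u) /\<^sub>R e)" using e by (simp add: divide_inverse mult.commute del: scaleR_right_diff_distrib)
  finally have "R < norm ((y - u) /\<^sub>R e)" .
  then show ?thesis using phi_zero by (simp add: phi_eps_def)
qed

lemma pe_bounded:
  assumes "0 < e" obtains M where "0 < M" "\<And>y u. pe e y u \<le> M"
proof -
  obtain M where M: "0 < M" "\<And>x. \<phi> x \<le> M" using phi_bounded by blast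
  then show ?thesis using that[of "M / e ^ DIM('a)"] assms by (auto simp: phi_eps_def divide_right_mono)
qed

lemma phi_eps_cont: "continuous_on UNIV (phi_eps \<phi> e)"
proof -
  have "continuous_on UNIV (\<lambda>x. \<phi> (x /\<^sub>R e))"
    by (rule continuous_on_compose2[OF phi_cont]) (auto intro!: continuous_intros)
  then show ?thesis unfolding phi_eps_def divide_inverse by (intro continuous_intros)
qed

lemma phi_eps_tendsto: "(\<lambda>n. z n) \<longlonglongrightarrow> l \<Longrightarrow> (\<lambda>n. phi_eps \<phi> e (z n)) \<longlonglongrightarrow> phi_eps \<phi> e l"
  using phi_eps_cont[of e] by (simp add: continuous_on_eq_continuous_at isCont_tendsto_compose)

lemma pe_has_integral:
  assumes e: "0 < e"
  shows "integrable lborel (pe e y)" "(\<integral>u. pe e y u \<partial>lborel) = 1"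
proof -
  have eq: "pe e y (y + (- e) *\<^sub>R w) = \<phi> w / e ^ DIM('a)" for w
    using e by (simp add: phi_eps_def)
  have m: "(\<lambda>u. pe e y u) \<in> borel_measurable borel" by measurable
  show "integrable lborel (pe e y)"
    using lborel_integrable_affine[of "- e", OF _ m, of y] e phi_integrable unfolding eq by simp
  show "(\<integral>u. pe e y u \<partial>lborel) = 1"
    using lborel_integral_affine[of "- e" "pe e y" y] e phi_int unfolding eq by simp
qed

lemma Cc_inf_pe:
  assumes e: "0 < e" and sub: "cball y (R * e) \<subseteq> U"
  shows "Cc_inf U (\<lambda>u. pe e y u)"
proof -
  have s: "supp (\<lambda>u. pe e y u) \<subseteq> cball y (R * e)"
    unfolding supp_def by (rule closure_minimal) (use pe_zero[OF e] in force)+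
  then have c: "compact (supp (\<lambda>u. pe e y u))"
    by (intro compact_closed_subset[OF _ _ s]) (auto simp: supp_def)
  have "Ck k UNIV (\<lambda>u. pe e y u)" for k
  proof -
    have "Ck k UNIV (\<lambda>u. (1 / e ^ DIM('a)) * \<phi> ((- inverse e) *\<^sub>R u + y /\<^sub>R e) + 0 * \<phi> u)"
      using phi_smooth unfolding C_inf_def by (intro Ck_lincomb Ck_affine) auto
    then show ?thesis by (simp add: phi_eps_def scaleR_right_diff_distrib)
  qed
  then show ?thesis using c s sub by (auto simp: Cc_inf_def C_inf_def)
qed

text \<open>The bound on F is asked almost everywhere because \<open>ln (1 / norm 0)\<close> is 0 by
  convention: lower bounds on the logarithmic kernel fail exactly at its singularity.\<close>

lemma avg_ge:
  assumes e: "0 < e" and i: "integrable lborel (\<lambda>v. F v * pe e y v)"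
    and F: "AE v in lborel. v \<in> cball y (R * e) \<longrightarrow> a \<le> F v"
  shows "a \<le> (\<integral>v. F v * pe e y v \<partial>lborel)"
proof -
  have "a = (\<integral>v. a * pe e y v \<partial>lborel)" using pe_has_integral[OF e, of y] by simp
  also have "\<dots> \<le> (\<integral>v. F v * pe e y v \<partial>lborel)"
  proof (rule integral_mono_AE[OF _ i])
    show "integrable lborel (\<lambda>v. a * pe e y v)" using pe_has_integral[OF e, of y] by simp
    show "AE v in lborel. a * pe e y v \<le> F v * pe e y v"
      using F
    proof eventually_elim
      case (elim v)
      then show ?case using pe_nonneg[OF e, of y v] pe_zero[OF e, of v y] by (cases "v \<in> cball y (R * e)") (auto intro: mult_right_mono)
    qed
  qed
  finally show ?thesis .
qed

lemma avg_le:
  assumes e: "0 < e" and i: "integrable lborel (\<lambda>v. F v * pe e y v)"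
    and F: "AE v in lborel. v \<in> cball y (R * e) \<longrightarrow> F v \<le> a"
  shows "(\<integral>v. F v * pe e y v \<partial>lborel) \<le> a"
  using avg_ge[OF e, of "\<lambda>v. - F v" y "- a"] i F by simp

lemma avg_close:
  assumes e: "0 < e" and i: "integrable lborel (\<lambda>v. F v * pe e y v)"
    and F: "AE v in lborel. v \<in> cball y (R * e) \<longrightarrow> \<bar>F v - a\<bar> \<le> b"
  shows "\<bar>(\<integral>v. F v * pe e y v \<partial>lborel) - a\<bar> \<le> b"
proof -
  have "a - b \<le> (\<integral>v. F v * pe e y v \<partial>lborel)" "(\<integral>v. F v * pe e y v \<partial>lborel) \<le> a + b"
    by (rule avg_ge[OF e i] avg_le[OF e i]; use F in eventually_elim; auto)+
  then show ?thesis by linarith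
qed

text \<open>The contribution of the logarithm to E X(u) X_e(y).\<close>

definition lpot :: "real \<Rightarrow> 'a \<Rightarrow> 'a \<Rightarrow> real" where
  "lpot e y u = (\<integral>v. ln (1 / norm (u - v)) * pe e y v \<partial>lborel)"

lemma lpot_integrable:
  assumes e: "0 < e"
  shows "integrable lborel (\<lambda>v. ln (1 / norm (u - v)) * pe e y v)"
proof -
  obtain M where M: "0 < M" "\<And>y u. pe e y u \<le> M" using pe_bounded[OF e] by blast
  define r where "r = norm (u - y) + R * e"
  have "integrable lborel (\<lambda>v. indicator (cball 0 r) (u - v) * ln (1 / norm (u - v)))"
  proof -
    have eq: "indicator (cball 0 r) (u - (u + (-1) *\<^sub>R w)) * ln (1 / norm (u - (u + (-1) *\<^sub>R w))) = indicator (cball 0 r) w * ln (1 / norm w)" for w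
      by simp
    show ?thesis
    proof (subst lborel_integrable_affine[of "-1" _ u])
      have [measurable]: "(\<lambda>v. indicator (cball 0 r) (u - v) :: real) \<in> borel_measurable borel"
        by (rule measurable_compose[of "\<lambda>v. u - v" borel borel]) measurable
      show "(\<lambda>v. indicator (cball 0 r) (u - v) * ln (1 / norm (u - v))) \<in> borel_measurable borel" by measurable
      show "integrable lborel (\<lambda>w. indicator (cball 0 r) (u - (u + (-1) *\<^sub>R w)) * ln (1 / norm (u - (u + (-1) *\<^sub>R w))))"
        unfolding eq by (rule integrable_indicator_cball_ln)
    qed simp
  qed
  then have i: "integrable lborel (\<lambda>v. M * (indicator (cball 0 r) (u - v) * ln (1 / norm (u - v))))" by simp
  show ?thesis
  proof (rule Bochner_Integration.integrable_bound[OF i])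
    show "AE v in lborel. norm (ln (1 / norm (u - v)) * pe e y v) \<le> norm (M * (indicator (cball 0 r) (u - v) * ln (1 / norm (u - v))))"
    proof (rule AE_I2)
      fix v
      show "norm (ln (1 / norm (u - v)) * pe e y v) \<le> norm (M * (indicator (cball 0 r) (u - v) * ln (1 / norm (u - v))))"
      proof (cases "v \<in> cball y (R * e)")
        case True
        then have "norm (u - v) \<le> r" unfolding r_def using norm_triangle_ineq[of "u - y" "y - v"] by (simp add: dist_norm)
        then show ?thesis using M pe_nonneg[OF e, of y v] by (auto simp: abs_mult mult.commute intro!: mult_right_mono)
      qed (simp add: pe_zero[OF e])
    qed
  qed measurable
qed

text \<open>With r = |u - v| / e the kernel is ln (1 / e) + ln (1 / r). The mollifier is at most M /
  e^d, and the singular part of ln (1 / r), rescaled, has an integral of order e^d; the powers of e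
  cancel and the bound is uniform in y and u.\<close>

lemma lpot_le:
  "\<exists>C\<ge>0. \<forall>e>0. \<forall>y u. lpot e y u \<le> ln (1 / e) + C"
proof -
  obtain M where M: "0 < M" "\<And>x. \<phi> x \<le> M" using phi_bounded by blast
  have h: "(1/2::real) < real DIM('a)" using DIM_positive[where 'a='a] by linarith
  define k where "k w = indicator (ball 0 1) w * norm w powr (-(1/2))" for w :: 'a
  have ki: "integrable lborel k" unfolding k_def using integrable_norm_powr_ball[of "1/2", where 'a='a] h by simp
  have k0: "0 \<le> k w" for w by (simp add: k_def)
  have km[measurable]: "k \<in> borel_measurable borel" unfolding k_def by measurable
  define I where "I = (\<integral>w. k w \<partial>lborel)"
  have I0: "0 \<le> I" unfolding I_def by (rule integral_nonneg_AE) (use k0 in auto)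
  have "lpot e y u \<le> ln (1 / e) + 2 * M * I" if e: "0 < e" for e y u
  proof -
    have kk: "k ((u + e *\<^sub>R w - u) /\<^sub>R e) = k w" for w using e by simp
    have km': "(\<lambda>v. k ((v - u) /\<^sub>R e)) \<in> borel_measurable borel" by measurable
    have ki': "integrable lborel (\<lambda>v. k ((v - u) /\<^sub>R e))"
      by (subst lborel_integrable_affine[of e, OF _ km', of u]) (use e ki kk in simp_all)
    have kI: "(\<integral>v. k ((v - u) /\<^sub>R e) \<partial>lborel) = e ^ DIM('a) * I"
      unfolding I_def by (subst lborel_integral_affine[of e _ u]) (use e kk in simp_all)
    have "lpot e y u \<le> (\<integral>v. ln (1 / e) * pe e y v + (2 * M / e ^ DIM('a)) * k ((v - u) /\<^sub>R e) \<partial>lborel)"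
      unfolding lpot_def
    proof (rule integral_mono_AE[OF lpot_integrable[OF e]])
      show "integrable lborel (\<lambda>v. ln (1 / e) * pe e y v + (2 * M / e ^ DIM('a)) * k ((v - u) /\<^sub>R e))"
        using pe_has_integral(1)[OF e, of y] ki' by (intro Bochner_Integration.integrable_add integrable_mult_right)
      show "AE v in lborel. ln (1 / norm (u - v)) * pe e y v \<le> ln (1 / e) * pe e y v + (2 * M / e ^ DIM('a)) * k ((v - u) /\<^sub>R e)"
        using AE_lborel_singleton[of u]
      proof eventually_elim
        case (elim v)
        define r where "r = norm (u - v) / e"
        have r: "0 < r" using elim e by (simp add: r_def)
        have nr: "norm ((v - u) /\<^sub>R e) = r" using e by (simp add: r_def norm_minus_commute divide_inverse mult.commute)
        have ln: "ln (1 / norm (u - v)) = ln (1 / e) + ln (1 / r)" using e elim by (simp add: r_def ln_div)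
        have lk: "ln (1 / r) \<le> 2 * k ((v - u) /\<^sub>R e)"
        proof (cases "r < 1")
          case True
          then show ?thesis using ln_inverse_le_powr_half[OF r] nr by (simp add: k_def)
        next
          case False
          then have "ln (1 / r) \<le> 0" using r by simp
          then show ?thesis using k0[of "(v - u) /\<^sub>R e"] by linarith
        qed
        have "ln (1 / r) * pe e y v \<le> 2 * k ((v - u) /\<^sub>R e) * pe e y v"
          by (rule mult_right_mono[OF lk pe_nonneg[OF e]])
        also have "\<dots> \<le> 2 * k ((v - u) /\<^sub>R e) * (M / e ^ DIM('a))"
          using M(2) k0[of "(v - u) /\<^sub>R e"] e by (intro mult_left_mono) (auto simp: phi_eps_def divide_right_mono)
        finally show ?case unfolding ln by (simp add: algebra_simps)
      qed
    qed
    also have "\<dots> = ln (1 / e) * 1 + (2 * M / e ^ DIM('a)) * (e ^ DIM('a) * I)"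
      using pe_has_integral[OF e, of y] ki' kI by (subst Bochner_Integration.integral_add) auto
    also have "\<dots> = ln (1 / e) + 2 * M * I" using e by simp
    finally show ?thesis .
  qed
  then show ?thesis using M I0 by (intro exI[of _ "2 * M * I"]) auto
qed

lemma lpot_ge:
  assumes e: "0 < e" and r: "norm (u - y) + R * e \<le> r"
  shows "ln (1 / r) \<le> lpot e y u"
  unfolding lpot_def
proof (rule avg_ge[OF e lpot_integrable[OF e]])
  show "AE v in lborel. v \<in> cball y (R * e) \<longrightarrow> ln (1 / r) \<le> ln (1 / norm (u - v))"
    using AE_lborel_singleton[of u]
  proof eventually_elim
    case (elim v)
    show ?case
    proof
      assume "v \<in> cball y (R * e)"
      then have "norm (u - v) \<le> r" using r norm_triangle_ineq[of "u - y" "y - v"] by (simp add: dist_norm)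
      moreover have "0 < norm (u - v)" using elim by simp
      moreover from calculation have "0 < r" by linarith
      ultimately show "ln (1 / r) \<le> ln (1 / norm (u - v))" by (subst ln_le_cancel_iff) (auto intro!: divide_left_mono mult_pos_pos)
    qed
  qed
qed

lemma lpot_le_far:
  assumes e: "0 < e" and far: "2 * R * e \<le> norm (u - y)"
  shows "lpot e y u \<le> ln (2 / norm (u - y))"
  unfolding lpot_def
proof (rule avg_le[OF e lpot_integrable[OF e]], rule AE_I2, rule impI)
  fix v assume "v \<in> cball y (R * e)"
  then have "norm (u - y) - R * e \<le> norm (u - v)" using norm_triangle_ineq[of "u - v" "v - y"] by (simp add: dist_norm norm_minus_commute)
  moreover have "0 < R * e" using R1 e by simp
  ultimately have "norm (u - y) / 2 \<le> norm (u - v)" "0 < norm (u - y)" using far by linarith+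
  then show "ln (1 / norm (u - v)) \<le> ln (2 / norm (u - y))"
    by (subst ln_le_cancel_iff) (auto simp: field_simps simp del: zero_less_norm_iff)
qed

text \<open>From below: the support of the mollifier lies within (1 + R) max e |u - y| of u. From
  above: if |u - y| >= 2 R e the singularity is out of reach; otherwise e and max e |u - y| are
  comparable and \<open>lpot_le\<close> suffices.\<close>

lemma lpot_bound:
  "\<exists>C. \<forall>e>0. \<forall>y u. \<bar>lpot e y u - ln (1 / max e (norm (u - y)))\<bar> \<le> C"
proof -
  obtain C where C: "0 \<le> C" "\<And>e y u. 0 < e \<Longrightarrow> lpot e y u \<le> ln (1 / e) + C" using lpot_le by blast
  have "\<bar>lpot e y u - ln (1 / max e (norm (u - y)))\<bar> \<le> C + ln (1 + R) + ln (2 * R)" if e: "0 < e" for e y u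
  proof -
    define m where "m = max e (norm (u - y))"
    have m: "0 < m" "e \<le> m" "norm (u - y) \<le> m" using e by (auto simp: m_def)
    have "norm (u - y) + R * e \<le> (1 + R) * m" using m R1 by (simp add: distrib_right add_mono mult_left_mono)
    from lpot_ge[OF e this] have "ln (1 / ((1 + R) * m)) \<le> lpot e y u" .
    then have lo: "ln (1 / m) - ln (1 + R) \<le> lpot e y u" using m R1 by (simp add: ln_div ln_mult)
    have lp: "0 \<le> ln (1 + R)" "0 \<le> ln (2 * R)" "ln 2 \<le> ln (2 * R)" using R1 by auto
    have up: "lpot e y u \<le> ln (1 / m) + C + ln (2 * R)"
    proof (cases "2 * R * e \<le> norm (u - y)")
      case True
      moreover have "1 * e \<le> 2 * R * e" using R1 e by (intro mult_right_mono) auto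
      ultimately have "m = norm (u - y)" by (simp add: m_def)
      then have "lpot e y u \<le> ln (1 / m) + ln 2" using lpot_le_far[OF e True] m by (simp add: ln_div)
      then show ?thesis using lp C by linarith
    next
      case False
      moreover have "1 * e \<le> 2 * R * e" using R1 e by (intro mult_right_mono) auto
      ultimately have "m \<le> 2 * R * e" by (simp add: m_def)
      then have "ln m \<le> ln (2 * R * e)" using m R1 e by simp
      then have "ln (1 / e) \<le> ln (1 / m) + ln (2 * R)" using m R1 e by (simp add: ln_div ln_mult)
      then show ?thesis using C(2)[OF e, of y u] by linarith
    qed
    show ?thesis unfolding m_def[symmetric] using lo up lp C(1) by linarith
  qed
  then show ?thesis by blast
qed

lemma lpot_tendsto:
  assumes e: "0 < e" and u: "un \<longlonglongrightarrow> u"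
  shows "(\<lambda>n. lpot e y (un n)) \<longlonglongrightarrow> lpot e y u"
proof -
  obtain M where M: "0 < M" "\<And>y u. pe e y u \<le> M" using pe_bounded[OF e] by blast
  \<comment> \<open>The substitution w = u - v fixes the singular factor and moves u into the
    continuous mollifier, so dominated convergence applies.\<close>
  have eq: "lpot e y u = (\<integral>w. ln (1 / norm w) * pe e y (u + (-1) *\<^sub>R w) \<partial>lborel)" for u
    unfolding lpot_def by (subst lborel_integral_affine[of "-1" _ u]) simp_all
  obtain B where B: "\<And>n. norm (un n) \<le> B" using u convergent_imp_bounded[OF u] by (auto simp: bounded_iff)
  define r where "r = B + norm y + R * e"
  show ?thesis unfolding eq
  proof (rule integral_dominated_convergence[where w="\<lambda>w. M * \<bar>indicator (cball 0 r) w * ln (1 / norm w)\<bar>"])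
    show "integrable lborel (\<lambda>w::'a. M * \<bar>indicator (cball 0 r) w * ln (1 / norm w)\<bar>)"
      using integrable_indicator_cball_ln[of r, where 'a='a] by (intro integrable_mult_right integrable_abs)
    show "AE w in lborel. (\<lambda>n. ln (1 / norm w) * pe e y (un n + (-1) *\<^sub>R w)) \<longlonglongrightarrow> ln (1 / norm w) * pe e y (u + (-1) *\<^sub>R w)"
      by (intro AE_I2 tendsto_intros phi_eps_tendsto u)
    show "AE w in lborel. norm (ln (1 / norm w) * pe e y (un n + (-1) *\<^sub>R w)) \<le> M * \<bar>indicator (cball 0 r) w * ln (1 / norm w)\<bar>" for n
    proof (rule AE_I2)
      fix w :: 'a
      let ?v = "un n + (-1) *\<^sub>R w"
      show "norm (ln (1 / norm w) * pe e y ?v) \<le> M * \<bar>indicator (cball 0 r) w * ln (1 / norm w)\<bar>"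
      proof (cases "?v \<in> cball y (R * e)")
        case True
        then have "norm (y - un n + w) \<le> R * e" by (simp add: dist_norm algebra_simps)
        moreover have "norm w \<le> norm (y - un n + w) + norm (un n) + norm y"
          using norm_triangle_ineq4[of "y - un n + w" "y - un n"] norm_triangle_ineq4[of y "un n"] by simp
        ultimately have "norm w \<le> r" using B[of n] by (simp add: r_def)
        then show ?thesis using M pe_nonneg[OF e, of y ?v] by (simp add: abs_mult mult.commute[of M] mult_left_mono)
      qed (use M pe_zero[OF e] in simp)
    qed
  qed measurable
qed

end

text \<open>Differences of points of A stay in a fixed ball, so by translation invariance the inner
  integral is bounded by one constant J for all u, and Fubini applies.\<close>

lemma integrable_pair_difference_kernel:
  fixes A :: "'a::euclidean_space set" and F :: "'a \<Rightarrow> real"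
  assumes A: "compact A" and F[measurable]: "F \<in> borel_measurable borel"
    and i: "\<And>D. integrable lborel (\<lambda>w. indicator (cball 0 D) w * F w)"
  shows "integrable (lborel \<Otimes>\<^sub>M lborel) (\<lambda>(u, v). indicator A u * indicator A v * F (u - v))"
proof -
  have Am[measurable]: "A \<in> sets borel" by (rule borel_closed[OF compact_imp_closed[OF A]])
  obtain B where B: "\<And>u. u \<in> A \<Longrightarrow> norm u \<le> B" using compact_imp_bounded[OF A] unfolding bounded_iff by blast
  let ?k = "\<lambda>w. \<bar>indicator (cball 0 (2 * B)) w * F w\<bar>"
  define J where "J = (\<integral>w. ?k w \<partial>lborel)"
  have ki: "integrable lborel ?k" using i by (rule integrable_abs)
  have eq: "?k (u - (u + (-1) *\<^sub>R w)) = ?k w" for u w by simp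
  have mk: "(\<lambda>v. ?k (u - v)) \<in> borel_measurable borel" for u
    by (rule measurable_compose[of "\<lambda>v. u - v" borel borel]) measurable
  have ki': "integrable lborel (\<lambda>v. ?k (u - v))" for u
    by (subst lborel_integrable_affine[of "-1" _ u]) (use mk[of u] ki in \<open>simp_all add: eq\<close>)
  have kJ: "(\<integral>v. ?k (u - v) \<partial>lborel) = J" for u
    unfolding J_def by (subst lborel_integral_affine[of "-1" _ u]) (simp_all add: eq)
  let ?f = "\<lambda>u v. indicator A u * indicator A v * F (u - v)"
  have fm: "(\<lambda>(u, v). ?f u v) \<in> borel_measurable (lborel \<Otimes>\<^sub>M lborel)" by measurable
  have fb: "norm (?f u v) \<le> norm (indicator A u * ?k (u - v))" for u v
  proof (cases "u \<in> A \<and> v \<in> A")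
    case True
    then have "norm (u - v) \<le> 2 * B" using norm_triangle_ineq4[of u v] B[of u] B[of v] by simp
    then show ?thesis using True by simp
  qed auto
  have fi: "integrable lborel (\<lambda>v. ?f u v)" for u
    by (rule Bochner_Integration.integrable_bound[OF integrable_mult_right[OF ki'[of u], of "indicator A u"]])
       (use fb in \<open>simp_all add: F\<close>)
  show ?thesis
  proof (rule lborel_pair.Fubini_integrable[OF fm])
    show "AE u in lborel. integrable lborel (\<lambda>v. case (u, v) of (u, v) \<Rightarrow> ?f u v)" using fi by simp
    show "integrable lborel (\<lambda>u. \<integral>v. norm (case (u, v) of (u, v) \<Rightarrow> ?f u v) \<partial>lborel)"
    proof (rule Bochner_Integration.integrable_bound)
      show "integrable lborel (\<lambda>u. indicator A u *\<^sub>R J)"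
        using emeasure_compact_finite[OF A] by (intro integrable_scaleR_left integrable_real_indicator) (auto simp: Am)
      show "AE u in lborel. norm (\<integral>v. norm (case (u, v) of (u, v) \<Rightarrow> ?f u v) \<partial>lborel) \<le> norm (indicator A u *\<^sub>R J)"
      proof (rule AE_I2)
        fix u
        have "norm (\<integral>v. norm (?f u v) \<partial>lborel) = (\<integral>v. norm (?f u v) \<partial>lborel)"
          by (simp add: integral_nonneg_AE)
        also have "\<dots> \<le> (\<integral>v. norm (indicator A u * ?k (u - v)) \<partial>lborel)"
          by (intro integral_mono integrable_norm fi integrable_mult_right ki' fb)
        also have "\<dots> = indicator A u * J" using kJ[of u] by (simp add: abs_mult)
        also have "\<dots> \<le> norm (indicator A u *\<^sub>R J)" by (simp only: real_norm_def real_scaleR_def abs_ge_self)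
        finally show "norm (\<integral>v. norm (case (u, v) of (u, v) \<Rightarrow> ?f u v) \<partial>lborel) \<le> norm (indicator A u *\<^sub>R J)"
          by (simp only: prod.case)
      qed
    qed measurable
  qed
qed

lemma integrable_pair_powr:
  assumes A: "compact (A :: 'a::euclidean_space set)" and s: "0 \<le> s" "s < real DIM('a)"
  shows "integrable (lborel \<Otimes>\<^sub>M lborel) (\<lambda>(u, v). indicator A u * indicator A v * norm (u - v) powr (- s))"
proof (rule integrable_pair_difference_kernel[OF A])
  fix D
  show "integrable lborel (\<lambda>w::'a. indicator (cball 0 D) w * norm w powr (- s))"
  proof (rule Bochner_Integration.integrable_bound)
    show "integrable lborel (\<lambda>w::'a. indicator (ball 0 1) w * norm w powr (- s) + indicator (cball 0 D) w *\<^sub>R 1)"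
      by (intro Bochner_Integration.integrable_add integrable_norm_powr_ball s integrable_scaleR_left integrable_real_indicator)
         (auto simp: emeasure_lborel_cball_finite[unfolded infinity_ennreal_def])
    show "AE w::'a in lborel. norm (indicator (cball 0 D) w * norm w powr (- s))
      \<le> norm (indicator (ball 0 1) w * norm w powr (- s) + indicator (cball 0 D) w *\<^sub>R 1)"
    proof (rule AE_I2)
      fix w :: 'a
      have "norm w powr (- s) \<le> 1" if "1 \<le> norm w"
      proof -
        have "norm w powr (- s) \<le> norm w powr 0" using that s by (intro powr_mono) auto
        also have "norm w powr 0 = 1" using that by auto
        finally show ?thesis .
      qed
      then show "norm (indicator (cball 0 D) w * norm w powr (- s))
        \<le> norm (indicator (ball 0 1) w * norm w powr (- s) + indicator (cball 0 D) w *\<^sub>R 1)"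
        by (cases "norm w < 1") (auto simp: indicator_def)
    qed
  qed measurable
qed measurable

section \<open>Covariances of the mollified field near a compact set\<close>

locale log_kernel = mollifier \<phi> R for \<phi> :: "'a::euclidean_space \<Rightarrow> real" and R +
  fixes \<Omega> :: "'a set" and g :: "'a \<Rightarrow> 'a \<Rightarrow> real" and K :: "'a set" and \<eta>0 :: real
  assumes Om_open: "open \<Omega>"
    and g_continuous: "continuous_on (\<Omega> \<times> \<Omega>) (\<lambda>(x, y). g x y)"
    and Sig_symmetric: "\<And>x y. x \<in> \<Omega> \<Longrightarrow> y \<in> \<Omega> \<Longrightarrow> Sig g x y = Sig g y x"
    and K_compact: "compact K" and eta0: "0 < \<eta>0" "\<eta>0 \<le> 1"
    and K_nbhd: "\<And>x. x \<in> K \<Longrightarrow> cball x (R * \<eta>0) \<subseteq> \<Omega>"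
begin

text \<open>A compact subset of \<Omega> that carries every mollifier of scale at most
  \<open>\<eta>0\<close> centred in K. The continuous g is bounded on K1 x K1, and the integrals
  over \<Omega> in \<open>cov\<close> see nothing outside K1, so there are no boundary
  effects.\<close>

definition K1 where "K1 = {x + y | x y. x \<in> K \<and> y \<in> cball 0 (R * \<eta>0)}"

lemma K1_compact: "compact K1"
  unfolding K1_def by (rule compact_sums) (use K_compact in auto)

lemma K1_meas[measurable]: "K1 \<in> sets borel"
  by (rule borel_closed[OF compact_imp_closed[OF K1_compact]])

lemma Om_meas[measurable]: "\<Omega> \<in> sets borel"
  using Om_open by auto

lemma K_meas[measurable]: "K \<in> sets borel"
  by (rule borel_closed[OF compact_imp_closed[OF K_compact]])

lemma cball_K1: "y \<in> K \<Longrightarrow> e \<le> \<eta>0 \<Longrightarrow> cball y (R * e) \<subseteq> K1"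
proof
  fix v assume y: "y \<in> K" "e \<le> \<eta>0" and v: "v \<in> cball y (R * e)"
  have "v = y + (v - y)" by simp
  moreover have "R * e \<le> R * \<eta>0" using y R1 by simp
  then have "v - y \<in> cball 0 (R * \<eta>0)" using v by (simp add: dist_norm norm_minus_commute)
  ultimately show "v \<in> K1" unfolding K1_def using y by blast
qed

lemma K_K1: "K \<subseteq> K1"
proof
  fix x assume "x \<in> K"
  then show "x \<in> K1" using cball_K1[of x 0] eta0 by auto
qed

lemma K1_Om: "K1 \<subseteq> \<Omega>"
proof
  fix v assume "v \<in> K1"
  then obtain x y where "v = x + y" "x \<in> K" "y \<in> cball 0 (R * \<eta>0)" unfolding K1_def by blast
  then show "v \<in> \<Omega>" using K_nbhd[of x] by (auto simp: dist_norm)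
qed

lemma K_Om: "K \<subseteq> \<Omega>"
  using K_K1 K1_Om by blast

definition gK :: "'a \<Rightarrow> 'a \<Rightarrow> real" where
  "gK u v = indicator (K1 \<times> K1) (u, v) * g u v"

lemma gK_meas[measurable]: "(\<lambda>(u, v). gK u v) \<in> borel_measurable (borel \<Otimes>\<^sub>M borel)"
proof -
  have c: "continuous_on (K1 \<times> K1) (\<lambda>p. g (fst p) (snd p))"
    using continuous_on_subset[OF g_continuous, of "K1 \<times> K1"] K1_Om by (auto simp: case_prod_beta)
  have "K1 \<times> K1 \<in> sets borel" using K1_compact by (intro borel_closed compact_imp_closed compact_Times)
  from borel_measurable_continuous_on_indicator[OF this c]
  show ?thesis unfolding borel_prod gK_def by (simp add: case_prod_unfold)
qed

lemma gK_meas'[measurable]: "(\<lambda>u. gK u v) \<in> borel_measurable borel"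
  using measurable_compose[OF measurable_Pair2' gK_meas, of v] by simp

lemma gK_bounded: obtains B where "0 < B" "\<And>u v. \<bar>gK u v\<bar> \<le> B"
proof -
  have "compact ((\<lambda>(x, y). g x y) ` (K1 \<times> K1))"
    using K1_Om by (intro compact_continuous_image continuous_on_subset[OF g_continuous] compact_Times K1_compact) auto
  then obtain B where B: "\<And>u v. u \<in> K1 \<Longrightarrow> v \<in> K1 \<Longrightarrow> \<bar>g u v\<bar> \<le> B"
    unfolding compact_eq_bounded_closed bounded_iff by force
  have "\<bar>gK u v\<bar> \<le> max B 0 + 1" for u v using B[of u v] by (auto simp: gK_def indicator_def)
  then show ?thesis using that[of "max B 0 + 1"] by simp
qed

text \<open>The covariance kernel cut off outside K1 x K1. Unlike \<open>Sig g\<close>, it is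
  measurable and integrable on the whole product space, and thus open to Fubini and dominated
  convergence.\<close>

definition SK :: "'a \<Rightarrow> 'a \<Rightarrow> real" where
  "SK u v = indicator K1 u * indicator K1 v * ln (1 / norm (u - v)) + gK u v"

lemma SK_eq: "u \<in> K1 \<Longrightarrow> v \<in> K1 \<Longrightarrow> SK u v = Sig g u v"
  by (simp add: SK_def gK_def Sig_def)

lemma SK_zero: "u \<notin> K1 \<or> v \<notin> K1 \<Longrightarrow> SK u v = 0"
  by (auto simp: SK_def gK_def)

lemma SK_sym: "SK u v = SK v u"
  using SK_eq SK_zero Sig_symmetric K1_Om by (cases "u \<in> K1 \<and> v \<in> K1") (metis subsetD)+

lemma SK_integrable: "integrable (lborel \<Otimes>\<^sub>M lborel) (\<lambda>(u, v). SK u v)"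
proof -
  obtain B where B: "0 < B" "\<And>u v. \<bar>gK u v\<bar> \<le> B" using gK_bounded by blast
  have "integrable (lborel \<Otimes>\<^sub>M lborel) (\<lambda>(u, v). indicator K1 u * indicator K1 v * ln (1 / norm (u - v)))"
    by (rule integrable_pair_difference_kernel[OF K1_compact, of "\<lambda>w. ln (1 / norm w)"]) (measurable, rule integrable_indicator_cball_ln)
  moreover have "integrable (lborel \<Otimes>\<^sub>M lborel) (\<lambda>(u, v). gK u v)"
  proof (rule Bochner_Integration.integrable_bound)
    have "integrable lborel (indicator (K1 \<times> K1) :: _ \<Rightarrow> real)"
      using emeasure_compact_finite[OF compact_Times[OF K1_compact K1_compact]]
      by (intro integrable_real_indicator) (auto simp: borel_prod[symmetric])
    then show "integrable (lborel \<Otimes>\<^sub>M lborel) (\<lambda>p. indicator (K1 \<times> K1) p *\<^sub>R B)"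
      unfolding lborel_prod by (intro integrable_scaleR_left)
    show "AE p in lborel \<Otimes>\<^sub>M lborel. norm (case p of (u, v) \<Rightarrow> gK u v) \<le> norm (indicator (K1 \<times> K1) p *\<^sub>R B)"
    proof (rule AE_I2)
      fix p :: "'a \<times> 'a"
      obtain u v where p: "p = (u, v)" by fastforce
      show "norm (case p of (u, v) \<Rightarrow> gK u v) \<le> norm (indicator (K1 \<times> K1) p *\<^sub>R B)"
        using B(2)[of u v] B(1) by (cases "p \<in> K1 \<times> K1") (auto simp: p gK_def)
    qed
  qed measurable
  ultimately have "integrable (lborel \<Otimes>\<^sub>M lborel) (\<lambda>p. (case p of (u, v) \<Rightarrow> indicator K1 u * indicator K1 v * ln (1 / norm (u - v)))
      + (case p of (u, v) \<Rightarrow> gK u v))"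
    by (rule Bochner_Integration.integrable_add)
  then show ?thesis by (simp only: SK_def case_prod_unfold)
qed

lemma SK_meas[measurable]: "(\<lambda>(u, v). SK u v) \<in> borel_measurable (borel \<Otimes>\<^sub>M borel)"
  unfolding SK_def by measurable

lemma SK_weighted_integrable:
  assumes [measurable]: "f \<in> borel_measurable borel" "h \<in> borel_measurable borel"
    and b: "\<And>u. \<bar>f u\<bar> \<le> B" "\<And>u. \<bar>h u\<bar> \<le> B'"
  shows "integrable (lborel \<Otimes>\<^sub>M lborel) (\<lambda>(u, v). f u * SK u v * h v)"
proof (rule Bochner_Integration.integrable_bound)
  show "integrable (lborel \<Otimes>\<^sub>M lborel) (\<lambda>p. (B * B') * (case p of (u, v) \<Rightarrow> SK u v))"
    by (intro integrable_mult_right SK_integrable)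
  have "0 \<le> B" "0 \<le> B'" using b[of undefined] abs_ge_zero order_trans by blast+
  then show "AE p in lborel \<Otimes>\<^sub>M lborel. norm (case p of (u, v) \<Rightarrow> f u * SK u v * h v) \<le> norm ((B * B') * (case p of (u, v) \<Rightarrow> SK u v))"
    using b by (intro AE_I2) (auto simp: abs_mult mult_ac intro!: mult_left_mono mult_mono)
qed measurable

lemma field_cov_eq:
  assumes [measurable]: "f \<in> borel_measurable borel" "h \<in> borel_measurable borel"
    and b: "\<And>u. \<bar>f u\<bar> \<le> B" "\<And>u. \<bar>h u\<bar> \<le> B'"
    and z: "\<And>u. u \<notin> K1 \<Longrightarrow> f u = 0" "\<And>u. u \<notin> K1 \<Longrightarrow> h u = 0"
  shows "field_cov \<Omega> g f h = (\<integral>(u, v). f u * SK u v * h v \<partial>(lborel \<Otimes>\<^sub>M lborel))"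
proof -
  have e: "indicator \<Omega> v *\<^sub>R (f u * Sig g u v * h v) = f u * SK u v * h v" if "u \<in> K1" for u v
    using that K1_Om SK_eq[of u v] z(2)[of v] by (cases "v \<in> K1") auto
  have "field_cov \<Omega> g f h = (\<integral>u. \<integral>v. f u * SK u v * h v \<partial>lborel \<partial>lborel)"
    unfolding field_cov_def set_lebesgue_integral_def
  proof (intro Bochner_Integration.integral_cong refl)
    fix u
    show "indicator \<Omega> u *\<^sub>R (\<integral>v. indicator \<Omega> v *\<^sub>R (f u * Sig g u v * h v) \<partial>lborel) = (\<integral>v. f u * SK u v * h v \<partial>lborel)"
    proof (cases "u \<in> K1")
      case True
      then have "indicator \<Omega> u = (1::real)" using K1_Om by auto
      then show ?thesis by (simp only: e[OF True] scaleR_one)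
    qed (use z(1) in simp)
  qed
  also have "\<dots> = (\<integral>(u, v). f u * SK u v * h v \<partial>(lborel \<Otimes>\<^sub>M lborel))"
    using lborel_pair.integral_fst'[OF SK_weighted_integrable[OF assms(1-4)]] by simp
  finally show ?thesis .
qed

lemma pe_K1_zero: "y \<in> K \<Longrightarrow> 0 < e \<Longrightarrow> e \<le> \<eta>0 \<Longrightarrow> u \<notin> K1 \<Longrightarrow> pe e y u = 0"
  using cball_K1[of y e] pe_zero[of e u y] by blast

lemma pe_abs_bounded:
  assumes "0 < e" obtains M where "0 < M" "\<And>y u. \<bar>pe e y u\<bar> \<le> M"
  using pe_bounded[OF assms] pe_nonneg[OF assms] by (metis abs_of_nonneg)

lemma cov_pos_eq:
  assumes "x \<in> K" "y \<in> K" "0 < e" "e \<le> \<eta>0" "0 < e'" "e' \<le> \<eta>0"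
  shows "cov \<Omega> g \<phi> e x e' y = (\<integral>(u, v). pe e x u * SK u v * pe e' y v \<partial>(lborel \<Otimes>\<^sub>M lborel))"
proof -
  obtain M where M0: "0 < M" "\<And>y u. \<bar>pe e y u\<bar> \<le> M" using pe_abs_bounded[OF assms(3)] by blast
  obtain M' where M0': "0 < M'" "\<And>y u. \<bar>pe e' y u\<bar> \<le> M'" using pe_abs_bounded[OF assms(5)] by blast
  have "cov \<Omega> g \<phi> e x e' y = field_cov \<Omega> g (\<lambda>u. pe e x u) (\<lambda>v. pe e' y v)"
    using assms by (simp add: cov_def)
  also have "\<dots> = (\<integral>(u, v). pe e x u * SK u v * pe e' y v \<partial>(lborel \<Otimes>\<^sub>M lborel))"
    by (rule field_cov_eq) (use M0(2) M0'(2) pe_K1_zero assms in auto)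
  finally show ?thesis .
qed

text \<open>Bilinearity identifies the variance of a linear combination of mollified values with the
  quadratic form of \<open>cov\<close>; the Gaussian hypothesis speaks of variances of single
  pairings only.\<close>

lemma field_cov_pe_sum:
  assumes z: "\<And>j. j < n \<Longrightarrow> z j \<in> K" and \<eta>: "\<And>j. j < n \<Longrightarrow> 0 < \<eta> j" "\<And>j. j < n \<Longrightarrow> \<eta> j \<le> \<eta>0"
  shows "field_cov \<Omega> g (\<lambda>u. \<Sum>j<n. t j * pe (\<eta> j) (z j) u) (\<lambda>u. \<Sum>j<n. t j * pe (\<eta> j) (z j) u)
      = (\<Sum>i<n. \<Sum>j<n. t i * t j * cov \<Omega> g \<phi> (\<eta> i) (z i) (\<eta> j) (z j))"
proof -
  have "\<exists>M. \<forall>u. \<bar>pe (\<eta> j) (z j) u\<bar> \<le> M" if "j < n" for j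
    using pe_abs_bounded[OF \<eta>(1)[OF that]] by metis
  then obtain M where M: "\<And>j u. j < n \<Longrightarrow> \<bar>pe (\<eta> j) (z j) u\<bar> \<le> M j" by metis
  let ?h = "\<lambda>u. \<Sum>j<n. t j * pe (\<eta> j) (z j) u"
  have hb: "\<bar>?h u\<bar> \<le> (\<Sum>j<n. \<bar>t j\<bar> * M j)" for u
    by (rule order_trans[OF sum_abs sum_mono]) (auto simp: abs_mult intro!: mult_left_mono M)
  have "field_cov \<Omega> g ?h ?h = (\<integral>(u, v). ?h u * SK u v * ?h v \<partial>(lborel \<Otimes>\<^sub>M lborel))"
    by (rule field_cov_eq[OF _ _ hb hb]) (use pe_K1_zero z \<eta> in auto)
  also have "\<dots> = (\<integral>p. (\<Sum>i<n. \<Sum>j<n. t i * t j * (case p of (u, v) \<Rightarrow> pe (\<eta> i) (z i) u * SK u v * pe (\<eta> j) (z j) v)) \<partial>(lborel \<Otimes>\<^sub>M lborel))"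
    by (intro Bochner_Integration.integral_cong refl)
       (auto simp: sum_product sum_distrib_left sum_distrib_right mult_ac intro!: sum.cong)
  also have "\<dots> = (\<Sum>i<n. \<Sum>j<n. t i * t j * (\<integral>(u, v). pe (\<eta> i) (z i) u * SK u v * pe (\<eta> j) (z j) v \<partial>(lborel \<Otimes>\<^sub>M lborel)))"
  proof -
    have i: "integrable (lborel \<Otimes>\<^sub>M lborel) (\<lambda>p. case p of (u, v) \<Rightarrow> pe (\<eta> i) (z i) u * SK u v * pe (\<eta> j) (z j) v)"
      if "i < n" "j < n" for i j
      by (rule SK_weighted_integrable) (use M that in auto)
    show ?thesis
      by (subst Bochner_Integration.integral_sum, use i in force)+
         (intro sum.cong refl, subst Bochner_Integration.integral_sum, use i in force, simp)
  qed
  also have "\<dots> = (\<Sum>i<n. \<Sum>j<n. t i * t j * cov \<Omega> g \<phi> (\<eta> i) (z i) (\<eta> j) (z j))"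
    by (intro sum.cong refl) (subst cov_pos_eq, use z \<eta> in auto)
  finally show ?thesis .
qed

text \<open>E X(u) X_e(y) for u in K1. The logarithmic part is kept uncut because it is continuous
  in all u.\<close>

definition Hh :: "real \<Rightarrow> 'a \<Rightarrow> 'a \<Rightarrow> real" where
  "Hh e y u = lpot e y u + (\<integral>v. gK u v * pe e y v \<partial>lborel)"

lemma gK_pe_integrable: "0 < e \<Longrightarrow> integrable lborel (\<lambda>v. gK u v * pe e y v)"
proof -
  assume e: "0 < e"
  obtain B where B: "0 < B" "\<And>u v. \<bar>gK u v\<bar> \<le> B" using gK_bounded by blast
  show ?thesis
    by (rule Bochner_Integration.integrable_bound[OF integrable_mult_right[OF pe_has_integral(1)[OF e, of y], of B]])
       (use B in \<open>auto simp: abs_mult intro!: mult_right_mono\<close>)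
qed

lemma gK_pe_bound: "0 < e \<Longrightarrow> (\<And>u v. \<bar>gK u v\<bar> \<le> B) \<Longrightarrow> \<bar>\<integral>v. gK u v * pe e y v \<partial>lborel\<bar> \<le> B"
  using avg_close[of e "gK u" y 0 B] gK_pe_integrable[of e u y] by simp

lemma Hh_bound: "\<exists>C\<ge>0. \<forall>e>0. \<forall>y u. \<bar>Hh e y u - ln (1 / max e (norm (u - y)))\<bar> \<le> C"
proof -
  obtain C where C: "\<And>e y u. 0 < e \<Longrightarrow> \<bar>lpot e y u - ln (1 / max e (norm (u - y)))\<bar> \<le> C" using lpot_bound by blast
  obtain B where B: "0 < B" "\<And>u v. \<bar>gK u v\<bar> \<le> B" using gK_bounded by blast
  have "0 \<le> C" using C[of 1] abs_ge_zero order_trans by (metis zero_less_one)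
  moreover have "\<bar>Hh e y u - ln (1 / max e (norm (u - y)))\<bar> \<le> C + B" if "0 < e" for e y u
    using C[OF that, of y u] gK_pe_bound[OF that, of B u y] B unfolding Hh_def by fastforce
  ultimately show ?thesis using B by (intro exI[of _ "C + B"]) auto
qed

lemma Sig_pe_eq:
  assumes "u \<in> K1" "y \<in> K" "0 < e" "e \<le> \<eta>0"
  shows "(LINT v:\<Omega>|lborel. Sig g u v * pe e y v) = Hh e y u"
    and "(LINT v:\<Omega>|lborel. pe e y v * Sig g v u) = Hh e y u"
proof -
  have "indicator \<Omega> v *\<^sub>R (Sig g u v * pe e y v) = ln (1 / norm (u - v)) * pe e y v + gK u v * pe e y v" for v
    using assms K1_Om pe_K1_zero[of y e v] by (cases "v \<in> K1") (auto simp: Sig_def gK_def algebra_simps)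
  then show *: "(LINT v:\<Omega>|lborel. Sig g u v * pe e y v) = Hh e y u"
    unfolding set_lebesgue_integral_def Hh_def lpot_def
    using lpot_integrable[of e u y] gK_pe_integrable[of e u y] assms by simp
  have "(LINT v:\<Omega>|lborel. pe e y v * Sig g v u) = (LINT v:\<Omega>|lborel. Sig g u v * pe e y v)"
    by (rule set_lebesgue_integral_cong) (use Sig_symmetric[of _ u] assms K1_Om in \<open>auto simp: mult.commute\<close>)
  then show "(LINT v:\<Omega>|lborel. pe e y v * Sig g v u) = Hh e y u" using * by simp
qed

text \<open>The points stay in K1 because the cut-off kernel \<open>gK\<close> may jump at the
  boundary of K1.\<close>

lemma Hh_tendsto:
  assumes e: "0 < e" and u: "un \<longlonglongrightarrow> u" and K: "\<And>n. un n \<in> K1" "u \<in> K1"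
  shows "(\<lambda>n. Hh e y (un n)) \<longlonglongrightarrow> Hh e y u"
  unfolding Hh_def
proof (intro tendsto_add lpot_tendsto[OF e u])
  obtain B where B: "0 < B" "\<And>u v. \<bar>gK u v\<bar> \<le> B" using gK_bounded by blast
  show "(\<lambda>n. \<integral>v. gK (un n) v * pe e y v \<partial>lborel) \<longlonglongrightarrow> (\<integral>v. gK u v * pe e y v \<partial>lborel)"
  proof (rule integral_dominated_convergence[where w="\<lambda>v. B * pe e y v"])
    show "integrable lborel (\<lambda>v. B * pe e y v)" using pe_has_integral(1)[OF e] by simp
    show "AE v in lborel. norm (gK (un n) v * pe e y v) \<le> B * pe e y v" for n
      using B pe_nonneg[OF e] by (auto simp: abs_mult intro!: mult_right_mono)
    have "(\<lambda>n. gK (un n) v) \<longlonglongrightarrow> gK u v" for v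
    proof (cases "v \<in> K1")
      case True
      have un: "un n \<in> \<Omega>" "u \<in> \<Omega>" "v \<in> \<Omega>" for n using K True K1_Om by auto
      have "(\<lambda>n. (\<lambda>(x, y). g x y) (un n, v)) \<longlonglongrightarrow> (\<lambda>(x, y). g x y) (u, v)"
        by (rule continuous_on_tendsto_compose[OF g_continuous])
           (use un u in \<open>auto intro!: tendsto_intros\<close>)
      then show ?thesis using K True by (simp add: gK_def)
    qed (simp add: gK_def)
    then show "AE v in lborel. (\<lambda>n. gK (un n) v * pe e y v) \<longlonglongrightarrow> gK u v * pe e y v"
      by (intro AE_I2 tendsto_intros)
  qed measurable
qed

lemma lpot_meas[measurable]: "lpot e y \<in> borel_measurable borel"
  unfolding lpot_def by measurable

lemma Hh_meas[measurable]: "Hh e y \<in> borel_measurable borel"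
  unfolding Hh_def by measurable

text \<open>On the support of the mollifier max e' |u - y| lies between e' and D, so
  \<open>Hh\<close> is bounded there.\<close>

lemma Hh_pe_integrable:
  assumes e: "0 < e" "0 < e'"
  shows "integrable lborel (\<lambda>u. Hh e' y u * pe e x u)"
proof -
  obtain C where C: "0 \<le> C" "\<And>e y u. 0 < e \<Longrightarrow> \<bar>Hh e y u - ln (1 / max e (norm (u - y)))\<bar> \<le> C" using Hh_bound by blast
  define D where "D = norm (x - y) + R * e + e'"
  have D: "0 < D" using e R1 by (simp add: D_def add_nonneg_pos)
  define B where "B = C + \<bar>ln e'\<bar> + \<bar>ln D\<bar>"
  show ?thesis
  proof (rule Bochner_Integration.integrable_bound[OF integrable_mult_right[OF pe_has_integral(1)[OF e(1), of x], of B]])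
    show "AE u in lborel. norm (Hh e' y u * pe e x u) \<le> norm (B * pe e x u)"
    proof (rule AE_I2)
      fix u
      show "norm (Hh e' y u * pe e x u) \<le> norm (B * pe e x u)"
      proof (cases "u \<in> cball x (R * e)")
        case True
        define m where "m = max e' (norm (u - y))"
        have "norm (u - y) \<le> norm (x - y) + R * e"
          using True norm_triangle_ineq[of "u - x" "x - y"] by (simp add: dist_norm norm_minus_commute)
        moreover have "0 \<le> R * e" using R1 e by simp
        ultimately have m: "e' \<le> m" "m \<le> D" "0 < m" using e by (auto simp: m_def D_def)
        then have "ln e' \<le> ln m" "ln m \<le> ln D" using e by auto
        moreover have "ln (1 / m) = - ln m" using m by (simp add: ln_div)
        ultimately have "\<bar>Hh e' y u\<bar> \<le> B" using C(2)[OF e(2), of y u] unfolding m_def[symmetric] B_def by linarith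
        then show ?thesis by (simp add: abs_mult mult_right_mono)
      qed (simp add: pe_zero[OF e(1)])
    qed
  qed measurable
qed

lemma cov_0_pos: "x \<in> K \<Longrightarrow> y \<in> K \<Longrightarrow> 0 < e \<Longrightarrow> e \<le> \<eta>0 \<Longrightarrow> cov \<Omega> g \<phi> 0 x e y = Hh e y x"
  using Sig_pe_eq(1)[of x y e] K_K1 by (auto simp: cov_def)

lemma cov_pos_0: "x \<in> K \<Longrightarrow> y \<in> K \<Longrightarrow> 0 < e \<Longrightarrow> e \<le> \<eta>0 \<Longrightarrow> cov \<Omega> g \<phi> e x 0 y = Hh e x y"
  using Sig_pe_eq(2)[of y x e] K_K1 by (auto simp: cov_def)

lemma cov_pos_pos:
  assumes "x \<in> K" "y \<in> K" "0 < e" "e \<le> \<eta>0" "0 < e'" "e' \<le> \<eta>0"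
  shows "cov \<Omega> g \<phi> e x e' y = (\<integral>u. Hh e' y u * pe e x u \<partial>lborel)"
proof -
  have "cov \<Omega> g \<phi> e x e' y = (LINT u:\<Omega>|lborel. LINT v:\<Omega>|lborel. pe e x u * Sig g u v * pe e' y v)"
    using assms by (simp add: cov_def field_cov_def)
  also have "\<dots> = (\<integral>u. Hh e' y u * pe e x u \<partial>lborel)"
    unfolding set_lebesgue_integral_def
  proof (intro Bochner_Integration.integral_cong refl)
    fix u
    show "indicator \<Omega> u *\<^sub>R (\<integral>v. indicator \<Omega> v *\<^sub>R (pe e x u * Sig g u v * pe e' y v) \<partial>lborel) = Hh e' y u * pe e x u"
    proof (cases "u \<in> K1")
      case True
      have "(\<integral>v. indicator \<Omega> v *\<^sub>R (pe e x u * Sig g u v * pe e' y v) \<partial>lborel)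
        = (\<integral>v. pe e x u * (indicator \<Omega> v *\<^sub>R (Sig g u v * pe e' y v)) \<partial>lborel)"
        by (intro Bochner_Integration.integral_cong refl) (simp add: mult_ac)
      then show ?thesis
        using True K1_Om Sig_pe_eq(1)[OF True assms(2,5,6)] by (auto simp: set_lebesgue_integral_def mult.commute)
    qed (use pe_K1_zero[OF assms(1,3,4)] in simp)
  qed
  finally show ?thesis .
qed

lemma cov_sym:
  assumes "x \<in> K" "y \<in> K" "0 \<le> e" "e \<le> \<eta>0" "0 \<le> e'" "e' \<le> \<eta>0"
  shows "cov \<Omega> g \<phi> e x e' y = cov \<Omega> g \<phi> e' y e x"
proof (cases "e = 0 \<or> e' = 0")
  case True
  then show ?thesis
    using assms cov_0_pos[of y x e] cov_pos_0[of x y e] cov_0_pos[of x y e'] cov_pos_0[of y x e'] Sig_symmetric[of x y] K_Om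
    by (cases "e = 0"; cases "e' = 0") (auto simp: cov_def)
next
  case False
  then have e: "0 < e" "0 < e'" using assms by auto
  let ?f = "\<lambda>(u, v). pe e x u * SK u v * pe e' y v"
  have "(\<integral>(u, v). pe e' y u * SK u v * pe e x v \<partial>(lborel \<Otimes>\<^sub>M lborel)) = (\<integral>(u, v). ?f (v, u) \<partial>(lborel \<Otimes>\<^sub>M lborel))"
    by (intro Bochner_Integration.integral_cong refl) (auto simp: SK_sym mult_ac)
  also have "\<dots> = integral\<^sup>L (lborel \<Otimes>\<^sub>M lborel) ?f"
    by (rule lborel_pair.integral_product_swap) measurable
  finally show ?thesis using assms e by (simp add: cov_pos_eq)
qed

text \<open>Let e <= e'. Averaging over a ball of radius R * e changes max e' |u - y| by a factor of
  at most 1 + R, so it costs ln (1 + R) on top of \<open>Hh_bound\<close>; symmetry covers e' < e.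
  The positivity condition excludes coinciding points with both scales 0, where \<open>Sig\<close>
  carries a default value.\<close>

lemma cov_bound:
  "\<exists>C\<ge>0. \<forall>x\<in>K. \<forall>y\<in>K. \<forall>e e'. 0 \<le> e \<longrightarrow> e \<le> \<eta>0 \<longrightarrow> 0 \<le> e' \<longrightarrow> e' \<le> \<eta>0 \<longrightarrow> 0 < max (max e e') (norm (x - y)) \<longrightarrow>
     \<bar>cov \<Omega> g \<phi> e x e' y - ln (1 / max (max e e') (norm (x - y)))\<bar> \<le> C"
proof -
  obtain C where C: "0 \<le> C" "\<And>e y u. 0 < e \<Longrightarrow> \<bar>Hh e y u - ln (1 / max e (norm (u - y)))\<bar> \<le> C" using Hh_bound by blast
  obtain B where B: "0 < B" "\<And>u v. \<bar>gK u v\<bar> \<le> B" using gK_bounded by blast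
  have lR: "0 \<le> ln (1 + R)" using R1 by simp
  define D where "D = C + B + ln (1 + R)"
  have pos: "\<bar>cov \<Omega> g \<phi> e x e' y - ln (1 / max e' (norm (x - y)))\<bar> \<le> D"
    if x: "x \<in> K" "y \<in> K" and e: "0 \<le> e" "e \<le> e'" "e' \<le> \<eta>0" "0 < e'" for x y e e'
  proof (cases "e = 0")
    case True
    then show ?thesis using C(2)[of e' y x] cov_0_pos[OF x, of e'] e B lR by (simp add: D_def)
  next
    case False
    then have e0: "0 < e" using e by simp
    define m where "m = max e' (norm (x - y))"
    have m: "0 < m" "e' \<le> m" using e by (auto simp: m_def)
    have "\<bar>(\<integral>u. Hh e' y u * pe e x u \<partial>lborel) - ln (1 / m)\<bar> \<le> D"
    proof (rule avg_close[OF e0 Hh_pe_integrable[OF e0 e(4)]], rule AE_I2, rule impI)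
      fix u assume u: "u \<in> cball x (R * e)"
      define m' where "m' = max e' (norm (u - y))"
      have m': "0 < m'" using e by (auto simp: m'_def)
      have Re: "R * e \<le> R * e'" "0 \<le> R * e'" using e R1 by auto
      have n: "norm (u - y) \<le> norm (x - y) + R * e'" "norm (x - y) \<le> norm (u - y) + R * e'"
        using u Re norm_triangle_ineq[of "u - x" "x - y"] norm_triangle_ineq[of "x - u" "u - y"]
        by (auto simp: dist_norm norm_minus_commute)
      have "R * e' \<le> R * m" "R * e' \<le> R * m'" using R1 by (auto simp: m_def m'_def)
      then have "m' \<le> (1 + R) * m" "m \<le> (1 + R) * m'"
        using n Re unfolding distrib_right by (auto simp: m_def m'_def)
      then have "ln m' \<le> ln (1 + R) + ln m" "ln m \<le> ln (1 + R) + ln m'"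
        using m m' R1 ln_le_cancel_iff[of m' "(1 + R) * m"] ln_le_cancel_iff[of m "(1 + R) * m'"]
          ln_mult[of "1 + R" m] ln_mult[of "1 + R" m'] by auto
      moreover have "ln (1 / m) = - ln m" "ln (1 / m') = - ln m'" using m m' by (simp_all add: ln_div)
      ultimately show "\<bar>Hh e' y u - ln (1 / m)\<bar> \<le> D"
        using C(2)[OF e(4), of y u] B unfolding m'_def[symmetric] D_def by linarith
    qed
    then show ?thesis using cov_pos_pos[OF x e0 _ e(4,3)] e by (simp add: m_def)
  qed
  have "\<bar>cov \<Omega> g \<phi> e x e' y - ln (1 / max (max e e') (norm (x - y)))\<bar> \<le> D"
    if x: "x \<in> K" "y \<in> K" and e: "0 \<le> e" "e \<le> \<eta>0" "0 \<le> e'" "e' \<le> \<eta>0" and p: "0 < max (max e e') (norm (x - y))" for x y e e'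
  proof (cases "e = 0 \<and> e' = 0")
    case True
    then show ?thesis using B(2)[of x y] x K_K1 C(1) lR p
      by (auto simp: cov_def Sig_def gK_def D_def subset_iff max_def)
  next
    case False
    show ?thesis
    proof (cases "e \<le> e'")
      case True
      then have "0 < e'" using False e by auto
      moreover have "max e e' = e'" using True by simp
      ultimately show ?thesis using pos[OF x e(1) True e(4)] by (simp only:)
    next
      case g: False
      then have "0 < e" "e' \<le> e" using e by auto
      moreover from this have "max e e' = e" by simp
      ultimately show ?thesis
        using pos[OF x(2,1) e(3) _ e(2)] unfolding cov_sym[OF x e] norm_minus_commute[of x y] by (simp only:)
    qed
  qed
  moreover have "0 \<le> D" using C(1) B lR by (simp add: D_def)
  ultimately show ?thesis by blast
qed

lemma cov_tendsto_points:
  assumes e: "0 < e" "e \<le> \<eta>0" and x: "xn \<longlonglongrightarrow> x" "\<And>n. xn n \<in> K" "x \<in> K" and y: "yn \<longlonglongrightarrow> y" "\<And>n. yn n \<in> K" "y \<in> K"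
  shows "(\<lambda>n. cov \<Omega> g \<phi> e (xn n) e (yn n)) \<longlonglongrightarrow> cov \<Omega> g \<phi> e x e y"
proof -
  obtain M where M: "0 < M" "\<And>y u. \<bar>pe e y u\<bar> \<le> M" using pe_abs_bounded[OF e(1)] by blast
  show ?thesis
    unfolding cov_pos_eq[OF x(2) y(2) e e] cov_pos_eq[OF x(3) y(3) e e]
  proof (rule integral_dominated_convergence[where w="\<lambda>p. (M * M) * \<bar>case p of (u, v) \<Rightarrow> SK u v\<bar>"])
    show "integrable (lborel \<Otimes>\<^sub>M lborel) (\<lambda>p. (M * M) * \<bar>case p of (u, v) \<Rightarrow> SK u v\<bar>)"
      by (intro integrable_mult_right integrable_abs SK_integrable)
    show "AE p in lborel \<Otimes>\<^sub>M lborel. (\<lambda>n. case p of (u, v) \<Rightarrow> pe e (xn n) u * SK u v * pe e (yn n) v) \<longlonglongrightarrow> (case p of (u, v) \<Rightarrow> pe e x u * SK u v * pe e y v)"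
      by (intro AE_I2) (auto intro!: tendsto_intros phi_eps_tendsto x y)
    show "AE p in lborel \<Otimes>\<^sub>M lborel. norm (case p of (u, v) \<Rightarrow> pe e (xn n) u * SK u v * pe e (yn n) v) \<le> (M * M) * \<bar>case p of (u, v) \<Rightarrow> SK u v\<bar>" for n
      using M by (intro AE_I2) (auto simp: abs_mult mult_ac intro!: mult_left_mono mult_mono)
  qed measurable
qed

text \<open>The scale \<eta> stays positive, so \<open>Hh \<eta> z\<close> is continuous and its
  averages around x converge even if x = z.\<close>

lemma cov_tendsto_eps_left:
  assumes x: "x \<in> K" "z \<in> K" and \<eta>: "0 < \<eta>" "\<eta> \<le> \<eta>0" and en: "\<And>n. 0 < en n" "en \<longlonglongrightarrow> 0"
  shows "(\<lambda>n. cov \<Omega> g \<phi> (en n) x \<eta> z) \<longlonglongrightarrow> cov \<Omega> g \<phi> 0 x \<eta> z"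
proof (rule LIMSEQ_I)
  fix r :: real assume r: "0 < r"
  have "continuous_on K1 (Hh \<eta> z)"
    unfolding continuous_on_sequentially using Hh_tendsto[OF \<eta>(1)] by (auto simp: o_def)
  then obtain d where d: "0 < d" "\<And>u. u \<in> K1 \<Longrightarrow> dist u x < d \<Longrightarrow> dist (Hh \<eta> z u) (Hh \<eta> z x) < r / 2"
    unfolding continuous_on_iff using x K_K1 r by (metis half_gt_zero subsetD)
  have "(\<lambda>n. R * en n) \<longlonglongrightarrow> R * 0" by (intro tendsto_intros en)
  then have "\<forall>\<^sub>F n in sequentially. R * en n < d" using d by (intro order_tendstoD) auto
  moreover have "\<forall>\<^sub>F n in sequentially. en n < \<eta>0" using eta0 en by (intro order_tendstoD) auto
  ultimately have "\<forall>\<^sub>F n in sequentially. norm (cov \<Omega> g \<phi> (en n) x \<eta> z - cov \<Omega> g \<phi> 0 x \<eta> z) < r"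
  proof eventually_elim
    case (elim n)
    have "\<bar>(\<integral>u. Hh \<eta> z u * pe (en n) x u \<partial>lborel) - Hh \<eta> z x\<bar> \<le> r / 2"
    proof (rule avg_close[OF en(1) Hh_pe_integrable[OF en(1) \<eta>(1)]], rule AE_I2, rule impI)
      fix u assume u: "u \<in> cball x (R * en n)"
      then have "u \<in> K1" using cball_K1[of x "en n"] x elim by auto
      moreover have "dist u x < d" using u elim by (simp add: dist_commute)
      ultimately show "\<bar>Hh \<eta> z u - Hh \<eta> z x\<bar> \<le> r / 2" using d(2)[of u] by (simp add: dist_real_def)
    qed
    then show ?case using cov_pos_pos[OF x en(1)[of n] _ \<eta>] cov_0_pos[OF x \<eta>] elim r by simp
  qed
  then show "\<exists>no. \<forall>n\<ge>no. norm (cov \<Omega> g \<phi> (en n) x \<eta> z - cov \<Omega> g \<phi> 0 x \<eta> z) < r"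
    by (simp add: eventually_sequentially)
qed

lemma Sig_near:
  assumes x: "x \<in> K" "y \<in> K" "x \<noteq> y" and r: "0 < r"
  obtains d where "0 < d" "\<And>u v. u \<in> K1 \<Longrightarrow> v \<in> K1 \<Longrightarrow> dist u x < d \<Longrightarrow> dist v y < d \<Longrightarrow> \<bar>Sig g u v - Sig g x y\<bar> < r"
proof -
  let ?T = "K1 \<times> K1 \<inter> {p. fst p \<noteq> snd p}"
  have "continuous_on ?T (\<lambda>p. g (fst p) (snd p))"
    using continuous_on_subset[OF g_continuous, of ?T] K1_Om by (auto simp: case_prod_beta)
  then have "continuous_on ?T (\<lambda>p. Sig g (fst p) (snd p))"
    unfolding Sig_def by (intro continuous_intros) auto
  moreover have "(x, y) \<in> ?T" using x K_K1 by auto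
  ultimately have "\<exists>d>0. \<forall>p\<in>?T. dist p (x, y) < d \<longrightarrow> dist (Sig g (fst p) (snd p)) (Sig g (fst (x, y)) (snd (x, y))) < r"
    unfolding continuous_on_iff using r by blast
  then obtain d where d: "0 < d" "\<And>p. p \<in> ?T \<Longrightarrow> dist p (x, y) < d \<Longrightarrow> dist (Sig g (fst p) (snd p)) (Sig g x y) < r"
    by auto
  \<comment> \<open>Moving each point by less than half their distance keeps them apart, away from
    the singularity.\<close>
  define d' where "d' = min (d / 2) (dist x y / 2)"
  show ?thesis
  proof (rule that)
    show "0 < d'" using d x by (simp add: d'_def)
    fix u v assume uv: "u \<in> K1" "v \<in> K1" "dist u x < d'" "dist v y < d'"
    have "u \<noteq> v"
    proof
      assume "u = v"
      then have "dist x y \<le> dist u x + dist v y" using dist_triangle[of x y u] by (simp add: dist_commute)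
      also have "\<dots> < dist x y" using uv by (simp add: d'_def)
      finally show False by simp
    qed
    moreover have "dist (u, v) (x, y) \<le> dist u x + dist v y" by (rule dist_Pair_Pair[THEN eq_refl, THEN order_trans]) (rule sqrt_sum_squares_le_sum; simp)
    moreover have "dist u x + dist v y < d" using uv by (simp add: d'_def)
    ultimately show "\<bar>Sig g u v - Sig g x y\<bar> < r" using d(2)[of "(u, v)"] uv by (simp add: dist_real_def)
  qed
qed

lemma cov_tendsto_Sig:
  assumes x: "x \<in> K" "y \<in> K" "x \<noteq> y" and en: "\<And>n. 0 < en n" "en \<longlonglongrightarrow> 0"
  shows "(\<lambda>n. cov \<Omega> g \<phi> 0 x (en n) y) \<longlonglongrightarrow> Sig g x y"
    and "(\<lambda>n. cov \<Omega> g \<phi> (en n) x (en n) y) \<longlonglongrightarrow> Sig g x y"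
proof -
  have key: "\<forall>\<^sub>F n in sequentially. \<bar>cov \<Omega> g \<phi> 0 x (en n) y - Sig g x y\<bar> < r \<and> \<bar>cov \<Omega> g \<phi> (en n) x (en n) y - Sig g x y\<bar> < r"
    if r: "0 < r" for r
  proof -
    obtain d where d: "0 < d" "\<And>u v. u \<in> K1 \<Longrightarrow> v \<in> K1 \<Longrightarrow> dist u x < d \<Longrightarrow> dist v y < d \<Longrightarrow> \<bar>Sig g u v - Sig g x y\<bar> < r / 2"
      using Sig_near[OF x, of "r / 2"] r by (metis half_gt_zero)
    have "(\<lambda>n. R * en n) \<longlonglongrightarrow> R * 0" by (intro tendsto_intros en)
    then have "\<forall>\<^sub>F n in sequentially. R * en n < d" using d by (intro order_tendstoD) auto
    moreover have "\<forall>\<^sub>F n in sequentially. en n < \<eta>0" using eta0 en by (intro order_tendstoD) auto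
    ultimately show ?thesis
    proof eventually_elim
      case (elim n)
      have Hn: "\<bar>Hh (en n) y u - Sig g x y\<bar> \<le> r / 2" if u: "u \<in> K1" "dist u x < d" for u
      proof -
        have hh: "Hh (en n) y u = (\<integral>v. (ln (1 / norm (u - v)) + gK u v) * pe (en n) y v \<partial>lborel)"
          unfolding Hh_def lpot_def using lpot_integrable[OF en(1)[of n], of u y] gK_pe_integrable[OF en(1)[of n], of u y] by (simp add: distrib_right)
        show ?thesis unfolding hh
        proof (rule avg_close[OF en(1)], simp add: distrib_right lpot_integrable[OF en(1)] gK_pe_integrable[OF en(1)], rule AE_I2, rule impI)
          fix v assume v: "v \<in> cball y (R * en n)"
          then have "v \<in> K1" using cball_K1[of y "en n"] x elim by auto
          moreover have "dist v y < d" using v elim by (simp add: dist_commute)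
          ultimately show "\<bar>ln (1 / norm (u - v)) + gK u v - Sig g x y\<bar> \<le> r / 2" using d(2)[of u v] u by (simp add: Sig_def gK_def)
        qed
      qed
      have "\<bar>(\<integral>u. Hh (en n) y u * pe (en n) x u \<partial>lborel) - Sig g x y\<bar> \<le> r / 2"
      proof (rule avg_close[OF en(1) Hh_pe_integrable[OF en(1) en(1)]], rule AE_I2, rule impI)
        fix u assume u: "u \<in> cball x (R * en n)"
        then have "u \<in> K1" using cball_K1[of x "en n"] x elim by auto
        moreover have "dist u x < d" using u elim by (simp add: dist_commute)
        ultimately show "\<bar>Hh (en n) y u - Sig g x y\<bar> \<le> r / 2" by (rule Hn)
      qed
      moreover have "\<bar>Hh (en n) y x - Sig g x y\<bar> \<le> r / 2" using Hn[of x] x K_K1 d by auto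
      ultimately show ?case
        using cov_pos_pos[OF x(1,2) en(1)[of n] _ en(1)[of n]] cov_0_pos[OF x(1,2) en(1)[of n]] elim r by simp
    qed
  qed
  show "(\<lambda>n. cov \<Omega> g \<phi> 0 x (en n) y) \<longlonglongrightarrow> Sig g x y" "(\<lambda>n. cov \<Omega> g \<phi> (en n) x (en n) y) \<longlonglongrightarrow> Sig g x y"
    by (rule tendstoI, use key in \<open>force simp: dist_real_def elim: eventually_mono\<close>)+
qed

end

section \<open>The approximating fields\<close>

lemma limsup_ereal_le_imp_eventually_less:
  fixes f :: "nat \<Rightarrow> real"
  assumes "limsup (\<lambda>N. ereal (f N)) \<le> ereal c" "c < d"
  shows "\<forall>\<^sub>F N in sequentially. f N < d"
proof -
  have "limsup (\<lambda>N. ereal (f N)) < ereal d" using assms by (metis ereal_less(2) le_less_trans less_ereal.simps(1))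
  then have "\<forall>\<^sub>F N in sequentially. ereal (f N) < ereal d" by (rule Limsup_lessD)
  then show ?thesis by simp
qed

locale gmc_approximation = log_kernel \<phi> R \<Omega> g K \<eta>0
  for \<phi> :: "'a::euclidean_space \<Rightarrow> real" and R \<Omega> g K \<eta>0 +
  fixes Pm :: "'w measure" and Xg :: "'w \<Rightarrow> ('a \<Rightarrow> real) \<Rightarrow> real"
    and PN :: "nat \<Rightarrow> 'b measure" and XN :: "nat \<Rightarrow> 'b \<Rightarrow> 'a \<Rightarrow> real"
    and \<epsilon>N :: "nat \<Rightarrow> real" and \<gamma> :: real
  assumes P_prob: "prob_space Pm"
    and P_meas: "\<And>h. Cc_inf UNIV h \<Longrightarrow> (\<lambda>w. Xg w h) \<in> borel_measurable Pm"
    and P_lin: "\<And>w h k (a::real) b. Cc_inf UNIV h \<Longrightarrow> Cc_inf UNIV k \<Longrightarrow>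
                  Xg w (\<lambda>u. a * h u + b * k u) = a * Xg w h + b * Xg w k"
    and P_gauss: "\<And>h t. Cc_inf UNIV h \<Longrightarrow> char (distr Pm borel (\<lambda>w. Xg w h)) t
                     = complex_of_real (exp (- (t^2 * field_cov \<Omega> g h h) / 2))"
    and P_cont: "\<And>w e. 0 < e \<Longrightarrow> continuous_on UNIV (\<lambda>x. Xg w (\<lambda>u. phi_eps \<phi> e (x - u)))"
    and PN_prob: "\<And>N. prob_space (PN N)"
    and XN_meas: "\<And>N. (\<lambda>(w,x). XN N w x) \<in> borel_measurable (PN N \<Otimes>\<^sub>M lborel)"
    and XN_int: "\<And>N w. set_integrable lborel \<Omega> (XN N w)"
    and XN_expmom: "\<And>N (\<alpha>::real) x. \<alpha> > 0 \<Longrightarrow> x \<in> \<Omega> \<Longrightarrow> integrable (PN N) (\<lambda>w. exp (\<alpha> * XN N w x))"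
    and XN_expint: "\<And>N h. Cc_inf \<Omega> h \<Longrightarrow>
                     integrable (PN N) (\<lambda>w. exp (LINT u:\<Omega>|lborel. h u * XN N w u))"
    and XN_law: "\<And>h. Cc_inf \<Omega> h \<Longrightarrow>
                  weak_conv_m (\<lambda>N. distr (PN N) borel (\<lambda>w. LINT u:\<Omega>|lborel. h u * XN N w u))
                              (distr Pm borel (\<lambda>w. Xg w h))"
    and gamma: "0 < \<gamma>" "\<gamma>\<^sup>2 < 2 * real DIM('a)"
    and epsN: "\<And>N. 0 < \<epsilon>N N" "\<epsilon>N \<longlonglongrightarrow> 0"
    and a1: "A1 \<Omega> g \<phi> PN XN \<gamma>" and a2: "A2 \<Omega> \<phi> PN XN \<gamma>" and a3: "A3 \<Omega> \<phi> PN XN \<gamma> \<epsilon>N"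
    and a4: "A4 \<Omega> g \<phi> PN XN \<gamma> \<epsilon>N" and a5: "A5 \<Omega> \<phi> PN XN \<gamma> \<epsilon>N" and a6: "A6 \<Omega> g \<phi> PN XN \<gamma>"
    and a7: "A7 \<Omega> g \<phi> PN XN \<gamma> \<epsilon>N" and a8: "A8 \<Omega> \<phi> PN XN \<gamma> \<epsilon>N"
begin

abbreviation (input) X :: "nat \<Rightarrow> real \<Rightarrow> 'b \<Rightarrow> 'a \<Rightarrow> real" where
  "X N e w x \<equiv> XNe \<Omega> \<phi> XN N e w x"

abbreviation (input) GX :: "real \<Rightarrow> 'w \<Rightarrow> 'a \<Rightarrow> real" where
  "GX e w x \<equiv> Xg w (\<lambda>u. phi_eps \<phi> e (x - u))"

abbreviation (input) Cv :: "real \<Rightarrow> 'a \<Rightarrow> real \<Rightarrow> 'a \<Rightarrow> real" where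
  "Cv e x e' y \<equiv> cov \<Omega> g \<phi> e x e' y"

lemma XN_measurable[measurable (raw)]:
  assumes "f \<in> M \<rightarrow>\<^sub>M PN N" "h \<in> M \<rightarrow>\<^sub>M borel"
  shows "(\<lambda>w. XN N (f w) (h w)) \<in> borel_measurable M"
proof -
  have "(\<lambda>w. (f w, h w)) \<in> M \<rightarrow>\<^sub>M PN N \<Otimes>\<^sub>M lborel" using assms by (intro measurable_Pair) auto
  from measurable_compose[OF this XN_meas[of N]] show ?thesis by simp
qed

lemma X_measurable[measurable (raw)]:
  assumes [measurable]: "f \<in> M \<rightarrow>\<^sub>M PN N" "h \<in> M \<rightarrow>\<^sub>M borel"
  shows "(\<lambda>w. X N e (f w) (h w)) \<in> borel_measurable M"
  unfolding XNe_def mollify_def set_lebesgue_integral_def by measurable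

lemma X_zero: "X N 0 w x = XN N w x"
  by (simp add: XNe_def mollify_def)

lemma Cc_inf_pe_Om: "x \<in> K \<Longrightarrow> 0 < e \<Longrightarrow> e \<le> \<eta>0 \<Longrightarrow> Cc_inf \<Omega> (\<lambda>u. phi_eps \<phi> e (x - u))"
  using Cc_inf_pe[of e x \<Omega>] cball_K1[of x e] K1_Om by auto

lemma X_pos: "0 < e \<Longrightarrow> X N e w x = (LINT u:\<Omega>|lborel. phi_eps \<phi> e (x - u) * XN N w u)"
  by (simp add: XNe_def mollify_def mult.commute)

lemma pe_XN_integrable:
  assumes e: "0 < e"
  shows "set_integrable lborel \<Omega> (\<lambda>u. phi_eps \<phi> e (x - u) * XN N w u)"
proof -
  obtain M where M: "0 < M" "\<And>y u. \<bar>phi_eps \<phi> e (y - u)\<bar> \<le> M" using pe_abs_bounded[OF e] by blast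
  have i: "integrable lborel (\<lambda>u. M * (indicator \<Omega> u *\<^sub>R XN N w u))"
    using XN_int[of N w] unfolding set_integrable_def by simp
  have m: "(\<lambda>u. indicator \<Omega> u *\<^sub>R XN N w u) \<in> borel_measurable lborel"
    using XN_int[of N w] unfolding set_integrable_def by (rule borel_measurable_integrable)
  have eq: "indicator \<Omega> u *\<^sub>R (phi_eps \<phi> e (x - u) * XN N w u) = phi_eps \<phi> e (x - u) * (indicator \<Omega> u *\<^sub>R XN N w u)" for u
    by simp
  show ?thesis unfolding set_integrable_def eq
  proof (rule Bochner_Integration.integrable_bound[OF i])
    show "(\<lambda>u. phi_eps \<phi> e (x - u) * (indicator \<Omega> u *\<^sub>R XN N w u)) \<in> borel_measurable lborel"
      by (intro borel_measurable_times m) measurable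
    show "AE u in lborel. norm (phi_eps \<phi> e (x - u) * (indicator \<Omega> u *\<^sub>R XN N w u)) \<le> norm (M * (indicator \<Omega> u *\<^sub>R XN N w u))"
      using M by (intro AE_I2) (auto simp: abs_mult intro!: mult_right_mono)
  qed
qed

text \<open>The Cramer-Wold device: a linear combination of mollified values is a single pairing
  with one test function, and the hypotheses on laws and exponential moments concern single
  pairings.\<close>

lemma X_sum_pairing:
  fixes n :: nat
  assumes \<eta>: "\<forall>j<n. 0 < \<eta> j"
  shows "(LINT u:\<Omega>|lborel. (\<Sum>j<n. t j * phi_eps \<phi> (\<eta> j) (z j - u)) * XN N w u) = (\<Sum>j<n. t j * X N (\<eta> j) w (z j))"
proof -
  have "(LINT u:\<Omega>|lborel. (\<Sum>j<n. t j * phi_eps \<phi> (\<eta> j) (z j - u)) * XN N w u)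
      = (\<integral>u. (\<Sum>j<n. t j * (indicator \<Omega> u *\<^sub>R (phi_eps \<phi> (\<eta> j) (z j - u) * XN N w u))) \<partial>lborel)"
    unfolding set_lebesgue_integral_def
    by (intro Bochner_Integration.integral_cong refl) (simp add: sum_distrib_right sum_distrib_left mult_ac)
  also have "\<dots> = (\<Sum>j<n. t j * X N (\<eta> j) w (z j))"
    using pe_XN_integrable \<eta> by (subst Bochner_Integration.integral_sum) (auto simp: X_pos set_integrable_def set_lebesgue_integral_def)
  finally show ?thesis .
qed

lemma X_exp_integrable:
  fixes n :: nat
  assumes "\<forall>j<n. z j \<in> K" "\<forall>j<n. 0 < \<eta> j" "\<forall>j<n. \<eta> j \<le> \<eta>0"
  shows "integrable (PN N) (\<lambda>w. exp (\<Sum>j<n. t j * X N (\<eta> j) w (z j)))"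
proof -
  have "Cc_inf \<Omega> (\<lambda>u. \<Sum>j<n. t j * phi_eps \<phi> (\<eta> j) (z j - u))"
    using assms by (intro Cc_inf_sum Cc_inf_pe_Om) auto
  from XN_expint[OF this, of N] show ?thesis unfolding X_sum_pairing[OF assms(2)] .
qed

lemma X_exp_integrable1:
  "x \<in> K \<Longrightarrow> 0 < e \<Longrightarrow> e \<le> \<eta>0 \<Longrightarrow> integrable (PN N) (\<lambda>w. exp (a * X N e w x))"
  using X_exp_integrable[of 1 "\<lambda>_. x" "\<lambda>_. e" N "\<lambda>_. a"] by simp

text \<open>One-sided on purpose: for the unmollified field only positive exponents are known to be
  integrable, while mollified values admit both signs. This is also the reason for the side
  condition on c in \<open>good_X\<close>.\<close>

definition good :: "nat \<Rightarrow> ('b \<Rightarrow> real) \<Rightarrow> bool" where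
  "good N Y \<longleftrightarrow> Y \<in> borel_measurable (PN N) \<and> (\<forall>a\<ge>0. integrable (PN N) (\<lambda>w. exp (a * Y w)))"

lemma good_integrable: "good N Y \<Longrightarrow> integrable (PN N) (\<lambda>w. exp (Y w))"
  unfolding good_def by (metis (no_types, lifting) Bochner_Integration.integrable_cong mult_1 zero_le_one)

lemma good_add:
  assumes "good N Y" "good N Y'" shows "good N (\<lambda>w. Y w + Y' w)"
proof -
  have [measurable]: "Y \<in> borel_measurable (PN N)" "Y' \<in> borel_measurable (PN N)" using assms by (auto simp: good_def)
  have "integrable (PN N) (\<lambda>w. exp (a * (Y w + Y' w)))" if a: "0 \<le> a" for a
  proof (rule Bochner_Integration.integrable_bound)
    show "integrable (PN N) (\<lambda>w. exp ((2 * a) * Y w) + exp ((2 * a) * Y' w))"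
      using assms a unfolding good_def by (intro Bochner_Integration.integrable_add) auto
    show "AE w in PN N. norm (exp (a * (Y w + Y' w))) \<le> norm (exp ((2 * a) * Y w) + exp ((2 * a) * Y' w))"
    proof (rule AE_I2)
      fix w
      have "0 \<le> (exp (a * Y w) - exp (a * Y' w))\<^sup>2" by simp
      also have "\<dots> = exp ((2 * a) * Y w) + exp ((2 * a) * Y' w) - 2 * exp (a * (Y w + Y' w))"
        by (simp add: power2_diff exp_double[symmetric] exp_add[symmetric] algebra_simps)
      finally have "exp (a * (Y w + Y' w)) \<le> exp ((2 * a) * Y w) + exp ((2 * a) * Y' w)"
        using exp_gt_zero[of "a * (Y w + Y' w)"] by linarith
      then show "norm (exp (a * (Y w + Y' w))) \<le> norm (exp ((2 * a) * Y w) + exp ((2 * a) * Y' w))"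
        by simp
    qed
  qed measurable
  then show ?thesis by (auto simp: good_def)
qed

lemma good_zero: "good N (\<lambda>_. 0)"
proof -
  interpret prob_space "PN N" by (rule PN_prob)
  show ?thesis by (simp add: good_def)
qed

lemma good_X:
  assumes x: "x \<in> K" and e: "0 \<le> e" "e \<le> \<eta>0" and c: "0 \<le> c \<or> 0 < e"
  shows "good N (\<lambda>w. c * X N e w x)"
proof -
  interpret prob_space "PN N" by (rule PN_prob)
  have m: "(\<lambda>w. c * X N e w x) \<in> borel_measurable (PN N)" by measurable
  have "integrable (PN N) (\<lambda>w. exp (a * (c * X N e w x)))" if a: "0 \<le> a" for a
  proof (cases "e = 0")
    case True
    then have "a * c = 0 \<or> 0 < a * c" using a c e by (auto simp: le_less)
    then show ?thesis using XN_expmom[of "a * c" x N] x K_Om True by (auto simp: X_zero mult.assoc[symmetric])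
  next
    case False
    then show ?thesis using X_exp_integrable1[OF x, of e N "a * c"] e by (simp add: mult.assoc)
  qed
  then show ?thesis using m by (simp add: good_def)
qed

lemma good_sum:
  fixes n :: nat
  assumes "\<And>j. j < n \<Longrightarrow> good N (Y j)" shows "good N (\<lambda>w. \<Sum>j<n. Y j w)"
  using assms by (induction n) (auto simp: good_zero intro!: good_add)

lemma mN_pos:
  assumes "x \<in> K" "0 \<le> e" "e \<le> \<eta>0" shows "0 < (\<integral>w. exp (\<gamma> * X N e w x) \<partial>PN N)"
proof -
  interpret prob_space "PN N" by (rule PN_prob)
  show ?thesis by (rule expectation_exp_pos) (rule good_integrable[OF good_X[OF assms]], use gamma in simp)
qed

lemma good_pair:
  assumes "x \<in> K" "y \<in> K" "0 \<le> e" "e \<le> \<eta>0" "0 \<le> e'" "e' \<le> \<eta>0"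
  shows "good N (\<lambda>w. \<gamma> * X N e w x + \<gamma> * X N e' w y)"
  using assms gamma by (intro good_add good_X) auto

lemma pair_pos:
  assumes "x \<in> K" "y \<in> K" "0 \<le> e" "e \<le> \<eta>0" "0 \<le> e'" "e' \<le> \<eta>0"
  shows "0 < (\<integral>w. exp (\<gamma> * X N e w x + \<gamma> * X N e' w y) \<partial>PN N)"
proof -
  interpret prob_space "PN N" by (rule PN_prob)
  show ?thesis by (rule expectation_exp_pos) (rule good_integrable[OF good_pair[OF assms]])
qed

section \<open>The Gaussian side and joint convergence in law at positive scales\<close>

lemma GX_meas: "0 < e \<Longrightarrow> (\<lambda>w. GX e w x) \<in> borel_measurable Pm"
  by (rule P_meas) (rule Cc_inf_pe, auto)

lemma GX_sum:
  fixes n :: nat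
  assumes \<eta>: "\<forall>j<n. 0 < \<eta> j"
  shows "Xg w (\<lambda>u. \<Sum>j<n. t j * phi_eps \<phi> (\<eta> j) (z j - u)) = (\<Sum>j<n. t j * GX (\<eta> j) w (z j))"
  using assms
proof (induction n)
  case 0
  show ?case using P_lin[OF Cc_inf_zero Cc_inf_zero, of w 0 0] by simp
next
  case (Suc n)
  have "Cc_inf UNIV (\<lambda>u. \<Sum>j<n. t j * phi_eps \<phi> (\<eta> j) (z j - u))"
    using Suc.prems by (intro Cc_inf_sum Cc_inf_pe) auto
  moreover have "Cc_inf UNIV (\<lambda>u. phi_eps \<phi> (\<eta> n) (z n - u))" using Suc.prems by (intro Cc_inf_pe) auto
  ultimately have "Xg w (\<lambda>u. 1 * (\<Sum>j<n. t j * phi_eps \<phi> (\<eta> j) (z j - u)) + t n * phi_eps \<phi> (\<eta> n) (z n - u))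
     = 1 * Xg w (\<lambda>u. \<Sum>j<n. t j * phi_eps \<phi> (\<eta> j) (z j - u)) + t n * GX (\<eta> n) w (z n)"
    by (rule P_lin)
  then show ?case using Suc by simp
qed

context
  fixes n :: nat and z :: "nat \<Rightarrow> 'a" and \<eta> :: "nat \<Rightarrow> real"
  assumes z: "\<forall>j<n. z j \<in> K" and \<eta>: "\<forall>j<n. 0 < \<eta> j" "\<forall>j<n. \<eta> j \<le> \<eta>0"
begin

lemma GX_lincomb_meas: "(\<lambda>w. \<Sum>j<n. t j * GX (\<eta> j) w (z j)) \<in> borel_measurable Pm"
  by (intro borel_measurable_sum borel_measurable_times GX_meas) (use \<eta> in auto)

lemma GX_exp_moment:
  fixes t :: "nat \<Rightarrow> real"
  defines "v \<equiv> \<Sum>i<n. \<Sum>j<n. t i * t j * Cv (\<eta> i) (z i) (\<eta> j) (z j)"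
  shows "integrable Pm (\<lambda>w. exp (\<Sum>j<n. t j * GX (\<eta> j) w (z j)))"
    and "(\<integral>w. exp (\<Sum>j<n. t j * GX (\<eta> j) w (z j)) \<partial>Pm) = exp (v / 2)"
proof -
  interpret prob_space Pm by (rule P_prob)
  have c: "Cc_inf UNIV (\<lambda>u. \<Sum>j<n. t j * phi_eps \<phi> (\<eta> j) (z j - u))" using \<eta> by (intro Cc_inf_sum Cc_inf_pe) auto
  note m = GX_lincomb_meas[of t]
  have ch: "char (distr Pm borel (\<lambda>w. \<Sum>j<n. t j * GX (\<eta> j) w (z j))) s = complex_of_real (exp (- (s\<^sup>2 * v) / 2))" for s
  proof -
    have "field_cov \<Omega> g (\<lambda>u. \<Sum>j<n. t j * phi_eps \<phi> (\<eta> j) (z j - u)) (\<lambda>u. \<Sum>j<n. t j * phi_eps \<phi> (\<eta> j) (z j - u)) = v"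
      unfolding v_def by (rule field_cov_pe_sum) (use z \<eta> in auto)
    then show ?thesis using P_gauss[OF c, of s] unfolding GX_sum[OF \<eta>(1)] by simp
  qed
  interpret D: real_distribution "distr Pm borel (\<lambda>w. \<Sum>j<n. t j * GX (\<eta> j) w (z j))"
    by (rule real_distribution_distr[OF m])
  \<comment> \<open>A characteristic function is bounded by 1, which forces the variance v to be
    nonnegative.\<close>
  have "norm (complex_of_real (exp (- (1\<^sup>2 * v) / 2))) \<le> 1" using D.cmod_char_le_1[of 1] unfolding ch .
  then have v: "0 \<le> v" unfolding norm_of_real by simp
  show "integrable Pm (\<lambda>w. exp (\<Sum>j<n. t j * GX (\<eta> j) w (z j)))"
    using gaussian_char_imp_exp_moment(1)[OF m v ch, of 1] by simp
  show "(\<integral>w. exp (\<Sum>j<n. t j * GX (\<eta> j) w (z j)) \<partial>Pm) = exp (v / 2)"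
    using gaussian_char_imp_exp_moment(2)[OF m v ch, of 1] by simp
qed

lemma X_lincomb_meas: "(\<lambda>w. \<Sum>j<n. t j * X N (\<eta> j) w (z j)) \<in> borel_measurable (PN N)"
  by measurable

lemma X_lincomb_law:
  "weak_conv_m (\<lambda>N. distr (PN N) borel (\<lambda>w. \<Sum>j<n. t j * X N (\<eta> j) w (z j)))
     (distr Pm borel (\<lambda>w. \<Sum>j<n. t j * GX (\<eta> j) w (z j)))"
proof -
  have "Cc_inf \<Omega> (\<lambda>u. \<Sum>j<n. t j * phi_eps \<phi> (\<eta> j) (z j - u))" using z \<eta> by (intro Cc_inf_sum Cc_inf_pe_Om) auto
  from XN_law[OF this] show ?thesis unfolding GX_sum[OF \<eta>(1)] X_sum_pairing[OF \<eta>(1)] .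
qed

lemma X_lincomb_iexp_tendsto:
  "(\<lambda>N. \<integral>w. iexp (\<Sum>j<n. t j * X N (\<eta> j) w (z j)) \<partial>PN N) \<longlonglongrightarrow> (\<integral>w. iexp (\<Sum>j<n. t j * GX (\<eta> j) w (z j)) \<partial>Pm)"
proof -
  have rd: "real_distribution (distr (PN N) borel (\<lambda>w. \<Sum>j<n. t j * X N (\<eta> j) w (z j)))"
    "real_distribution (distr Pm borel (\<lambda>w. \<Sum>j<n. t j * GX (\<eta> j) w (z j)))" for N
    using PN_prob P_prob X_lincomb_meas GX_lincomb_meas by (auto intro!: prob_space.real_distribution_distr)
  from levy_continuity1[OF rd X_lincomb_law, of 1]
  show ?thesis unfolding char_def using X_lincomb_meas GX_lincomb_meas by (simp add: integral_distr)
qed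

lemma X_product_tendsto:
  assumes \<psi>: "\<And>j x. isCont (\<psi> j) x" "\<And>j x. norm (\<psi> j x) \<le> 1"
  shows "(\<lambda>N. \<integral>w. (\<Prod>j<n. \<psi> j (X N (\<eta> j) w (z j))) \<partial>PN N) \<longlonglongrightarrow> (\<integral>w. (\<Prod>j<n. \<psi> j (GX (\<eta> j) w (z j)) :: complex) \<partial>Pm)"
  by (rule iexp_tendsto_imp_product_tendsto[OF PN_prob P_prob _ _ X_lincomb_iexp_tendsto \<psi>]) (use \<eta> in \<open>auto intro: GX_meas\<close>)

end

section \<open>Boundedness and convergence of exponential moments at positive scales\<close>

lemma A6_bound:
  "\<exists>C. \<forall>e e' \<eta> x y. 0 \<le> e \<and> 0 < e' \<and> e \<le> e' \<and> e' \<le> \<eta> \<and> (x,y) \<in> K \<times> K \<longrightarrow>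
       limsup (\<lambda>N. ereal
         (EN PN N (\<lambda>w. exp (\<gamma> * X N e w x + \<gamma> * X N e' w y + lam * X N \<eta> w y))
          / EN PN N (\<lambda>w. exp (\<gamma> * X N e w x + \<gamma> * X N e' w y))))
       \<le> ereal (C * exp (lam^2 / 2 * Cv \<eta> y \<eta> y + lam * \<gamma> * Cv e x \<eta> y + lam * \<gamma> * Cv e' y \<eta> y))"
  by (rule a6[unfolded A6_def, rule_format, of "K \<times> K" lam]) (use K_compact K_Om in \<open>auto intro: compact_Times\<close>)

lemma A6_eventually:
  assumes xy: "x \<in> K" "y \<in> K" and e: "0 \<le> e" "0 < e'" "e \<le> e'" "e' \<le> \<eta>"
  shows "\<exists>D. \<forall>\<^sub>F N in sequentially. (\<integral>w. exp (\<gamma> * X N e w x + \<gamma> * X N e' w y + lam * X N \<eta> w y) \<partial>PN N)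
          / (\<integral>w. exp (\<gamma> * X N e w x + \<gamma> * X N e' w y) \<partial>PN N) < D"
proof -
  obtain C where C: "\<forall>e e' \<eta> x y. 0 \<le> e \<and> 0 < e' \<and> e \<le> e' \<and> e' \<le> \<eta> \<and> (x,y) \<in> K \<times> K \<longrightarrow>
       limsup (\<lambda>N. ereal
         (EN PN N (\<lambda>w. exp (\<gamma> * X N e w x + \<gamma> * X N e' w y + lam * X N \<eta> w y))
          / EN PN N (\<lambda>w. exp (\<gamma> * X N e w x + \<gamma> * X N e' w y))))
       \<le> ereal (C * exp (lam^2 / 2 * Cv \<eta> y \<eta> y + lam * \<gamma> * Cv e x \<eta> y + lam * \<gamma> * Cv e' y \<eta> y))"
    using A6_bound by (rule exE)
  have "limsup (\<lambda>N. ereal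
         (EN PN N (\<lambda>w. exp (\<gamma> * X N e w x + \<gamma> * X N e' w y + lam * X N \<eta> w y))
          / EN PN N (\<lambda>w. exp (\<gamma> * X N e w x + \<gamma> * X N e' w y))))
       \<le> ereal (C * exp (lam^2 / 2 * Cv \<eta> y \<eta> y + lam * \<gamma> * Cv e x \<eta> y + lam * \<gamma> * Cv e' y \<eta> y))"
    by (rule C[THEN spec, THEN spec, THEN spec, THEN spec, THEN spec, THEN mp, of e e' \<eta> x y]) (simp add: assms)
  from limsup_ereal_le_imp_eventually_less[OF this less_add_one] show ?thesis unfolding EN_def by (intro exI)
qed

text \<open>Convergence in law alone bounds no moment. (A2) at coinciding points bounds the second
  moment of exp (\<gamma> X_e) relative to its squared mean, and the Paley-Zygmund argument then
  bounds the mean itself. (A6) carries the bound over to any exponent.\<close>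

lemma X_exp_moment_bounded:
  assumes x: "x \<in> K" and e: "0 < e" "e \<le> \<eta>0"
  shows "\<exists>B. \<forall>\<^sub>F N in sequentially. (\<integral>w. exp (a * X N e w x) \<partial>PN N) \<le> B"
proof -
  have xO: "x \<in> \<Omega>" using x K_Om by auto
  have law: "weak_conv_m (\<lambda>N. distr (PN N) borel (\<lambda>w. \<gamma> * X N e w x)) (distr Pm borel (\<lambda>w. \<gamma> * GX e w x))"
    using X_lincomb_law[of 1 "\<lambda>_. x" "\<lambda>_. e" "\<lambda>_. \<gamma>"] x e by simp
  obtain B0 where B0: "\<And>N. WN \<Omega> \<phi> PN XN \<gamma> N e e x x \<le> B0"
    using a2[unfolded A2_def, rule_format, of e e "{x}"] e xO by auto
  define B where "B = max B0 0"
  have B: "0 \<le> B" "\<And>N. WN \<Omega> \<phi> PN XN \<gamma> N e e x x \<le> B"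
    unfolding B_def by (rule max.cobounded2, rule max.coboundedI1[OF B0])
  have e2: "exp (2 * (\<gamma> * X N e w x)) = exp (\<gamma> * X N e w x + \<gamma> * X N e w x)" for N w by (simp only: mult_2)
  have bd: "(\<integral>w. exp (2 * (\<gamma> * X N e w x)) \<partial>PN N) \<le> B * (\<integral>w. exp (\<gamma> * X N e w x) \<partial>PN N)\<^sup>2" for N
  proof -
    have m: "0 < (\<integral>w. exp (\<gamma> * X N e w x) \<partial>PN N)" using mN_pos[OF x, of e N] e by simp
    have "(\<integral>w. exp (\<gamma> * X N e w x + \<gamma> * X N e w x) \<partial>PN N) / (\<integral>w. exp (\<gamma> * X N e w x) \<partial>PN N)\<^sup>2 \<le> B"
      using B(2)[of N] unfolding WN_def EN_def power2_eq_square .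
    then show ?thesis unfolding e2 using m by (subst (asm) pos_divide_le_eq) auto
  qed
  have i: "integrable (PN N) (\<lambda>w. exp (c * X N e w x))" for N c by (rule X_exp_integrable1[OF x e])
  obtain C where C: "\<forall>\<^sub>F N in sequentially. (\<integral>w. exp (\<gamma> * X N e w x) \<partial>PN N) \<le> C"
    using weak_conv_m_imp_exp_moment_bounded[OF PN_prob P_prob _ _ law _ _ bd B(1)] i[of _ \<gamma>] i[of _ "2 * \<gamma>"] GX_meas[OF e(1)]
    by (auto simp: mult.assoc)
  \<comment> \<open>(A6) with both points x and all scales e turns the exponent 2\<gamma> into
    a.\<close>
  define lam where "lam = a - 2 * \<gamma>"
  obtain D where D: "\<forall>\<^sub>F N in sequentially. (\<integral>w. exp (\<gamma> * X N e w x + \<gamma> * X N e w x + lam * X N e w x) \<partial>PN N)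
          / (\<integral>w. exp (\<gamma> * X N e w x + \<gamma> * X N e w x) \<partial>PN N) < D"
    using A6_eventually[OF x x, of e e e lam] e by auto
  from C D have "\<forall>\<^sub>F N in sequentially. (\<integral>w. exp (a * X N e w x) \<partial>PN N) \<le> (max D 0 + 1) * (B * C\<^sup>2)"
  proof eventually_elim
    case (elim N)
    have p: "0 < (\<integral>w. exp (\<gamma> * X N e w x + \<gamma> * X N e w x) \<partial>PN N)" by (rule pair_pos) (use x e in auto)
    have e3: "exp (\<gamma> * X N e w x + \<gamma> * X N e w x + lam * X N e w x) = exp (a * X N e w x)" for w
      by (simp add: lam_def algebra_simps)
    have "(\<integral>w. exp (a * X N e w x) \<partial>PN N) \<le> (max D 0 + 1) * (\<integral>w. exp (\<gamma> * X N e w x + \<gamma> * X N e w x) \<partial>PN N)"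
    proof -
      have "(\<integral>w. exp (\<gamma> * X N e w x + \<gamma> * X N e w x + lam * X N e w x) \<partial>PN N) < D * (\<integral>w. exp (\<gamma> * X N e w x + \<gamma> * X N e w x) \<partial>PN N)"
        using elim(2) p by (subst (asm) pos_divide_less_eq) auto
      also have "\<dots> \<le> (max D 0 + 1) * (\<integral>w. exp (\<gamma> * X N e w x + \<gamma> * X N e w x) \<partial>PN N)"
        using p by (intro mult_right_mono) auto
      finally show ?thesis using e3 by simp
    qed
    also have "\<dots> \<le> (max D 0 + 1) * (B * (\<integral>w. exp (\<gamma> * X N e w x) \<partial>PN N)\<^sup>2)"
      using bd[of N] unfolding e2 by (intro mult_left_mono) auto
    also have "\<dots> \<le> (max D 0 + 1) * (B * C\<^sup>2)"
      using elim(1) mN_pos[OF x, of e N] e B(1) by (intro mult_left_mono power_mono) auto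
    finally show ?case .
  qed
  then show ?thesis by blast
qed

text \<open>Each summand is split off by a b <= a^2 + b^2, which doubles all coefficients; the
  induction therefore runs over all t.\<close>

lemma X_lincomb_exp_moment_bounded:
  fixes n :: nat
  assumes z: "\<forall>j<n. z j \<in> K" and \<eta>: "\<forall>j<n. 0 < \<eta> j" "\<forall>j<n. \<eta> j \<le> \<eta>0"
  shows "\<exists>B. \<forall>\<^sub>F N in sequentially. (\<integral>w. exp (\<Sum>j<n. t j * X N (\<eta> j) w (z j)) \<partial>PN N) \<le> B"
  using assms
proof (induction n arbitrary: t)
  case 0
  have "(\<integral>w. exp (\<Sum>j<0. t j * X N (\<eta> j) w (z j)) \<partial>PN N) = 1" for N using prob_space.prob_space[OF PN_prob[of N]] by simp
  then show ?case by (metis (mono_tags, lifting) always_eventually order_refl)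
next
  case (Suc n)
  obtain B where B: "\<forall>\<^sub>F N in sequentially. (\<integral>w. exp (\<Sum>j<n. (2 * t j) * X N (\<eta> j) w (z j)) \<partial>PN N) \<le> B"
    using Suc.IH[of "\<lambda>j. 2 * t j"] Suc.prems by auto
  obtain B' where B': "\<forall>\<^sub>F N in sequentially. (\<integral>w. exp ((2 * t n) * X N (\<eta> n) w (z n)) \<partial>PN N) \<le> B'"
    using X_exp_moment_bounded[of "z n" "\<eta> n" "2 * t n"] Suc.prems by auto
  show ?case
  proof (rule exI[of _ "B + B'"], use B B' in eventually_elim)
    case (elim N)
    let ?S = "\<lambda>w. \<Sum>j<n. t j * X N (\<eta> j) w (z j)"
    have i: "integrable (PN N) (\<lambda>w. exp (\<Sum>j<n. (2 * t j) * X N (\<eta> j) w (z j)))"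
      "integrable (PN N) (\<lambda>w. exp ((2 * t n) * X N (\<eta> n) w (z n)))"
      "integrable (PN N) (\<lambda>w. exp (\<Sum>j<Suc n. t j * X N (\<eta> j) w (z j)))"
      using Suc.prems by (intro X_exp_integrable X_exp_integrable1; simp)+
    have "(\<integral>w. exp (\<Sum>j<Suc n. t j * X N (\<eta> j) w (z j)) \<partial>PN N) \<le> (\<integral>w. exp (\<Sum>j<n. (2 * t j) * X N (\<eta> j) w (z j)) + exp ((2 * t n) * X N (\<eta> n) w (z n)) \<partial>PN N)"
    proof (rule integral_mono[OF i(3) Bochner_Integration.integrable_add[OF i(1,2)]])
      fix w
      define a where "a = exp (?S w)"
      define b where "b = exp (t n * X N (\<eta> n) w (z n))"
      have ab: "0 < a" "0 < b" by (auto simp: a_def b_def)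
      have a2: "exp (\<Sum>j<n. (2 * t j) * X N (\<eta> j) w (z j)) = a\<^sup>2"
        by (simp add: a_def exp_double[symmetric] sum_distrib_left mult.assoc)
      have b2: "exp ((2 * t n) * X N (\<eta> n) w (z n)) = b\<^sup>2" by (simp add: b_def exp_double[symmetric] mult.assoc)
      have "0 \<le> (a - b)\<^sup>2" "0 < a * b" using ab by auto
      then have "a * b \<le> a\<^sup>2 + b\<^sup>2" by (simp add: power2_diff)
      moreover have "exp (\<Sum>j<Suc n. t j * X N (\<eta> j) w (z j)) = a * b" by (simp add: a_def b_def exp_add)
      ultimately show "exp (\<Sum>j<Suc n. t j * X N (\<eta> j) w (z j)) \<le> exp (\<Sum>j<n. (2 * t j) * X N (\<eta> j) w (z j)) + exp ((2 * t n) * X N (\<eta> n) w (z n))"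
        unfolding a2 b2 by simp
    qed
    also have "\<dots> \<le> B + B'" using elim i by simp
    finally show ?case .
  qed
qed

text \<open>Boundedness at the doubled coefficients upgrades convergence in law to convergence of
  exponential moments.\<close>

lemma X_exp_moment_tendsto:
  fixes n :: nat
  assumes z: "\<forall>j<n. z j \<in> K" and \<eta>: "\<forall>j<n. 0 < \<eta> j" "\<forall>j<n. \<eta> j \<le> \<eta>0"
  shows "(\<lambda>N. \<integral>w. exp (\<Sum>j<n. t j * X N (\<eta> j) w (z j)) \<partial>PN N)
     \<longlonglongrightarrow> exp ((\<Sum>i<n. \<Sum>j<n. t i * t j * Cv (\<eta> i) (z i) (\<eta> j) (z j)) / 2)"
proof -
  have e2: "exp (2 * (\<Sum>j<n. t j * X N (\<eta> j) w (z j))) = exp (\<Sum>j<n. (2 * t j) * X N (\<eta> j) w (z j))"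
    "exp (2 * (\<Sum>j<n. t j * GX (\<eta> j) w' (z j))) = exp (\<Sum>j<n. (2 * t j) * GX (\<eta> j) w' (z j))" for N w w'
    by (simp_all add: sum_distrib_left mult.assoc)
  obtain B where B: "\<forall>\<^sub>F N in sequentially. (\<integral>w. exp (2 * (\<Sum>j<n. t j * X N (\<eta> j) w (z j))) \<partial>PN N) \<le> B"
    unfolding e2 using X_lincomb_exp_moment_bounded[OF z \<eta>, where t="\<lambda>j. 2 * t j"] by (rule exE)
  show ?thesis
    unfolding GX_exp_moment(2)[OF z \<eta>, symmetric]
    by (rule weak_conv_m_imp_exp_moment_tendsto[OF PN_prob P_prob X_lincomb_meas[OF z \<eta>] GX_lincomb_meas[OF z \<eta>] X_lincomb_law[OF z \<eta>]
          X_exp_integrable[OF z \<eta>] GX_exp_moment(1)[OF z \<eta>] _ _ B], unfold e2,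
        rule X_exp_integrable[OF z \<eta>], rule GX_exp_moment(1)[OF z \<eta>])
qed

lemma X_exp_moment_tendsto1:
  assumes "x \<in> K" "0 < e" "e \<le> \<eta>0"
  shows "(\<lambda>N. \<integral>w. exp (s * X N e w x) \<partial>PN N) \<longlonglongrightarrow> exp (s\<^sup>2 * Cv e x e x / 2)"
  using X_exp_moment_tendsto[of 1 "\<lambda>_. x" "\<lambda>_. e" "\<lambda>_. s"] assms by (simp add: power2_eq_square)

lemma X_exp_moment_tendsto2:
  assumes "x \<in> K" "0 < e" "e \<le> \<eta>0" "y \<in> K" "0 < e'" "e' \<le> \<eta>0"
  shows "(\<lambda>N. \<integral>w. exp (s * X N e w x + t * X N e' w y) \<partial>PN N)
    \<longlonglongrightarrow> exp ((s\<^sup>2 * Cv e x e x + 2 * s * t * Cv e x e' y + t\<^sup>2 * Cv e' y e' y) / 2)"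
proof -
  have "Cv e' y e x = Cv e x e' y" using cov_sym[of x y e e'] assms by simp
  then show ?thesis
    using X_exp_moment_tendsto[of 2 "\<lambda>j. if j = 0 then x else y" "\<lambda>j. if j = 0 then e else e'" "\<lambda>j. if j = 0 then s else t"] assms
    by (simp add: numeral_2_eq_2 power2_eq_square algebra_simps)
qed

text \<open>Under the law tilted by \<open>exp (\<gamma> X_e(x) + \<gamma> X_e'(y))\<close> the field is in the limit Gaussian with
  the same covariance and a shifted mean; (A4) gives this for exponential moments, hence in law.\<close>

lemma tilted_product_tendsto:
  fixes \<psi> :: "nat \<Rightarrow> real \<Rightarrow> complex"
  assumes xy: "x \<in> K" "y \<in> K" "x \<noteq> y" and e: "0 \<le> e" "e \<le> \<eta>0" "0 \<le> e'" "e' \<le> \<eta>0"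
    and z: "\<forall>j<n. z j \<in> K" and \<eta>: "\<forall>j<n. 0 < \<eta> j" "\<forall>j<n. \<eta> j \<le> \<eta>0"
    and \<psi>: "\<And>j x. isCont (\<psi> j) x" "\<And>j x. norm (\<psi> j x) \<le> 1"
  shows "(\<lambda>N. (\<integral>w. exp (\<gamma> * X N e w x + \<gamma> * X N e' w y) *\<^sub>R (\<Prod>j<n. \<psi> j (X N (\<eta> j) w (z j))) \<partial>PN N)
       /\<^sub>R (\<integral>w. exp (\<gamma> * X N e w x + \<gamma> * X N e' w y) \<partial>PN N))
     \<longlonglongrightarrow> (\<integral>w. (\<Prod>j<n. \<psi> j (\<gamma> * (Cv e x (\<eta> j) (z j) + Cv e' y (\<eta> j) (z j)) + GX (\<eta> j) w (z j))) \<partial>Pm)"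
proof -
  let ?F = "\<lambda>N w. \<gamma> * X N e w x + \<gamma> * X N e' w y"
  define m where "m N = (\<integral>w. exp (?F N w) \<partial>PN N)" for N
  have m: "0 < m N" for N unfolding m_def by (rule pair_pos[OF xy(1,2) e])
  have gF: "good N (?F N)" for N by (rule good_pair[OF xy(1,2) e])
  define Q where "Q N = density (PN N) (\<lambda>w. ennreal (exp (?F N w) / m N))" for N
  have dm[measurable]: "(\<lambda>w. exp (?F N w) / m N) \<in> borel_measurable (PN N)" for N by measurable
  have pQ: "prob_space (Q N)" for N
    unfolding Q_def
    by (rule prob_space_density_of_integral) (use good_integrable[OF gF] m[of N] in \<open>auto simp: m_def[symmetric] less_imp_le\<close>)
  define \<mu> where "\<mu> j = \<gamma> * (Cv e x (\<eta> j) (z j) + Cv e' y (\<eta> j) (z j))" for j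
  have IQ: "(\<integral>w. H w \<partial>Q N) = (\<integral>w. exp (?F N w) *\<^sub>R H w \<partial>PN N) /\<^sub>R m N"
    if [measurable]: "H \<in> borel_measurable (PN N)" for H :: "'b \<Rightarrow> 'z::{banach,second_countable_topology}" and N
  proof -
    have "(\<integral>w. H w \<partial>Q N) = (\<integral>w. (exp (?F N w) / m N) *\<^sub>R H w \<partial>PN N)"
      unfolding Q_def by (rule integral_density) (use m[of N] in \<open>auto simp: less_imp_le\<close>)
    also have "\<dots> = (\<integral>w. inverse (m N) *\<^sub>R (exp (?F N w) *\<^sub>R H w) \<partial>PN N)" by (simp add: divide_inverse mult.commute)
    also have "\<dots> = (\<integral>w. exp (?F N w) *\<^sub>R H w \<partial>PN N) /\<^sub>R m N" by (rule integral_scaleR_right)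
    finally show ?thesis .
  qed
  have XmQ: "(\<lambda>w. X N e1 w u) \<in> borel_measurable (Q N)" for N e1 u unfolding Q_def by simp
  have "(\<lambda>N. \<integral>w. (\<Prod>j<n. \<psi> j (X N (\<eta> j) w (z j))) \<partial>Q N) \<longlonglongrightarrow> (\<integral>w. (\<Prod>j<n. \<psi> j (\<mu> j + GX (\<eta> j) w (z j))) \<partial>Pm)"
  proof (rule iexp_tendsto_imp_product_tendsto[OF pQ P_prob XmQ _ _ \<psi>])
    show "(\<lambda>w. \<mu> j + GX (\<eta> j) w (z j)) \<in> borel_measurable Pm" if "j < n" for j
      using GX_meas[OF \<eta>(1)[rule_format, OF that]] by measurable
    fix t :: "nat \<Rightarrow> real"
    show "(\<lambda>N. \<integral>w. iexp (\<Sum>j<n. t j * X N (\<eta> j) w (z j)) \<partial>Q N) \<longlonglongrightarrow> (\<integral>w. iexp (\<Sum>j<n. t j * (\<mu> j + GX (\<eta> j) w (z j))) \<partial>Pm)"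
    proof (rule mgf_tendsto_imp_iexp_tendsto[OF pQ P_prob])
      show "(\<lambda>w. \<Sum>j<n. t j * X N (\<eta> j) w (z j)) \<in> borel_measurable (Q N)" for N
        by (intro borel_measurable_sum borel_measurable_times XmQ borel_measurable_const)
      have split: "(\<Sum>j<n. t j * (\<mu> j + GX (\<eta> j) w (z j))) = (\<Sum>j<n. t j * \<mu> j) + (\<Sum>j<n. t j * GX (\<eta> j) w (z j))" for w
        by (simp add: ring_distribs sum.distrib)
      show "(\<lambda>w. \<Sum>j<n. t j * (\<mu> j + GX (\<eta> j) w (z j))) \<in> borel_measurable Pm"
        unfolding split by (intro borel_measurable_add borel_measurable_const GX_lincomb_meas[OF z \<eta>])
      fix s :: real
      have st: "s * (\<Sum>j<n. t j * r j) = (\<Sum>j<n. (s * t j) * r j)" for r :: "nat \<Rightarrow> real" by (simp add: sum_distrib_left mult.assoc)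
      have gS: "good N (\<lambda>w. ?F N w + (\<Sum>j<n. (s * t j) * X N (\<eta> j) w (z j)))" for N
        by (intro good_add[OF gF] good_sum good_X) (use z \<eta> in \<open>auto simp: less_imp_le\<close>)
      show "integrable (Q N) (\<lambda>w. exp (s * (\<Sum>j<n. t j * X N (\<eta> j) w (z j))))" for N
      proof -
        have "integrable (PN N) (\<lambda>w. (exp (?F N w) / m N) *\<^sub>R exp (s * (\<Sum>j<n. t j * X N (\<eta> j) w (z j))))"
          using integrable_mult_right[OF good_integrable[OF gS[of N]], of "inverse (m N)"]
          by (simp add: st exp_add divide_inverse mult_ac)
        then show ?thesis unfolding Q_def by (subst integrable_density) (use m[of N] in \<open>auto simp: less_imp_le\<close>)
      qed
      have Es: "exp (s * (\<Sum>j<n. t j * (\<mu> j + GX (\<eta> j) w (z j)))) = exp (\<Sum>j<n. (s * t j) * \<mu> j) * exp (\<Sum>j<n. (s * t j) * GX (\<eta> j) w (z j))" for w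
        proof -
        have "s * (\<Sum>j<n. t j * (\<mu> j + GX (\<eta> j) w (z j))) = (\<Sum>j<n. (s * t j) * \<mu> j) + (\<Sum>j<n. (s * t j) * GX (\<eta> j) w (z j))"
          unfolding split by (simp only: ring_distribs st)
        then show ?thesis by (simp only: exp_add)
      qed
      show "integrable Pm (\<lambda>w. exp (s * (\<Sum>j<n. t j * (\<mu> j + GX (\<eta> j) w (z j)))))"
        unfolding Es by (intro integrable_mult_right GX_exp_moment(1)[OF z \<eta>])
      define L where "L = exp ((\<Sum>k<n. \<gamma> * (s * t k) * (Cv e x (\<eta> k) (z k) + Cv e' y (\<eta> k) (z k)))
                + 1/2 * (\<Sum>j<n. \<Sum>k<n. (s * t j) * (s * t k) * Cv (\<eta> j) (z j) (\<eta> k) (z k)))"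
      have L0: "0 < L" by (simp add: L_def)
      have EL: "(\<integral>w. exp (s * (\<Sum>j<n. t j * (\<mu> j + GX (\<eta> j) w (z j)))) \<partial>Pm) = L"
        unfolding Es using GX_exp_moment(2)[OF z \<eta>, of "\<lambda>j. s * t j"]
        by (simp add: L_def exp_add \<mu>_def mult_ac)
      have fin: "\<forall>\<^sub>F N in sequentially. \<forall>k\<in>{..<n}. \<epsilon>N N < \<eta> k"
        by (rule eventually_ball_finite) (use \<eta> in \<open>auto intro!: order_tendstoD(2)[OF epsN(2)]\<close>)
      have dxy: "0 < dist x y" using xy by simp
      \<comment> \<open>The pair (x, y) is fixed, so the compact set in (A4) is a singleton and
        \<rho> is the distance itself. The scales are fixed as well and eventually exceed
        \<open>\<epsilon>N N\<close>, which is \<open>fin\<close>.\<close>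
      have a: "\<forall>\<delta>>0. \<forall>\<^sub>F N in sequentially. \<forall>x1 y1 (\<eta>::nat \<Rightarrow> real) (z::nat \<Rightarrow> 'a).
        (x1,y1) \<in> {(x,y)} \<and> (\<forall>k<n. \<epsilon>N N < \<eta> k \<and> \<eta> k \<le> 1 \<and> z k \<in> K) \<longrightarrow>
        \<bar>(EN PN N (\<lambda>w. exp (\<gamma> * X N e w x1 + \<gamma> * X N e' w y1) *
                         exp (\<Sum>k<n. (s * t k) * X N (\<eta> k) w (z k)))
          / EN PN N (\<lambda>w. exp (\<gamma> * X N e w x1 + \<gamma> * X N e' w y1)))
         / exp ((\<Sum>k<n. \<gamma> * (s * t k) * (Cv e x1 (\<eta> k) (z k) + Cv e' y1 (\<eta> k) (z k)))
                + 1/2 * (\<Sum>j<n. \<Sum>k<n. (s * t j) * (s * t k) * Cv (\<eta> j) (z j) (\<eta> k) (z k)))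
         - 1\<bar> \<le> \<delta>"
        by (rule a4[unfolded A4_def, THEN spec[of _ "dist x y"], THEN mp, OF dxy, THEN spec[of _ e], THEN mp, OF e(1),
             THEN spec[of _ e'], THEN mp, OF e(3), THEN spec[of _ n], THEN spec[of _ "\<lambda>k. s * t k"], THEN spec[of _ "{(x,y)}"],
             THEN spec[of _ K], THEN mp])
           (use xy K_Om K_compact in auto)
      define r where "r N = (EN PN N (\<lambda>w. exp (\<gamma> * X N e w x + \<gamma> * X N e' w y) * exp (\<Sum>k<n. (s * t k) * X N (\<eta> k) w (z k)))
          / EN PN N (\<lambda>w. exp (\<gamma> * X N e w x + \<gamma> * X N e' w y)))" for N
      have rL: "(\<lambda>N. r N / L) \<longlonglongrightarrow> 1"
      proof (rule tendstoI)
        fix \<delta> :: real assume d: "0 < \<delta>"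
        then have d2: "0 < \<delta> / 2" by simp
        show "\<forall>\<^sub>F N in sequentially. dist (r N / L) 1 < \<delta>"
          using a[rule_format, OF d2] fin
        proof eventually_elim
          case (elim N)
          have "\<eta> k \<le> 1" if "k < n" for k using \<eta>(2)[rule_format, OF that] eta0 by simp
          then have "\<bar>r N / L - 1\<bar> \<le> \<delta> / 2" using elim(1)[rule_format, of x y \<eta> z] elim(2) z unfolding r_def L_def by auto
          then show ?case using d by (simp add: dist_real_def)
        qed
      qed
      have "(\<lambda>N. r N / L * L) \<longlonglongrightarrow> 1 * L" by (intro tendsto_intros rL)
      then have rl: "r \<longlonglongrightarrow> L" using L0 by simp
      have "(\<integral>w. exp (s * (\<Sum>j<n. t j * X N (\<eta> j) w (z j))) \<partial>Q N) = r N" for N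
        by (subst IQ) (simp_all add: r_def EN_def m_def st divide_inverse mult.commute)
      then show "(\<lambda>N. \<integral>w. exp (s * (\<Sum>j<n. t j * X N (\<eta> j) w (z j))) \<partial>Q N) \<longlonglongrightarrow> (\<integral>w. exp (s * (\<Sum>j<n. t j * (\<mu> j + GX (\<eta> j) w (z j)))) \<partial>Pm)"
        unfolding EL using rl by simp
    qed
  qed
  moreover have "(\<integral>w. (\<Prod>j<n. \<psi> j (X N (\<eta> j) w (z j))) \<partial>Q N) = (\<integral>w. exp (?F N w) *\<^sub>R (\<Prod>j<n. \<psi> j (X N (\<eta> j) w (z j))) \<partial>PN N) /\<^sub>R m N" for N
  proof (rule IQ)
    have [measurable]: "\<psi> j \<in> borel_measurable borel" for j
      using \<psi>(1) by (auto intro!: borel_measurable_continuous_onI continuous_at_imp_continuous_on)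
    show "(\<lambda>w. \<Prod>j<n. \<psi> j (X N (\<eta> j) w (z j))) \<in> borel_measurable (PN N)" by measurable
  qed
  ultimately show ?thesis unfolding m_def \<mu>_def by simp
qed

end

section \<open>Integrals of mollified exponentials\<close>

lemma ennreal_norm_integral_le:
  fixes f :: "'a \<Rightarrow> 'b::{banach, second_countable_topology}"
  shows "ennreal (norm (\<integral>x. f x \<partial>M)) \<le> (\<integral>\<^sup>+x. ennreal (norm (f x)) \<partial>M)"
  by (cases "integrable M f") (auto simp: integral_norm_bound_ennreal not_integrable_integral_eq)

lemma abs_le_weighted_square:
  fixes a k :: real
  assumes k: "0 < k"
  shows "\<bar>a\<bar> \<le> (k + a\<^sup>2 / k) / 2"
proof -
  define t where "t = a\<^sup>2 / k"
  have "0 \<le> (\<bar>a\<bar> - k)\<^sup>2 / k" using k by simp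
  also have "\<dots> = t - 2 * \<bar>a\<bar> + k" using k by (simp add: t_def power2_eq_square field_simps)
  finally show ?thesis unfolding t_def[symmetric] by simp
qed

lemma norm_iexp_diff_le: "cmod (iexp a - iexp b) \<le> \<bar>a - b\<bar>"
proof -
  have "iexp b * iexp (a - b) = iexp (b + (a - b))" by (simp only: of_real_add ring_distribs exp_add)
  then have "iexp a - iexp b = iexp b * (iexp (a - b) - 1)" by (simp only: right_diff_distrib) simp
  then have "cmod (iexp a - iexp b) = cmod (iexp (a - b) - 1)" by (simp add: norm_mult)
  also have "\<dots> \<le> \<bar>a - b\<bar>" using iexp_approx1[of "a - b" 0] by simp
  finally show ?thesis .
qed

text \<open>The hypothesis is a nonnegative integral, so closeness in mean can be stated without
  separate integrability of I and J.\<close>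

lemma (in prob_space) iexp_expectation_diff_le:
  assumes [measurable]: "I \<in> borel_measurable M" "J \<in> borel_measurable M"
    and c: "(\<integral>\<^sup>+w. ennreal \<bar>I w - J w\<bar> \<partial>M) \<le> ennreal c" "0 \<le> c"
  shows "cmod ((\<integral>w. iexp (s * I w) \<partial>M) - (\<integral>w. iexp (s * J w) \<partial>M)) \<le> \<bar>s\<bar> * c"
proof -
  have i: "integrable M (\<lambda>w. iexp (s * I w))" "integrable M (\<lambda>w. iexp (s * J w))"
    by (rule integrable_const_bound[of _ 1]; simp)+
  have "ennreal (cmod ((\<integral>w. iexp (s * I w) \<partial>M) - (\<integral>w. iexp (s * J w) \<partial>M))) = ennreal (cmod (\<integral>w. iexp (s * I w) - iexp (s * J w) \<partial>M))"
    by (subst Bochner_Integration.integral_diff[OF i]) simp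
  also have "\<dots> \<le> (\<integral>\<^sup>+w. ennreal (cmod (iexp (s * I w) - iexp (s * J w))) \<partial>M)"
    by (rule ennreal_norm_integral_le)
  also have "\<dots> \<le> (\<integral>\<^sup>+w. ennreal \<bar>s\<bar> * ennreal \<bar>I w - J w\<bar> \<partial>M)"
  proof (rule nn_integral_mono)
    fix w
    have "cmod (iexp (s * I w) - iexp (s * J w)) \<le> \<bar>s\<bar> * \<bar>I w - J w\<bar>"
      using norm_iexp_diff_le[of "s * I w" "s * J w"] by (simp only: right_diff_distrib[symmetric] abs_mult)
    then show "ennreal (cmod (iexp (s * I w) - iexp (s * J w))) \<le> ennreal \<bar>s\<bar> * ennreal \<bar>I w - J w\<bar>"
      by (simp add: ennreal_mult[symmetric] ennreal_leI)
  qed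
  also have "\<dots> = ennreal \<bar>s\<bar> * (\<integral>\<^sup>+w. ennreal \<bar>I w - J w\<bar> \<partial>M)" by (rule nn_integral_cmult) measurable
  also have "\<dots> \<le> ennreal \<bar>s\<bar> * ennreal c" by (intro mult_left_mono c) simp
  also have "\<dots> = ennreal (\<bar>s\<bar> * c)" using c(2) by (simp add: ennreal_mult)
  finally have le: "ennreal (cmod ((\<integral>w. iexp (s * I w) \<partial>M) - (\<integral>w. iexp (s * J w) \<partial>M))) \<le> ennreal (\<bar>s\<bar> * c)" .
  have "0 \<le> \<bar>s\<bar> * c" using c(2) by (intro mult_nonneg_nonneg) auto
  from le show ?thesis unfolding ennreal_le_iff[OF \<open>0 \<le> \<bar>s\<bar> * c\<close>] .
qed

text \<open>A point belongs to the cell of the first centre within distance d; this choice makes the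
  cells disjoint and Borel.\<close>

lemma compact_partition:
  fixes K :: "'a::euclidean_space set"
  assumes K: "compact K" and d: "0 < d"
  obtains n and xp :: "nat \<Rightarrow> 'a" and p :: "'a \<Rightarrow> nat" where
    "\<And>i. i < n \<Longrightarrow> xp i \<in> K" "\<And>x. x \<in> K \<Longrightarrow> p x < n" "\<And>x. x \<in> K \<Longrightarrow> dist x (xp (p x)) < d"
    "\<And>i. {x \<in> K. p x = i} \<in> sets borel"
proof -
  have "K \<subseteq> (\<Union>x\<in>K. ball x d)" using d by auto
  then obtain F where F: "F \<subseteq> K" "finite F" "K \<subseteq> (\<Union>x\<in>F. ball x d)"
    using compactE_image[OF K, of K "\<lambda>x. ball x d"] by (metis open_ball)
  obtain n :: nat and xp where xp: "F = xp ` {i. i < n}" using finite_imp_nat_seg_image_inj_on[OF F(2)] by blast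
  define p where "p x = (LEAST i. dist x (xp i) < d)" for x
  have ex: "\<exists>i<n. dist x (xp i) < d" if x: "x \<in> K" for x
  proof -
    obtain y where "y \<in> F" "x \<in> ball y d" using F(3) x by blast
    then show ?thesis unfolding xp by (auto simp: dist_commute)
  qed
  have p1: "dist x (xp (p x)) < d" "p x < n" if x: "x \<in> K" for x
  proof -
    obtain i where i: "i < n" "dist x (xp i) < d" using ex[OF x] by blast
    show "dist x (xp (p x)) < d" unfolding p_def by (rule LeastI[of _ i]) (rule i)
    have "p x \<le> i" unfolding p_def by (rule Least_le) (rule i)
    then show "p x < n" using i by simp
  qed
  have "{x \<in> K. p x = i} = (K \<inter> ball (xp i) d) - (\<Union>j<i. ball (xp j) d)" for i
  proof (intro set_eqI iffI)
    fix x assume "x \<in> {x \<in> K. p x = i}"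
    then have x: "x \<in> K" "p x = i" by auto
    then have "\<not> dist x (xp j) < d" if "j < i" for j using that not_less_Least[of j "\<lambda>i. dist x (xp i) < d"] unfolding p_def by blast
    then show "x \<in> (K \<inter> ball (xp i) d) - (\<Union>j<i. ball (xp j) d)" using p1(1)[of x] x by (auto simp: dist_commute)
  next
    fix x assume x: "x \<in> (K \<inter> ball (xp i) d) - (\<Union>j<i. ball (xp j) d)"
    have "p x = i" unfolding p_def
    proof (rule Least_equality)
      show "dist x (xp i) < d" using x by (simp add: dist_commute)
      fix j assume "dist x (xp j) < d"
      then show "i \<le> j" using x by (auto simp: dist_commute not_less[symmetric])
    qed
    then show "x \<in> {x \<in> K. p x = i}" using x by simp
  qed
  moreover have "K \<in> sets borel" by (rule borel_closed[OF compact_imp_closed[OF K]])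
  ultimately have "{x \<in> K. p x = i} \<in> sets borel" for i by (auto intro!: sets.Diff sets.Int sets.countable_UN)
  moreover have "xp i \<in> K" if "i < n" for i using F(1) xp that by blast
  ultimately show ?thesis using that[of n xp p] p1 by blast
qed

section \<open>Normalised exponentials and their integrals against f\<close>

locale gmc_test = gmc_approximation \<phi> R \<Omega> g K \<eta>0 Pm Xg PN XN \<epsilon>N \<gamma>
  for \<phi> :: "'a::euclidean_space \<Rightarrow> real" and R \<Omega> g K \<eta>0 and Pm :: "'w measure" and Xg and PN :: "nat \<Rightarrow> 'b measure" and XN \<epsilon>N \<gamma> +
  fixes f :: "'a \<Rightarrow> real"
  assumes f_cont: "continuous_on UNIV f" and f_zero: "\<And>x. x \<notin> K \<Longrightarrow> f x = 0"
begin

lemma f_meas[measurable]: "f \<in> borel_measurable borel"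
  using f_cont by (rule borel_measurable_continuous_onI)

lemma f_bounded: obtains B where "0 < B" "\<And>x. \<bar>f x\<bar> \<le> B"
proof -
  have "compact (f ` K)" by (intro compact_continuous_image continuous_on_subset[OF f_cont] K_compact) auto
  then obtain B where B: "\<And>x. x \<in> K \<Longrightarrow> \<bar>f x\<bar> \<le> B"
    unfolding compact_eq_bounded_closed bounded_iff by force
  have "\<bar>f x\<bar> \<le> max B 0 + 1" for x using B[of x] f_zero[of x] by (cases "x \<in> K") auto
  then show ?thesis using that[of "max B 0 + 1"] by simp
qed

lemma K_finite: "emeasure lborel K < \<infinity>"
  by (rule emeasure_compact_finite[OF K_compact])

lemma f_weight_integrable:
  assumes [measurable]: "h \<in> borel_measurable borel" and b: "\<And>x. x \<in> K \<Longrightarrow> \<bar>h x\<bar> \<le> C"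
  shows "integrable lborel (\<lambda>x. f x * h x)"
proof -
  obtain B where B: "0 < B" "\<And>x. \<bar>f x\<bar> \<le> B" using f_bounded by blast
  show ?thesis
  proof (rule Bochner_Integration.integrable_bound)
  show "integrable lborel (\<lambda>x. indicator K x *\<^sub>R (B * \<bar>C\<bar>))"
    using K_finite by (intro integrable_scaleR_left integrable_real_indicator) auto
  show "AE x in lborel. norm (f x * h x) \<le> norm (indicator K x *\<^sub>R (B * \<bar>C\<bar>))"
  proof (rule AE_I2)
    fix x
    show "norm (f x * h x) \<le> norm (indicator K x *\<^sub>R (B * \<bar>C\<bar>))"
    proof (cases "x \<in> K")
      case True
      have "\<bar>f x\<bar> * \<bar>h x\<bar> \<le> B * \<bar>C\<bar>" using B(2)[of x] b[OF True] by (intro mult_mono) auto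
      then show ?thesis using True B(1) by (simp add: abs_mult)
    qed (simp add: f_zero)
  qed
  qed measurable
qed

definition F1 where "F1 = (\<integral>x. \<bar>f x\<bar> \<partial>lborel)"

lemma f_integrable: "integrable lborel f"
  using f_weight_integrable[of "\<lambda>_. 1" 1] by simp

lemma F1_nonneg: "0 \<le> F1"
  unfolding F1_def by (rule integral_nonneg_AE) auto

definition mN :: "nat \<Rightarrow> real \<Rightarrow> 'a \<Rightarrow> real" where
  "mN N e x = (\<integral>w. exp (\<gamma> * X N e w x) \<partial>PN N)"

definition V :: "nat \<Rightarrow> real \<Rightarrow> 'b \<Rightarrow> 'a \<Rightarrow> real" where
  "V N e w x = exp (\<gamma> * X N e w x) / mN N e x"

definition IN :: "nat \<Rightarrow> real \<Rightarrow> 'b \<Rightarrow> real" where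
  "IN N e w = (\<integral>x. f x * V N e w x \<partial>lborel)"

definition VP :: "real \<Rightarrow> 'w \<Rightarrow> 'a \<Rightarrow> real" where
  "VP e w x = exp (\<gamma> * GX e w x - \<gamma>\<^sup>2 / 2 * Cv e x e x)"

definition IP :: "real \<Rightarrow> 'w \<Rightarrow> real" where
  "IP e w = (\<integral>x. f x * VP e w x \<partial>lborel)"

lemma mN_measurable[measurable]: "mN N e \<in> borel_measurable borel"
proof -
  interpret prob_space "PN N" by (rule PN_prob)
  show ?thesis unfolding mN_def by measurable
qed

lemma V_measurable[measurable (raw)]:
  assumes [measurable]: "h \<in> M \<rightarrow>\<^sub>M PN N" "k \<in> M \<rightarrow>\<^sub>M borel"
  shows "(\<lambda>w. V N e (h w) (k w)) \<in> borel_measurable M"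
  unfolding V_def by measurable

lemma IN_measurable[measurable]: "IN N e \<in> borel_measurable (PN N)"
  unfolding IN_def by measurable

lemma mN_gt0: "x \<in> K \<Longrightarrow> 0 \<le> e \<Longrightarrow> e \<le> \<eta>0 \<Longrightarrow> 0 < mN N e x"
  unfolding mN_def by (rule mN_pos)

lemma mN_ge0: "0 \<le> mN N e x"
  unfolding mN_def by (rule integral_nonneg_AE) auto

lemma V_nonneg: "0 \<le> V N e w x"
  unfolding V_def using mN_ge0 by (simp add: divide_nonneg_nonneg)

lemma V_expectation:
  assumes "x \<in> K" "0 \<le> e" "e \<le> \<eta>0"
  shows "integrable (PN N) (\<lambda>w. V N e w x)" "(\<integral>w. V N e w x \<partial>PN N) = 1"
proof -
  have i: "integrable (PN N) (\<lambda>w. exp (\<gamma> * X N e w x))"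
    by (rule good_integrable[OF good_X]) (use assms gamma in auto)
  show "integrable (PN N) (\<lambda>w. V N e w x)" unfolding V_def using i by (intro integrable_divide) auto
  show "(\<integral>w. V N e w x \<partial>PN N) = 1" unfolding V_def using mN_gt0[OF assms, of N] by (simp add: mN_def)
qed

lemma VV_expectation:
  assumes "x \<in> K" "y \<in> K" "0 \<le> e" "e \<le> \<eta>0" "0 \<le> e'" "e' \<le> \<eta>0"
  shows "integrable (PN N) (\<lambda>w. V N e w x * V N e' w y)"
    "(\<integral>w. V N e w x * V N e' w y \<partial>PN N) = WN \<Omega> \<phi> PN XN \<gamma> N e e' x y"
proof -
  have eq: "V N e w x * V N e' w y = exp (\<gamma> * X N e w x + \<gamma> * X N e' w y) / (mN N e x * mN N e' y)" for w
    by (simp add: V_def exp_add)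
  have i: "integrable (PN N) (\<lambda>w. exp (\<gamma> * X N e w x + \<gamma> * X N e' w y))"
    by (rule good_integrable[OF good_pair[OF assms]])
  show "integrable (PN N) (\<lambda>w. V N e w x * V N e' w y)" unfolding eq using i by (intro integrable_divide) auto
  show "(\<integral>w. V N e w x * V N e' w y \<partial>PN N) = WN \<Omega> \<phi> PN XN \<gamma> N e e' x y"
    unfolding eq WN_def EN_def mN_def by simp
qed

text \<open>At positive scale this follows from the limits of the exponential moments and includes x
  = y, which (A1) leaves out and which second moments of increments require.\<close>

lemma WN_tendsto_same:
  assumes xy: "x \<in> K" "y \<in> K" and e: "0 < e" "e \<le> \<eta>0"
  shows "(\<lambda>N. WN \<Omega> \<phi> PN XN \<gamma> N e e x y) \<longlonglongrightarrow> exp (\<gamma>\<^sup>2 * Cv e x e y)"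
proof -
  have "(\<lambda>N. WN \<Omega> \<phi> PN XN \<gamma> N e e x y) \<longlonglongrightarrow>
     exp ((\<gamma>\<^sup>2 * Cv e x e x + 2 * \<gamma> * \<gamma> * Cv e x e y + \<gamma>\<^sup>2 * Cv e y e y) / 2) / (exp (\<gamma>\<^sup>2 * Cv e x e x / 2) * exp (\<gamma>\<^sup>2 * Cv e y e y / 2))"
    unfolding WN_def EN_def
    by (intro tendsto_divide tendsto_mult X_exp_moment_tendsto1 X_exp_moment_tendsto2 xy e) auto
  also have "exp ((\<gamma>\<^sup>2 * Cv e x e x + 2 * \<gamma> * \<gamma> * Cv e x e y + \<gamma>\<^sup>2 * Cv e y e y) / 2) / (exp (\<gamma>\<^sup>2 * Cv e x e x / 2) * exp (\<gamma>\<^sup>2 * Cv e y e y / 2)) = exp (\<gamma>\<^sup>2 * Cv e x e y)"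
    by (simp add: exp_add[symmetric] exp_diff[symmetric] power2_eq_square add_divide_distrib)
  finally show ?thesis .
qed

lemma pair_sf: "pair_sigma_finite (PN N) lborel"
proof -
  interpret prob_space "PN N" by (rule PN_prob)
  show ?thesis by unfold_locales
qed

text \<open>Tonelli. The almost sure integrability matters because an undefined Bochner integral is
  0: integrals over x may be added only for those w for which each of them exists.\<close>

lemma expectation_abs_integral_le:
  assumes D[measurable]: "(\<lambda>(w, x). D w x) \<in> borel_measurable (PN N \<Otimes>\<^sub>M borel)"
    and b: "\<And>x. x \<in> K \<Longrightarrow> (\<integral>\<^sup>+w. ennreal \<bar>D w x\<bar> \<partial>PN N) \<le> ennreal (b x)" "\<And>x. x \<in> K \<Longrightarrow> 0 \<le> b x"
    and bi: "integrable lborel (\<lambda>x. \<bar>f x\<bar> * b x)"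
  shows "(\<integral>\<^sup>+w. ennreal \<bar>\<integral>x. f x * D w x \<partial>lborel\<bar> \<partial>PN N) \<le> ennreal (\<integral>x. \<bar>f x\<bar> * b x \<partial>lborel)"
    and "(\<integral>\<^sup>+w. (\<integral>\<^sup>+x. ennreal \<bar>f x * D w x\<bar> \<partial>lborel) \<partial>PN N) \<le> ennreal (\<integral>x. \<bar>f x\<bar> * b x \<partial>lborel)"
    and "AE w in PN N. integrable lborel (\<lambda>x. f x * D w x)"
proof -
  interpret pair_sigma_finite "PN N" lborel by (rule pair_sf)
  have Dm[measurable (raw)]: "(\<lambda>w. D (h w) (k w)) \<in> borel_measurable M" if [measurable]: "h \<in> M \<rightarrow>\<^sub>M PN N" "k \<in> M \<rightarrow>\<^sub>M borel" for M :: "'m measure" and h k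
  proof -
    have "(\<lambda>w. (h w, k w)) \<in> M \<rightarrow>\<^sub>M PN N \<Otimes>\<^sub>M borel" by measurable
    from measurable_compose[OF this D] show ?thesis by simp
  qed
  have Dmx: "(\<lambda>w. D w x) \<in> borel_measurable (PN N)" for x by (rule Dm) auto
  have Dmw: "(\<lambda>x. D w x) \<in> borel_measurable borel" if "w \<in> space (PN N)" for w by (rule Dm) (use that in auto)
  have jm: "(\<lambda>(w, x). ennreal \<bar>f x * D w x\<bar>) \<in> borel_measurable (PN N \<Otimes>\<^sub>M lborel)"
  proof -
    have "(\<lambda>w. D (fst w) (snd w)) \<in> borel_measurable (PN N \<Otimes>\<^sub>M lborel)" by (rule Dm) measurable
    then show ?thesis unfolding case_prod_beta' by measurable
  qed
  show two: "(\<integral>\<^sup>+w. (\<integral>\<^sup>+x. ennreal \<bar>f x * D w x\<bar> \<partial>lborel) \<partial>PN N) \<le> ennreal (\<integral>x. \<bar>f x\<bar> * b x \<partial>lborel)"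
  proof -
    have "(\<integral>\<^sup>+w. (\<integral>\<^sup>+x. ennreal \<bar>f x * D w x\<bar> \<partial>lborel) \<partial>PN N) = (\<integral>\<^sup>+x. (\<integral>\<^sup>+w. ennreal \<bar>f x * D w x\<bar> \<partial>PN N) \<partial>lborel)"
      using Fubini'[OF jm] by simp
    also have "\<dots> \<le> (\<integral>\<^sup>+x. ennreal (\<bar>f x\<bar> * b x) \<partial>lborel)"
    proof (rule nn_integral_mono)
      fix x
      show "(\<integral>\<^sup>+w. ennreal \<bar>f x * D w x\<bar> \<partial>PN N) \<le> ennreal (\<bar>f x\<bar> * b x)"
      proof (cases "x \<in> K")
        case True
        have "(\<integral>\<^sup>+w. ennreal \<bar>f x * D w x\<bar> \<partial>PN N) = (\<integral>\<^sup>+w. ennreal \<bar>f x\<bar> * ennreal \<bar>D w x\<bar> \<partial>PN N)"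
          by (intro nn_integral_cong) (simp add: abs_mult ennreal_mult)
        also have "\<dots> = ennreal \<bar>f x\<bar> * (\<integral>\<^sup>+w. ennreal \<bar>D w x\<bar> \<partial>PN N)"
          by (rule nn_integral_cmult) (intro measurable_compose[OF _ measurable_ennreal] borel_measurable_abs Dmx)
        also have "\<dots> \<le> ennreal \<bar>f x\<bar> * ennreal (b x)" by (intro mult_left_mono b True) simp
        finally show ?thesis using b(2)[OF True] by (simp add: ennreal_mult)
      qed (simp add: f_zero)
    qed
    also have "\<dots> = ennreal (\<integral>x. \<bar>f x\<bar> * b x \<partial>lborel)"
    proof (rule nn_integral_eq_integral[OF bi])
      show "AE x in lborel. 0 \<le> \<bar>f x\<bar> * b x"
      proof (rule AE_I2)
        fix x show "0 \<le> \<bar>f x\<bar> * b x" using b(2)[of x] f_zero[of x] by (cases "x \<in> K") auto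
      qed
    qed
    finally show ?thesis .
  qed
  show "(\<integral>\<^sup>+w. ennreal \<bar>\<integral>x. f x * D w x \<partial>lborel\<bar> \<partial>PN N) \<le> ennreal (\<integral>x. \<bar>f x\<bar> * b x \<partial>lborel)"
  proof (rule order_trans[OF nn_integral_mono two])
    fix w
    show "ennreal \<bar>\<integral>x. f x * D w x \<partial>lborel\<bar> \<le> (\<integral>\<^sup>+x. ennreal \<bar>f x * D w x\<bar> \<partial>lborel)"
      using ennreal_norm_integral_le[of lborel "\<lambda>x. f x * D w x"] by simp
  qed
  have "(\<lambda>w. \<integral>\<^sup>+x. ennreal \<bar>f x * D w x\<bar> \<partial>lborel) \<in> borel_measurable (PN N)"
    using lborel.borel_measurable_nn_integral_fst[OF jm] by simp
  moreover have "(\<integral>\<^sup>+w. (\<integral>\<^sup>+x. ennreal \<bar>f x * D w x\<bar> \<partial>lborel) \<partial>PN N) \<noteq> \<infinity>"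
    using two by (metis ennreal_less_top infinity_ennreal_def leD top.not_eq_extremum)
  ultimately have "AE w in PN N. (\<integral>\<^sup>+x. ennreal \<bar>f x * D w x\<bar> \<partial>lborel) \<noteq> \<infinity>"
    by (rule nn_integral_PInf_AE)
  then show "AE w in PN N. integrable lborel (\<lambda>x. f x * D w x)"
    using AE_space
  proof eventually_elim
    case (elim w)
    have "(\<lambda>x. f x * D w x) \<in> borel_measurable lborel" using Dmw[OF elim(2)] by simp
    then show ?case using elim(1) by (intro integrableI_bounded) (auto simp: top.not_eq_extremum)
  qed
qed

lemma V_AE_integrable:
  assumes "0 \<le> e" "e \<le> \<eta>0"
  shows "AE w in PN N. integrable lborel (\<lambda>x. f x * V N e w x)"
proof (rule expectation_abs_integral_le(3)[where b="\<lambda>_. 1"])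
  show "(\<integral>\<^sup>+w. ennreal \<bar>V N e w x\<bar> \<partial>PN N) \<le> ennreal 1" if "x \<in> K" for x
    using V_expectation[OF that assms, of N] V_nonneg by (subst nn_integral_eq_integral) auto
  show "integrable lborel (\<lambda>x. \<bar>f x\<bar> * 1)" using f_integrable by simp
qed auto

lemma GX_tendsto_points: "0 < e \<Longrightarrow> xn \<longlonglongrightarrow> x \<Longrightarrow> (\<lambda>n. GX e w (xn n)) \<longlonglongrightarrow> GX e w x"
  using P_cont[of e w] isCont_tendsto_compose[of x "\<lambda>x. GX e w x" xn sequentially]
  by (simp add: continuous_on_eq_continuous_at)

lemma VP_continuous:
  assumes e: "0 < e" "e \<le> \<eta>0" shows "continuous_on K (VP e w)"
  unfolding continuous_on_sequentially
proof (intro allI ballI impI)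
  fix xn x assume x: "x \<in> K" and xn: "(\<forall>n. xn n \<in> K) \<and> xn \<longlonglongrightarrow> x"
  then have "(\<lambda>n. VP e w (xn n)) \<longlonglongrightarrow> VP e w x"
    unfolding VP_def by (intro tendsto_intros GX_tendsto_points cov_tendsto_points e) auto
  then show "(VP e w \<circ> xn) \<longlonglongrightarrow> VP e w x" by (simp add: o_def)
qed

text \<open>Both sides are replaced by Riemann sums over a fine partition. Under P they converge by
  continuity in x. Under P_N the error is bounded by the second moments \<open>QN\<close> of
  increments, whose limit \<open>Q\<close> is small for close points because the covariance is
  uniformly continuous. For a fixed partition the sum depends on finitely many field values, and
  joint convergence applies.\<close>

lemma mollified_integral_law:
  assumes e: "0 < e" "e \<le> \<eta>0"
  shows "IP e \<in> borel_measurable Pm"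
    and "(\<lambda>N. \<integral>w. iexp (s * IN N e w) \<partial>PN N) \<longlonglongrightarrow> (\<integral>w. iexp (s * IP e w) \<partial>Pm)"
proof -
  interpret P: prob_space Pm by (rule P_prob)
  have e0: "0 \<le> e" using e by simp
  define PQ where "PQ m q \<longleftrightarrow> (\<forall>i<fst q. fst (snd q) i \<in> K) \<and> (\<forall>x\<in>K. snd (snd q) x < fst q) \<and>
      (\<forall>x\<in>K. dist x (fst (snd q) (snd (snd q) x)) < 1 / real (Suc m)) \<and> (\<forall>i. {x \<in> K. snd (snd q) x = i} \<in> sets borel)"
    for m and q :: "nat \<times> (nat \<Rightarrow> 'a) \<times> ('a \<Rightarrow> nat)"
  have "\<exists>q. PQ m q" for m
  proof -
    have d: "0 < 1 / real (Suc m)" by simp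
    show ?thesis
    proof (rule compact_partition[OF K_compact d])
      fix n and xp :: "nat \<Rightarrow> 'a" and p :: "'a \<Rightarrow> nat"
      assume "\<And>i. i < n \<Longrightarrow> xp i \<in> K" "\<And>x. x \<in> K \<Longrightarrow> p x < n" "\<And>x. x \<in> K \<Longrightarrow> dist x (xp (p x)) < 1 / real (Suc m)"
        "\<And>i. {x \<in> K. p x = i} \<in> sets borel"
      then have "PQ m (n, xp, p)" unfolding PQ_def by simp
      then show ?thesis ..
    qed
  qed
  then have "\<forall>m. \<exists>q. PQ m q" ..
  then obtain q where q: "PQ m (q m)" for m using choice[of PQ] by blast
  define nn where "nn m = fst (q m)" for m
  define xp where "xp m = fst (snd (q m))" for m
  define p where "p m = snd (snd (q m))" for m
  have part: "\<And>m i. i < nn m \<Longrightarrow> xp m i \<in> K" "\<And>m x. x \<in> K \<Longrightarrow> p m x < nn m"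
      "\<And>m x. x \<in> K \<Longrightarrow> dist x (xp m (p m x)) < 1 / real (Suc m)" "\<And>m i. {x \<in> K. p m x = i} \<in> sets borel"
    using q unfolding PQ_def nn_def xp_def p_def by blast+
  define A where "A m i = {x \<in> K. p m x = i}" for m i
  have Am[measurable]: "A m i \<in> sets borel" for m i using part(4) by (simp add: A_def)
  define c where "c m i = (\<integral>x. f x * indicator (A m i) x \<partial>lborel)" for m i
  have ci: "integrable lborel (\<lambda>x. f x * indicator (A m i) x)" for m i
    by (rule f_weight_integrable[of _ 1]) auto
  have step: "(\<Sum>i<nn m. indicator (A m i) x * h i) = h (p m x)" if x: "x \<in> K" for m x and h :: "nat \<Rightarrow> real"
  proof -
    have "(\<Sum>i<nn m. indicator (A m i) x * h i) = (\<Sum>i<nn m. if i = p m x then h i else 0)"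
      using x by (intro sum.cong) (auto simp: A_def)
    also have "\<dots> = h (p m x)" using part(2)[OF x] by simp
    finally show ?thesis .
  qed
  have cs: "(\<Sum>i<nn m. c m i * h i) = (\<integral>x. f x * (\<Sum>i<nn m. indicator (A m i) x * h i) \<partial>lborel)"
    "integrable lborel (\<lambda>x. f x * (\<Sum>i<nn m. indicator (A m i) x * h i))" for m and h :: "nat \<Rightarrow> real"
  proof -
    have eq: "f x * (\<Sum>i<nn m. indicator (A m i) x * h i) = (\<Sum>i<nn m. f x * indicator (A m i) x * h i)" for x
      by (simp only: sum_distrib_left mult.assoc)
    have i: "integrable lborel (\<lambda>x. f x * indicator (A m i) x * h i)" for i using ci by simp
    show "integrable lborel (\<lambda>x. f x * (\<Sum>i<nn m. indicator (A m i) x * h i))"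
      unfolding eq by (intro Bochner_Integration.integrable_sum i)
    show "(\<Sum>i<nn m. c m i * h i) = (\<integral>x. f x * (\<Sum>i<nn m. indicator (A m i) x * h i) \<partial>lborel)"
      unfolding eq c_def by (subst Bochner_Integration.integral_sum[OF i]) simp
  qed
  define SP where "SP m w = (\<Sum>i<nn m. c m i * VP e w (xp m i))" for m w
  define SN where "SN m N w = (\<Sum>i<nn m. c m i * V N e w (xp m i))" for m N w
  have VPm: "(\<lambda>w. VP e w x) \<in> borel_measurable Pm" for x
    unfolding VP_def using GX_meas[OF e(1), of x] by measurable
  have SPm: "SP m \<in> borel_measurable Pm" for m
    unfolding SP_def by (intro borel_measurable_sum borel_measurable_times VPm) auto
  have SNm: "SN m N \<in> borel_measurable (PN N)" for m N unfolding SN_def by measurable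
  have SP_lim: "(\<lambda>m. SP m w) \<longlonglongrightarrow> IP e w" for w
  proof (rule LIMSEQ_I)
    fix r :: real assume r: "0 < r"
    define r' where "r' = r / (F1 + 1)"
    have r': "0 < r'" using r F1_nonneg by (simp add: r'_def add_nonneg_pos)
    have uc: "uniformly_continuous_on K (VP e w)" by (rule compact_uniformly_continuous[OF VP_continuous[OF e] K_compact])
    obtain d where d: "0 < d" "\<And>x y. x \<in> K \<Longrightarrow> y \<in> K \<Longrightarrow> dist y x < d \<Longrightarrow> dist (VP e w y) (VP e w x) < r'"
      by (rule uniformly_continuous_onE[OF uc r']) (rule that)
    obtain M where M: "1 / real (Suc M) < d" using nat_approx_posE[OF d(1)] .
    obtain BV where BV: "\<And>x. x \<in> K \<Longrightarrow> \<bar>VP e w x\<bar> \<le> BV"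
      using compact_imp_bounded[OF compact_continuous_image[OF VP_continuous[OF e] K_compact]] unfolding bounded_iff by force
    have VPi: "integrable lborel (\<lambda>x. f x * VP e w x)"
    proof -
      have "(\<lambda>x. indicator K x *\<^sub>R VP e w x) \<in> borel_measurable borel"
        by (rule borel_measurable_continuous_on_indicator[OF K_meas VP_continuous[OF e]])
      then have "integrable lborel (\<lambda>x. f x * (indicator K x *\<^sub>R VP e w x))"
        by (rule f_weight_integrable[of _ BV]) (use BV in auto)
      moreover have "f x * (indicator K x *\<^sub>R VP e w x) = f x * VP e w x" for x using f_zero[of x] by (cases "x \<in> K") auto
      ultimately show ?thesis by (simp only:)
    qed
    show "\<exists>no. \<forall>m\<ge>no. norm (SP m w - IP e w) < r"
    proof (intro exI allI impI)
      fix m assume m: "M \<le> m"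
      then have "1 / real (Suc m) \<le> 1 / real (Suc M)" by (simp add: frac_le)
      then have dm: "1 / real (Suc m) < d" using M by simp
      have "SP m w - IP e w = (\<integral>x. f x * (\<Sum>i<nn m. indicator (A m i) x * VP e w (xp m i)) - f x * VP e w x \<partial>lborel)"
        unfolding SP_def IP_def cs(1) by (rule Bochner_Integration.integral_diff[symmetric]) (rule cs(2), rule VPi)
      also have "norm \<dots> \<le> (\<integral>x. \<bar>f x\<bar> * r' \<partial>lborel)"
      proof (rule integral_norm_bound[THEN order_trans], rule integral_mono)
        show "integrable lborel (\<lambda>x. norm (f x * (\<Sum>i<nn m. indicator (A m i) x * VP e w (xp m i)) - f x * VP e w x))"
          by (intro integrable_norm Bochner_Integration.integrable_diff cs(2) VPi)
        show "integrable lborel (\<lambda>x. \<bar>f x\<bar> * r')" using f_integrable by simp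
        fix x
        show "norm (f x * (\<Sum>i<nn m. indicator (A m i) x * VP e w (xp m i)) - f x * VP e w x) \<le> \<bar>f x\<bar> * r'"
        proof (cases "x \<in> K")
          case True
          have "dist (VP e w (xp m (p m x))) (VP e w x) < r'"
            using d(2)[OF True part(1)[OF part(2)[OF True]], of m] part(3)[OF True, of m] dm by (simp add: dist_commute)
          then have "\<bar>f x\<bar> * \<bar>VP e w (xp m (p m x)) - VP e w x\<bar> \<le> \<bar>f x\<bar> * r'"
            by (intro mult_left_mono) (auto simp: dist_real_def)
          then show ?thesis unfolding step[OF True] right_diff_distrib[symmetric] by (simp add: abs_mult)
        qed (simp add: f_zero)
      qed
      also have "\<dots> = F1 * r'" by (simp add: F1_def)
      also have "\<dots> < (F1 + 1) * r'" using r' by simp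
      also have "\<dots> = r" using F1_nonneg by (simp add: r'_def)
      finally show "norm (SP m w - IP e w) < r" .
    qed
  qed
  \<comment> \<open>The sample paths are continuous in x, so the integral is a pointwise limit of
    measurable Riemann sums.\<close>
  show IPm: "IP e \<in> borel_measurable Pm" by (rule borel_measurable_LIMSEQ_real[OF SP_lim SPm])
  have P_lim: "(\<lambda>m. \<integral>w. iexp (s * SP m w) \<partial>Pm) \<longlonglongrightarrow> (\<integral>w. iexp (s * IP e w) \<partial>Pm)"
  proof (rule integral_dominated_convergence[where w="\<lambda>_. 1"])
    show "AE w in Pm. (\<lambda>m. iexp (s * SP m w)) \<longlonglongrightarrow> iexp (s * IP e w)"
      by (intro AE_I2 tendsto_intros SP_lim)
    show "(\<lambda>w. iexp (s * IP e w)) \<in> borel_measurable Pm" "(\<lambda>w. iexp (s * SP m w)) \<in> borel_measurable Pm" for m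
      using IPm SPm[of m] by measurable
  qed auto
  define w where "w x y = exp (\<gamma>\<^sup>2 * Cv e x e y)" for x y
  define Q where "Q x y = w x x - 2 * w x y + w y y" for x y
  define QN where "QN N x y = WN \<Omega> \<phi> PN XN \<gamma> N e e x x - 2 * WN \<Omega> \<phi> PN XN \<gamma> N e e x y + WN \<Omega> \<phi> PN XN \<gamma> N e e y y" for N x y
  have QN_lim: "(\<lambda>N. QN N x y) \<longlonglongrightarrow> Q x y" if "x \<in> K" "y \<in> K" for x y
    unfolding QN_def Q_def w_def by (intro tendsto_intros WN_tendsto_same that e)
  have QN_eq: "QN N x y = (\<integral>w. (V N e w x - V N e w y)\<^sup>2 \<partial>PN N)" "integrable (PN N) (\<lambda>w. (V N e w x - V N e w y)\<^sup>2)" if xy: "x \<in> K" "y \<in> K" for N x y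
  proof -
    note ee = e0 e(2) e0 e(2)
    have eq: "(V N e w x - V N e w y)\<^sup>2 = V N e w x * V N e w x - 2 * (V N e w x * V N e w y) + V N e w y * V N e w y" for w
      by (simp add: power2_eq_square algebra_simps)
    note v = VV_expectation[OF xy(1) xy(1) ee, of N] VV_expectation[OF xy(1) xy(2) ee, of N] VV_expectation[OF xy(2) xy(2) ee, of N]
    show "integrable (PN N) (\<lambda>w. (V N e w x - V N e w y)\<^sup>2)" unfolding eq using v by auto
    show "QN N x y = (\<integral>w. (V N e w x - V N e w y)\<^sup>2 \<partial>PN N)" unfolding eq QN_def using v by simp
  qed
  have QN0: "0 \<le> QN N x y" if "x \<in> K" "y \<in> K" for N x y
    unfolding QN_eq(1)[OF that] by (rule integral_nonneg_AE) auto
  obtain B0 where "\<forall>N. \<forall>x\<in>K. \<forall>y\<in>K. WN \<Omega> \<phi> PN XN \<gamma> N e e x y \<le> B0"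
    using a2[unfolded A2_def, THEN spec[of _ e], THEN mp, OF e0, THEN spec[of _ e], THEN mp, OF e(1), THEN spec[of _ K], THEN mp] K_compact K_Om by blast
  then have B0: "WN \<Omega> \<phi> PN XN \<gamma> N e e x y \<le> B0" if "x \<in> K" "y \<in> K" for N x y using that by blast
  have W0: "0 \<le> WN \<Omega> \<phi> PN XN \<gamma> N e e x y" if "x \<in> K" "y \<in> K" for N x y
    unfolding VV_expectation(2)[OF that e0 e(2) e0 e(2), symmetric] by (rule integral_nonneg_AE) (simp add: V_nonneg)
  have QNb: "QN N x y \<le> 2 * B0" if "x \<in> K" "y \<in> K" for N x y
    unfolding QN_def using B0[of x x N] B0[of y y N] W0[of x y N] that by simp
  have QNm: "(\<lambda>x. indicator K x * QN N x (xp m i)) \<in> borel_measurable borel" for N m i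
    unfolding QN_def WN_def EN_def
  proof -
    interpret prob_space "PN N" by (rule PN_prob)
    show "(\<lambda>x. indicator K x * ((\<integral>w. exp (\<gamma> * X N e w x + \<gamma> * X N e w x) \<partial>PN N) / ((\<integral>w. exp (\<gamma> * X N e w x) \<partial>PN N) * (\<integral>w. exp (\<gamma> * X N e w x) \<partial>PN N))
      - 2 * ((\<integral>w. exp (\<gamma> * X N e w x + \<gamma> * X N e w (xp m i)) \<partial>PN N) / ((\<integral>w. exp (\<gamma> * X N e w x) \<partial>PN N) * (\<integral>w. exp (\<gamma> * X N e w (xp m i)) \<partial>PN N)))
      + (\<integral>w. exp (\<gamma> * X N e w (xp m i) + \<gamma> * X N e w (xp m i)) \<partial>PN N) / ((\<integral>w. exp (\<gamma> * X N e w (xp m i)) \<partial>PN N) * (\<integral>w. exp (\<gamma> * X N e w (xp m i)) \<partial>PN N)))) \<in> borel_measurable borel"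
      by measurable
  qed
  show "(\<lambda>N. \<integral>w. iexp (s * IN N e w) \<partial>PN N) \<longlonglongrightarrow> (\<integral>w. iexp (s * IP e w) \<partial>Pm)"
  proof (rule LIMSEQ_I)
    fix r :: real assume r: "0 < r"
    \<comment> \<open>Makes |s| (F1 + 1) \<kappa> at most r / 4, one quarter of the error; the
      changed normalisation, the convergence in law and the Riemann error under P take the other
      three.\<close>
    define \<kappa> where "\<kappa> = r / (4 * (\<bar>s\<bar> + 1) * (F1 + 1))"
    have k: "0 < \<kappa>" using r F1_nonneg by (simp add: \<kappa>_def add_nonneg_pos)
    have wc: "continuous_on (K \<times> K) (\<lambda>(x, y). w x y)"
      unfolding continuous_on_sequentially
    proof (intro allI ballI impI)
      fix pn and q :: "'a \<times> 'a" assume q: "q \<in> K \<times> K" and pn: "(\<forall>n. pn n \<in> K \<times> K) \<and> pn \<longlonglongrightarrow> q"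
      have "(\<lambda>n. w (fst (pn n)) (snd (pn n))) \<longlonglongrightarrow> w (fst q) (snd q)"
        unfolding w_def by (intro tendsto_intros cov_tendsto_points e tendsto_fst tendsto_snd) (use pn q in \<open>auto simp: mem_Times_iff\<close>)
      then show "((\<lambda>(x, y). w x y) \<circ> pn) \<longlonglongrightarrow> (case q of (x, y) \<Rightarrow> w x y)" by (simp add: o_def case_prod_beta)
    qed
    have ucw: "uniformly_continuous_on (K \<times> K) (\<lambda>(x, y). w x y)"
      by (rule compact_uniformly_continuous[OF wc compact_Times[OF K_compact K_compact]])
    have k2: "0 < \<kappa>\<^sup>2 / 2" using k by simp
    obtain d where d: "0 < d" "\<And>q q'. q \<in> K \<times> K \<Longrightarrow> q' \<in> K \<times> K \<Longrightarrow> dist q' q < d \<Longrightarrow> dist ((\<lambda>(x, y). w x y) q') ((\<lambda>(x, y). w x y) q) < \<kappa>\<^sup>2 / 2"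
      by (rule uniformly_continuous_onE[OF ucw k2]) (rule that)
    have Qk: "Q x y \<le> \<kappa>\<^sup>2" if xy: "x \<in> K" "y \<in> K" "dist x y < d" for x y
    proof -
      have "dist (w x x) (w x y) < \<kappa>\<^sup>2 / 2" using d(2)[of "(x, y)" "(x, x)"] xy by (simp add: dist_Pair_Pair dist_commute)
      moreover have "dist (w y y) (w x y) < \<kappa>\<^sup>2 / 2" using d(2)[of "(x, y)" "(y, y)"] xy by (simp add: dist_Pair_Pair dist_commute)
      ultimately show ?thesis unfolding Q_def dist_real_def by linarith
    qed
    obtain M where M: "1 / real (Suc M) < d" using nat_approx_posE[OF d(1)] .
    have "\<forall>\<^sub>F m in sequentially. norm ((\<integral>w. iexp (s * SP m w) \<partial>Pm) - (\<integral>w. iexp (s * IP e w) \<partial>Pm)) < r / 4"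
      using tendstoD[OF P_lim, of "r / 4"] r by (simp add: dist_norm)
    with eventually_ge_at_top[of M] have "\<forall>\<^sub>F m in sequentially. M \<le> m \<and> norm ((\<integral>w. iexp (s * SP m w) \<partial>Pm) - (\<integral>w. iexp (s * IP e w) \<partial>Pm)) < r / 4"
      by (rule eventually_conj)
    then obtain m where m: "M \<le> m" "norm ((\<integral>w. iexp (s * SP m w) \<partial>Pm) - (\<integral>w. iexp (s * IP e w) \<partial>Pm)) < r / 4"
      using eventually_happens'[OF sequentially_bot] by blast
    have "1 / real (Suc m) \<le> 1 / real (Suc M)" using m by (simp add: frac_le)
    then have dm: "dist x (xp m (p m x)) < d" if "x \<in> K" for x using M part(3)[OF that, of m] by simp
    \<comment> \<open>the bounds come from \<open>\<bar>a\<bar> \<le> (\<kappa> + a\<^sup>2 / \<kappa>) / 2\<close>, with \<open>a\<close> the error of a Riemann sum\<close>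
    define b where "b N x = (\<Sum>i<nn m. indicator (A m i) x * ((\<kappa> + (indicator K x * QN N x (xp m i)) / \<kappa>) / 2))" for N x
    define b' where "b' x = (\<Sum>i<nn m. indicator (A m i) x * ((\<kappa> + Q x (xp m i) / \<kappa>) / 2))" for x
    have bK: "b N x = (\<kappa> + QN N x (xp m (p m x)) / \<kappa>) / 2" if "x \<in> K" for N x unfolding b_def step[OF that] using that by simp
    have b'K: "b' x = (\<kappa> + Q x (xp m (p m x)) / \<kappa>) / 2" if "x \<in> K" for x unfolding b'_def step[OF that] ..
    have xpK: "xp m (p m x) \<in> K" if "x \<in> K" for x using part(1)[OF part(2)[OF that]] .
    have bm[measurable]: "b N \<in> borel_measurable borel" for N
      unfolding b_def by (intro borel_measurable_sum borel_measurable_times borel_measurable_divide borel_measurable_add borel_measurable_const QNm) measurable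
    have bb: "0 \<le> b N x" "b N x \<le> (\<kappa> + 2 * B0 / \<kappa>) / 2" if x: "x \<in> K" for N x
      unfolding bK[OF x] using QN0[OF x xpK[OF x], of N] QNb[OF x xpK[OF x], of N] k by (auto simp: divide_right_mono)
    have bi: "integrable lborel (\<lambda>x. \<bar>f x\<bar> * b N x)" for N
    proof -
      have "integrable lborel (\<lambda>x. f x * b N x)" by (rule f_weight_integrable[of _ "(\<kappa> + 2 * B0 / \<kappa>) / 2"]) (use bb in auto)
      then have "integrable lborel (\<lambda>x. \<bar>f x * b N x\<bar>)" by (rule integrable_abs)
      moreover have "\<bar>f x * b N x\<bar> = \<bar>f x\<bar> * b N x" for x using bb(1)[of x N] f_zero[of x] by (cases "x \<in> K") (auto simp: abs_mult)
      ultimately show ?thesis by (simp only:)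
    qed
    have blim: "(\<lambda>N. \<integral>x. \<bar>f x\<bar> * b N x \<partial>lborel) \<longlonglongrightarrow> (\<integral>x. \<bar>f x\<bar> * b' x \<partial>lborel)"
    proof (rule integral_dominated_convergence[where w="\<lambda>x. \<bar>f x\<bar> * ((\<kappa> + 2 * B0 / \<kappa>) / 2)"])
      have pt: "(\<lambda>N. \<bar>f x\<bar> * b N x) \<longlonglongrightarrow> \<bar>f x\<bar> * b' x" for x
      proof (cases "x \<in> K")
        case True
        show ?thesis unfolding bK[OF True] b'K[OF True] by (intro tendsto_intros QN_lim True xpK) (use k in auto)
      qed (simp add: f_zero)
      then show "AE x in lborel. (\<lambda>N. \<bar>f x\<bar> * b N x) \<longlonglongrightarrow> \<bar>f x\<bar> * b' x" by simp
      show "(\<lambda>x. \<bar>f x\<bar> * b' x) \<in> borel_measurable lborel" by (rule borel_measurable_LIMSEQ_real[OF pt]) measurable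
      show "integrable lborel (\<lambda>x. \<bar>f x\<bar> * ((\<kappa> + 2 * B0 / \<kappa>) / 2))" using f_integrable by (intro integrable_mult_left integrable_abs)
      show "AE x in lborel. norm (\<bar>f x\<bar> * b N x) \<le> \<bar>f x\<bar> * ((\<kappa> + 2 * B0 / \<kappa>) / 2)" for N
      proof (rule AE_I2)
        fix x show "norm (\<bar>f x\<bar> * b N x) \<le> \<bar>f x\<bar> * ((\<kappa> + 2 * B0 / \<kappa>) / 2)"
        proof (cases "x \<in> K")
          case True
          have "norm (\<bar>f x\<bar> * b N x) = \<bar>f x\<bar> * b N x" using bb(1)[OF True, of N] by (simp add: abs_mult)
          also have "\<dots> \<le> \<bar>f x\<bar> * ((\<kappa> + 2 * B0 / \<kappa>) / 2)" by (rule mult_left_mono[OF bb(2)[OF True]]) simp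
          finally show ?thesis .
        qed (simp add: f_zero)
      qed
    qed measurable
    have "(\<integral>x. \<bar>f x\<bar> * b' x \<partial>lborel) \<le> F1 * \<kappa>"
    proof -
      have le: "\<bar>f x\<bar> * b' x \<le> \<bar>f x\<bar> * \<kappa>" for x
      proof (cases "x \<in> K")
        case True
        have "Q x (xp m (p m x)) / \<kappa> \<le> \<kappa>" using Qk[OF True xpK[OF True] dm[OF True]] k by (simp add: divide_le_eq power2_eq_square)
        then show ?thesis unfolding b'K[OF True] by (intro mult_left_mono) auto
      qed (simp add: f_zero)
      have "(\<integral>x. \<bar>f x\<bar> * b' x \<partial>lborel) \<le> (\<integral>x. \<bar>f x\<bar> * \<kappa> \<partial>lborel)"
        by (rule integral_mono') (use f_integrable le k in auto)
      then show ?thesis by (simp add: F1_def)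
    qed
    also have "\<dots> < (F1 + 1) * \<kappa>" using k by simp
    finally have ev1: "\<forall>\<^sub>F N in sequentially. (\<integral>x. \<bar>f x\<bar> * b N x \<partial>lborel) < (F1 + 1) * \<kappa>"
      using blim by (intro order_tendstoD) auto
    have term1: "cmod ((\<integral>w. iexp (s * IN N e w) \<partial>PN N) - (\<integral>w. iexp (s * SN m N w) \<partial>PN N)) \<le> \<bar>s\<bar> * (\<integral>x. \<bar>f x\<bar> * b N x \<partial>lborel)" for N
    proof (rule prob_space.iexp_expectation_diff_le[OF PN_prob IN_measurable SNm])
      define D where "D w x = V N e w x - (\<Sum>i<nn m. indicator (A m i) x * V N e w (xp m i))" for w x
      have Dm: "(\<lambda>(w, x). D w x) \<in> borel_measurable (PN N \<Otimes>\<^sub>M borel)" unfolding D_def by measurable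
      have Db: "(\<integral>\<^sup>+w. ennreal \<bar>D w x\<bar> \<partial>PN N) \<le> ennreal (b N x)" if x: "x \<in> K" for x
      proof -
        interpret prob_space "PN N" by (rule PN_prob)
        let ?y = "xp m (p m x)"
        have "(\<integral>\<^sup>+w. ennreal \<bar>D w x\<bar> \<partial>PN N) \<le> (\<integral>\<^sup>+w. ennreal ((\<kappa> + (V N e w x - V N e w ?y)\<^sup>2 / \<kappa>) / 2) \<partial>PN N)"
        proof (intro nn_integral_mono ennreal_leI)
          fix w
          show "\<bar>D w x\<bar> \<le> (\<kappa> + (V N e w x - V N e w ?y)\<^sup>2 / \<kappa>) / 2"
            unfolding D_def step[OF x] by (rule abs_le_weighted_square[OF k])
        qed
        also have "\<dots> = ennreal (\<integral>w. (\<kappa> + (V N e w x - V N e w ?y)\<^sup>2 / \<kappa>) / 2 \<partial>PN N)"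
          using QN_eq(2)[OF x xpK[OF x], of N] k by (intro nn_integral_eq_integral) auto
        also have "(\<integral>w. (\<kappa> + (V N e w x - V N e w ?y)\<^sup>2 / \<kappa>) / 2 \<partial>PN N) = b N x"
          unfolding bK[OF x] QN_eq(1)[OF x xpK[OF x]] using QN_eq(2)[OF x xpK[OF x], of N] by (simp add: prob_space)
        finally show ?thesis .
      qed
      have "(\<integral>\<^sup>+w. ennreal \<bar>IN N e w - SN m N w\<bar> \<partial>PN N) = (\<integral>\<^sup>+w. ennreal \<bar>\<integral>x. f x * D w x \<partial>lborel\<bar> \<partial>PN N)"
      proof (rule nn_integral_cong_AE, use V_AE_integrable[OF e0 e(2), of N] in eventually_elim)
        case (elim w)
        have "IN N e w - SN m N w = (\<integral>x. f x * V N e w x - f x * (\<Sum>i<nn m. indicator (A m i) x * V N e w (xp m i)) \<partial>lborel)"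
          unfolding IN_def SN_def cs(1) by (rule Bochner_Integration.integral_diff[symmetric]) (rule elim, rule cs(2))
        then show ?case unfolding D_def by (simp add: right_diff_distrib)
      qed
      also have "\<dots> \<le> ennreal (\<integral>x. \<bar>f x\<bar> * b N x \<partial>lborel)"
        by (rule expectation_abs_integral_le(1)[OF Dm Db bb(1) bi])
      finally show "(\<integral>\<^sup>+w. ennreal \<bar>IN N e w - SN m N w\<bar> \<partial>PN N) \<le> ennreal (\<integral>x. \<bar>f x\<bar> * b N x \<partial>lborel)" .
      show "0 \<le> (\<integral>x. \<bar>f x\<bar> * b N x \<partial>lborel)"
      proof (rule integral_nonneg_AE, rule AE_I2)
        fix x show "0 \<le> \<bar>f x\<bar> * b N x" using bb(1)[of x N] f_zero[of x] by (cases "x \<in> K") auto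
      qed
    qed
    define mi where "mi i = exp (\<gamma>\<^sup>2 * Cv e (xp m i) e (xp m i) / 2)" for i
    have mi: "(\<lambda>N. mN N e (xp m i)) \<longlonglongrightarrow> mi i" if "i < nn m" for i
      unfolding mN_def mi_def by (rule X_exp_moment_tendsto1[OF part(1)[OF that] e])
    have mi0: "0 < mi i" for i by (simp add: mi_def)
    \<comment> \<open>The normalising constants depend on N. Replacing them by their limits leaves
      one fixed continuous function of the field values.\<close>
    define SN' where "SN' N w = (\<Sum>i<nn m. c m i * (exp (\<gamma> * X N e w (xp m i)) / mi i))" for N w
    define er where "er N = (\<Sum>i<nn m. \<bar>c m i\<bar> * (mN N e (xp m i) * \<bar>1 / mN N e (xp m i) - 1 / mi i\<bar>))" for N
    have "er \<longlonglongrightarrow> (\<Sum>i<nn m. \<bar>c m i\<bar> * (mi i * \<bar>1 / mi i - 1 / mi i\<bar>))"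
      unfolding er_def by (intro tendsto_intros mi) (auto simp: mi_def)
    then have er0: "er \<longlonglongrightarrow> 0" by simp
    have term2: "cmod ((\<integral>w. iexp (s * SN m N w) \<partial>PN N) - (\<integral>w. iexp (s * SN' N w) \<partial>PN N)) \<le> \<bar>s\<bar> * er N" for N
    proof (rule prob_space.iexp_expectation_diff_le[OF PN_prob SNm])
      show "SN' N \<in> borel_measurable (PN N)" unfolding SN'_def by measurable
      show "0 \<le> er N" unfolding er_def by (intro sum_nonneg mult_nonneg_nonneg mN_ge0) auto
      let ?u = "\<lambda>w. \<Sum>i<nn m. \<bar>c m i\<bar> * (exp (\<gamma> * X N e w (xp m i)) * \<bar>1 / mN N e (xp m i) - 1 / mi i\<bar>)"
      have ui: "integrable (PN N) (\<lambda>w. \<bar>c m i\<bar> * (exp (\<gamma> * X N e w (xp m i)) * \<bar>1 / mN N e (xp m i) - 1 / mi i\<bar>))" if "i < nn m" for i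
        by (intro integrable_mult_right integrable_mult_left X_exp_integrable1[OF part(1)[OF that] e])
      have uI: "integrable (PN N) ?u" by (rule Bochner_Integration.integrable_sum, rule ui) simp
      have "(\<integral>\<^sup>+w. ennreal \<bar>SN m N w - SN' N w\<bar> \<partial>PN N) \<le> (\<integral>\<^sup>+w. ennreal (?u w) \<partial>PN N)"
      proof (intro nn_integral_mono ennreal_leI)
        fix w
        have eq: "SN m N w - SN' N w = (\<Sum>i<nn m. c m i * (exp (\<gamma> * X N e w (xp m i)) * (1 / mN N e (xp m i) - 1 / mi i)))"
          unfolding SN_def SN'_def V_def sum_subtractf[symmetric] by (intro sum.cong refl) (simp add: right_diff_distrib)
        show "\<bar>SN m N w - SN' N w\<bar> \<le> ?u w"
          unfolding eq by (rule order_trans[OF sum_abs]) (simp only: abs_mult abs_exp_cancel order_refl)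
      qed
      also have "\<dots> = ennreal (\<integral>w. ?u w \<partial>PN N)"
        by (rule nn_integral_eq_integral[OF uI], rule AE_I2, rule sum_nonneg) simp
      also have "(\<integral>w. ?u w \<partial>PN N) = (\<Sum>i<nn m. \<integral>w. \<bar>c m i\<bar> * (exp (\<gamma> * X N e w (xp m i)) * \<bar>1 / mN N e (xp m i) - 1 / mi i\<bar>) \<partial>PN N)"
        by (rule Bochner_Integration.integral_sum, rule ui) simp
      also have "\<dots> = er N"
        unfolding er_def by (intro sum.cong refl) (simp only: integral_mult_right_zero integral_mult_left_zero mN_def)
      finally show "(\<integral>\<^sup>+w. ennreal \<bar>SN m N w - SN' N w\<bar> \<partial>PN N) \<le> ennreal (er N)" .
    qed
    \<comment> \<open>\<open>iexp\<close> of a sum over cells is a product of functions of one field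
      value each, the form that \<open>X_product_tendsto\<close> takes.\<close>
    define \<psi> where "\<psi> i y = iexp (s * (c m i * (exp (\<gamma> * y) / mi i)))" for i and y :: real
    have isum: "iexp (s * (\<Sum>i<nn m. h i)) = (\<Prod>i<nn m. iexp (s * h i))" for h :: "nat \<Rightarrow> real"
      by (simp add: sum_distrib_left exp_sum)
    have "(\<lambda>N. \<integral>w. (\<Prod>i<nn m. \<psi> i (X N e w (xp m i))) \<partial>PN N) \<longlonglongrightarrow> (\<integral>w. (\<Prod>i<nn m. \<psi> i (GX e w (xp m i))) \<partial>Pm)"
    proof (rule X_product_tendsto)
      show "\<forall>j<nn m. xp m j \<in> K" using part(1) by blast
      show "isCont (\<psi> j) x" for j x unfolding \<psi>_def using mi0[of j] by (intro continuous_intros) auto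
      show "cmod (\<psi> j x) \<le> 1" for j x unfolding \<psi>_def by simp
    qed (use e in auto)
    moreover have "(\<Prod>i<nn m. \<psi> i (X N e w (xp m i))) = iexp (s * SN' N w)" for N w
      unfolding SN'_def isum \<psi>_def ..
    moreover have "(\<Prod>i<nn m. \<psi> i (GX e w (xp m i))) = iexp (s * SP m w)" for w
    proof -
      have "VP e w (xp m i) = exp (\<gamma> * GX e w (xp m i)) / mi i" for i by (simp add: VP_def mi_def exp_diff)
      then show ?thesis unfolding SP_def isum \<psi>_def by simp
    qed
    ultimately have term3: "(\<lambda>N. \<integral>w. iexp (s * SN' N w) \<partial>PN N) \<longlonglongrightarrow> (\<integral>w. iexp (s * SP m w) \<partial>Pm)" by simp
    have s1: "0 < \<bar>s\<bar> + 1" by simp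
    have "\<forall>\<^sub>F N in sequentially. er N < r / (4 * (\<bar>s\<bar> + 1))" using er0 r s1 by (intro order_tendstoD) auto
    moreover have "\<forall>\<^sub>F N in sequentially. norm ((\<integral>w. iexp (s * SN' N w) \<partial>PN N) - (\<integral>w. iexp (s * SP m w) \<partial>Pm)) < r / 4"
      using tendstoD[OF term3, of "r / 4"] r by (simp add: dist_norm)
    ultimately have "\<forall>\<^sub>F N in sequentially. norm ((\<integral>w. iexp (s * IN N e w) \<partial>PN N) - (\<integral>w. iexp (s * IP e w) \<partial>Pm)) < r"
      using ev1
    proof eventually_elim
      case (elim N)
      have "\<bar>s\<bar> * (\<integral>x. \<bar>f x\<bar> * b N x \<partial>lborel) \<le> \<bar>s\<bar> * ((F1 + 1) * \<kappa>)"
        using elim(3) by (intro mult_left_mono) auto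
      also have "\<dots> \<le> (\<bar>s\<bar> + 1) * ((F1 + 1) * \<kappa>)"
        using k F1_nonneg by (intro mult_right_mono) auto
      also have "\<dots> = r / 4"
      proof -
        have aux: "a * (b * (r / (4 * a * b))) = r / 4" if "a \<noteq> 0" "b \<noteq> 0" for a b :: real using that by simp
        show ?thesis unfolding \<kappa>_def by (rule aux) (use s1 F1_nonneg in linarith)+
      qed
      finally have 1: "\<bar>s\<bar> * (\<integral>x. \<bar>f x\<bar> * b N x \<partial>lborel) \<le> r / 4" .
      have "\<bar>s\<bar> * er N \<le> \<bar>s\<bar> * (r / (4 * (\<bar>s\<bar> + 1)))" using elim(1) by (intro mult_left_mono) auto
      also have "\<dots> \<le> (\<bar>s\<bar> + 1) * (r / (4 * (\<bar>s\<bar> + 1)))" using r s1 by (intro mult_right_mono) auto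
      also have "\<dots> = r / 4"
      proof -
        have aux: "a * (r / (4 * a)) = r / 4" if "a \<noteq> 0" for a :: real using that by simp
        show ?thesis by (rule aux) (use s1 in linarith)
      qed
      finally have 2: "\<bar>s\<bar> * er N \<le> r / 4" .
      let ?a = "\<integral>w. iexp (s * IN N e w) \<partial>PN N" and ?b = "\<integral>w. iexp (s * SN m N w) \<partial>PN N" and ?c = "\<integral>w. iexp (s * SN' N w) \<partial>PN N"
        and ?d = "\<integral>w. iexp (s * SP m w) \<partial>Pm" and ?e = "\<integral>w. iexp (s * IP e w) \<partial>Pm"
      have "norm (?a - ?e) \<le> norm (?a - ?b) + norm (?b - ?c) + norm (?c - ?d) + norm (?d - ?e)"
        using norm_triangle_ineq[of "?a - ?b" "?b - ?e"] norm_triangle_ineq[of "?b - ?c" "?c - ?e"] norm_triangle_ineq[of "?c - ?d" "?d - ?e"] by simp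
      then show ?case using term1[of N] term2[of N] 1 2 elim(2) m(2) by linarith
    qed
    then show "\<exists>no. \<forall>N\<ge>no. norm ((\<integral>w. iexp (s * IN N e w) \<partial>PN N) - (\<integral>w. iexp (s * IP e w) \<partial>Pm)) < r"
      by (simp add: eventually_sequentially)
  qed
qed

end

section \<open>Soft truncation\<close>

text \<open>A reverse Fatou lemma: dominated convergence for the positive part of u - L. Domination
  holds only eventually, hence the shift by N0.\<close>

lemma limsup_integral_le:
  fixes u :: "nat \<Rightarrow> 'c \<Rightarrow> real"
  assumes um: "\<And>N. u N \<in> borel_measurable M" and w: "integrable M w" and L: "integrable M L"
    and dom: "\<forall>\<^sub>F N in sequentially. \<forall>p\<in>space M. 0 \<le> u N p \<and> u N p \<le> w p"
    and L0: "\<And>p. p \<in> space M \<Longrightarrow> 0 \<le> L p"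
    and pt: "AE p in M. \<forall>\<delta>>0. \<forall>\<^sub>F N in sequentially. u N p < L p + \<delta>" and d: "0 < (\<delta>::real)"
  shows "\<forall>\<^sub>F N in sequentially. (\<integral>p. u N p \<partial>M) < (\<integral>p. L p \<partial>M) + \<delta>"
proof -
  note [measurable] = um borel_measurable_integrable[OF w] borel_measurable_integrable[OF L]
  obtain N0 where N0: "\<And>N p. N0 \<le> N \<Longrightarrow> p \<in> space M \<Longrightarrow> 0 \<le> u N p \<and> u N p \<le> w p"
    using dom unfolding eventually_sequentially by blast
  define v where "v N p = max 0 (u (N + N0) p - L p)" for N p
  have vm: "v N \<in> borel_measurable M" for N unfolding v_def by measurable
  have vb: "0 \<le> v N p" "p \<in> space M \<Longrightarrow> v N p \<le> w p" for N p
    using N0[of "N + N0" p] L0[of p] by (auto simp: v_def)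
  have v0: "(\<lambda>N. \<integral>p. v N p \<partial>M) \<longlonglongrightarrow> (\<integral>p. 0 \<partial>M)"
  proof (rule integral_dominated_convergence[OF _ vm w])
    show "AE p in M. (\<lambda>N. v N p) \<longlonglongrightarrow> 0"
      using pt
    proof eventually_elim
      case (elim p)
      show ?case
      proof (rule tendstoI)
        fix e :: real assume e: "0 < e"
        have "\<forall>\<^sub>F N in sequentially. u (N + N0) p < L p + e"
          using elim[rule_format, OF e] by (rule sequentially_offset)
        then show "\<forall>\<^sub>F N in sequentially. dist (v N p) 0 < e"
          by eventually_elim (use e in \<open>simp add: v_def\<close>)
      qed
    qed
    show "AE p in M. norm (v N p) \<le> w p" for N using vb by (intro AE_I2) simp
  qed simp
  have ui: "integrable M (u (N + N0))" for N
  proof (rule Bochner_Integration.integrable_bound[OF w um], rule AE_I2)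
    fix p assume p: "p \<in> space M"
    have "0 \<le> u (N + N0) p \<and> u (N + N0) p \<le> w p" by (rule N0[OF _ p]) simp
    then show "norm (u (N + N0) p) \<le> norm (w p)" unfolding real_norm_def by linarith
  qed
  have vi: "integrable M (v N)" for N
  proof (rule Bochner_Integration.integrable_bound[OF w vm], rule AE_I2)
    fix p assume p: "p \<in> space M"
    show "norm (v N p) \<le> norm (w p)" using vb(1)[of N p] vb(2)[OF p, of N] unfolding real_norm_def by linarith
  qed
  have le: "(\<integral>p. u (N + N0) p \<partial>M) \<le> (\<integral>p. v N p \<partial>M) + (\<integral>p. L p \<partial>M)" for N
  proof -
    have "(\<integral>p. u (N + N0) p \<partial>M) \<le> (\<integral>p. v N p + L p \<partial>M)"
      by (rule integral_mono[OF ui Bochner_Integration.integrable_add[OF vi L]]) (simp add: v_def)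
    then show ?thesis using vi L by simp
  qed
  have "\<forall>\<^sub>F N in sequentially. (\<integral>p. v N p \<partial>M) < \<delta>" using v0 d by (intro order_tendstoD) auto
  then have "\<forall>\<^sub>F N in sequentially. (\<integral>p. u (N + N0) p \<partial>M) < (\<integral>p. L p \<partial>M) + \<delta>"
  proof eventually_elim
    case (elim N) then show ?case using le[of N] by linarith
  qed
  then show ?thesis by (subst (asm) eventually_sequentially_seg)
qed

text \<open>Raise s / p <= exp (s / p) to the power p. With p = be / la this turns a factor
  \<open>exp (- sk)\<close> into the exponential of a negative multiple of the field.\<close>

lemma exp_neg_le_powr:
  fixes s p :: real
  assumes "0 < s" "0 < p"
  shows "exp (- s) \<le> p powr p * s powr (- p)"
proof -
  have "s / p \<le> exp (s / p)" using exp_ge_add_one_self[of "s / p"] by linarith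
  then have "(s / p) powr p \<le> exp (s / p) powr p" using assms by (intro powr_mono2) auto
  also have "exp (s / p) powr p = exp s" using assms by (simp add: powr_def)
  finally have "s powr p / p powr p \<le> exp s" using assms by (simp add: powr_divide)
  then have "exp (- s) \<le> p powr p / s powr p" using assms by (simp add: exp_minus field_simps)
  then show ?thesis by (simp add: powr_minus_divide)
qed

lemma one_minus_exp_le: "1 - exp (- s) \<le> (s::real)"
  using exp_ge_add_one_self[of "- s"] by linarith

section \<open>Scales, exponents and the truncated two-point function\<close>

locale gmc_thick = gmc_test \<phi> R \<Omega> g K \<eta>0 Pm Xg PN XN \<epsilon>N \<gamma> f
  for \<phi> :: "'a::euclidean_space \<Rightarrow> real" and R \<Omega> g K \<eta>0 and Pm :: "'w measure" and Xg and PN :: "nat \<Rightarrow> 'b measure" and XN \<epsilon>N \<gamma> f +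
  fixes \<alpha> :: real
  assumes alpha: "\<gamma> < \<alpha>" "\<alpha> < 2 * \<gamma>"
begin

abbreviation (input) W :: "nat \<Rightarrow> real \<Rightarrow> real \<Rightarrow> 'a \<Rightarrow> 'a \<Rightarrow> real" where
  "W N e e' x y \<equiv> WN \<Omega> \<phi> PN XN \<gamma> N e e' x y"

definition cK :: real where
  "cK = (SOME C. 0 \<le> C \<and> (\<forall>x\<in>K. \<forall>y\<in>K. \<forall>e e'. 0 \<le> e \<longrightarrow> e \<le> \<eta>0 \<longrightarrow> 0 \<le> e' \<longrightarrow> e' \<le> \<eta>0 \<longrightarrow> 0 < max (max e e') (norm (x - y)) \<longrightarrow>
     \<bar>Cv e x e' y - ln (1 / max (max e e') (norm (x - y)))\<bar> \<le> C))"

lemma cK: "0 \<le> cK \<and> (\<forall>x\<in>K. \<forall>y\<in>K. \<forall>e e'. 0 \<le> e \<longrightarrow> e \<le> \<eta>0 \<longrightarrow> 0 \<le> e' \<longrightarrow> e' \<le> \<eta>0 \<longrightarrow> 0 < max (max e e') (norm (x - y)) \<longrightarrow>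
     \<bar>Cv e x e' y - ln (1 / max (max e e') (norm (x - y)))\<bar> \<le> cK)"
  unfolding cK_def by (rule someI_ex[OF cov_bound])

lemma cov_upper:
  assumes "x \<in> K" "y \<in> K" "0 \<le> e" "e \<le> \<eta>0" "0 \<le> e'" "e' \<le> \<eta>0" "0 < r" "r \<le> max (max e e') (norm (x - y))"
  shows "Cv e x e' y \<le> ln (1 / r) + cK"
proof -
  define m where "m = max (max e e') (norm (x - y))"
  have m: "0 < m" "r \<le> m" using assms unfolding m_def by linarith+
  have "\<bar>Cv e x e' y - ln (1 / m)\<bar> \<le> cK"
    unfolding m_def by (rule cK[THEN conjunct2, rule_format]) (use assms in \<open>auto simp: m_def[symmetric] m\<close>)
  moreover have "ln (1 / m) \<le> ln (1 / r)" using m assms(7) by (simp add: ln_div)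
  ultimately show ?thesis by linarith
qed

lemma cov_lower:
  assumes "x \<in> K" "y \<in> K" "0 \<le> e" "e \<le> \<eta>0" "0 \<le> e'" "e' \<le> \<eta>0" "0 < max (max e e') (norm (x - y))" "max (max e e') (norm (x - y)) \<le> r"
  shows "ln (1 / r) - cK \<le> Cv e x e' y"
proof -
  define m where "m = max (max e e') (norm (x - y))"
  have m: "0 < m" "m \<le> r" using assms unfolding m_def by linarith+
  have "\<bar>Cv e x e' y - ln (1 / m)\<bar> \<le> cK"
    unfolding m_def by (rule cK[THEN conjunct2, rule_format]) (use assms in auto)
  moreover have "ln (1 / r) \<le> ln (1 / m)" using m by (simp add: ln_div)
  ultimately show ?thesis by linarith
qed

definition dy :: "nat \<Rightarrow> real" where "dy k = (1/2) ^ k"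
definition lg :: "nat \<Rightarrow> real" where "lg k = real k * ln 2"

lemma dy_pos: "0 < dy k" by (simp add: dy_def)
lemma dy_le1: "dy k \<le> 1" by (simp add: dy_def power_le_one)
lemma dy_mono: "k \<le> l \<Longrightarrow> dy l \<le> dy k" by (simp add: dy_def power_decreasing)
lemma dy_exp: "dy k = exp (- lg k)"
proof -
  have "exp (- lg k) = exp (real k * (- ln 2))" by (simp add: lg_def)
  also have "\<dots> = exp (- ln 2) ^ k" by (rule exp_of_nat_mult)
  also have "exp (- ln 2) = (1/2 :: real)" by (simp add: exp_minus)
  finally show ?thesis by (simp add: dy_def)
qed
lemma ln_dy: "ln (1 / dy k) = lg k"
proof -
  have "1 / exp (- lg k) = exp (lg k)" by (simp add: exp_minus field_simps)
  then show ?thesis unfolding dy_exp by simp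
qed
lemma dy_tendsto: "dy \<longlonglongrightarrow> 0"
  unfolding dy_def by (rule LIMSEQ_realpow_zero) auto

text \<open>The exponents of the truncation, up to bounded errors. Under the tilt by \<gamma> X(x)
  the field at scale \<open>dy k\<close> has mean \<gamma> lg k, and \<open>la\<close> is the best
  exponent against an excess over \<alpha> lg k: la \<gamma> + la^2 / 2 - la \<alpha> = - la^2 / 2,
  so q ^ k is the cost of scale k. Under a tilt at two points closer than \<open>dy k\<close> the
  mean is 2\<gamma> lg k, and \<open>be\<close> measures the way back to \<alpha>: be \<alpha> +
  be^2 / 2 - 2 be \<gamma> = - be^2 / 2, which lowers the exponent \<gamma>^2 of the two-point
  function to s.\<close>

definition la where "la = \<alpha> - \<gamma>"
definition be where "be = 2 * \<gamma> - \<alpha>"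
definition q where "q = exp (- (la\<^sup>2 / 2) * ln 2)"
definition s where "s = \<gamma>\<^sup>2 - be\<^sup>2 / 2"

lemma la_pos: "0 < la" using alpha by (simp add: la_def)
lemma be_pos: "0 < be" "be < \<gamma>" using alpha by (simp_all add: be_def)
lemma q01: "0 < q" "q < 1" using la_pos by (simp_all add: q_def)
lemma q_power: "q ^ k = exp (- (la\<^sup>2 / 2) * lg k)"
proof -
  have "q ^ k = exp (real k * (- (la\<^sup>2 / 2) * ln 2))" unfolding q_def by (rule exp_of_nat_mult[symmetric])
  also have "real k * (- (la\<^sup>2 / 2) * ln 2) = - (la\<^sup>2 / 2) * lg k" unfolding lg_def by (simp only: mult_ac)
  finally show ?thesis .
qed
lemma s_pos: "0 < s"
proof -
  have "be\<^sup>2 < \<gamma>\<^sup>2" using be_pos by (intro power_strict_mono) auto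
  moreover have "0 \<le> be\<^sup>2" by simp
  ultimately show ?thesis unfolding s_def by linarith
qed

lemma geometric_tail: "finite A \<Longrightarrow> (\<And>k. k \<in> A \<Longrightarrow> m \<le> k) \<Longrightarrow> (\<Sum>k\<in>A. q ^ k) \<le> q ^ m / (1 - q)"
proof -
  assume A: "finite A" "\<And>k. k \<in> A \<Longrightarrow> m \<le> k"
  have sm: "(\<lambda>i. q ^ (i + m)) sums (q ^ m / (1 - q))"
    using sums_mult[OF geometric_sums[of q], of "q ^ m"] q01 by (simp add: power_add mult.commute)
  have "(\<Sum>k\<in>A. q ^ k) = (\<Sum>i\<in>(\<lambda>k. k - m) ` A. q ^ (i + m))"
    by (subst sum.reindex) (use A(2) in \<open>auto intro!: inj_onI sum.cong simp: eq_diff_iff\<close>)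
  also have "\<dots> \<le> (\<Sum>i. q ^ (i + m))"
    using q01 A(1) by (intro sum_le_suminf sums_summable[OF sm]) auto
  also have "\<dots> = q ^ m / (1 - q)" using sm by (simp add: sums_iff)
  finally show ?thesis .
qed

text \<open>\<open>G\<close> is a soft version of the indicator that \<open>X\<close> at scale \<open>dy k\<close> stays below \<open>\<alpha> ln (1 / dy k)\<close>
  for \<open>k0 \<le> k \<le> k1\<close>: it is as cheap to remove as the indicator, \<open>1 - G \<le> \<Sum> sk\<close>, and at every
  scale \<open>G \<le> C sk powr (- be / la)\<close>, so that all truncated moments are exponential moments.\<close>

definition sk :: "nat \<Rightarrow> nat \<Rightarrow> 'b \<Rightarrow> 'a \<Rightarrow> real" where
  "sk N k w x = exp (la * (X N (dy k) w x - \<alpha> * lg k))"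

definition G :: "nat \<Rightarrow> nat \<Rightarrow> nat \<Rightarrow> 'b \<Rightarrow> 'a \<Rightarrow> real" where
  "G N k0 k1 w x = exp (- (\<Sum>k\<in>{k0..k1}. sk N k w x))"

definition U :: "nat \<Rightarrow> nat \<Rightarrow> real \<Rightarrow> nat \<Rightarrow> 'b \<Rightarrow> 'a \<Rightarrow> real" where
  "U N k0 e k1 w x = V N e w x * G N k0 k1 w x"

text \<open>The truncated two-point function. Mollification scale and last truncation scale are
  separate for the two points, since the truncated difference pairs the unmollified field with the
  mollified one.\<close>

definition J :: "nat \<Rightarrow> nat \<Rightarrow> real \<Rightarrow> nat \<Rightarrow> real \<Rightarrow> nat \<Rightarrow> 'a \<Rightarrow> 'a \<Rightarrow> real" where
  "J N k0 e k1 e' k2 x y = (\<integral>w. U N k0 e k1 w x * U N k0 e' k2 w y \<partial>PN N)"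

lemma sk_measurable[measurable (raw)]:
  assumes [measurable]: "h \<in> M \<rightarrow>\<^sub>M PN N" "l \<in> M \<rightarrow>\<^sub>M borel"
  shows "(\<lambda>w. sk N k (h w) (l w)) \<in> borel_measurable M"
  unfolding sk_def by measurable

lemma G_measurable[measurable (raw)]:
  assumes [measurable]: "h \<in> M \<rightarrow>\<^sub>M PN N" "l \<in> M \<rightarrow>\<^sub>M borel"
  shows "(\<lambda>w. G N k0 k1 (h w) (l w)) \<in> borel_measurable M"
  unfolding G_def by measurable

lemma U_measurable[measurable (raw)]:
  assumes [measurable]: "h \<in> M \<rightarrow>\<^sub>M PN N" "l \<in> M \<rightarrow>\<^sub>M borel"
  shows "(\<lambda>w. U N k0 e k1 (h w) (l w)) \<in> borel_measurable M"
  unfolding U_def by measurable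

lemma sk_pos: "0 < sk N k w x" by (simp add: sk_def)

lemma sum_sk_nonneg: "0 \<le> (\<Sum>k\<in>A. sk N k w x)"
  by (intro sum_nonneg less_imp_le sk_pos)

lemma G_bounds: "0 < G N k0 k1 w x" "G N k0 k1 w x \<le> 1"
  using sum_sk_nonneg[of N w x "{k0..k1}"] by (simp_all add: G_def)

lemma U_bounds: "0 \<le> U N k0 e k1 w x" "U N k0 e k1 w x \<le> V N e w x"
  using G_bounds[of N k0 k1 w x] V_nonneg[of N e w x] by (simp_all add: U_def mult_left_le)

lemma G_defect: "1 - G N k0 k1 w x \<le> (\<Sum>k\<in>{k0..k1}. sk N k w x)"
  unfolding G_def by (rule one_minus_exp_le)

lemma G_le_scale:
  assumes k: "k0 \<le> k" "k \<le> k1"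
  shows "G N k0 k1 w x \<le> (be / la) powr (be / la) * exp (be * \<alpha> * lg k) * exp (- be * X N (dy k) w x)"
proof -
  have "sk N k w x \<le> (\<Sum>k\<in>{k0..k1}. sk N k w x)"
    using k by (intro member_le_sum) (auto intro: less_imp_le sk_pos)
  then have "G N k0 k1 w x \<le> exp (- sk N k w x)" by (simp add: G_def)
  also have "\<dots> \<le> (be / la) powr (be / la) * sk N k w x powr (- (be / la))"
    using be_pos la_pos by (intro exp_neg_le_powr sk_pos) auto
  also have "sk N k w x powr (- (be / la)) = exp (- (be / la) * (la * (X N (dy k) w x - \<alpha> * lg k)))"
    unfolding sk_def powr_def by simp
  also have "- (be / la) * (la * (X N (dy k) w x - \<alpha> * lg k)) = be * \<alpha> * lg k + (- be * X N (dy k) w x)"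
    using la_pos by (simp add: field_simps)
  finally show ?thesis by (simp only: exp_add mult.assoc)
qed

lemma VV_exp_expectation:
  assumes xy: "x \<in> K" "y \<in> K" and e: "0 \<le> e" "e \<le> \<eta>0" "0 \<le> e'" "e' \<le> \<eta>0" and z: "z \<in> K" "0 < \<eta>" "\<eta> \<le> \<eta>0"
  shows "integrable (PN N) (\<lambda>w. V N e w x * V N e' w y * exp (t * X N \<eta> w z))"
    and "(\<integral>w. V N e w x * V N e' w y * exp (t * X N \<eta> w z) \<partial>PN N)
      = W N e e' x y * ((\<integral>w. exp (\<gamma> * X N e w x + \<gamma> * X N e' w y + t * X N \<eta> w z) \<partial>PN N) / (\<integral>w. exp (\<gamma> * X N e w x + \<gamma> * X N e' w y) \<partial>PN N))"
proof -
  have eq: "V N e w x * V N e' w y * exp (t * X N \<eta> w z) = exp (\<gamma> * X N e w x + \<gamma> * X N e' w y + t * X N \<eta> w z) / (mN N e x * mN N e' y)" for w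
    by (simp add: V_def exp_add)
  have gd: "good N (\<lambda>w. \<gamma> * X N e w x + \<gamma> * X N e' w y + t * X N \<eta> w z)"
    by (rule good_add[OF good_pair[OF xy e] good_X[OF z(1)]]) (use z in simp_all)
  show "integrable (PN N) (\<lambda>w. V N e w x * V N e' w y * exp (t * X N \<eta> w z))"
    unfolding eq by (rule integrable_divide) (rule good_integrable[OF gd])
  have "(\<integral>w. exp (\<gamma> * X N e w x + \<gamma> * X N e' w y) \<partial>PN N) \<noteq> 0" using pair_pos[OF xy e, of N] by simp
  then show "(\<integral>w. V N e w x * V N e' w y * exp (t * X N \<eta> w z) \<partial>PN N)
      = W N e e' x y * ((\<integral>w. exp (\<gamma> * X N e w x + \<gamma> * X N e' w y + t * X N \<eta> w z) \<partial>PN N) / (\<integral>w. exp (\<gamma> * X N e w x + \<gamma> * X N e' w y) \<partial>PN N))"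
    unfolding eq by (simp add: WN_def EN_def mN_def)
qed

lemma W_nonneg:
  assumes "x \<in> K" "y \<in> K" "0 \<le> e" "e \<le> \<eta>0" "0 \<le> e'" "e' \<le> \<eta>0"
  shows "0 \<le> W N e e' x y"
  unfolding VV_expectation(2)[OF assms, symmetric] by (rule integral_nonneg_AE, rule AE_I2, rule mult_nonneg_nonneg) (rule V_nonneg)+

lemma UU_integrable:
  assumes xy: "x \<in> K" "y \<in> K" and e: "0 \<le> e" "e \<le> \<eta>0" "0 \<le> e'" "e' \<le> \<eta>0"
  shows "integrable (PN N) (\<lambda>w. U N k0 e k1 w x * U N k0 e' k2 w y)"
proof (rule Bochner_Integration.integrable_bound[OF VV_expectation(1)[OF xy e]])
  show "(\<lambda>w. U N k0 e k1 w x * U N k0 e' k2 w y) \<in> borel_measurable (PN N)" by measurable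
  show "AE w in PN N. norm (U N k0 e k1 w x * U N k0 e' k2 w y) \<le> norm (V N e w x * V N e' w y)"
  proof (rule AE_I2)
    fix w
    have "U N k0 e k1 w x * U N k0 e' k2 w y \<le> V N e w x * V N e' w y"
      by (intro mult_mono U_bounds V_nonneg)
    moreover have "0 \<le> U N k0 e k1 w x * U N k0 e' k2 w y" by (intro mult_nonneg_nonneg U_bounds)
    ultimately show "norm (U N k0 e k1 w x * U N k0 e' k2 w y) \<le> norm (V N e w x * V N e' w y)"
      unfolding real_norm_def by linarith
  qed
qed

lemma J_nonneg: "0 \<le> J N k0 e k1 e' k2 x y"
  unfolding J_def by (rule integral_nonneg_AE, rule AE_I2, rule mult_nonneg_nonneg) (rule U_bounds)+

lemma J_le_W:
  assumes xy: "x \<in> K" "y \<in> K" and e: "0 \<le> e" "e \<le> \<eta>0" "0 \<le> e'" "e' \<le> \<eta>0"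
  shows "J N k0 e k1 e' k2 x y \<le> W N e e' x y"
  unfolding J_def VV_expectation(2)[OF xy e, symmetric]
  by (rule integral_mono[OF UU_integrable[OF xy e] VV_expectation(1)[OF xy e]]) (intro mult_mono U_bounds V_nonneg)

lemma J_sym: "J N k0 e k1 e' k2 x y = J N k0 e' k2 e k1 y x"
  unfolding J_def by (simp only: mult.commute)

text \<open>The truncation is exploited at y and at one scale k only; at x it is bounded by 1. What
  remains is an exponential moment with coefficient - be.\<close>

lemma J_le_scale:
  assumes xy: "x \<in> K" "y \<in> K" and e: "0 \<le> e" "e \<le> \<eta>0" "0 \<le> e'" "e' \<le> \<eta>0" and k: "k0 \<le> k" "k \<le> k2" "dy k \<le> \<eta>0"
  shows "J N k0 e k1 e' k2 x y \<le> (be / la) powr (be / la) * exp (be * \<alpha> * lg k) * (W N e e' x y *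
     ((\<integral>w. exp (\<gamma> * X N e w x + \<gamma> * X N e' w y + (- be) * X N (dy k) w y) \<partial>PN N) / (\<integral>w. exp (\<gamma> * X N e w x + \<gamma> * X N e' w y) \<partial>PN N)))"
proof -
  let ?c = "(be / la) powr (be / la) * exp (be * \<alpha> * lg k)"
  have "J N k0 e k1 e' k2 x y \<le> (\<integral>w. ?c * (V N e w x * V N e' w y * exp ((- be) * X N (dy k) w y)) \<partial>PN N)"
    unfolding J_def
  proof (rule integral_mono[OF UU_integrable[OF xy e] integrable_mult_right])
    show "integrable (PN N) (\<lambda>w. V N e w x * V N e' w y * exp ((- be) * X N (dy k) w y))"
      by (rule VV_exp_expectation(1)[OF xy e xy(2) dy_pos k(3)])
    fix w
    have "U N k0 e k1 w x * U N k0 e' k2 w y \<le> V N e w x * (V N e' w y * (?c * exp (- be * X N (dy k) w y)))"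
      unfolding U_def[of N k0 e' k2] by (intro mult_mono U_bounds V_nonneg mult_left_mono G_le_scale k mult_nonneg_nonneg less_imp_le[OF G_bounds(1)])
    then show "U N k0 e k1 w x * U N k0 e' k2 w y \<le> ?c * (V N e w x * V N e' w y * exp ((- be) * X N (dy k) w y))"
      by (simp only: mult_ac)
  qed
  also have "\<dots> = ?c * (\<integral>w. V N e w x * V N e' w y * exp ((- be) * X N (dy k) w y) \<partial>PN N)" by (rule integral_mult_right_zero)
  finally show ?thesis unfolding VV_exp_expectation(2)[OF xy e xy(2) dy_pos k(3)] .
qed

text \<open>The scale at which the truncation is exploited for points at distance r: within a factor
  2 of r, or the last available scale if r is smaller.\<close>

lemma pair_scale:
  assumes r: "0 < r" "r \<le> dy k0" and k1: "k0 \<le> k1"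
  obtains k where "k0 \<le> k" "k \<le> k1" "max (dy k1) r \<le> dy k" "dy k \<le> 2 * max (dy k1) r"
proof -
  define m where "m = max (dy k1) r"
  have m: "0 < m" "m \<le> dy k0" using r dy_pos[of k1] dy_mono[OF k1] by (auto simp: m_def)
  then have "m \<le> 1" using dy_le1[of k0] by linarith
  obtain k where k: "(1/2) ^ Suc k < m" "m \<le> (1/2) ^ k" by (rule dyadic_scale[OF m(1) \<open>m \<le> 1\<close>])
  have k': "m \<le> dy k" "dy k \<le> 2 * m" using k by (auto simp: dy_def)
  have "dy (Suc k) < dy k0" using k m by (simp add: dy_def)
  then have "k0 \<le> k" unfolding dy_def by (metis dy_def dy_mono leD not_less_eq_eq)
  moreover have "k \<le> k1"
  proof (rule ccontr)
    assume "\<not> k \<le> k1"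
    then have "dy k \<le> dy (Suc k1)" by (intro dy_mono) simp
    also have "\<dots> < dy k1" using dy_pos[of k1] by (simp add: dy_def)
    also have "\<dots> \<le> m" by (simp add: m_def)
    finally show False using k' by simp
  qed
  ultimately show ?thesis using that[of k] k' by (simp add: m_def)
qed

end

lemma limsup_mult_less:
  fixes W r :: "nat \<Rightarrow> real"
  assumes W: "W \<longlonglongrightarrow> w" "\<And>N. 0 \<le> W N" and A: "0 \<le> A"
    and r: "\<And>d. 0 < d \<Longrightarrow> \<forall>\<^sub>F N in sequentially. r N < \<rho> + d" and d: "0 < \<delta>"
  shows "\<forall>\<^sub>F N in sequentially. A * (W N * r N) < A * (w * \<rho>) + \<delta>"
proof -
  have w: "0 \<le> w" by (rule LIMSEQ_le_const[OF W(1)]) (use W(2) in blast)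
  define d where "d = \<delta> / (2 * (A * w + 1))"
  have Aw: "0 \<le> A * w" using A w by simp
  have d0: "0 < d" using d Aw by (simp add: d_def)
  have "A * w * d < \<delta>"
  proof -
    have "A * w * d \<le> (A * w + 1) * d" using d0 by (intro mult_right_mono) auto
    also have "\<dots> = \<delta> / 2"
    proof -
      have aux: "a * (\<delta> / (2 * a)) = \<delta> / 2" if "a \<noteq> 0" for a :: real using that by simp
      show ?thesis unfolding d_def by (rule aux) (use Aw in linarith)
    qed
    finally show ?thesis using d by linarith
  qed
  then have "A * (w * (\<rho> + d)) < A * (w * \<rho>) + \<delta>" by (simp add: algebra_simps)
  moreover have "(\<lambda>N. A * (W N * (\<rho> + d))) \<longlonglongrightarrow> A * (w * (\<rho> + d))" by (intro tendsto_intros W)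
  ultimately have "\<forall>\<^sub>F N in sequentially. A * (W N * (\<rho> + d)) < A * (w * \<rho>) + \<delta>" by (intro order_tendstoD)
  with r[OF d0] show ?thesis
  proof eventually_elim
    case (elim N)
    have "A * (W N * r N) \<le> A * (W N * (\<rho> + d))" using elim(1) A W(2)[of N] by (intro mult_left_mono) auto
    then show ?case using elim(2) by linarith
  qed
qed

lemma prod_lessThan_double: "(\<Prod>j<2 * n. h j) = (\<Prod>i<n. h (2 * i) * h (Suc (2 * i)))" for h :: "nat \<Rightarrow> 'a::comm_monoid_mult"
  by (induction n) (simp_all add: mult.assoc)

lemma sum_atLeastAtMost_shift: "k0 \<le> m \<Longrightarrow> (\<Sum>k\<in>{k0..m}. h k) = (\<Sum>i<Suc m - k0. h (k0 + i))" for h :: "nat \<Rightarrow> 'a::comm_monoid_add" and k0 :: nat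
  by (rule sum.reindex_bij_witness[of _ "\<lambda>i. k0 + i" "\<lambda>k. k - k0"]) auto

context gmc_thick
begin

section \<open>Truncated moments near the diagonal\<close>

lemma W_tendsto:
  assumes xy: "x \<in> K" "y \<in> K" "x \<noteq> y" and e: "0 \<le> e" "0 \<le> e'"
  shows "(\<lambda>N. W N e e' x y) \<longlonglongrightarrow> exp (\<gamma>\<^sup>2 * Cv e x e' y)"
proof -
  have "uniform_limit {(x, y)} (\<lambda>N (x,y). W N e e' x y) (\<lambda>(x,y). exp (\<gamma>\<^sup>2 * Cv e x e' y)) sequentially"
    by (rule a1[unfolded A1_def, rule_format, OF e]) (use xy K_Om in auto)
  from tendsto_uniform_limitI[OF this, of "(x, y)"] show ?thesis by simp
qed

text \<open>The last truncation scale for the unmollified field: for large N,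
  \<open>\<epsilon>N N\<close> < \<open>dy (KN N)\<close> <= 2 * \<open>\<epsilon>N N\<close>. It is
  the finest dyadic scale in the range of (A4), (A5) and (A7), of which (A4) asks for the strict
  inequality.\<close>

definition KN :: "nat \<Rightarrow> nat" where "KN N = (LEAST k. dy k \<le> 2 * \<epsilon>N N)"

lemma KN_le: "dy (KN N) \<le> 2 * \<epsilon>N N"
proof -
  have "\<forall>\<^sub>F k in sequentially. dy k < 2 * \<epsilon>N N" by (rule order_tendstoD(2)[OF dy_tendsto]) (use epsN(1)[of N] in simp)
  then obtain k where "dy k < 2 * \<epsilon>N N" using eventually_happens'[OF sequentially_bot] by blast
  then have "dy k \<le> 2 * \<epsilon>N N" by simp
  then show ?thesis unfolding KN_def by (rule LeastI)
qed

lemma KN_gt: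
  assumes "2 * \<epsilon>N N < dy m" shows "m < KN N" "\<epsilon>N N < dy (KN N)"
proof -
  show m: "m < KN N"
  proof (rule ccontr)
    assume "\<not> m < KN N"
    then have "dy m \<le> dy (KN N)" by (intro dy_mono) simp
    then show False using KN_le[of N] assms by simp
  qed
  then obtain l where l: "KN N = Suc l" by (cases "KN N") auto
  have "\<not> dy l \<le> 2 * \<epsilon>N N" using l unfolding KN_def by (metis lessI not_less_Least)
  then show "\<epsilon>N N < dy (KN N)" unfolding l by (simp add: dy_def)
qed

lemma KN_eventually: "\<forall>\<^sub>F N in sequentially. m < KN N \<and> \<epsilon>N N < dy (KN N) \<and> 2 * \<epsilon>N N < dy m"
proof -
  have "(\<lambda>N. 2 * \<epsilon>N N) \<longlonglongrightarrow> 2 * 0" by (intro tendsto_intros epsN(2))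
  then have "\<forall>\<^sub>F N in sequentially. 2 * \<epsilon>N N < dy m" by (rule order_tendstoD(2)) (simp add: dy_pos)
  then show ?thesis by eventually_elim (simp add: KN_gt)
qed

definition c0 where "c0 = (be / la) powr (be / la)"

lemma c0_nonneg: "0 \<le> c0" by (simp add: c0_def)

text \<open>(A6) with coefficient - be at the scale k of the pair, and W of order exp (\<gamma>^2 lg
  k). The two values of e respect the ordering of scales in (A6). Its limsup is taken for fixed
  parameters, so the bound holds eventually for each pair, with an extra \<delta>. The depth
  \<open>k1\<close> at x may vary with N because the truncation there is only bounded by 1.\<close>

lemma near_mollified:
  "\<exists>C\<ge>0. \<forall>k0 e M x y k1 \<delta>. dy k0 \<le> \<eta>0 \<longrightarrow> k0 \<le> M \<longrightarrow> e = 0 \<or> e = dy M \<longrightarrow> x \<in> K \<longrightarrow> y \<in> K \<longrightarrow> x \<noteq> y \<longrightarrow> norm (x - y) \<le> dy k0 \<longrightarrow> 0 < \<delta> \<longrightarrow>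
     (\<forall>\<^sub>F N in sequentially. J N k0 e (k1 N) (dy M) M x y < C * norm (x - y) powr (- s) + \<delta>)"
proof -
  obtain C6 where C6: "\<forall>e e' \<eta> x y. 0 \<le> e \<and> 0 < e' \<and> e \<le> e' \<and> e' \<le> \<eta> \<and> (x,y) \<in> K \<times> K \<longrightarrow>
       limsup (\<lambda>N. ereal
         (EN PN N (\<lambda>w. exp (\<gamma> * X N e w x + \<gamma> * X N e' w y + (- be) * X N \<eta> w y))
          / EN PN N (\<lambda>w. exp (\<gamma> * X N e w x + \<gamma> * X N e' w y))))
       \<le> ereal (C6 * exp ((- be)^2 / 2 * Cv \<eta> y \<eta> y + (- be) * \<gamma> * Cv e x \<eta> y + (- be) * \<gamma> * Cv e' y \<eta> y))"
    using A6_bound[of "- be"] by (rule exE)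
  define D where "D = max C6 0"
  define C where "C = c0 * D * exp (\<gamma>\<^sup>2 * (ln 2 + cK) + be\<^sup>2 / 2 * cK + 2 * be * \<gamma> * cK)"
  have D: "0 \<le> D" "C6 \<le> D" by (simp_all add: D_def)
  have C0: "0 \<le> C" unfolding C_def by (intro mult_nonneg_nonneg c0_nonneg D) simp
  have main: "\<forall>\<^sub>F N in sequentially. J N k0 e (k1 N) (dy M) M x y < C * norm (x - y) powr (- s) + \<delta>"
    if h: "dy k0 \<le> \<eta>0" "k0 \<le> M" "e = 0 \<or> e = dy M" and xy: "x \<in> K" "y \<in> K" "x \<noteq> y" "norm (x - y) \<le> dy k0" and \<delta>: "0 < \<delta>"
    for k0 e M x y and k1 :: "nat \<Rightarrow> nat" and \<delta> :: real
  proof -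
    define m where "m = max (dy M) (norm (x - y))"
    have nxy: "0 < norm (x - y)" using xy by simp
    obtain k where k: "k0 \<le> k" "k \<le> M" "m \<le> dy k" "dy k \<le> 2 * m"
      using pair_scale[OF nxy xy(4) h(2)] unfolding m_def by blast
    have m: "0 < m" "dy M \<le> m" "norm (x - y) \<le> m" using dy_pos[of M] by (simp_all add: m_def)
    have dk: "dy k \<le> \<eta>0" using dy_mono[OF k(1)] h(1) by linarith
    have e: "0 \<le> e" "e \<le> dy M" using h(3) dy_pos[of M] by auto
    have e': "0 \<le> dy M" "0 < dy M" using dy_pos[of M] by auto
    have es: "e \<le> \<eta>0" "dy M \<le> \<eta>0" "0 \<le> dy k" "dy M \<le> dy k" using e m k dk dy_pos[of k] by linarith+
    define w where "w = exp (\<gamma>\<^sup>2 * Cv e x (dy M) y)"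
    define E1 where "E1 = (- be)^2 / 2 * Cv (dy k) y (dy k) y + (- be) * \<gamma> * Cv e x (dy k) y + (- be) * \<gamma> * Cv (dy M) y (dy k) y"
    define r where "r N = (\<integral>w. exp (\<gamma> * X N e w x + \<gamma> * X N (dy M) w y + (- be) * X N (dy k) w y) \<partial>PN N) / (\<integral>w. exp (\<gamma> * X N e w x + \<gamma> * X N (dy M) w y) \<partial>PN N)" for N
    have ls: "limsup (\<lambda>N. ereal (r N)) \<le> ereal (C6 * exp E1)"
      using C6[THEN spec[of _ e], THEN spec[of _ "dy M"], THEN spec[of _ "dy k"], THEN spec[of _ x], THEN spec[of _ y], THEN mp] e e' es xy
      unfolding r_def E1_def EN_def by simp
    have rl: "\<forall>\<^sub>F N in sequentially. r N < D * exp E1 + d" if "0 < d" for d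
    proof (rule limsup_ereal_le_imp_eventually_less[OF ls])
      have "C6 * exp E1 \<le> D * exp E1" using D by (intro mult_right_mono) auto
      then show "C6 * exp E1 < D * exp E1 + d" using that by linarith
    qed
    have A0: "0 \<le> c0 * exp (be * \<alpha> * lg k)" using c0_nonneg by simp
    have ev: "\<forall>\<^sub>F N in sequentially. c0 * exp (be * \<alpha> * lg k) * (W N e (dy M) x y * r N) < c0 * exp (be * \<alpha> * lg k) * (w * (D * exp E1)) + \<delta>"
      by (rule limsup_mult_less[OF _ _ A0 rl \<delta>], unfold w_def, rule W_tendsto[OF xy(1-3) e(1) e'(1)], rule W_nonneg[OF xy(1,2) e(1) es(1) e'(1) es(2)])
    have bE: "E1 \<le> be\<^sup>2 / 2 * (lg k + cK) + 2 * (- be * \<gamma> * (lg k - cK))"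
    proof -
      have 1: "Cv (dy k) y (dy k) y \<le> lg k + cK"
        using cov_upper[OF xy(2) xy(2), of "dy k" "dy k" "dy k"] dy_pos[of k] dk by (simp add: ln_dy)
      have 2: "lg k - cK \<le> Cv e x (dy k) y"
        using cov_lower[OF xy(1,2), of e "dy k" "dy k"] dy_pos[of k] dk e es m k by (simp add: ln_dy)
      have 3: "lg k - cK \<le> Cv (dy M) y (dy k) y"
        using cov_lower[OF xy(2) xy(2), of "dy M" "dy k" "dy k"] dy_pos[of k] dk e' es by (simp add: ln_dy)
      have bg: "0 \<le> be * \<gamma>" using be_pos gamma by simp
      have "(- be)^2 / 2 * Cv (dy k) y (dy k) y \<le> be\<^sup>2 / 2 * (lg k + cK)" using 1 by (simp add: mult_left_mono)
      moreover have "be * \<gamma> * (lg k - cK) \<le> be * \<gamma> * Cv e x (dy k) y" by (rule mult_left_mono[OF 2 bg])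
      moreover have "be * \<gamma> * (lg k - cK) \<le> be * \<gamma> * Cv (dy M) y (dy k) y" by (rule mult_left_mono[OF 3 bg])
      ultimately show ?thesis unfolding E1_def minus_mult_left[symmetric] by linarith
    qed
    have bw: "w \<le> exp (\<gamma>\<^sup>2 * (lg k + ln 2 + cK))"
    proof -
      have 1: "Cv e x (dy M) y \<le> ln (1 / m) + cK"
        by (rule cov_upper[OF xy(1,2) e(1) es(1) e'(1) es(2) m(1)]) (simp add: m_def)
      have "dy k / 2 \<le> m" using k by simp
      then have "ln (dy k / 2) \<le> ln m" using dy_pos[of k] m by simp
      then have "ln (1 / m) \<le> ln (1 / dy k) + ln 2" using dy_pos[of k] m by (simp add: ln_div)
      then have "Cv e x (dy M) y \<le> lg k + ln 2 + cK" using 1 unfolding ln_dy by linarith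
      then show ?thesis unfolding w_def by (simp add: mult_left_mono)
    qed
    have "c0 * exp (be * \<alpha> * lg k) * (w * (D * exp E1))
       \<le> c0 * exp (be * \<alpha> * lg k) * (exp (\<gamma>\<^sup>2 * (lg k + ln 2 + cK)) * (D * exp (be\<^sup>2 / 2 * (lg k + cK) + 2 * (- be * \<gamma> * (lg k - cK)))))"
      using bE bw D A0 by (intro mult_left_mono mult_mono) (auto simp: w_def)
    also have "\<dots> = c0 * D * (exp (be * \<alpha> * lg k) * exp (\<gamma>\<^sup>2 * (lg k + ln 2 + cK)) * exp (be\<^sup>2 / 2 * (lg k + cK) + 2 * (- be * \<gamma> * (lg k - cK))))"
      by (simp only: mult_ac)
    also have "\<dots> = c0 * D * exp (be * \<alpha> * lg k + \<gamma>\<^sup>2 * (lg k + ln 2 + cK) + (be\<^sup>2 / 2 * (lg k + cK) + 2 * (- be * \<gamma> * (lg k - cK))))"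
      by (simp only: exp_add)
    \<comment> \<open>The coefficients of \<open>lg k\<close> add up to s because \<alpha> =
      2\<gamma> - be.\<close>
    also have "be * \<alpha> * lg k + \<gamma>\<^sup>2 * (lg k + ln 2 + cK) + (be\<^sup>2 / 2 * (lg k + cK) + 2 * (- be * \<gamma> * (lg k - cK)))
       = (\<gamma>\<^sup>2 * (ln 2 + cK) + be\<^sup>2 / 2 * cK + 2 * be * \<gamma> * cK) + s * lg k"
      unfolding s_def be_def by (simp add: power2_eq_square field_simps)
    also have "c0 * D * exp ((\<gamma>\<^sup>2 * (ln 2 + cK) + be\<^sup>2 / 2 * cK + 2 * be * \<gamma> * cK) + s * lg k) = C * exp (s * lg k)"
      unfolding C_def exp_add by (simp only: mult_ac)
    also have "exp (s * lg k) = dy k powr (- s)" unfolding dy_exp powr_def by simp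
    also have "C * dy k powr (- s) \<le> C * norm (x - y) powr (- s)"
      using m k nxy s_pos by (intro mult_left_mono[OF _ C0] powr_mono2') auto
    finally have fin: "c0 * exp (be * \<alpha> * lg k) * (w * (D * exp E1)) \<le> C * norm (x - y) powr (- s)" .
    show ?thesis
      using ev
    proof eventually_elim
      case (elim N)
      have "J N k0 e (k1 N) (dy M) M x y \<le> c0 * exp (be * \<alpha> * lg k) * (W N e (dy M) x y * r N)"
        unfolding c0_def r_def by (rule J_le_scale[OF xy(1,2) e(1) es(1) e'(1) es(2) k(1,2) dk])
      then show ?case using elim fin by linarith
    qed
  qed
  show ?thesis using C0 main by (intro exI[of _ C]) simp
qed

text \<open>(A7) with coefficient - be, uniformly in points and scales. W stays as a factor because
  it is bounded pointwise only at distances of at least \<open>\<epsilon>N N\<close>; below, only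
  its integral is controlled.\<close>

lemma unmollified_scale:
  "\<exists>C\<ge>0. \<forall>\<^sub>F N in sequentially. \<forall>k0 k x y. dy k0 \<le> \<eta>0 \<longrightarrow> k0 \<le> k \<longrightarrow> k \<le> KN N \<longrightarrow> x \<in> K \<longrightarrow> y \<in> K \<longrightarrow> norm (x - y) \<le> dy k \<longrightarrow>
     J N k0 0 (KN N) 0 (KN N) x y \<le> C * exp (- (be\<^sup>2 / 2) * lg k) * W N 0 0 x y"
proof -
  have "\<exists>C. \<forall>\<^sub>F N in sequentially.
     \<forall>\<eta> x y. \<epsilon>N N \<le> \<eta> \<and> (x,y) \<in> K \<times> K \<longrightarrow>
       (let r = EN PN N (\<lambda>w. exp (\<gamma> * XN N w x + \<gamma> * XN N w y + (- be) * X N \<eta> w x))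
                / EN PN N (\<lambda>w. exp (\<gamma> * XN N w x + \<gamma> * XN N w y))
        in 0 \<le> r \<and> r \<le> C * exp ((- be)^2 / 2 * Cv \<eta> x \<eta> x + (- be) * \<gamma> * Cv 0 x \<eta> x + (- be) * \<gamma> * Cv 0 y \<eta> x))"
    by (rule a7[unfolded A7_def, THEN spec[of _ "- be"], THEN spec[of _ "K \<times> K"], THEN mp])
       (use K_compact K_Om in \<open>auto intro: compact_Times\<close>)
  then obtain C7 where C7: "\<forall>\<^sub>F N in sequentially.
     \<forall>\<eta> x y. \<epsilon>N N \<le> \<eta> \<and> (x,y) \<in> K \<times> K \<longrightarrow>
       (let r = EN PN N (\<lambda>w. exp (\<gamma> * XN N w x + \<gamma> * XN N w y + (- be) * X N \<eta> w x))
                / EN PN N (\<lambda>w. exp (\<gamma> * XN N w x + \<gamma> * XN N w y))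
        in 0 \<le> r \<and> r \<le> C7 * exp ((- be)^2 / 2 * Cv \<eta> x \<eta> x + (- be) * \<gamma> * Cv 0 x \<eta> x + (- be) * \<gamma> * Cv 0 y \<eta> x))"
    by (rule exE)
  define D where "D = max C7 0"
  have D: "0 \<le> D" "C7 \<le> D" by (simp_all add: D_def)
  define C where "C = c0 * D * exp (be\<^sup>2 / 2 * cK + 2 * be * \<gamma> * cK)"
  have C0: "0 \<le> C" unfolding C_def by (intro mult_nonneg_nonneg c0_nonneg D) simp
  have "\<forall>\<^sub>F N in sequentially. \<forall>k0 k x y. dy k0 \<le> \<eta>0 \<longrightarrow> k0 \<le> k \<longrightarrow> k \<le> KN N \<longrightarrow> x \<in> K \<longrightarrow> y \<in> K \<longrightarrow> norm (x - y) \<le> dy k \<longrightarrow>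
     J N k0 0 (KN N) 0 (KN N) x y \<le> C * exp (- (be\<^sup>2 / 2) * lg k) * W N 0 0 x y"
    using C7 KN_eventually[of 0]
  proof eventually_elim
    case (elim N)
    show ?case
    proof (intro allI impI)
      fix k0 k x y
      assume h: "dy k0 \<le> \<eta>0" "k0 \<le> k" "k \<le> KN N" and xy: "x \<in> K" "y \<in> K" "norm (x - y) \<le> dy k"
      have ek: "\<epsilon>N N \<le> dy k" using elim(2) dy_mono[OF h(3)] by linarith
      have dk: "dy k \<le> \<eta>0" using dy_mono[OF h(2)] h(1) by linarith
      define r where "r = (\<integral>w. exp (\<gamma> * X N 0 w x + \<gamma> * X N 0 w y + (- be) * X N (dy k) w y) \<partial>PN N) / (\<integral>w. exp (\<gamma> * X N 0 w x + \<gamma> * X N 0 w y) \<partial>PN N)"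
      define E1 where "E1 = (- be)^2 / 2 * Cv (dy k) y (dy k) y + (- be) * \<gamma> * Cv 0 y (dy k) y + (- be) * \<gamma> * Cv 0 x (dy k) y"
      \<comment> \<open>(A7) tilts at its first point and \<open>J_le_scale\<close> at its second,
        hence the exchange of x and y.\<close>
      have "r \<le> C7 * exp E1"
        using elim(1)[rule_format, of "dy k" y x] ek xy unfolding Let_def EN_def r_def E1_def X_zero
        by (simp add: add.commute[of "\<gamma> * XN N _ y"])
      also have "\<dots> \<le> D * exp E1" using D by (intro mult_right_mono) auto
      also have "\<dots> \<le> D * exp (be\<^sup>2 / 2 * (lg k + cK) + 2 * (- be * \<gamma> * (lg k - cK)))"
      proof (rule mult_left_mono[OF _ D(1)])
        have 1: "Cv (dy k) y (dy k) y \<le> lg k + cK"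
          using cov_upper[OF xy(2) xy(2), of "dy k" "dy k" "dy k"] dy_pos[of k] dk by (simp add: ln_dy)
        have 2: "lg k - cK \<le> Cv 0 x (dy k) y"
          using cov_lower[OF xy(1,2), of 0 "dy k" "dy k"] dy_pos[of k] dk eta0 xy(3) by (simp add: ln_dy)
        have 3: "lg k - cK \<le> Cv 0 y (dy k) y"
          using cov_lower[OF xy(2) xy(2), of 0 "dy k" "dy k"] dy_pos[of k] dk eta0 by (simp add: ln_dy)
        have bg: "0 \<le> be * \<gamma>" using be_pos gamma by simp
        have "(- be)^2 / 2 * Cv (dy k) y (dy k) y \<le> be\<^sup>2 / 2 * (lg k + cK)" using 1 by (simp add: mult_left_mono)
        moreover have "be * \<gamma> * (lg k - cK) \<le> be * \<gamma> * Cv 0 x (dy k) y" by (rule mult_left_mono[OF 2 bg])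
        moreover have "be * \<gamma> * (lg k - cK) \<le> be * \<gamma> * Cv 0 y (dy k) y" by (rule mult_left_mono[OF 3 bg])
        ultimately have "E1 \<le> be\<^sup>2 / 2 * (lg k + cK) + 2 * (- be * \<gamma> * (lg k - cK))"
          unfolding E1_def minus_mult_left[symmetric] by linarith
        then show "exp E1 \<le> exp (be\<^sup>2 / 2 * (lg k + cK) + 2 * (- be * \<gamma> * (lg k - cK)))" by simp
      qed
      finally have rb: "r \<le> D * exp (be\<^sup>2 / 2 * (lg k + cK) + 2 * (- be * \<gamma> * (lg k - cK)))" .
      have W0: "0 \<le> W N 0 0 x y" by (rule W_nonneg[OF xy(1,2)]) (use eta0 in auto)
      have "J N k0 0 (KN N) 0 (KN N) x y \<le> c0 * exp (be * \<alpha> * lg k) * (W N 0 0 x y * r)"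
        unfolding c0_def r_def by (rule J_le_scale[OF xy(1,2) _ _ _ _ h(2,3) dk]) (use eta0 in auto)
      also have "\<dots> \<le> c0 * exp (be * \<alpha> * lg k) * (W N 0 0 x y * (D * exp (be\<^sup>2 / 2 * (lg k + cK) + 2 * (- be * \<gamma> * (lg k - cK)))))"
        using rb W0 c0_nonneg by (intro mult_left_mono) auto
      also have "\<dots> = c0 * D * exp (be * \<alpha> * lg k + (be\<^sup>2 / 2 * (lg k + cK) + 2 * (- be * \<gamma> * (lg k - cK)))) * W N 0 0 x y"
        by (simp only: exp_add mult_ac)
      also have "be * \<alpha> * lg k + (be\<^sup>2 / 2 * (lg k + cK) + 2 * (- be * \<gamma> * (lg k - cK))) = (be\<^sup>2 / 2 * cK + 2 * be * \<gamma> * cK) + (- (be\<^sup>2 / 2) * lg k)"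
        unfolding be_def by (simp add: power2_eq_square field_simps)
      also have "c0 * D * exp ((be\<^sup>2 / 2 * cK + 2 * be * \<gamma> * cK) + (- (be\<^sup>2 / 2) * lg k)) * W N 0 0 x y = C * exp (- (be\<^sup>2 / 2) * lg k) * W N 0 0 x y"
        unfolding C_def exp_add by (simp only: mult_ac)
      finally show "J N k0 0 (KN N) 0 (KN N) x y \<le> C * exp (- (be\<^sup>2 / 2) * lg k) * W N 0 0 x y" .
    qed
  qed
  then show ?thesis using C0 by (intro exI[of _ C] conjI)
qed

text \<open>Above \<open>\<epsilon>N N\<close>, (A3) contributes the power - \<gamma>^2 and the
  truncation be^2 / 2, together - s. Below, the truncation at the last scale contributes a power of
  \<open>\<epsilon>N N\<close>, and W is left for (A8).\<close>

lemma near_unmollified: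
  "\<exists>C\<ge>0. \<forall>k0. dy k0 \<le> \<eta>0 \<longrightarrow> (\<forall>\<^sub>F N in sequentially. \<forall>x y. x \<in> K \<longrightarrow> y \<in> K \<longrightarrow>
     (\<epsilon>N N \<le> norm (x - y) \<longrightarrow> norm (x - y) \<le> dy k0 \<longrightarrow> J N k0 0 (KN N) 0 (KN N) x y \<le> C * norm (x - y) powr (- s)) \<and>
     (norm (x - y) \<le> \<epsilon>N N \<longrightarrow> J N k0 0 (KN N) 0 (KN N) x y \<le> C * \<epsilon>N N powr (be\<^sup>2 / 2) * W N 0 0 x y))"
proof -
  obtain C1 where C1: "0 \<le> C1" "\<forall>\<^sub>F N in sequentially. \<forall>k0 k x y. dy k0 \<le> \<eta>0 \<longrightarrow> k0 \<le> k \<longrightarrow> k \<le> KN N \<longrightarrow> x \<in> K \<longrightarrow> y \<in> K \<longrightarrow> norm (x - y) \<le> dy k \<longrightarrow>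
     J N k0 0 (KN N) 0 (KN N) x y \<le> C1 * exp (- (be\<^sup>2 / 2) * lg k) * W N 0 0 x y"
    using unmollified_scale by (elim exE conjE)
  have "\<exists>C. \<forall>\<^sub>F N in sequentially.
     \<forall>(x,y)\<in>K \<times> K. dist x y \<ge> \<epsilon>N N \<longrightarrow> 0 \<le> W N 0 0 x y \<and> W N 0 0 x y \<le> C * dist x y powr (-(\<gamma>^2))"
    by (rule a3[unfolded A3_def, THEN spec[of _ "K \<times> K"], THEN mp]) (use K_compact K_Om in \<open>auto intro: compact_Times\<close>)
  then obtain C3 where C3: "\<forall>\<^sub>F N in sequentially.
     \<forall>(x,y)\<in>K \<times> K. dist x y \<ge> \<epsilon>N N \<longrightarrow> 0 \<le> W N 0 0 x y \<and> W N 0 0 x y \<le> C3 * dist x y powr (-(\<gamma>^2))"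
    by (rule exE)
  define D where "D = max C3 0"
  have D: "0 \<le> D" "C3 \<le> D" by (simp_all add: D_def)
  define b where "b = be\<^sup>2 / 2"
  have b0: "0 \<le> b" by (simp add: b_def)
  define C where "C = C1 * (D + 1) * 4 powr b"
  have C0: "0 \<le> C" unfolding C_def using C1(1) D by simp
  have expb: "exp (- b * lg k) = dy k powr b" for k unfolding dy_exp powr_def by simp
  have "\<forall>\<^sub>F N in sequentially. \<forall>x y. x \<in> K \<longrightarrow> y \<in> K \<longrightarrow>
     (\<epsilon>N N \<le> norm (x - y) \<longrightarrow> norm (x - y) \<le> dy k0 \<longrightarrow> J N k0 0 (KN N) 0 (KN N) x y \<le> C * norm (x - y) powr (- s)) \<and>
     (norm (x - y) \<le> \<epsilon>N N \<longrightarrow> J N k0 0 (KN N) 0 (KN N) x y \<le> C * \<epsilon>N N powr b * W N 0 0 x y)" if k0: "dy k0 \<le> \<eta>0" for k0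
    using C1(2) C3 KN_eventually[of k0]
  proof eventually_elim
    case (elim N)
    note J1 = elim(1)[unfolded b_def[symmetric], rule_format, OF k0]
    have kK: "k0 \<le> KN N" "\<epsilon>N N \<le> dy (KN N)" using elim(3) by auto
    show ?case
    proof (intro allI impI conjI)
      fix x y assume xy: "x \<in> K" "y \<in> K" and n: "\<epsilon>N N \<le> norm (x - y)" "norm (x - y) \<le> dy k0"
      have nxy: "0 < norm (x - y)" using n epsN(1)[of N] by linarith
      obtain k where k: "k0 \<le> k" "k \<le> KN N" "max (dy (KN N)) (norm (x - y)) \<le> dy k" "dy k \<le> 2 * max (dy (KN N)) (norm (x - y))"
        using pair_scale[OF nxy n(2) kK(1)] by blast
      \<comment> \<open>The last truncation scale is at most 2 * \<open>\<epsilon>N N\<close>, so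
        even when the distance falls below it the scale k is within a factor 4 of the
        distance.\<close>
      have "max (dy (KN N)) (norm (x - y)) \<le> 2 * norm (x - y)" using KN_le[of N] n nxy by simp
      then have dk: "dy k \<le> 4 * norm (x - y)" "norm (x - y) \<le> dy k" using k by linarith+
      have "\<epsilon>N N \<le> dist x y" using n by (simp add: dist_norm)
      moreover have "(x, y) \<in> K \<times> K" using xy by simp
      ultimately have W3: "0 \<le> W N 0 0 x y" "W N 0 0 x y \<le> C3 * norm (x - y) powr (-(\<gamma>^2))"
        using elim(2) unfolding dist_norm by blast+
      have "C3 * norm (x - y) powr (-(\<gamma>^2)) \<le> (D + 1) * norm (x - y) powr (-(\<gamma>^2))" using D by (intro mult_right_mono) auto
      then have W4: "W N 0 0 x y \<le> (D + 1) * norm (x - y) powr (-(\<gamma>^2))" using W3 by linarith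
      have "J N k0 0 (KN N) 0 (KN N) x y \<le> C1 * exp (- b * lg k) * W N 0 0 x y" by (rule J1[OF k(1,2) xy dk(2)])
      also have "\<dots> \<le> C1 * ((4 * norm (x - y)) powr b) * ((D + 1) * norm (x - y) powr (-(\<gamma>^2)))"
        unfolding expb using C1(1) W3(1) W4 dk dy_pos[of k] b0 by (intro mult_mono mult_left_mono powr_mono2) auto
      also have "\<dots> = C * (norm (x - y) powr b * norm (x - y) powr (-(\<gamma>^2)))"
        unfolding C_def using nxy by (simp only: powr_mult mult_ac)
      also have "norm (x - y) powr b * norm (x - y) powr (-(\<gamma>^2)) = norm (x - y) powr (- s)"
        unfolding powr_add[symmetric] by (simp add: s_def b_def)
      finally show "J N k0 0 (KN N) 0 (KN N) x y \<le> C * norm (x - y) powr (- s)" .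
    next
      fix x y assume xy: "x \<in> K" "y \<in> K" and n: "norm (x - y) \<le> \<epsilon>N N"
      have W0: "0 \<le> W N 0 0 x y" by (rule W_nonneg[OF xy]) (use eta0 in auto)
      have nk: "norm (x - y) \<le> dy (KN N)" using n kK by linarith
      have "J N k0 0 (KN N) 0 (KN N) x y \<le> C1 * exp (- b * lg (KN N)) * W N 0 0 x y" by (rule J1[OF kK(1) order_refl xy nk])
      also have "\<dots> \<le> C1 * ((4 * \<epsilon>N N) powr b) * W N 0 0 x y"
      proof -
        have "dy (KN N) \<le> 4 * \<epsilon>N N" using KN_le[of N] epsN(1)[of N] by linarith
        then have "dy (KN N) powr b \<le> (4 * \<epsilon>N N) powr b" using dy_pos[of "KN N"] b0 by (intro powr_mono2) auto
        then show ?thesis unfolding expb using C1(1) W0 by (intro mult_right_mono mult_left_mono)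
      qed
      also have "\<dots> = C1 * 1 * 4 powr b * \<epsilon>N N powr b * W N 0 0 x y" using epsN(1)[of N] by (simp add: powr_mult)
      also have "\<dots> \<le> C * \<epsilon>N N powr b * W N 0 0 x y"
        unfolding C_def using C1(1) D W0 by (intro mult_right_mono mult_left_mono) auto
      finally show "J N k0 0 (KN N) 0 (KN N) x y \<le> C * \<epsilon>N N powr b * W N 0 0 x y" .
    qed
  qed
  then show ?thesis unfolding b_def using C0 by (intro exI[of _ C]) simp
qed

section \<open>Depth of the truncation away from the diagonal\<close>

text \<open>(A4) with one additional factor, at relative error \<delta> = 1; hence the factor 2. It
  is uniform in the scale, which lets the costs of all scales be added for the same N.\<close>

lemma A4_single:
  assumes xy: "x \<in> K" "y \<in> K" "x \<noteq> y" and e: "0 \<le> e" "0 \<le> e'"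
  shows "\<forall>\<^sub>F N in sequentially. \<forall>\<eta> z. \<epsilon>N N < \<eta> \<longrightarrow> \<eta> \<le> 1 \<longrightarrow> z \<in> K \<longrightarrow>
     (\<integral>w. exp (\<gamma> * X N e w x + \<gamma> * X N e' w y + la * X N \<eta> w z) \<partial>PN N) / (\<integral>w. exp (\<gamma> * X N e w x + \<gamma> * X N e' w y) \<partial>PN N)
       \<le> 2 * exp (\<gamma> * la * (Cv e x \<eta> z + Cv e' y \<eta> z) + 1/2 * (la * la * Cv \<eta> z \<eta> z))"
proof -
  have dxy: "0 < dist x y" using xy by simp
  have "\<forall>\<delta>>0. \<forall>\<^sub>F N in sequentially. \<forall>x1 y1 (\<eta>::nat \<Rightarrow> real) (z::nat \<Rightarrow> 'a).
        (x1,y1) \<in> {(x,y)} \<and> (\<forall>k<1. \<epsilon>N N < \<eta> k \<and> \<eta> k \<le> 1 \<and> z k \<in> K) \<longrightarrow>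
        \<bar>(EN PN N (\<lambda>w. exp (\<gamma> * X N e w x1 + \<gamma> * X N e' w y1) *
                         exp (\<Sum>k<1. la * X N (\<eta> k) w (z k)))
          / EN PN N (\<lambda>w. exp (\<gamma> * X N e w x1 + \<gamma> * X N e' w y1)))
         / exp ((\<Sum>k<1. \<gamma> * la * (Cv e x1 (\<eta> k) (z k) + Cv e' y1 (\<eta> k) (z k)))
                + 1/2 * (\<Sum>j<1. \<Sum>k<1. la * la * Cv (\<eta> j) (z j) (\<eta> k) (z k)))
         - 1\<bar> \<le> \<delta>"
    by (rule a4[unfolded A4_def, THEN spec[of _ "dist x y"], THEN mp, OF dxy, THEN spec[of _ e], THEN mp, OF e(1),
             THEN spec[of _ e'], THEN mp, OF e(2), THEN spec[of _ 1], THEN spec[of _ "\<lambda>_. la"], THEN spec[of _ "{(x,y)}"],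
             THEN spec[of _ K], THEN mp])
       (use xy K_Om K_compact in auto)
  from this[rule_format, of 1] have "\<forall>\<^sub>F N in sequentially. \<forall>x1 y1 (\<eta>::nat \<Rightarrow> real) (z::nat \<Rightarrow> 'a).
        (x1,y1) \<in> {(x,y)} \<and> (\<forall>k<1. \<epsilon>N N < \<eta> k \<and> \<eta> k \<le> 1 \<and> z k \<in> K) \<longrightarrow>
        \<bar>(EN PN N (\<lambda>w. exp (\<gamma> * X N e w x1 + \<gamma> * X N e' w y1) *
                         exp (\<Sum>k<1. la * X N (\<eta> k) w (z k)))
          / EN PN N (\<lambda>w. exp (\<gamma> * X N e w x1 + \<gamma> * X N e' w y1)))
         / exp ((\<Sum>k<1. \<gamma> * la * (Cv e x1 (\<eta> k) (z k) + Cv e' y1 (\<eta> k) (z k)))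
                + 1/2 * (\<Sum>j<1. \<Sum>k<1. la * la * Cv (\<eta> j) (z j) (\<eta> k) (z k)))
         - 1\<bar> \<le> 1" by simp
  then show ?thesis
  proof eventually_elim
    case (elim N)
    show ?case
    proof (intro allI impI)
      fix \<eta> z assume h: "\<epsilon>N N < \<eta>" "\<eta> \<le> 1" "z \<in> K"
      define r where "r = (\<integral>w. exp (\<gamma> * X N e w x + \<gamma> * X N e' w y + la * X N \<eta> w z) \<partial>PN N) / (\<integral>w. exp (\<gamma> * X N e w x + \<gamma> * X N e' w y) \<partial>PN N)"
      define E where "E = exp (\<gamma> * la * (Cv e x \<eta> z + Cv e' y \<eta> z) + 1/2 * (la * la * Cv \<eta> z \<eta> z))"
      have s1: "(\<Sum>k<Suc 0. h k) = h 0" for h :: "nat \<Rightarrow> real" by simp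
      have "\<bar>r / E - 1\<bar> \<le> 1"
        using elim[THEN spec[of _ x], THEN spec[of _ y], THEN spec[of _ "\<lambda>_. \<eta>"], THEN spec[of _ "\<lambda>_. z"], THEN mp] h
        unfolding EN_def One_nat_def s1 exp_add[symmetric] r_def E_def by simp
      then have "r / E \<le> 2" by linarith
      moreover have "0 < E" by (simp add: E_def)
      ultimately have "r \<le> 2 * E" by (simp only: pos_divide_le_eq)
      then show "r \<le> 2 * E" .
    qed
  qed
qed

text \<open>For points at distance at least \<rho> the tilt at the other point shifts the mean by a
  bounded amount, so each scale costs q ^ k just as for a single point. The bound is relative to W
  and uniform in the final depths, which may therefore grow with N.\<close>

lemma far_truncation:
  assumes \<rho>: "0 < \<rho>"
  shows "\<exists>C\<ge>0. \<forall>k0 m e e' x y. dy k0 \<le> \<eta>0 \<longrightarrow> k0 \<le> m \<longrightarrow> 0 \<le> e \<longrightarrow> e \<le> \<eta>0 \<longrightarrow> 0 \<le> e' \<longrightarrow> e' \<le> \<eta>0 \<longrightarrow> x \<in> K \<longrightarrow> y \<in> K \<longrightarrow> \<rho> \<le> norm (x - y) \<longrightarrow>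
     (\<forall>\<^sub>F N in sequentially. \<forall>k1 k2. m \<le> k1 \<longrightarrow> m \<le> k2 \<longrightarrow> \<epsilon>N N < dy k1 \<longrightarrow> \<epsilon>N N < dy k2 \<longrightarrow>
        \<bar>J N k0 e k1 e' k2 x y - J N k0 e m e' m x y\<bar> \<le> W N e e' x y * (C * q ^ m))"
proof -
  define E0 where "E0 = 2 * exp (\<gamma> * la * (ln (1 / \<rho>) + 2 * cK) + la\<^sup>2 / 2 * cK)"
  \<comment> \<open>Two points, each with the geometric tail of q ^ k beyond m.\<close>
  define C where "C = 2 * E0 / (1 - q)"
  have E0: "0 \<le> E0" by (simp add: E0_def)
  have C0: "0 \<le> C" unfolding C_def using E0 q01 by simp
  have main: "\<forall>\<^sub>F N in sequentially. \<forall>k1 k2. m \<le> k1 \<longrightarrow> m \<le> k2 \<longrightarrow> \<epsilon>N N < dy k1 \<longrightarrow> \<epsilon>N N < dy k2 \<longrightarrow>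
        \<bar>J N k0 e k1 e' k2 x y - J N k0 e m e' m x y\<bar> \<le> W N e e' x y * (C * q ^ m)"
    if k0: "dy k0 \<le> \<eta>0" "k0 \<le> m" and e: "0 \<le> e" "e \<le> \<eta>0" "0 \<le> e'" "e' \<le> \<eta>0" and xy: "x \<in> K" "y \<in> K" "\<rho> \<le> norm (x - y)"
    for k0 m e e' x y
  proof -
    have ne: "x \<noteq> y" using xy \<rho> by auto
    show ?thesis
      using A4_single[OF xy(1,2) ne e(1,3)]
    proof eventually_elim
      case (elim N)
      have W0: "0 \<le> W N e e' x y" by (rule W_nonneg[OF xy(1,2) e])
      have scale: "integrable (PN N) (\<lambda>w. V N e w x * V N e' w y * sk N k w z)"
        "(\<integral>w. V N e w x * V N e' w y * sk N k w z \<partial>PN N) \<le> W N e e' x y * (E0 * q ^ k)"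
        if k: "m \<le> k" "\<epsilon>N N < dy k" and z: "z = x \<or> z = y" for k z
      proof -
        have zK: "z \<in> K" using z xy by blast
        have dk: "dy k \<le> \<eta>0" using dy_mono[of k0 k] k k0 by linarith
        have eq: "V N e w x * V N e' w y * sk N k w z = V N e w x * V N e' w y * exp (la * X N (dy k) w z) * exp (- (la * \<alpha> * lg k))" for w
          unfolding sk_def by (simp add: right_diff_distrib exp_diff exp_minus divide_inverse mult.assoc)
        show "integrable (PN N) (\<lambda>w. V N e w x * V N e' w y * sk N k w z)"
          unfolding eq by (rule integrable_mult_left) (rule VV_exp_expectation(1)[OF xy(1,2) e zK dy_pos dk])
        define r where "r = (\<integral>w. exp (\<gamma> * X N e w x + \<gamma> * X N e' w y + la * X N (dy k) w z) \<partial>PN N) / (\<integral>w. exp (\<gamma> * X N e w x + \<gamma> * X N e' w y) \<partial>PN N)"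
        have r: "r \<le> 2 * exp (\<gamma> * la * (Cv e x (dy k) z + Cv e' y (dy k) z) + 1/2 * (la * la * Cv (dy k) z (dy k) z))"
          unfolding r_def by (rule elim[rule_format, OF k(2) dy_le1 zK])
        have zz: "Cv (dy k) z (dy k) z \<le> lg k + cK"
          using cov_upper[OF zK zK, of "dy k" "dy k" "dy k"] dy_pos[of k] dk by (simp add: ln_dy)
        have sum: "Cv e x (dy k) z + Cv e' y (dy k) z \<le> (lg k + cK) + (ln (1 / \<rho>) + cK)"
        proof (cases "z = x")
          case True
          have "Cv e x (dy k) x \<le> lg k + cK"
            using cov_upper[OF xy(1) xy(1) e(1,2), of "dy k" "dy k"] dy_pos[of k] dk by (simp add: ln_dy)
          moreover have "Cv e' y (dy k) x \<le> ln (1 / \<rho>) + cK"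
            by (rule cov_upper[OF xy(2,1) e(3,4) less_imp_le[OF dy_pos] dk \<rho>]) (use xy(3) in \<open>simp add: norm_minus_commute le_max_iff_disj\<close>)
          ultimately show ?thesis unfolding True by linarith
        next
          case False
          then have zy: "z = y" using z by simp
          have "Cv e' y (dy k) y \<le> lg k + cK"
            using cov_upper[OF xy(2) xy(2) e(3,4), of "dy k" "dy k"] dy_pos[of k] dk by (simp add: ln_dy)
          moreover have "Cv e x (dy k) y \<le> ln (1 / \<rho>) + cK"
            by (rule cov_upper[OF xy(1,2) e(1,2) less_imp_le[OF dy_pos] dk \<rho>]) (use xy(3) in \<open>simp add: le_max_iff_disj\<close>)
          ultimately show ?thesis unfolding zy by linarith
        qed
        have gl: "0 \<le> \<gamma> * la" using gamma la_pos by simp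
        have "\<gamma> * la * (Cv e x (dy k) z + Cv e' y (dy k) z) \<le> \<gamma> * la * ((lg k + cK) + (ln (1 / \<rho>) + cK))"
          by (rule mult_left_mono[OF sum gl])
        moreover have "1/2 * (la * la * Cv (dy k) z (dy k) z) \<le> 1/2 * (la * la * (lg k + cK))" using zz by (intro mult_left_mono) auto
        ultimately have "exp (\<gamma> * la * (Cv e x (dy k) z + Cv e' y (dy k) z) + 1/2 * (la * la * Cv (dy k) z (dy k) z))
          \<le> exp (\<gamma> * la * ((lg k + cK) + (ln (1 / \<rho>) + cK)) + 1/2 * (la * la * (lg k + cK)))" by simp
        then have r2: "r \<le> 2 * exp (\<gamma> * la * ((lg k + cK) + (ln (1 / \<rho>) + cK)) + 1/2 * (la * la * (lg k + cK)))" using r by linarith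
        have "(\<integral>w. V N e w x * V N e' w y * sk N k w z \<partial>PN N) = W N e e' x y * r * exp (- (la * \<alpha> * lg k))"
          unfolding eq integral_mult_left_zero VV_exp_expectation(2)[OF xy(1,2) e zK dy_pos dk] r_def ..
        also have "\<dots> \<le> W N e e' x y * (2 * exp (\<gamma> * la * ((lg k + cK) + (ln (1 / \<rho>) + cK)) + 1/2 * (la * la * (lg k + cK)))) * exp (- (la * \<alpha> * lg k))"
          by (intro mult_right_mono mult_left_mono r2 W0) simp
        also have "\<dots> = W N e e' x y * (2 * exp (\<gamma> * la * ((lg k + cK) + (ln (1 / \<rho>) + cK)) + 1/2 * (la * la * (lg k + cK)) + - (la * \<alpha> * lg k)))"
          by (simp only: exp_add mult.assoc)
        also have "\<gamma> * la * ((lg k + cK) + (ln (1 / \<rho>) + cK)) + 1/2 * (la * la * (lg k + cK)) + - (la * \<alpha> * lg k)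
            = (\<gamma> * la * (ln (1 / \<rho>) + 2 * cK) + la\<^sup>2 / 2 * cK) + - (la\<^sup>2 / 2) * lg k"
          unfolding la_def by (simp add: power2_eq_square field_simps)
        also have "W N e e' x y * (2 * exp ((\<gamma> * la * (ln (1 / \<rho>) + 2 * cK) + la\<^sup>2 / 2 * cK) + - (la\<^sup>2 / 2) * lg k)) = W N e e' x y * (E0 * q ^ k)"
          unfolding E0_def exp_add q_power by (simp only: mult.assoc)
        finally show "(\<integral>w. V N e w x * V N e' w y * sk N k w z \<partial>PN N) \<le> W N e e' x y * (E0 * q ^ k)" .
      qed
      show ?case
      proof (intro allI impI)
        fix k1 k2 assume k: "m \<le> k1" "m \<le> k2" "\<epsilon>N N < dy k1" "\<epsilon>N N < dy k2"
        have ek: "\<epsilon>N N < dy l" if "l \<in> {m<..k1} \<or> l \<in> {m<..k2}" for l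
        proof -
          have "l \<le> k1 \<or> l \<le> k2" using that by auto
          then show ?thesis using dy_mono[of l k1] dy_mono[of l k2] k by fastforce
        qed
        define A where "A w = (\<Sum>l\<in>{m<..k1}. V N e w x * V N e' w y * sk N l w x)" for w
        define B where "B w = (\<Sum>l\<in>{m<..k2}. V N e w x * V N e' w y * sk N l w y)" for w
        have Ai: "integrable (PN N) A" unfolding A_def by (rule Bochner_Integration.integrable_sum, rule scale(1)) (use ek in auto)
        have Bi: "integrable (PN N) B" unfolding B_def by (rule Bochner_Integration.integrable_sum, rule scale(1)) (use ek in auto)
        have gt: "(\<Sum>l\<in>{m<..kk}. q ^ l) \<le> q ^ m / (1 - q)" for kk by (rule geometric_tail) auto
        have IA: "(\<integral>w. A w \<partial>PN N) \<le> W N e e' x y * (E0 * (q ^ m / (1 - q)))"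
        proof -
          have "(\<integral>w. A w \<partial>PN N) = (\<Sum>l\<in>{m<..k1}. \<integral>w. V N e w x * V N e' w y * sk N l w x \<partial>PN N)"
            unfolding A_def by (rule Bochner_Integration.integral_sum, rule scale(1)) (use ek in auto)
          also have "\<dots> \<le> (\<Sum>l\<in>{m<..k1}. W N e e' x y * (E0 * q ^ l))" by (rule sum_mono, rule scale(2)) (use ek in auto)
          also have "\<dots> = W N e e' x y * (E0 * (\<Sum>l\<in>{m<..k1}. q ^ l))" by (simp only: sum_distrib_left)
          also have "\<dots> \<le> W N e e' x y * (E0 * (q ^ m / (1 - q)))" by (intro mult_left_mono gt E0 W0)
          finally show ?thesis .
        qed
        have IB: "(\<integral>w. B w \<partial>PN N) \<le> W N e e' x y * (E0 * (q ^ m / (1 - q)))"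
        proof -
          have "(\<integral>w. B w \<partial>PN N) = (\<Sum>l\<in>{m<..k2}. \<integral>w. V N e w x * V N e' w y * sk N l w y \<partial>PN N)"
            unfolding B_def by (rule Bochner_Integration.integral_sum, rule scale(1)) (use ek in auto)
          also have "\<dots> \<le> (\<Sum>l\<in>{m<..k2}. W N e e' x y * (E0 * q ^ l))" by (rule sum_mono, rule scale(2)) (use ek in auto)
          also have "\<dots> = W N e e' x y * (E0 * (\<Sum>l\<in>{m<..k2}. q ^ l))" by (simp only: sum_distrib_left)
          also have "\<dots> \<le> W N e e' x y * (E0 * (q ^ m / (1 - q)))" by (intro mult_left_mono gt E0 W0)
          finally show ?thesis .
        qed
        have Gs: "G N k0 kk w z = G N k0 m w z * exp (- (\<Sum>l\<in>{m<..kk}. sk N l w z))" if "m \<le> kk" for kk w z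
        proof -
          have "{k0..kk} = {k0..m} \<union> {m<..kk}" using that k0 by auto
          then have "(\<Sum>l\<in>{k0..kk}. sk N l w z) = (\<Sum>l\<in>{k0..m}. sk N l w z) + (\<Sum>l\<in>{m<..kk}. sk N l w z)"
            by (simp only:) (rule sum.union_disjoint, auto)
          then show ?thesis unfolding G_def by (simp add: exp_add[symmetric])
        qed
        \<comment> \<open>Going deeper than m multiplies the product by \<open>exp (- S)\<close>,
          where S collects the additional \<open>sk\<close> at both points; the loss is then at most
          S times the untruncated product.\<close>
        have pt: "0 \<le> U N k0 e m w x * U N k0 e' m w y - U N k0 e k1 w x * U N k0 e' k2 w y"
          "U N k0 e m w x * U N k0 e' m w y - U N k0 e k1 w x * U N k0 e' k2 w y \<le> A w + B w" for w
        proof -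
          define S where "S = (\<Sum>l\<in>{m<..k1}. sk N l w x) + (\<Sum>l\<in>{m<..k2}. sk N l w y)"
          define g where "g = G N k0 m w x * G N k0 m w y"
          define v where "v = V N e w x * V N e' w y"
          have S: "0 \<le> S" unfolding S_def by (intro add_nonneg_nonneg sum_sk_nonneg)
          have g: "0 \<le> g" "g \<le> 1" unfolding g_def
            by (intro mult_nonneg_nonneg less_imp_le G_bounds(1), rule mult_le_one[OF G_bounds(2) less_imp_le[OF G_bounds(1)] G_bounds(2)])
          have v: "0 \<le> v" unfolding v_def by (intro mult_nonneg_nonneg V_nonneg)
          have "U N k0 e k1 w x * U N k0 e' k2 w y = v * g * exp (- S)"
            unfolding U_def Gs[OF k(1)] Gs[OF k(2)] S_def g_def v_def minus_add_distrib exp_add by (simp only: mult_ac)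
          moreover have "U N k0 e m w x * U N k0 e' m w y = v * g" unfolding U_def g_def v_def by (simp only: mult_ac)
          ultimately have eq: "U N k0 e m w x * U N k0 e' m w y - U N k0 e k1 w x * U N k0 e' k2 w y = v * g * (1 - exp (- S))"
            by (simp add: right_diff_distrib)
          have AB: "A w + B w = v * S" unfolding A_def B_def S_def v_def by (simp only: sum_distrib_left distrib_left)
          have "exp (- S) \<le> 1" using S by simp
          then show "0 \<le> U N k0 e m w x * U N k0 e' m w y - U N k0 e k1 w x * U N k0 e' k2 w y"
            unfolding eq using g v by (intro mult_nonneg_nonneg) auto
          have "v * g * (1 - exp (- S)) \<le> v * 1 * S"
            using g v S one_minus_exp_le[of S] by (intro mult_mono mult_left_mono mult_nonneg_nonneg) auto
          then show "U N k0 e m w x * U N k0 e' m w y - U N k0 e k1 w x * U N k0 e' k2 w y \<le> A w + B w"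
            unfolding eq AB by simp
        qed
        have J: "J N k0 e m e' m x y - J N k0 e k1 e' k2 x y = (\<integral>w. U N k0 e m w x * U N k0 e' m w y - U N k0 e k1 w x * U N k0 e' k2 w y \<partial>PN N)"
          unfolding J_def by (rule Bochner_Integration.integral_diff[symmetric]) (rule UU_integrable[OF xy(1,2) e])+
        have Di: "integrable (PN N) (\<lambda>w. U N k0 e m w x * U N k0 e' m w y - U N k0 e k1 w x * U N k0 e' k2 w y)"
          by (rule Bochner_Integration.integrable_diff) (rule UU_integrable[OF xy(1,2) e])+
        have "J N k0 e m e' m x y - J N k0 e k1 e' k2 x y \<le> (\<integral>w. A w + B w \<partial>PN N)"
          unfolding J by (rule integral_mono[OF Di Bochner_Integration.integrable_add[OF Ai Bi] pt(2)])
        also have "\<dots> = (\<integral>w. A w \<partial>PN N) + (\<integral>w. B w \<partial>PN N)" by (rule Bochner_Integration.integral_add[OF Ai Bi])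
        also have "\<dots> \<le> W N e e' x y * (E0 * (q ^ m / (1 - q))) + W N e e' x y * (E0 * (q ^ m / (1 - q)))" by (rule add_mono[OF IA IB])
        also have "\<dots> = W N e e' x y * (C * q ^ m)" unfolding C_def by (simp add: field_simps)
        finally have "J N k0 e m e' m x y - J N k0 e k1 e' k2 x y \<le> W N e e' x y * (C * q ^ m)" .
        moreover have "0 \<le> J N k0 e m e' m x y - J N k0 e k1 e' k2 x y"
          unfolding J by (rule integral_nonneg_AE, rule AE_I2, rule pt(1))
        ultimately show "\<bar>J N k0 e k1 e' k2 x y - J N k0 e m e' m x y\<bar> \<le> W N e e' x y * (C * q ^ m)" by linarith
      qed
    qed
  qed
  show ?thesis using C0 main by (intro exI[of _ C]) simp
qed

section \<open>First-moment cost of the truncation\<close>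

lemma V_sk_expectation:
  assumes x: "x \<in> K" and e: "0 \<le> e" "e \<le> \<eta>0" and k: "dy k \<le> \<eta>0"
  shows "integrable (PN N) (\<lambda>w. V N e w x * sk N k w x)"
    and "(\<integral>w. V N e w x * sk N k w x \<partial>PN N)
      = (\<integral>w. exp (\<gamma> * X N e w x + la * X N (dy k) w x) \<partial>PN N) / (\<integral>w. exp (\<gamma> * X N e w x) \<partial>PN N) * exp (- (la * \<alpha> * lg k))"
proof -
  have eq: "V N e w x * sk N k w x = exp (\<gamma> * X N e w x + la * X N (dy k) w x) / mN N e x * exp (- (la * \<alpha> * lg k))" for w
    unfolding V_def sk_def by (simp add: right_diff_distrib exp_diff exp_minus exp_add divide_inverse mult_ac)
  have gd: "good N (\<lambda>w. \<gamma> * X N e w x + la * X N (dy k) w x)"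
    by (rule good_add[OF good_X[OF x e] good_X[OF x]]) (use k gamma dy_pos[of k] in simp_all)
  show "integrable (PN N) (\<lambda>w. V N e w x * sk N k w x)"
    unfolding eq by (rule integrable_mult_left, rule integrable_divide) (rule good_integrable[OF gd])
  show "(\<integral>w. V N e w x * sk N k w x \<partial>PN N)
      = (\<integral>w. exp (\<gamma> * X N e w x + la * X N (dy k) w x) \<partial>PN N) / (\<integral>w. exp (\<gamma> * X N e w x) \<partial>PN N) * exp (- (la * \<alpha> * lg k))"
    unfolding eq mN_def by (simp only: integral_mult_left_zero integral_divide_zero)
qed

text \<open>The bound of 1 - G by the sum of the \<open>sk\<close> reduces the defect to one-scale
  costs; the bound by 1 serves as a majorant independent of N.\<close>

lemma V_defect_le:
  assumes x: "x \<in> K" and e: "0 \<le> e" "e \<le> \<eta>0" and k0: "dy k0 \<le> \<eta>0"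
  shows "integrable (PN N) (\<lambda>w. V N e w x - U N k0 e k1 w x)"
    and "(\<integral>w. V N e w x - U N k0 e k1 w x \<partial>PN N) \<le> (\<Sum>k\<in>{k0..k1}. \<integral>w. V N e w x * sk N k w x \<partial>PN N)"
    and "(\<integral>w. V N e w x - U N k0 e k1 w x \<partial>PN N) \<le> 1"
proof -
  have b: "0 \<le> V N e w x - U N k0 e k1 w x" "V N e w x - U N k0 e k1 w x \<le> V N e w x" for w
    using U_bounds[of N k0 e k1 w x] by simp_all
  show i: "integrable (PN N) (\<lambda>w. V N e w x - U N k0 e k1 w x)"
  proof (rule Bochner_Integration.integrable_bound[OF V_expectation(1)[OF x e]])
    show "AE w in PN N. norm (V N e w x - U N k0 e k1 w x) \<le> norm (V N e w x)"
    proof (rule AE_I2)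
      fix w show "norm (V N e w x - U N k0 e k1 w x) \<le> norm (V N e w x)"
        using b[of w] unfolding real_norm_def by linarith
    qed
  qed measurable
  have "(\<integral>w. V N e w x - U N k0 e k1 w x \<partial>PN N) \<le> (\<integral>w. V N e w x \<partial>PN N)"
    by (rule integral_mono[OF i V_expectation(1)[OF x e] b(2)])
  then show "(\<integral>w. V N e w x - U N k0 e k1 w x \<partial>PN N) \<le> 1" unfolding V_expectation(2)[OF x e] .
  have dk: "dy k \<le> \<eta>0" if "k \<in> {k0..k1}" for k using dy_mono[of k0 k] that k0 by simp
  have si: "integrable (PN N) (\<lambda>w. V N e w x * sk N k w x)" if "k \<in> {k0..k1}" for k
    by (rule V_sk_expectation(1)[OF x e dk[OF that]])
  have "(\<integral>w. V N e w x - U N k0 e k1 w x \<partial>PN N) \<le> (\<integral>w. (\<Sum>k\<in>{k0..k1}. V N e w x * sk N k w x) \<partial>PN N)"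
  proof (rule integral_mono[OF i Bochner_Integration.integrable_sum[OF si]])
    fix w
    have "V N e w x * (1 - G N k0 k1 w x) \<le> V N e w x * (\<Sum>k\<in>{k0..k1}. sk N k w x)"
      by (rule mult_left_mono[OF G_defect V_nonneg])
    then show "V N e w x - U N k0 e k1 w x \<le> (\<Sum>k\<in>{k0..k1}. V N e w x * sk N k w x)"
      unfolding U_def sum_distrib_left right_diff_distrib by simp
  qed simp
  also have "\<dots> = (\<Sum>k\<in>{k0..k1}. \<integral>w. V N e w x * sk N k w x \<partial>PN N)" by (rule Bochner_Integration.integral_sum[OF si])
  finally show "(\<integral>w. V N e w x - U N k0 e k1 w x \<partial>PN N) \<le> (\<Sum>k\<in>{k0..k1}. \<integral>w. V N e w x * sk N k w x \<partial>PN N)" .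
qed

text \<open>(A5) at exponent \<open>la\<close> bounds the cost of scale k by a multiple of q ^ k,
  since la (la + 2\<gamma>) / 2 - la \<alpha> = - la^2 / 2, uniformly in x and in all scales down to
  \<open>KN N\<close>.\<close>

lemma first_moment_unmollified:
  "\<exists>C\<ge>0. \<forall>k0. dy k0 \<le> \<eta>0 \<longrightarrow> (\<forall>\<^sub>F N in sequentially. \<forall>x\<in>K. (\<integral>w. V N 0 w x - U N k0 0 (KN N) w x \<partial>PN N) \<le> C * q ^ k0)"
proof -
  have "\<exists>C. \<forall>\<^sub>F N in sequentially.
     \<forall>e x. \<epsilon>N N \<le> e \<and> e \<le> 1 \<and> x \<in> K \<longrightarrow>
       (let r = EN PN N (\<lambda>w. exp (\<gamma> * XN N w x + la * X N e w x))
                / EN PN N (\<lambda>w. exp (\<gamma> * XN N w x))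
        in 0 \<le> r \<and> r \<le> C * e powr (-(la * (la + 2 * \<gamma>) / 2)))"
    by (rule a5[unfolded A5_def, THEN spec[of _ la], THEN spec[of _ K], THEN mp]) (use K_compact K_Om in auto)
  then obtain C5 where C5: "\<forall>\<^sub>F N in sequentially.
     \<forall>e x. \<epsilon>N N \<le> e \<and> e \<le> 1 \<and> x \<in> K \<longrightarrow>
       (let r = EN PN N (\<lambda>w. exp (\<gamma> * XN N w x + la * X N e w x))
                / EN PN N (\<lambda>w. exp (\<gamma> * XN N w x))
        in 0 \<le> r \<and> r \<le> C5 * e powr (-(la * (la + 2 * \<gamma>) / 2)))"
    by (rule exE)
  define D where "D = max C5 0"
  have D: "0 \<le> D" "C5 \<le> D" by (simp_all add: D_def)
  define C where "C = D / (1 - q)"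
  have C0: "0 \<le> C" unfolding C_def using D q01 by simp
  have "\<forall>\<^sub>F N in sequentially. \<forall>x\<in>K. (\<integral>w. V N 0 w x - U N k0 0 (KN N) w x \<partial>PN N) \<le> C * q ^ k0" if k0: "dy k0 \<le> \<eta>0" for k0
    using C5 KN_eventually[of 0]
  proof eventually_elim
    case (elim N)
    show ?case
    proof
      fix x assume x: "x \<in> K"
      have e: "0 \<le> (0::real)" "0 \<le> \<eta>0" using eta0 by auto
      have tm: "(\<integral>w. V N 0 w x * sk N k w x \<partial>PN N) \<le> D * q ^ k" if k: "k \<in> {k0..KN N}" for k
      proof -
        have ek: "\<epsilon>N N \<le> dy k" using elim(2) dy_mono[of k "KN N"] k by simp
        have dk: "dy k \<le> \<eta>0" using dy_mono[of k0 k] k k0 by simp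
        define r where "r = (\<integral>w. exp (\<gamma> * X N 0 w x + la * X N (dy k) w x) \<partial>PN N) / (\<integral>w. exp (\<gamma> * X N 0 w x) \<partial>PN N)"
        have "r \<le> C5 * dy k powr (-(la * (la + 2 * \<gamma>) / 2))"
          using elim(1)[rule_format, of "dy k" x] ek dy_le1[of k] x unfolding Let_def EN_def r_def X_zero by simp
        also have "\<dots> \<le> D * dy k powr (-(la * (la + 2 * \<gamma>) / 2))" using D by (intro mult_right_mono) auto
        also have "dy k powr (-(la * (la + 2 * \<gamma>) / 2)) = exp (la * (la + 2 * \<gamma>) / 2 * lg k)" unfolding dy_exp powr_def by simp
        finally have r: "r \<le> D * exp (la * (la + 2 * \<gamma>) / 2 * lg k)" .
        have "(\<integral>w. V N 0 w x * sk N k w x \<partial>PN N) = r * exp (- (la * \<alpha> * lg k))"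
          unfolding V_sk_expectation(2)[OF x e dk] r_def ..
        also have "\<dots> \<le> D * exp (la * (la + 2 * \<gamma>) / 2 * lg k) * exp (- (la * \<alpha> * lg k))" using r by (intro mult_right_mono) auto
        also have "\<dots> = D * exp (la * (la + 2 * \<gamma>) / 2 * lg k + - (la * \<alpha> * lg k))" by (simp only: exp_add mult.assoc)
        also have "la * (la + 2 * \<gamma>) / 2 * lg k + - (la * \<alpha> * lg k) = - (la\<^sup>2 / 2) * lg k"
          unfolding la_def by (simp add: power2_eq_square field_simps)
        finally show ?thesis unfolding q_power .
      qed
      have "(\<integral>w. V N 0 w x - U N k0 0 (KN N) w x \<partial>PN N) \<le> (\<Sum>k\<in>{k0..KN N}. \<integral>w. V N 0 w x * sk N k w x \<partial>PN N)"
        by (rule V_defect_le(2)[OF x e k0])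
      also have "\<dots> \<le> (\<Sum>k\<in>{k0..KN N}. D * q ^ k)" by (rule sum_mono[OF tm])
      also have "\<dots> = D * (\<Sum>k\<in>{k0..KN N}. q ^ k)" by (simp only: sum_distrib_left)
      also have "\<dots> \<le> D * (q ^ k0 / (1 - q))" by (intro mult_left_mono geometric_tail D) auto
      finally show "(\<integral>w. V N 0 w x - U N k0 0 (KN N) w x \<partial>PN N) \<le> C * q ^ k0" unfolding C_def by simp
    qed
  qed
  then show ?thesis using C0 by (intro exI[of _ C]) simp
qed

text \<open>For fixed M only finitely many truncation factors occur, so the exponential moments may
  be replaced by their Gaussian limits. The constant does not depend on M because the covariance of
  scales \<open>dy M\<close> and \<open>dy k\<close> at x is at most lg k + cK.\<close>

lemma first_moment_mollified:
  "\<exists>C\<ge>0. \<forall>k0 M x \<delta>. dy k0 \<le> \<eta>0 \<longrightarrow> k0 \<le> M \<longrightarrow> x \<in> K \<longrightarrow> 0 < \<delta> \<longrightarrow>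
     (\<forall>\<^sub>F N in sequentially. (\<integral>w. V N (dy M) w x - U N k0 (dy M) M w x \<partial>PN N) < C * q ^ k0 + \<delta>)"
proof -
  define D where "D = exp ((la\<^sup>2 / 2 + la * \<gamma>) * cK)"
  define C where "C = D / (1 - q)"
  have D: "0 \<le> D" by (simp add: D_def)
  have C0: "0 \<le> C" unfolding C_def using D q01 by simp
  have "\<forall>\<^sub>F N in sequentially. (\<integral>w. V N (dy M) w x - U N k0 (dy M) M w x \<partial>PN N) < C * q ^ k0 + \<delta>"
    if k0: "dy k0 \<le> \<eta>0" and M: "k0 \<le> M" and x: "x \<in> K" and \<delta>: "0 < \<delta>" for k0 M x \<delta>
  proof -
    have dM: "dy M \<le> \<eta>0" using dy_mono[OF M] k0 by linarith
    have e: "0 \<le> dy M" "dy M \<le> \<eta>0" using dM dy_pos[of M] by auto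
    define c where "c k = exp ((\<gamma>\<^sup>2 * Cv (dy M) x (dy M) x + 2 * \<gamma> * la * Cv (dy M) x (dy k) x + la\<^sup>2 * Cv (dy k) x (dy k) x) / 2) / exp (\<gamma>\<^sup>2 * Cv (dy M) x (dy M) x / 2) * exp (- (la * \<alpha> * lg k))" for k
    have dk: "dy k \<le> \<eta>0" if "k \<in> {k0..M}" for k using dy_mono[of k0 k] that k0 by simp
    have lim: "(\<lambda>N. \<integral>w. V N (dy M) w x * sk N k w x \<partial>PN N) \<longlonglongrightarrow> c k" if "k \<in> {k0..M}" for k
      unfolding V_sk_expectation(2)[OF x e dk[OF that]] c_def
      by (intro tendsto_mult tendsto_divide tendsto_const X_exp_moment_tendsto1 X_exp_moment_tendsto2 x dy_pos dM dk[OF that]) simp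
    have cb: "c k \<le> D * q ^ k" if k: "k \<in> {k0..M}" for k
    proof -
      have 1: "Cv (dy M) x (dy k) x \<le> lg k + cK"
        using cov_upper[OF x x e, of "dy k" "dy k"] dy_pos[of k] dk[OF k] by (simp add: ln_dy)
      have 2: "Cv (dy k) x (dy k) x \<le> lg k + cK"
        using cov_upper[OF x x, of "dy k" "dy k" "dy k"] dy_pos[of k] dk[OF k] by (simp add: ln_dy)
      have "c k = exp (la * \<gamma> * Cv (dy M) x (dy k) x + la\<^sup>2 / 2 * Cv (dy k) x (dy k) x + - (la * \<alpha> * lg k))"
        unfolding c_def by (simp add: exp_diff[symmetric] exp_add[symmetric] add_divide_distrib algebra_simps)
      also have "\<dots> \<le> exp (la * \<gamma> * (lg k + cK) + la\<^sup>2 / 2 * (lg k + cK) + - (la * \<alpha> * lg k))"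
      proof -
        have "la * \<gamma> * Cv (dy M) x (dy k) x \<le> la * \<gamma> * (lg k + cK)" using la_pos gamma by (intro mult_left_mono 1) auto
        moreover have "la\<^sup>2 / 2 * Cv (dy k) x (dy k) x \<le> la\<^sup>2 / 2 * (lg k + cK)" by (intro mult_left_mono 2) auto
        ultimately show ?thesis by simp
      qed
      also have "la * \<gamma> * (lg k + cK) + la\<^sup>2 / 2 * (lg k + cK) + - (la * \<alpha> * lg k) = (la\<^sup>2 / 2 + la * \<gamma>) * cK + - (la\<^sup>2 / 2) * lg k"
        unfolding la_def by (simp add: power2_eq_square field_simps)
      finally show ?thesis unfolding D_def q_power exp_add .
    qed
    have "(\<lambda>N. \<Sum>k\<in>{k0..M}. \<integral>w. V N (dy M) w x * sk N k w x \<partial>PN N) \<longlonglongrightarrow> (\<Sum>k\<in>{k0..M}. c k)" by (rule tendsto_sum) (rule lim)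
    moreover have "(\<Sum>k\<in>{k0..M}. c k) < C * q ^ k0 + \<delta>"
    proof -
      have "(\<Sum>k\<in>{k0..M}. c k) \<le> (\<Sum>k\<in>{k0..M}. D * q ^ k)" by (rule sum_mono[OF cb])
      also have "\<dots> = D * (\<Sum>k\<in>{k0..M}. q ^ k)" by (simp only: sum_distrib_left)
      also have "\<dots> \<le> D * (q ^ k0 / (1 - q))" by (intro mult_left_mono geometric_tail D) auto
      finally show ?thesis using \<delta> unfolding C_def by simp
    qed
    ultimately have "\<forall>\<^sub>F N in sequentially. (\<Sum>k\<in>{k0..M}. \<integral>w. V N (dy M) w x * sk N k w x \<partial>PN N) < C * q ^ k0 + \<delta>" by (rule order_tendstoD)
    then show ?thesis
    proof eventually_elim
      case (elim N)
      then show ?case using V_defect_le(2)[OF x e k0, of N M] by linarith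
    qed
  qed
  then show ?thesis using C0 by (intro exI[of _ C]) simp
qed

text \<open>The factors of \<open>G N k0 m w x * G N k0 m w y\<close> are indexed by \<open>j\<close>: the scale is \<open>k0 + j div 2\<close>
  and the point is \<open>x\<close> for even and \<open>y\<close> for odd \<open>j\<close>.\<close>

definition pz :: "'a \<Rightarrow> 'a \<Rightarrow> nat \<Rightarrow> 'a" where "pz x y j = (if even j then x else y)"

definition tr :: "nat \<Rightarrow> nat \<Rightarrow> real \<Rightarrow> complex" where
  "tr k0 j v = complex_of_real (exp (- exp (la * (v - \<alpha> * lg (k0 + j div 2)))))"

text \<open>The limit of \<open>J\<close> as N tends to infinity: the limit of W times the Gaussian
  expectation of the truncation factors, the field being shifted by the mean that the two-point tilt
  creates.\<close>

definition jm :: "nat \<Rightarrow> nat \<Rightarrow> real \<Rightarrow> real \<Rightarrow> 'a \<Rightarrow> 'a \<Rightarrow> real" where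
  "jm k0 m e e' x y = exp (\<gamma>\<^sup>2 * Cv e x e' y) * Re (\<integral>w. (\<Prod>j<2 * (Suc m - k0). tr k0 j
      (\<gamma> * (Cv e x (dy (k0 + j div 2)) (pz x y j) + Cv e' y (dy (k0 + j div 2)) (pz x y j)) + GX (dy (k0 + j div 2)) w (pz x y j))) \<partial>Pm)"

lemma tr_props: "isCont (tr k0 j) v" "norm (tr k0 j v) \<le> 1"
  unfolding tr_def by (intro continuous_intros) simp

lemma G_prod:
  assumes "k0 \<le> m"
  shows "(\<Prod>j<2 * (Suc m - k0). tr k0 j (X N (dy (k0 + j div 2)) w (pz x y j))) = complex_of_real (G N k0 m w x * G N k0 m w y)"
proof -
  have e: "G N k0 m w z = (\<Prod>i<Suc m - k0. exp (- sk N (k0 + i) w z))" for z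
    unfolding G_def sum_atLeastAtMost_shift[OF assms] by (subst exp_sum[symmetric]) (simp_all add: sum_negf)
  show ?thesis
    unfolding prod_lessThan_double e prod.distrib[symmetric] of_real_prod
    by (rule prod.cong) (simp_all add: tr_def pz_def sk_def)
qed

text \<open>\<open>J\<close> is W times a tilted expectation of a product of bounded continuous
  functions of single field values.\<close>

lemma J_limit:
  assumes k0: "dy k0 \<le> \<eta>0" "k0 \<le> m" and e: "0 \<le> e" "e \<le> \<eta>0" "0 \<le> e'" "e' \<le> \<eta>0" and xy: "x \<in> K" "y \<in> K" "x \<noteq> y"
  shows "(\<lambda>N. J N k0 e m e' m x y) \<longlonglongrightarrow> jm k0 m e e' x y"
proof -
  let ?n = "2 * (Suc m - k0)" and ?h = "\<lambda>j. dy (k0 + j div 2)"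
  have z: "\<forall>j<?n. pz x y j \<in> K" using xy by (simp add: pz_def)
  have h: "\<forall>j<?n. 0 < ?h j" "\<forall>j<?n. ?h j \<le> \<eta>0"
    by (auto simp: dy_pos intro!: order_trans[OF dy_mono k0(1)])
  have lim: "(\<lambda>N. (\<integral>w. exp (\<gamma> * X N e w x + \<gamma> * X N e' w y) *\<^sub>R (\<Prod>j<?n. tr k0 j (X N (?h j) w (pz x y j))) \<partial>PN N)
       /\<^sub>R (\<integral>w. exp (\<gamma> * X N e w x + \<gamma> * X N e' w y) \<partial>PN N))
     \<longlonglongrightarrow> (\<integral>w. (\<Prod>j<?n. tr k0 j (\<gamma> * (Cv e x (?h j) (pz x y j) + Cv e' y (?h j) (pz x y j)) + GX (?h j) w (pz x y j))) \<partial>Pm)"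
    by (rule tilted_product_tendsto[OF xy e z h tr_props])
  have eq: "J N k0 e m e' m x y = W N e e' x y * Re ((\<integral>w. exp (\<gamma> * X N e w x + \<gamma> * X N e' w y) *\<^sub>R (\<Prod>j<?n. tr k0 j (X N (?h j) w (pz x y j))) \<partial>PN N)
       /\<^sub>R (\<integral>w. exp (\<gamma> * X N e w x + \<gamma> * X N e' w y) \<partial>PN N))" for N
  proof -
    define I where "I = (\<integral>w. exp (\<gamma> * X N e w x + \<gamma> * X N e' w y) * (G N k0 m w x * G N k0 m w y) \<partial>PN N)"
    define P where "P = (\<integral>w. exp (\<gamma> * X N e w x + \<gamma> * X N e' w y) \<partial>PN N)"
    have P: "0 < P" unfolding P_def by (rule pair_pos[OF xy(1,2) e])
    have "(\<integral>w. exp (\<gamma> * X N e w x + \<gamma> * X N e' w y) *\<^sub>R complex_of_real (G N k0 m w x * G N k0 m w y) \<partial>PN N) = complex_of_real I"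
      unfolding I_def integral_complex_of_real[symmetric] by (simp only: scaleR_conv_of_real of_real_mult)
    then have r: "W N e e' x y * Re ((\<integral>w. exp (\<gamma> * X N e w x + \<gamma> * X N e' w y) *\<^sub>R (\<Prod>j<?n. tr k0 j (X N (?h j) w (pz x y j))) \<partial>PN N)
       /\<^sub>R P) = W N e e' x y * (I / P)"
      unfolding G_prod[OF k0(2)] by (simp add: divide_inverse mult.commute)
    have "J N k0 e m e' m x y = (\<integral>w. exp (\<gamma> * X N e w x + \<gamma> * X N e' w y) * (G N k0 m w x * G N k0 m w y) / (mN N e x * mN N e' y) \<partial>PN N)"
      unfolding J_def U_def V_def exp_add by (intro Bochner_Integration.integral_cong refl) simp
    also have "\<dots> = I / (mN N e x * mN N e' y)" unfolding I_def by (rule integral_divide_zero)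
    also have "\<dots> = W N e e' x y * (I / P)" unfolding WN_def EN_def mN_def[symmetric] P_def[symmetric] using P by simp
    finally have Q: "J N k0 e m e' m x y = W N e e' x y * (I / P)" .
    show ?thesis by (rule trans[OF Q[unfolded P_def] r[unfolded P_def, symmetric]])
  qed
  show ?thesis unfolding eq jm_def by (intro tendsto_mult tendsto_Re lim W_tendsto xy e)
qed

lemma cov_limit:
  assumes xy: "x \<in> K" "y \<in> K" "x \<noteq> y" and ab: "a = (\<lambda>_. 0) \<or> a = dy" "b = (\<lambda>_. 0) \<or> b = dy"
  shows "(\<lambda>M. Cv (a M) x (b M) y) \<longlonglongrightarrow> Cv 0 x 0 y"
proof -
  have S: "Cv 0 x 0 y = Sig g x y" by (simp add: cov_def)
  have 1: "(\<lambda>M. Cv 0 x (dy M) y) \<longlonglongrightarrow> Sig g x y" "(\<lambda>M. Cv (dy M) x (dy M) y) \<longlonglongrightarrow> Sig g x y"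
    by (rule cov_tendsto_Sig[OF xy dy_pos dy_tendsto])+
  have 2: "(\<lambda>M. Cv 0 y (dy M) x) \<longlonglongrightarrow> Sig g y x"
    by (rule cov_tendsto_Sig(1)[OF xy(2,1) not_sym[OF xy(3)] dy_pos dy_tendsto])
  have ev: "\<forall>\<^sub>F M in sequentially. Cv 0 y (dy M) x = Cv (dy M) x 0 y"
    using order_tendstoD(2)[OF dy_tendsto eta0(1)]
  proof eventually_elim
    case (elim M)
    show ?case by (rule cov_sym[OF xy(2,1)]) (use elim eta0 dy_pos[of M] in auto)
  qed
  have "Sig g y x = Sig g x y" by (rule Sig_symmetric[OF subsetD[OF K_Om xy(2)] subsetD[OF K_Om xy(1)]])
  then have 3: "(\<lambda>M. Cv (dy M) x 0 y) \<longlonglongrightarrow> Sig g x y" using Lim_transform_eventually[OF 2 ev] by simp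
  from ab show ?thesis unfolding S
    by (elim disjE) (simp_all add: 1 3, simp add: cov_def)
qed

text \<open>The sequences a and b range over 0 and \<open>dy\<close> to cover the four terms of the
  expanded square. They enter through the covariance in front and through the shifts of the mean;
  the truncation factors are bounded by 1, so dominated convergence applies.\<close>

lemma jm_limit:
  assumes k0: "dy k0 \<le> \<eta>0" and xy: "x \<in> K" "y \<in> K" "x \<noteq> y" and ab: "a = (\<lambda>_. 0) \<or> a = dy" "b = (\<lambda>_. 0) \<or> b = dy"
  shows "(\<lambda>M. jm k0 m (a M) (b M) x y) \<longlonglongrightarrow> jm k0 m 0 0 x y"
proof -
  have c1: "(\<lambda>M. Cv (a' M) u (dy (k0 + i)) z) \<longlonglongrightarrow> Cv 0 u (dy (k0 + i)) z" if "a' = (\<lambda>_. 0) \<or> a' = dy" "u \<in> K" "z \<in> K" for a' u z i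
    using that(1)
  proof
    assume "a' = dy"
    moreover have "dy (k0 + i) \<le> \<eta>0" using dy_mono[of k0 "k0 + i"] k0 by simp
    ultimately show ?thesis using cov_tendsto_eps_left[OF that(2,3) dy_pos _ dy_pos dy_tendsto] by simp
  qed simp
  have pzK: "pz x y j \<in> K" for j using xy by (simp add: pz_def)
  interpret Pm: prob_space Pm by (rule P_prob)
  have trm[measurable]: "tr k0 j \<in> borel_measurable borel" for j
    by (rule borel_measurable_continuous_onI) (simp add: continuous_at_imp_continuous_on tr_props)
  have "(\<lambda>M. \<integral>w. (\<Prod>j<2 * (Suc m - k0). tr k0 j
      (\<gamma> * (Cv (a M) x (dy (k0 + j div 2)) (pz x y j) + Cv (b M) y (dy (k0 + j div 2)) (pz x y j)) + GX (dy (k0 + j div 2)) w (pz x y j))) \<partial>Pm)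
     \<longlonglongrightarrow> (\<integral>w. (\<Prod>j<2 * (Suc m - k0). tr k0 j
      (\<gamma> * (Cv 0 x (dy (k0 + j div 2)) (pz x y j) + Cv 0 y (dy (k0 + j div 2)) (pz x y j)) + GX (dy (k0 + j div 2)) w (pz x y j))) \<partial>Pm)"
  proof (rule integral_dominated_convergence[where w="\<lambda>_. 1"])
    have gm: "(\<lambda>w. tr k0 j (c + GX (dy (k0 + j div 2)) w (pz x y j))) \<in> borel_measurable Pm" for c j
      by (rule measurable_compose[OF _ trm]) (intro borel_measurable_add borel_measurable_const GX_meas dy_pos)
    show "(\<lambda>w. \<Prod>j<2 * (Suc m - k0). tr k0 j
      (\<gamma> * (Cv 0 x (dy (k0 + j div 2)) (pz x y j) + Cv 0 y (dy (k0 + j div 2)) (pz x y j)) + GX (dy (k0 + j div 2)) w (pz x y j))) \<in> borel_measurable Pm"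
      by (intro borel_measurable_prod gm)
    show "(\<lambda>w. \<Prod>j<2 * (Suc m - k0). tr k0 j
      (\<gamma> * (Cv (a M) x (dy (k0 + j div 2)) (pz x y j) + Cv (b M) y (dy (k0 + j div 2)) (pz x y j)) + GX (dy (k0 + j div 2)) w (pz x y j))) \<in> borel_measurable Pm" for M
      by (intro borel_measurable_prod gm)
    show "AE w in Pm. (\<lambda>M. \<Prod>j<2 * (Suc m - k0). tr k0 j
      (\<gamma> * (Cv (a M) x (dy (k0 + j div 2)) (pz x y j) + Cv (b M) y (dy (k0 + j div 2)) (pz x y j)) + GX (dy (k0 + j div 2)) w (pz x y j)))
      \<longlonglongrightarrow> (\<Prod>j<2 * (Suc m - k0). tr k0 j
      (\<gamma> * (Cv 0 x (dy (k0 + j div 2)) (pz x y j) + Cv 0 y (dy (k0 + j div 2)) (pz x y j)) + GX (dy (k0 + j div 2)) w (pz x y j)))"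
      by (intro AE_I2 tendsto_prod isCont_tendsto_compose[OF tr_props(1)] tendsto_intros c1 ab xy pzK)
    show "AE w in Pm. norm (\<Prod>j<2 * (Suc m - k0). tr k0 j
      (\<gamma> * (Cv (a M) x (dy (k0 + j div 2)) (pz x y j) + Cv (b M) y (dy (k0 + j div 2)) (pz x y j)) + GX (dy (k0 + j div 2)) w (pz x y j))) \<le> 1" for M
      unfolding prod_norm[symmetric] by (intro AE_I2 prod_le_1 conjI norm_ge_zero tr_props)
  qed simp
  then show ?thesis unfolding jm_def by (intro tendsto_mult tendsto_exp tendsto_const tendsto_Re cov_limit xy ab)
qed

end

section \<open>The second moment of the truncated difference\<close>

abbreviation (input) "P2 \<equiv> (lborel \<Otimes>\<^sub>M lborel :: ('a::euclidean_space \<times> 'a) measure)"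

text \<open>\<open>s_less\<close> makes |x - y|^(-s) integrable over pairs, and \<open>theta\<close>
  lets the truncation gain below \<open>\<epsilon>N\<close> beat the growth allowed by (A8). Both
  ask for a large \<open>be\<close>, while \<alpha> > \<gamma> asks for \<open>be\<close> <
  \<gamma>.\<close>

locale gmc_convergence = gmc_thick \<phi> R \<Omega> g K \<eta>0 Pm Xg PN XN \<epsilon>N \<gamma> f \<alpha>
  for \<phi> :: "'a::euclidean_space \<Rightarrow> real" and R \<Omega> g K \<eta>0 and Pm :: "'w measure" and Xg and PN :: "nat \<Rightarrow> 'b measure" and XN \<epsilon>N \<gamma> f \<alpha> +
  fixes C8 \<theta> :: real
  assumes s_less: "s < real DIM('a)" and theta: "\<theta> < be\<^sup>2 / 2" and C8: "0 \<le> C8"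
    and diagonal: "\<forall>\<^sub>F N in sequentially. (\<integral>\<^sup>+p. indicator (K \<times> K) p * indicator {p. dist (fst p) (snd p) \<le> \<epsilon>N N} p
        * ennreal (W N 0 0 (fst p) (snd p)) \<partial>P2) \<le> ennreal (C8 * \<epsilon>N N powr (- \<theta>))"
begin

definition ff :: "'a \<times> 'a \<Rightarrow> real" where "ff p = \<bar>f (fst p)\<bar> * \<bar>f (snd p)\<bar>"

lemma ff_measurable[measurable]: "ff \<in> borel_measurable P2"
  unfolding ff_def by measurable

lemma ff_nonneg: "0 \<le> ff p" by (simp add: ff_def)

lemma ff_zero: "p \<notin> K \<times> K \<Longrightarrow> ff p = 0"
  using f_zero[of "fst p"] f_zero[of "snd p"] by (auto simp: ff_def mem_Times_iff)

lemma K2_measurable[measurable]: "K \<times> K \<in> sets P2"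
  by (rule pair_measureI) simp_all

lemma ff_integrable:
  assumes w: "integrable P2 (\<lambda>p. indicator (K \<times> K) p * w p)" and h: "h \<in> borel_measurable P2"
    and le: "\<And>p. p \<in> K \<times> K \<Longrightarrow> \<bar>h p\<bar> \<le> w p"
  shows "integrable P2 (\<lambda>p. ff p * h p)"
proof -
  obtain B where B: "0 < B" "\<And>x. \<bar>f x\<bar> \<le> B" using f_bounded by blast
  show ?thesis
  proof (rule Bochner_Integration.integrable_bound[OF integrable_mult_right[OF w, of "B * B"]])
    show "(\<lambda>p. ff p * h p) \<in> borel_measurable P2" using h by measurable
    show "AE p in P2. norm (ff p * h p) \<le> norm (B * B * (indicator (K \<times> K) p * w p))"
    proof (rule AE_I2)
      fix p
      show "norm (ff p * h p) \<le> norm (B * B * (indicator (K \<times> K) p * w p))"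
      proof (cases "p \<in> K \<times> K")
        case True
        have "ff p \<le> B * B" unfolding ff_def using B by (intro mult_mono) auto
        then have "ff p * \<bar>h p\<bar> \<le> B * B * w p" using le[OF True] ff_nonneg[of p] B(1) by (intro mult_mono) auto
        moreover have "\<bar>ff p * h p\<bar> = ff p * \<bar>h p\<bar>" using ff_nonneg[of p] by (simp add: abs_mult)
        ultimately show ?thesis using True by simp
      qed (simp add: ff_zero)
    qed
  qed
qed

lemma K2_integrable: "integrable P2 (\<lambda>p. indicator (K \<times> K) p * (c::real))"
proof -
  have "emeasure P2 (K \<times> K) < \<infinity>"
    using K_finite by (simp add: lborel.emeasure_pair_measure_Times ennreal_mult_less_top)
  then show ?thesis by (intro integrable_mult_left integrable_real_indicator) auto
qed

lemma kernel_integrable: "integrable P2 (\<lambda>p. indicator (K \<times> K) p * (c + c' * norm (fst p - snd p) powr (- s)))"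
proof -
  have "integrable P2 (\<lambda>(u, v). indicator K u * indicator K v * norm (u - v) powr (- s))"
    by (rule integrable_pair_powr[OF K_compact]) (use s_pos s_less in auto)
  then have "integrable P2 (\<lambda>p. indicator (K \<times> K) p * c + c' * (indicator K (fst p) * indicator K (snd p) * norm (fst p - snd p) powr (- s)))"
    unfolding case_prod_beta' by (intro Bochner_Integration.integrable_add K2_integrable integrable_mult_right)
  moreover have "indicator (K \<times> K) p = (indicator K (fst p) * indicator K (snd p) :: real)" for p
    by (simp add: indicator_def mem_Times_iff)
  ultimately show ?thesis by (simp only: distrib_left mult_ac)
qed

lemma J_measurable[measurable]: "(\<lambda>p. J N k0 e k1 e' k2 (fst p) (snd p)) \<in> borel_measurable P2"
proof -
  interpret prob_space "PN N" by (rule PN_prob)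
  show ?thesis unfolding J_def by measurable
qed

lemma W_measurable[measurable]: "(\<lambda>p. W N e e' (fst p) (snd p)) \<in> borel_measurable P2"
proof -
  interpret prob_space "PN N" by (rule PN_prob)
  show ?thesis unfolding WN_def EN_def by measurable
qed

text \<open>(A8) covers distances up to \<open>\<epsilon>N N\<close>; beyond, the power in (A3) is
  at most its value at \<open>\<epsilon>N N\<close>. Both hold for large N only.\<close>

lemma W00_integrable: "\<forall>\<^sub>F N in sequentially. integrable P2 (\<lambda>p. indicator (K \<times> K) p * W N 0 0 (fst p) (snd p))"
proof -
  have KK: "compact (K \<times> K)" "K \<times> K \<subseteq> \<Omega> \<times> \<Omega>" using K_compact K_Om by (auto intro: compact_Times)
  obtain C3 where C3: "\<forall>\<^sub>F N in sequentially. \<forall>(x,y)\<in>K \<times> K. dist x y \<ge> \<epsilon>N N \<longrightarrow>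
       0 \<le> W N 0 0 x y \<and> W N 0 0 x y \<le> C3 * dist x y powr (-(\<gamma>^2))"
    using a3[unfolded A3_def, THEN spec[of _ "K \<times> K"], THEN mp, OF conjI[OF KK]] by (elim exE)
  show ?thesis
    using C3 diagonal
  proof eventually_elim
    case (elim N)
    let ?i = "indicator (K \<times> K) :: _ \<Rightarrow> real" and ?W = "\<lambda>p. W N 0 0 (fst p) (snd p)"
    have W0: "0 \<le> ?W p" if "p \<in> K \<times> K" for p using that eta0 by (intro W_nonneg) auto
    have 1: "integrable P2 (\<lambda>p. ?i p * (indicator {p. dist (fst p) (snd p) \<le> \<epsilon>N N} p * ?W p))"
    proof (rule integrableI_bounded)
      have "(\<integral>\<^sup>+p. ennreal (norm (?i p * (indicator {p. dist (fst p) (snd p) \<le> \<epsilon>N N} p * ?W p))) \<partial>P2)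
        = (\<integral>\<^sup>+p. indicator (K \<times> K) p * indicator {p. dist (fst p) (snd p) \<le> \<epsilon>N N} p * ennreal (?W p) \<partial>P2)"
        by (intro nn_integral_cong) (simp add: indicator_def W0)
      also have "\<dots> < \<infinity>" using elim(2) by (simp add: le_less_trans)
      finally show "(\<integral>\<^sup>+p. ennreal (norm (?i p * (indicator {p. dist (fst p) (snd p) \<le> \<epsilon>N N} p * ?W p))) \<partial>P2) < \<infinity>" .
    qed measurable
    have 2: "integrable P2 (\<lambda>p. ?i p * (indicator {p. \<not> dist (fst p) (snd p) \<le> \<epsilon>N N} p * ?W p))"
    proof (rule Bochner_Integration.integrable_bound[OF K2_integrable[of "\<bar>C3\<bar> * \<epsilon>N N powr (-(\<gamma>^2))"]])
      show "AE p in P2. norm (?i p * (indicator {p. \<not> dist (fst p) (snd p) \<le> \<epsilon>N N} p * ?W p)) \<le> norm (?i p * (\<bar>C3\<bar> * \<epsilon>N N powr (-(\<gamma>^2))))"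
      proof (rule AE_I2)
        fix p
        show "norm (?i p * (indicator {p. \<not> dist (fst p) (snd p) \<le> \<epsilon>N N} p * ?W p)) \<le> norm (?i p * (\<bar>C3\<bar> * \<epsilon>N N powr (-(\<gamma>^2))))"
        proof (cases "p \<in> K \<times> K \<and> \<not> dist (fst p) (snd p) \<le> \<epsilon>N N")
          case True
          then have d: "\<epsilon>N N \<le> dist (fst p) (snd p)" by simp
          have "?W p \<le> C3 * dist (fst p) (snd p) powr (-(\<gamma>^2))" using bspec[OF elim(1), of p] True d by (simp add: case_prod_beta)
          also have "\<dots> \<le> \<bar>C3\<bar> * dist (fst p) (snd p) powr (-(\<gamma>^2))" by (intro mult_right_mono) auto
          also have "\<dots> \<le> \<bar>C3\<bar> * \<epsilon>N N powr (-(\<gamma>^2))" using d epsN(1)[of N] by (intro mult_left_mono powr_mono2') auto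
          finally show ?thesis using True W0[of p] by simp
        qed (auto simp: indicator_def)
      qed
    qed measurable
    have "?i p * (indicator {p. dist (fst p) (snd p) \<le> \<epsilon>N N} p * ?W p) + ?i p * (indicator {p. \<not> dist (fst p) (snd p) \<le> \<epsilon>N N} p * ?W p) = ?i p * ?W p" for p
      by (simp add: indicator_def)
    with Bochner_Integration.integrable_add[OF 1 2] show ?case by (simp only:)
  qed
qed

lemma W_mollified_bounded:
  assumes e: "0 < e" "e \<le> \<eta>0"
  obtains B where "0 \<le> B" "\<And>N x y. x \<in> K \<Longrightarrow> y \<in> K \<Longrightarrow> W N 0 e x y \<le> B" "\<And>N x y. x \<in> K \<Longrightarrow> y \<in> K \<Longrightarrow> W N e 0 x y \<le> B"
    "\<And>N x y. x \<in> K \<Longrightarrow> y \<in> K \<Longrightarrow> W N e e x y \<le> B"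
proof -
  have KO: "compact K \<and> K \<subseteq> \<Omega>" using K_compact K_Om by simp
  note A = a2[unfolded A2_def]
  obtain B1 where B1: "\<forall>N. \<forall>x\<in>K. \<forall>y\<in>K. W N 0 e x y \<le> B1"
    using A[THEN spec[of _ 0], THEN mp, OF order_refl, THEN spec[of _ e], THEN mp, OF e(1), THEN spec[of _ K], THEN mp, OF KO] by (elim exE)
  obtain B2 where B2: "\<forall>N. \<forall>x\<in>K. \<forall>y\<in>K. W N e e x y \<le> B2"
    using A[THEN spec[of _ e], THEN mp, OF less_imp_le[OF e(1)], THEN spec[of _ e], THEN mp, OF e(1), THEN spec[of _ K], THEN mp, OF KO] by (elim exE)
  \<comment> \<open>(A2) wants the second scale positive; the scales (e, 0) are reached by
    symmetry.\<close>
  have sym: "W N e 0 x y = W N 0 e y x" for N x y unfolding WN_def by (simp only: add.commute mult.commute)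
  show ?thesis
  proof (rule that[of "max 0 (max B1 B2)"])
    show "W N 0 e x y \<le> max 0 (max B1 B2)" if "x \<in> K" "y \<in> K" for N x y using B1 that by (auto simp: le_max_iff_disj)
    show "W N e 0 x y \<le> max 0 (max B1 B2)" if "x \<in> K" "y \<in> K" for N x y unfolding sym using B1 that by (auto simp: le_max_iff_disj)
    show "W N e e x y \<le> max 0 (max B1 B2)" if "x \<in> K" "y \<in> K" for N x y using B2 that by (auto simp: le_max_iff_disj)
  qed simp
qed

definition Df :: "nat \<Rightarrow> nat \<Rightarrow> nat \<Rightarrow> 'b \<Rightarrow> 'a \<Rightarrow> real" where
  "Df N k0 M w x = U N k0 0 (KN N) w x - U N k0 (dy M) M w x"

definition HN :: "nat \<Rightarrow> nat \<Rightarrow> nat \<Rightarrow> 'a \<Rightarrow> 'a \<Rightarrow> real" where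
  "HN N k0 M x y = J N k0 0 (KN N) 0 (KN N) x y - J N k0 0 (KN N) (dy M) M x y - J N k0 (dy M) M 0 (KN N) x y + J N k0 (dy M) M (dy M) M x y"

lemma Df_measurable[measurable (raw)]:
  assumes [measurable]: "h \<in> M' \<rightarrow>\<^sub>M PN N" "l \<in> M' \<rightarrow>\<^sub>M borel"
  shows "(\<lambda>w. Df N k0 M (h w) (l w)) \<in> borel_measurable M'"
  unfolding Df_def by measurable

lemma Df_expectation:
  assumes xy: "x \<in> K" "y \<in> K" and M: "dy M \<le> \<eta>0"
  shows "integrable (PN N) (\<lambda>w. Df N k0 M w x * Df N k0 M w y)"
    and "(\<integral>w. Df N k0 M w x * Df N k0 M w y \<partial>PN N) = HN N k0 M x y"
    and "(\<integral>w. \<bar>Df N k0 M w x * Df N k0 M w y\<bar> \<partial>PN N) \<le> W N 0 0 x y + W N 0 (dy M) x y + W N (dy M) 0 x y + W N (dy M) (dy M) x y"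
proof -
  let ?u = "\<lambda>w x. U N k0 0 (KN N) w x" and ?v = "\<lambda>w x. U N k0 (dy M) M w x"
  have e: "0 \<le> (0::real)" "0 \<le> \<eta>0" "0 \<le> dy M" "dy M \<le> \<eta>0" using M eta0 dy_pos[of M] by auto
  have i: "integrable (PN N) (\<lambda>w. ?u w x * ?u w y)" "integrable (PN N) (\<lambda>w. ?u w x * ?v w y)"
    "integrable (PN N) (\<lambda>w. ?v w x * ?u w y)" "integrable (PN N) (\<lambda>w. ?v w x * ?v w y)"
    by (rule UU_integrable[OF xy], use e in simp_all)+
  have eq: "Df N k0 M w x * Df N k0 M w y = ?u w x * ?u w y - ?u w x * ?v w y - ?v w x * ?u w y + ?v w x * ?v w y" for w
    unfolding Df_def by (simp add: algebra_simps)
  show 1: "integrable (PN N) (\<lambda>w. Df N k0 M w x * Df N k0 M w y)" unfolding eq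
    by (intro Bochner_Integration.integrable_add Bochner_Integration.integrable_diff i)
  show "(\<integral>w. Df N k0 M w x * Df N k0 M w y \<partial>PN N) = HN N k0 M x y"
    unfolding eq HN_def J_def using i by simp
  have "(\<integral>w. \<bar>Df N k0 M w x * Df N k0 M w y\<bar> \<partial>PN N) \<le> (\<integral>w. ?u w x * ?u w y + ?u w x * ?v w y + ?v w x * ?u w y + ?v w x * ?v w y \<partial>PN N)"
  proof (rule integral_mono)
    show "integrable (PN N) (\<lambda>w. \<bar>Df N k0 M w x * Df N k0 M w y\<bar>)" using 1 by (rule integrable_abs)
    show "integrable (PN N) (\<lambda>w. ?u w x * ?u w y + ?u w x * ?v w y + ?v w x * ?u w y + ?v w x * ?v w y)"
      by (intro Bochner_Integration.integrable_add i)
    fix w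
    have "0 \<le> ?u w x * ?u w y" "0 \<le> ?u w x * ?v w y" "0 \<le> ?v w x * ?u w y" "0 \<le> ?v w x * ?v w y"
      by (intro mult_nonneg_nonneg U_bounds)+
    then show "\<bar>Df N k0 M w x * Df N k0 M w y\<bar> \<le> ?u w x * ?u w y + ?u w x * ?v w y + ?v w x * ?u w y + ?v w x * ?v w y"
      unfolding eq by linarith
  qed
  also have "\<dots> = J N k0 0 (KN N) 0 (KN N) x y + J N k0 0 (KN N) (dy M) M x y + J N k0 (dy M) M 0 (KN N) x y + J N k0 (dy M) M (dy M) M x y"
    unfolding J_def using i by simp
  also have "\<dots> \<le> W N 0 0 x y + W N 0 (dy M) x y + W N (dy M) 0 x y + W N (dy M) (dy M) x y"
    by (intro add_mono J_le_W xy) (use e in simp_all)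
  finally show "(\<integral>w. \<bar>Df N k0 M w x * Df N k0 M w y\<bar> \<partial>PN N) \<le> W N 0 0 x y + W N 0 (dy M) x y + W N (dy M) 0 x y + W N (dy M) (dy M) x y" .
qed

lemma HN_measurable[measurable]: "(\<lambda>p. HN N k0 M (fst p) (snd p)) \<in> borel_measurable P2"
  unfolding HN_def by measurable

lemma HN_abs_le: "\<bar>HN N k0 M x y\<bar> \<le> J N k0 0 (KN N) 0 (KN N) x y + (J N k0 0 (KN N) (dy M) M x y + J N k0 (dy M) M 0 (KN N) x y + J N k0 (dy M) M (dy M) M x y)"
  unfolding HN_def
  using J_nonneg[of N k0 0 "KN N" 0 "KN N" x y] J_nonneg[of N k0 0 "KN N" "dy M" M x y]
    J_nonneg[of N k0 "dy M" M 0 "KN N" x y] J_nonneg[of N k0 "dy M" M "dy M" M x y] by linarith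

text \<open>Fubini on pairs of points, justified by the integrability of E |Df(x) Df(y)|. Taking the
  absolute value of \<open>HN\<close> allows bounds from different regions to be added.\<close>

lemma second_moment:
  assumes M: "dy M \<le> \<eta>0" and i: "integrable P2 (\<lambda>p. indicator (K \<times> K) p * W N 0 0 (fst p) (snd p))"
  shows "integrable (PN N) (\<lambda>w. (\<integral>x. f x * Df N k0 M w x \<partial>lborel)\<^sup>2)"
    and "integrable P2 (\<lambda>p. ff p * \<bar>HN N k0 M (fst p) (snd p)\<bar>)"
    and "(\<integral>w. (\<integral>x. f x * Df N k0 M w x \<partial>lborel)\<^sup>2 \<partial>PN N) \<le> (\<integral>p. ff p * \<bar>HN N k0 M (fst p) (snd p)\<bar> \<partial>P2)"
proof -
  interpret prob_space "PN N" by (rule PN_prob)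
  interpret S: sigma_finite_measure P2 unfolding lborel_prod by (rule sigma_finite_lborel)
  interpret Q: pair_sigma_finite P2 "PN N" by unfold_locales
  let ?D = "Df N k0 M"
  obtain B where B: "0 \<le> B" "\<And>N x y. x \<in> K \<Longrightarrow> y \<in> K \<Longrightarrow> W N 0 (dy M) x y \<le> B" "\<And>N x y. x \<in> K \<Longrightarrow> y \<in> K \<Longrightarrow> W N (dy M) 0 x y \<le> B"
    "\<And>N x y. x \<in> K \<Longrightarrow> y \<in> K \<Longrightarrow> W N (dy M) (dy M) x y \<le> B"
    by (rule W_mollified_bounded[OF dy_pos M]) (rule that)
  have "integrable P2 (\<lambda>p. indicator (K \<times> K) p * W N 0 0 (fst p) (snd p) + indicator (K \<times> K) p * (3 * B))"
    by (rule Bochner_Integration.integrable_add[OF i K2_integrable])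
  then have iB: "integrable P2 (\<lambda>p. indicator (K \<times> K) p * (W N 0 0 (fst p) (snd p) + 3 * B))" by (simp only: distrib_left)
  have bd: "(\<integral>w. \<bar>?D w (fst p) * ?D w (snd p)\<bar> \<partial>PN N) \<le> W N 0 0 (fst p) (snd p) + 3 * B" if p: "p \<in> K \<times> K" for p
  proof -
    have xy: "fst p \<in> K" "snd p \<in> K" using p by (simp_all add: mem_Times_iff)
    show ?thesis using Df_expectation(3)[OF xy M, of N k0] B(2-4)[OF xy, of N] by linarith
  qed
  have absm: "(\<lambda>p. \<integral>w. \<bar>?D w (fst p) * ?D w (snd p)\<bar> \<partial>PN N) \<in> borel_measurable P2" by measurable
  have a: "integrable P2 (\<lambda>p. ff p * (\<integral>w. \<bar>?D w (fst p) * ?D w (snd p)\<bar> \<partial>PN N))"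
  proof (rule ff_integrable[OF iB absm])
    fix p assume p: "p \<in> K \<times> K"
    have "0 \<le> (\<integral>w. \<bar>?D w (fst p) * ?D w (snd p)\<bar> \<partial>PN N)" by (rule integral_nonneg_AE) simp
    then show "\<bar>\<integral>w. \<bar>?D w (fst p) * ?D w (snd p)\<bar> \<partial>PN N\<bar> \<le> W N 0 0 (fst p) (snd p) + 3 * B" using bd[OF p] by (simp only: abs_of_nonneg)
  qed
  show h: "integrable P2 (\<lambda>p. ff p * \<bar>HN N k0 M (fst p) (snd p)\<bar>)"
  proof (rule ff_integrable[OF iB])
    fix p assume p: "p \<in> K \<times> K"
    have xy: "fst p \<in> K" "snd p \<in> K" using p by (simp_all add: mem_Times_iff)
    have "\<bar>HN N k0 M (fst p) (snd p)\<bar> \<le> (\<integral>w. \<bar>?D w (fst p) * ?D w (snd p)\<bar> \<partial>PN N)"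
      unfolding Df_expectation(2)[OF xy M, symmetric] by (rule integral_abs_bound)
    then show "\<bar>\<bar>HN N k0 M (fst p) (snd p)\<bar>\<bar> \<le> W N 0 0 (fst p) (snd p) + 3 * B" using bd[OF p] by linarith
  qed measurable
  define F where "F = (\<lambda>p w. (f (fst p) * ?D w (fst p)) * (f (snd p) * ?D w (snd p)))"
  have Fe: "F p w = (f (fst p) * f (snd p)) * (?D w (fst p) * ?D w (snd p))" for p w unfolding F_def by (simp only: mult_ac)
  have Fi: "integrable (P2 \<Otimes>\<^sub>M PN N) (case_prod F)"
  proof (rule Q.Fubini_integrable)
    show "case_prod F \<in> borel_measurable (P2 \<Otimes>\<^sub>M PN N)" unfolding F_def case_prod_beta' by measurable
    have "(\<integral>w. norm (case_prod F (p, w)) \<partial>PN N) = ff p * (\<integral>w. \<bar>?D w (fst p) * ?D w (snd p)\<bar> \<partial>PN N)" for p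
      unfolding prod.case Fe real_norm_def abs_mult[of "f (fst p) * f (snd p)"] ff_def abs_mult[of "f (fst p)"] by (rule integral_mult_right_zero)
    then show "integrable P2 (\<lambda>p. \<integral>w. norm (case_prod F (p, w)) \<partial>PN N)" using a by (simp only:)
    show "AE p in P2. integrable (PN N) (\<lambda>w. case_prod F (p, w))"
    proof (rule AE_I2)
      fix p
      show "integrable (PN N) (\<lambda>w. case_prod F (p, w))"
      proof (cases "p \<in> K \<times> K")
        case True
        then have xy: "fst p \<in> K" "snd p \<in> K" by (simp_all add: mem_Times_iff)
        show ?thesis unfolding prod.case Fe by (rule integrable_mult_right[OF Df_expectation(1)[OF xy M]])
      next
        case False
        then have "f (fst p) * f (snd p) = 0" using f_zero[of "fst p"] f_zero[of "snd p"] by (auto simp: mem_Times_iff)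
        then show ?thesis unfolding prod.case Fe by simp
      qed
    qed
  qed
  have sq: "AE w in PN N. (\<integral>p. F p w \<partial>P2) = (\<integral>x. f x * ?D w x \<partial>lborel)\<^sup>2"
    using Q.AE_integrable_snd[OF Fi]
  proof eventually_elim
    case (elim w)
    have "(\<integral>p. F p w \<partial>P2) = (\<integral>x. \<integral>y. F (x, y) w \<partial>lborel \<partial>lborel)" by (rule lborel_pair.integral_fst'[OF elim, symmetric])
    also have "\<dots> = (\<integral>x. (f x * ?D w x) * (\<integral>y. f y * ?D w y \<partial>lborel) \<partial>lborel)"
      unfolding F_def fst_conv snd_conv by (intro Bochner_Integration.integral_cong refl integral_mult_right_zero)
    also have "\<dots> = (\<integral>x. f x * ?D w x \<partial>lborel)\<^sup>2" unfolding power2_eq_square by (rule integral_mult_left_zero)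
    finally show ?case .
  qed
  have m1: "(\<lambda>w. \<integral>p. F p w \<partial>P2) \<in> borel_measurable (PN N)" using Q.integrable_snd[OF Fi] by (rule borel_measurable_integrable)
  have m2: "(\<lambda>w. (\<integral>x. f x * ?D w x \<partial>lborel)\<^sup>2) \<in> borel_measurable (PN N)" by measurable
  show "integrable (PN N) (\<lambda>w. (\<integral>x. f x * ?D w x \<partial>lborel)\<^sup>2)"
    by (rule integrable_cong_AE_imp[OF Q.integrable_snd[OF Fi] m2]) (use sq in eventually_elim, simp only:)
  have "(\<integral>w. (\<integral>x. f x * ?D w x \<partial>lborel)\<^sup>2 \<partial>PN N) = (\<integral>w. \<integral>p. F p w \<partial>P2 \<partial>PN N)"
    by (rule integral_cong_AE[OF m2 m1]) (use sq in eventually_elim, simp only:)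
  also have "\<dots> = (\<integral>p. \<integral>w. F p w \<partial>PN N \<partial>P2)" by (rule Q.Fubini_integral[OF Fi])
  also have "\<dots> \<le> (\<integral>p. ff p * \<bar>HN N k0 M (fst p) (snd p)\<bar> \<partial>P2)"
  proof (rule integral_mono[OF Q.integrable_fst[OF Fi] h])
    fix p
    have "(\<integral>w. F p w \<partial>PN N) = (f (fst p) * f (snd p)) * (\<integral>w. ?D w (fst p) * ?D w (snd p) \<partial>PN N)"
      unfolding Fe by (rule integral_mult_right_zero)
    also have "\<dots> \<le> ff p * \<bar>HN N k0 M (fst p) (snd p)\<bar>"
    proof (cases "p \<in> K \<times> K")
      case True
      then have xy: "fst p \<in> K" "snd p \<in> K" by (simp_all add: mem_Times_iff)
      show ?thesis unfolding Df_expectation(2)[OF xy M] ff_def abs_mult[symmetric] by (rule abs_ge_self)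
    next
      case False
      then have z: "f (fst p) * f (snd p) = 0" using f_zero[of "fst p"] f_zero[of "snd p"] by (auto simp: mem_Times_iff)
      show ?thesis unfolding z using ff_nonneg[of p] by simp
    qed
    finally show "(\<integral>w. F p w \<partial>PN N) \<le> ff p * \<bar>HN N k0 M (fst p) (snd p)\<bar>" .
  qed
  finally show "(\<integral>w. (\<integral>x. f x * ?D w x \<partial>lborel)\<^sup>2 \<partial>PN N) \<le> (\<integral>p. ff p * \<bar>HN N k0 M (fst p) (snd p)\<bar> \<partial>P2)" .
qed

text \<open>The four terms are bounded separately, without cancellation.
  \<open>near_mollified\<close> has the mollified field at its second point, so the term with the
  two roles reversed is treated with x and y exchanged.\<close>

lemma HN_near:
  "\<exists>C\<ge>0. \<forall>k0 M x y \<delta>. dy k0 \<le> \<eta>0 \<longrightarrow> k0 \<le> M \<longrightarrow> x \<in> K \<longrightarrow> y \<in> K \<longrightarrow> x \<noteq> y \<longrightarrow> norm (x - y) \<le> dy k0 \<longrightarrow> 0 < \<delta> \<longrightarrow>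
     (\<forall>\<^sub>F N in sequentially. \<bar>HN N k0 M x y\<bar> < C * norm (x - y) powr (- s) + \<delta>)"
proof -
  from near_mollified obtain C1 where C1: "0 \<le> C1" "\<forall>k0 e M x y k1 \<delta>. dy k0 \<le> \<eta>0 \<longrightarrow> k0 \<le> M \<longrightarrow> e = 0 \<or> e = dy M \<longrightarrow> x \<in> K \<longrightarrow> y \<in> K \<longrightarrow> x \<noteq> y \<longrightarrow> norm (x - y) \<le> dy k0 \<longrightarrow> 0 < \<delta> \<longrightarrow>
     (\<forall>\<^sub>F N in sequentially. J N k0 e (k1 N) (dy M) M x y < C1 * norm (x - y) powr (- s) + \<delta>)" by (elim exE conjE)
  from near_unmollified obtain C2 where C2: "0 \<le> C2" "\<forall>k0. dy k0 \<le> \<eta>0 \<longrightarrow> (\<forall>\<^sub>F N in sequentially. \<forall>x y. x \<in> K \<longrightarrow> y \<in> K \<longrightarrow>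
     (\<epsilon>N N \<le> norm (x - y) \<longrightarrow> norm (x - y) \<le> dy k0 \<longrightarrow> J N k0 0 (KN N) 0 (KN N) x y \<le> C2 * norm (x - y) powr (- s)) \<and>
     (norm (x - y) \<le> \<epsilon>N N \<longrightarrow> J N k0 0 (KN N) 0 (KN N) x y \<le> C2 * \<epsilon>N N powr (be\<^sup>2 / 2) * W N 0 0 x y))" by (elim exE conjE)
  have "\<forall>\<^sub>F N in sequentially. \<bar>HN N k0 M x y\<bar> < (C2 + 3 * C1) * norm (x - y) powr (- s) + \<delta>"
    if k0: "dy k0 \<le> \<eta>0" "k0 \<le> M" and xy: "x \<in> K" "y \<in> K" "x \<noteq> y" and n: "norm (x - y) \<le> dy k0" and \<delta>: "0 < \<delta>" for k0 M x y \<delta>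
  proof -
    have d3: "0 < \<delta> / 3" using \<delta> by simp
    have n': "norm (y - x) \<le> dy k0" using n by (simp only: norm_minus_commute)
    have m1: "\<forall>\<^sub>F N in sequentially. J N k0 0 (KN N) (dy M) M x y < C1 * norm (x - y) powr (- s) + \<delta> / 3"
      by (rule C1(2)[rule_format, OF k0 _ xy n d3]) simp
    have m2: "\<forall>\<^sub>F N in sequentially. J N k0 0 (KN N) (dy M) M y x < C1 * norm (y - x) powr (- s) + \<delta> / 3"
      by (rule C1(2)[rule_format, OF k0 _ xy(2,1) not_sym[OF xy(3)] n' d3]) simp
    have m3: "\<forall>\<^sub>F N in sequentially. J N k0 (dy M) M (dy M) M x y < C1 * norm (x - y) powr (- s) + \<delta> / 3"
      by (rule C1(2)[rule_format, OF k0 _ xy n d3]) simp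
    have "0 < norm (x - y)" using xy(3) by simp
    then have ev: "\<forall>\<^sub>F N in sequentially. \<epsilon>N N < norm (x - y)" by (rule order_tendstoD(2)[OF epsN(2)])
    show ?thesis
      using m1 m2 m3 ev C2(2)[rule_format, OF k0(1)]
    proof eventually_elim
      case (elim N)
      have J0: "J N k0 0 (KN N) 0 (KN N) x y \<le> C2 * norm (x - y) powr (- s)"
        by (rule elim(5)[THEN spec[of _ x], THEN spec[of _ y], THEN mp, OF xy(1), THEN mp, OF xy(2), THEN conjunct1, THEN mp, OF less_imp_le[OF elim(4)], THEN mp, OF n])
      have "J N k0 (dy M) M 0 (KN N) x y < C1 * norm (x - y) powr (- s) + \<delta> / 3"
        unfolding J_sym[of N k0 "dy M" M 0 "KN N" x y] norm_minus_commute[of x y] by (rule elim(2))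
      then show ?case using J0 elim(1,3) HN_abs_le[of N k0 M x y] unfolding distrib_right by linarith
    qed
  qed
  then show ?thesis using C1(1) C2(1) by (intro exI[of _ "C2 + 3 * C1"]) simp
qed

text \<open>The limit of \<open>JC\<close>, the four-term combination with all truncations stopped
  at depth m. For fixed m the truncation involves finitely many field values, which is what a limit
  in law can handle; \<open>far_truncation\<close> leads from m to the full depth.\<close>

definition cmb :: "nat \<Rightarrow> nat \<Rightarrow> nat \<Rightarrow> 'a \<Rightarrow> 'a \<Rightarrow> real" where
  "cmb k0 m M x y = jm k0 m 0 0 x y - jm k0 m 0 (dy M) x y - jm k0 m (dy M) 0 x y + jm k0 m (dy M) (dy M) x y"

definition JC :: "nat \<Rightarrow> nat \<Rightarrow> nat \<Rightarrow> nat \<Rightarrow> 'a \<Rightarrow> 'a \<Rightarrow> real" where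
  "JC N k0 m M x y = J N k0 0 m 0 m x y - J N k0 0 m (dy M) m x y - J N k0 (dy M) m 0 m x y + J N k0 (dy M) m (dy M) m x y"

lemma JC_tendsto:
  assumes "dy k0 \<le> \<eta>0" "k0 \<le> m" "dy M \<le> \<eta>0" "x \<in> K" "y \<in> K" "x \<noteq> y"
  shows "(\<lambda>N. JC N k0 m M x y) \<longlonglongrightarrow> cmb k0 m M x y"
proof -
  have e: "0 \<le> (0::real)" "0 \<le> \<eta>0" "0 \<le> dy M" using eta0 dy_pos[of M] by auto
  show ?thesis unfolding JC_def cmb_def by (intro tendsto_add tendsto_diff J_limit assms e)
qed

lemma exp_cov_le:
  assumes \<rho>: "0 < \<rho>" "\<rho> \<le> norm (x - y)" and "x \<in> K" "y \<in> K" "0 \<le> e" "e \<le> \<eta>0" "0 \<le> e'" "e' \<le> \<eta>0"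
  shows "exp (\<gamma>\<^sup>2 * Cv e x e' y) \<le> exp (\<gamma>\<^sup>2 * (ln (1 / \<rho>) + cK))"
proof -
  have "Cv e x e' y \<le> ln (1 / \<rho>) + cK" by (rule cov_upper) (use assms in auto)
  then show ?thesis by (simp add: mult_left_mono)
qed

text \<open>Inherited in the limit from 0 <= J <= W.\<close>

lemma jm_bounds:
  assumes k0: "dy k0 \<le> \<eta>0" "k0 \<le> m" and \<rho>: "0 < \<rho>" "\<rho> \<le> norm (x - y)" and xy: "x \<in> K" "y \<in> K" and e: "0 \<le> e" "e \<le> \<eta>0" "0 \<le> e'" "e' \<le> \<eta>0"
  shows "0 \<le> jm k0 m e e' x y" "jm k0 m e e' x y \<le> exp (\<gamma>\<^sup>2 * (ln (1 / \<rho>) + cK))"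
proof -
  have ne: "x \<noteq> y" using \<rho> by auto
  note lim = J_limit[OF k0 e xy ne]
  show "0 \<le> jm k0 m e e' x y" by (rule LIMSEQ_le_const[OF lim]) (use J_nonneg in blast)
  have "jm k0 m e e' x y \<le> exp (\<gamma>\<^sup>2 * Cv e x e' y)"
    by (rule LIMSEQ_le[OF lim W_tendsto[OF xy ne e(1,3)]]) (use J_le_W[OF xy e] in blast)
  also note exp_cov_le[OF \<rho> xy e]
  finally show "jm k0 m e e' x y \<le> exp (\<gamma>\<^sup>2 * (ln (1 / \<rho>) + cK))" .
qed

lemma cmb_bound:
  assumes k0: "dy k0 \<le> \<eta>0" "k0 \<le> m" and \<rho>: "0 < \<rho>" "\<rho> \<le> norm (x - y)" and xy: "x \<in> K" "y \<in> K" and M: "dy M \<le> \<eta>0"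
  shows "\<bar>cmb k0 m M x y\<bar> \<le> 4 * exp (\<gamma>\<^sup>2 * (ln (1 / \<rho>) + cK))"
proof -
  have e: "0 \<le> (0::real)" "0 \<le> \<eta>0" "0 \<le> dy M" using eta0 dy_pos[of M] by auto
  note b = jm_bounds[OF k0 \<rho> xy]
  show ?thesis unfolding cmb_def using b[OF e(1,2) e(1,2)] b[OF e(1,2) e(3) M] b[OF e(3) M e(1,2)] b[OF e(3) M e(3) M] by linarith
qed

text \<open>Stopping the truncation at depth m changes each term by at most C q ^ m times its
  two-point function, which is bounded in the limit; the stopped combination converges to
  \<open>cmb\<close>.\<close>

lemma HN_far:
  assumes \<rho>: "0 < \<rho>"
  shows "\<exists>C\<ge>0. \<forall>k0 m M x y \<delta>. dy k0 \<le> \<eta>0 \<longrightarrow> k0 \<le> m \<longrightarrow> m \<le> M \<longrightarrow> x \<in> K \<longrightarrow> y \<in> K \<longrightarrow> \<rho> \<le> norm (x - y) \<longrightarrow> 0 < \<delta> \<longrightarrow>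
     (\<forall>\<^sub>F N in sequentially. \<bar>HN N k0 M x y\<bar> < C * q ^ m + \<bar>cmb k0 m M x y\<bar> + \<delta>)"
proof -
  from far_truncation[OF \<rho>] obtain C where C: "0 \<le> C" "\<forall>k0 m e e' x y. dy k0 \<le> \<eta>0 \<longrightarrow> k0 \<le> m \<longrightarrow> 0 \<le> e \<longrightarrow> e \<le> \<eta>0 \<longrightarrow> 0 \<le> e' \<longrightarrow> e' \<le> \<eta>0 \<longrightarrow> x \<in> K \<longrightarrow> y \<in> K \<longrightarrow> \<rho> \<le> norm (x - y) \<longrightarrow>
     (\<forall>\<^sub>F N in sequentially. \<forall>k1 k2. m \<le> k1 \<longrightarrow> m \<le> k2 \<longrightarrow> \<epsilon>N N < dy k1 \<longrightarrow> \<epsilon>N N < dy k2 \<longrightarrow>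
        \<bar>J N k0 e k1 e' k2 x y - J N k0 e m e' m x y\<bar> \<le> W N e e' x y * (C * q ^ m))" by (elim exE conjE)
  define E where "E = exp (\<gamma>\<^sup>2 * (ln (1 / \<rho>) + cK))"
  have E: "0 \<le> E" by (simp add: E_def)
  have "\<forall>\<^sub>F N in sequentially. \<bar>HN N k0 M x y\<bar> < (4 * E * C) * q ^ m + \<bar>cmb k0 m M x y\<bar> + \<delta>"
    if k0: "dy k0 \<le> \<eta>0" and m: "k0 \<le> m" and M: "m \<le> M" and xy: "x \<in> K" "y \<in> K" and n: "\<rho> \<le> norm (x - y)" and \<delta>: "0 < \<delta>" for k0 m M x y \<delta>
  proof -
    have ne: "x \<noteq> y" using \<rho> n by auto
    have dM: "dy M \<le> \<eta>0" using dy_mono[of k0 M] m M k0 by simp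
    have e: "0 \<le> (0::real)" "0 \<le> \<eta>0" "0 \<le> dy M" using eta0 dy_pos[of M] by auto
    note tr = C(2)[rule_format, OF k0 m _ _ _ _ xy n]
    note w = W_tendsto[OF xy ne] exp_cov_le[OF \<rho> n xy]
    define T where "T N = (W N 0 0 x y + W N 0 (dy M) x y + W N (dy M) 0 x y + W N (dy M) (dy M) x y) * (C * q ^ m) + \<bar>JC N k0 m M x y\<bar>" for N
    have "T \<longlonglongrightarrow> (exp (\<gamma>\<^sup>2 * Cv 0 x 0 y) + exp (\<gamma>\<^sup>2 * Cv 0 x (dy M) y) + exp (\<gamma>\<^sup>2 * Cv (dy M) x 0 y) + exp (\<gamma>\<^sup>2 * Cv (dy M) x (dy M) y)) * (C * q ^ m) + \<bar>cmb k0 m M x y\<bar>"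
      unfolding T_def by (intro tendsto_add tendsto_mult tendsto_const tendsto_rabs JC_tendsto k0 m dM xy ne w e)
    moreover have "(exp (\<gamma>\<^sup>2 * Cv 0 x 0 y) + exp (\<gamma>\<^sup>2 * Cv 0 x (dy M) y) + exp (\<gamma>\<^sup>2 * Cv (dy M) x 0 y) + exp (\<gamma>\<^sup>2 * Cv (dy M) x (dy M) y)) * (C * q ^ m) + \<bar>cmb k0 m M x y\<bar>
      < (4 * E * C) * q ^ m + \<bar>cmb k0 m M x y\<bar> + \<delta>"
    proof -
      have "exp (\<gamma>\<^sup>2 * Cv 0 x 0 y) + exp (\<gamma>\<^sup>2 * Cv 0 x (dy M) y) + exp (\<gamma>\<^sup>2 * Cv (dy M) x 0 y) + exp (\<gamma>\<^sup>2 * Cv (dy M) x (dy M) y) \<le> 4 * E"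
        using w(2)[OF e(1,2) e(1,2)] w(2)[OF e(1,2) e(3) dM] w(2)[OF e(3) dM e(1,2)] w(2)[OF e(3) dM e(3) dM] unfolding E_def by linarith
      then have "(exp (\<gamma>\<^sup>2 * Cv 0 x 0 y) + exp (\<gamma>\<^sup>2 * Cv 0 x (dy M) y) + exp (\<gamma>\<^sup>2 * Cv (dy M) x 0 y) + exp (\<gamma>\<^sup>2 * Cv (dy M) x (dy M) y)) * (C * q ^ m) \<le> 4 * E * (C * q ^ m)"
        using C(1) q01 by (intro mult_right_mono) auto
      then show ?thesis using \<delta> by (simp only: mult.assoc)
    qed
    ultimately have T: "\<forall>\<^sub>F N in sequentially. T N < (4 * E * C) * q ^ m + \<bar>cmb k0 m M x y\<bar> + \<delta>" by (rule order_tendstoD)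
    show ?thesis
      using T tr[OF e(1,2) e(1,2)] tr[OF e(1,2) e(3) dM] tr[OF e(3) dM e(1,2)] tr[OF e(3) dM e(3) dM] KN_eventually[of M]
    proof eventually_elim
      case (elim N)
      have k: "m \<le> KN N" "\<epsilon>N N < dy (KN N)" "\<epsilon>N N < dy M" using elim(6) M epsN(1)[of N] by auto
      have 1: "\<bar>J N k0 0 (KN N) 0 (KN N) x y - J N k0 0 m 0 m x y\<bar> \<le> W N 0 0 x y * (C * q ^ m)"
        by (rule elim(2)[rule_format, OF k(1,1,2,2)])
      have 2: "\<bar>J N k0 0 (KN N) (dy M) M x y - J N k0 0 m (dy M) m x y\<bar> \<le> W N 0 (dy M) x y * (C * q ^ m)"
        by (rule elim(3)[rule_format, OF k(1) M k(2,3)])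
      have 3: "\<bar>J N k0 (dy M) M 0 (KN N) x y - J N k0 (dy M) m 0 m x y\<bar> \<le> W N (dy M) 0 x y * (C * q ^ m)"
        by (rule elim(4)[rule_format, OF M k(1,3,2)])
      have 4: "\<bar>J N k0 (dy M) M (dy M) M x y - J N k0 (dy M) m (dy M) m x y\<bar> \<le> W N (dy M) (dy M) x y * (C * q ^ m)"
        by (rule elim(5)[rule_format, OF M M k(3,3)])
      have "\<bar>HN N k0 M x y - JC N k0 m M x y\<bar> \<le> (W N 0 0 x y + W N 0 (dy M) x y + W N (dy M) 0 x y + W N (dy M) (dy M) x y) * (C * q ^ m)"
        using 1 2 3 4 unfolding HN_def JC_def distrib_right by linarith
      then show ?case using elim(1) unfolding T_def by linarith
    qed
  qed
  then show ?thesis using C(1) E by (intro exI[of _ "4 * E * C"]) simp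
qed

end

lemma eventually_scaled_less:
  fixes a l \<delta> :: real
  assumes a: "0 \<le> a" and h: "\<And>\<delta>. 0 < \<delta> \<Longrightarrow> \<forall>\<^sub>F N in F. h N < l + \<delta>" and \<delta>: "0 < \<delta>"
  shows "\<forall>\<^sub>F N in F. a * h N < a * l + \<delta>"
proof -
  have p: "0 < \<delta> / (a + 1)" using a \<delta> by simp
  have "\<forall>\<^sub>F N in F. h N < l + \<delta> / (a + 1)" by (rule h[OF p])
  then show ?thesis
  proof eventually_elim
    case (elim N)
    have "a * h N \<le> a * (l + \<delta> / (a + 1))" using elim a by (intro mult_left_mono) auto
    moreover have "a * (\<delta> / (a + 1)) < \<delta>" using a \<delta> by (simp add: field_simps)
    ultimately show ?case unfolding distrib_left by linarith
  qed
qed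

context gmc_convergence
begin

lemma off_diagonal_AE: "AE p in P2. fst p \<noteq> (snd p :: 'a)"
proof (rule lborel_pair.AE_pair_measure)
  show "{p \<in> space P2. fst p \<noteq> (snd p :: 'a)} \<in> sets P2" by measurable
  show "AE x in lborel. AE y in lborel. fst (x, y) \<noteq> (snd (x, y) :: 'a)"
  proof (rule AE_I2)
    fix x :: 'a
    show "AE y in lborel. fst (x, y) \<noteq> (snd (x, y) :: 'a)" using AE_lborel_singleton[of x] by eventually_elim auto
  qed
qed

text \<open>Here W is known through its integral only, of order
  \<open>\<epsilon>N\<close>^(-\<theta>). The truncation puts \<open>\<epsilon>N\<close>^(be^2 / 2)
  in front, and the product tends to 0.\<close>

lemma near_diagonal_vanishes:
  assumes k0: "dy k0 \<le> \<eta>0" and \<delta>: "0 < \<delta>"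
  shows "\<forall>\<^sub>F N in sequentially. (\<integral>p. ff p * (if norm (fst p - snd p) < \<epsilon>N N then J N k0 0 (KN N) 0 (KN N) (fst p) (snd p) else 0) \<partial>P2) < \<delta>"
proof -
  from near_unmollified obtain C2 where C2: "0 \<le> C2" "\<forall>k0. dy k0 \<le> \<eta>0 \<longrightarrow> (\<forall>\<^sub>F N in sequentially. \<forall>x y. x \<in> K \<longrightarrow> y \<in> K \<longrightarrow>
     (\<epsilon>N N \<le> norm (x - y) \<longrightarrow> norm (x - y) \<le> dy k0 \<longrightarrow> J N k0 0 (KN N) 0 (KN N) x y \<le> C2 * norm (x - y) powr (- s)) \<and>
     (norm (x - y) \<le> \<epsilon>N N \<longrightarrow> J N k0 0 (KN N) 0 (KN N) x y \<le> C2 * \<epsilon>N N powr (be\<^sup>2 / 2) * W N 0 0 x y))" by (elim exE conjE)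
  obtain B where B: "0 < B" "\<And>x. \<bar>f x\<bar> \<le> B" using f_bounded by blast
  define A where "A = B * B * C2 * C8"
  have "(\<lambda>N. \<epsilon>N N powr (be\<^sup>2 / 2 - \<theta>)) \<longlonglongrightarrow> 0"
    by (rule tendsto_zero_powrI[OF epsN(2) tendsto_const]) (use theta less_imp_le[OF epsN(1)] in simp_all)
  then have "(\<lambda>N. A * \<epsilon>N N powr (be\<^sup>2 / 2 - \<theta>)) \<longlonglongrightarrow> A * 0" by (rule tendsto_mult[OF tendsto_const])
  then have ev: "\<forall>\<^sub>F N in sequentially. A * \<epsilon>N N powr (be\<^sup>2 / 2 - \<theta>) < \<delta>" by (rule order_tendstoD) (use \<delta> in simp)
  show ?thesis
    using ev C2(2)[rule_format, OF k0] diagonal W00_integrable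
  proof eventually_elim
    case (elim N)
    define u where "u p = ff p * (if norm (fst p - snd p) < \<epsilon>N N then J N k0 0 (KN N) 0 (KN N) (fst p) (snd p) else 0)" for p
    define c where "c = B * B * (C2 * \<epsilon>N N powr (be\<^sup>2 / 2))"
    have c: "0 \<le> c" unfolding c_def using B C2 by simp
    have u0: "0 \<le> u p" for p unfolding u_def using ff_nonneg[of p] J_nonneg by simp
    have um: "u \<in> borel_measurable P2" unfolding u_def by measurable
    have le: "ennreal (u p) \<le> ennreal c * (indicator (K \<times> K) p * indicator {p. dist (fst p) (snd p) \<le> \<epsilon>N N} p * ennreal (W N 0 0 (fst p) (snd p)))" for p
    proof (cases "p \<in> K \<times> K \<and> norm (fst p - snd p) < \<epsilon>N N")
      case True
      then have xy: "fst p \<in> K" "snd p \<in> K" and n: "norm (fst p - snd p) \<le> \<epsilon>N N" by (simp_all add: mem_Times_iff)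
      have J: "J N k0 0 (KN N) 0 (KN N) (fst p) (snd p) \<le> C2 * \<epsilon>N N powr (be\<^sup>2 / 2) * W N 0 0 (fst p) (snd p)"
        by (rule elim(2)[THEN spec[of _ "fst p"], THEN spec[of _ "snd p"], THEN mp, OF xy(1), THEN mp, OF xy(2), THEN conjunct2, THEN mp, OF n])
      have "ff p \<le> B * B" unfolding ff_def using B by (intro mult_mono) auto
      then have "u p \<le> B * B * (C2 * \<epsilon>N N powr (be\<^sup>2 / 2) * W N 0 0 (fst p) (snd p))"
        unfolding u_def using True J J_nonneg B ff_nonneg[of p] by (simp add: mult_mono)
      then have "u p \<le> c * W N 0 0 (fst p) (snd p)" unfolding c_def by (simp only: mult.assoc)
      then have "ennreal (u p) \<le> ennreal (c * W N 0 0 (fst p) (snd p))" by (rule ennreal_leI)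
      also have "\<dots> = ennreal c * ennreal (W N 0 0 (fst p) (snd p))"
        by (rule ennreal_mult[OF c W_nonneg[OF xy]]) (use eta0 in auto)
      finally show ?thesis using True n by (simp add: dist_norm)
    next
      case False
      then have "u p = 0" unfolding u_def using ff_zero[of p] by auto
      then show ?thesis by simp
    qed
    have "(\<integral>\<^sup>+p. ennreal (u p) \<partial>P2) \<le> (\<integral>\<^sup>+p. ennreal c * (indicator (K \<times> K) p * indicator {p. dist (fst p) (snd p) \<le> \<epsilon>N N} p * ennreal (W N 0 0 (fst p) (snd p))) \<partial>P2)"
      by (rule nn_integral_mono) (rule le)
    also have "\<dots> = ennreal c * (\<integral>\<^sup>+p. indicator (K \<times> K) p * indicator {p. dist (fst p) (snd p) \<le> \<epsilon>N N} p * ennreal (W N 0 0 (fst p) (snd p)) \<partial>P2)"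
      by (rule nn_integral_cmult) measurable
    also have "\<dots> \<le> ennreal c * ennreal (C8 * \<epsilon>N N powr (- \<theta>))" by (rule mult_left_mono[OF elim(3)]) simp
    also have "\<dots> = ennreal (c * (C8 * \<epsilon>N N powr (- \<theta>)))" by (rule ennreal_mult[symmetric, OF c]) (use C8 in simp)
    also have "c * (C8 * \<epsilon>N N powr (- \<theta>)) = A * \<epsilon>N N powr (be\<^sup>2 / 2 - \<theta>)"
    proof -
      have "\<epsilon>N N powr (be\<^sup>2 / 2) * \<epsilon>N N powr (- \<theta>) = \<epsilon>N N powr (be\<^sup>2 / 2 - \<theta>)" by (simp add: powr_add[symmetric])
      then show ?thesis unfolding c_def A_def by (simp add: mult_ac)
    qed
    finally have b: "(\<integral>\<^sup>+p. ennreal (u p) \<partial>P2) \<le> ennreal (A * \<epsilon>N N powr (be\<^sup>2 / 2 - \<theta>))" .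
    have "(\<integral>p. u p \<partial>P2) = enn2real (\<integral>\<^sup>+p. ennreal (u p) \<partial>P2)"
      by (rule integral_eq_nn_integral[OF um]) (use u0 in simp)
    also have "\<dots> \<le> A * \<epsilon>N N powr (be\<^sup>2 / 2 - \<theta>)"
      by (rule enn2real_leI[OF _ b]) (use B C2 C8 in \<open>simp add: A_def\<close>)
    finally show ?case using elim(1) unfolding u_def by linarith
  qed
qed

text \<open>The parameters are fixed in the order r, m, M: r makes the integral of |x - y|^(-s) over
  |x - y| < dy r small; m, whose constant depends on r, makes the remaining depth of the truncation
  harmless; M makes the four limits cancel. Each of these takes \<delta> / 5, as do the limsup error
  and the part below \<open>\<epsilon>N\<close>.\<close>

lemma second_moment_limit:
  assumes k0: "dy k0 \<le> \<eta>0" and \<delta>: "0 < \<delta>"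
  shows "\<exists>M0\<ge>k0. \<forall>M\<ge>M0. \<forall>\<^sub>F N in sequentially. (\<integral>p. ff p * \<bar>HN N k0 M (fst p) (snd p)\<bar> \<partial>P2) < \<delta>"
proof -
  let ?n = "\<lambda>p. norm (fst p - snd p :: 'a)"
  have d5: "0 < \<delta> / 5" using \<delta> by simp
  from HN_near obtain C1 where C1: "0 \<le> C1" "\<forall>k0 M x y \<delta>. dy k0 \<le> \<eta>0 \<longrightarrow> k0 \<le> M \<longrightarrow> x \<in> K \<longrightarrow> y \<in> K \<longrightarrow> x \<noteq> y \<longrightarrow> norm (x - y) \<le> dy k0 \<longrightarrow> 0 < \<delta> \<longrightarrow>
     (\<forall>\<^sub>F N in sequentially. \<bar>HN N k0 M x y\<bar> < C1 * norm (x - y) powr (- s) + \<delta>)" by (elim exE conjE)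
  define near where "near r p = (if ?n p < dy r then C1 * ?n p powr (- s) else 0)" for r p
  have near0: "0 \<le> near r p" for r p unfolding near_def using C1(1) by simp
  have nm: "near r \<in> borel_measurable P2" for r unfolding near_def by measurable
  have nb: "near r p \<le> C1 * ?n p powr (- s)" for r p unfolding near_def using C1(1) by simp
  have kint: "integrable P2 (\<lambda>p. indicator (K \<times> K) p * (C1 * ?n p powr (- s)))" using kernel_integrable[of 0 C1] by simp
  have nint: "integrable P2 (\<lambda>p. ff p * near r p)" for r
    by (rule ff_integrable[OF kint nm]) (use near0 nb in \<open>simp only: abs_of_nonneg\<close>)
  have "(\<lambda>r. \<integral>p. ff p * near r p \<partial>P2) \<longlonglongrightarrow> integral\<^sup>L P2 (\<lambda>p::'a \<times> 'a. 0)"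
  proof (rule integral_dominated_convergence[where w="\<lambda>p. ff p * (C1 * ?n p powr (- s))"])
    show "integrable P2 (\<lambda>p. ff p * (C1 * ?n p powr (- s)))"
      by (rule ff_integrable[OF kint]) (use C1(1) in simp_all)
    show "(\<lambda>p. ff p * near r p) \<in> borel_measurable P2" for r using nm[of r] by measurable
    show "AE p in P2. (\<lambda>r. ff p * near r p) \<longlonglongrightarrow> 0"
    proof (rule AE_I2)
      fix p :: "'a \<times> 'a"
      have "\<forall>\<^sub>F r in sequentially. ff p * near r p = 0"
      proof (cases "?n p = 0")
        case False
        then have "0 < ?n p" by simp
        then have "\<forall>\<^sub>F r in sequentially. dy r < ?n p" by (rule order_tendstoD(2)[OF dy_tendsto])
        then show ?thesis by eventually_elim (simp add: near_def)
      qed (simp add: near_def)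
      then show "(\<lambda>r. ff p * near r p) \<longlonglongrightarrow> 0" by (rule tendsto_eventually)
    qed
    show "AE p in P2. norm (ff p * near r p) \<le> ff p * (C1 * ?n p powr (- s))" for r
    proof (rule AE_I2)
      fix p
      have "ff p * near r p \<le> ff p * (C1 * ?n p powr (- s))" by (rule mult_left_mono[OF nb ff_nonneg])
      then show "norm (ff p * near r p) \<le> ff p * (C1 * ?n p powr (- s))" using ff_nonneg[of p] near0[of r p] by simp
    qed
  qed simp
  then have "\<forall>\<^sub>F r in sequentially. (\<integral>p. ff p * near r p \<partial>P2) < \<delta> / 5" by (rule order_tendstoD) (use d5 in simp)
  then have "\<forall>\<^sub>F r in sequentially. (\<integral>p. ff p * near r p \<partial>P2) < \<delta> / 5 \<and> k0 \<le> r"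
    by (rule eventually_conj) (rule eventually_ge_at_top)
  then obtain r where r: "(\<integral>p. ff p * near r p \<partial>P2) < \<delta> / 5" "k0 \<le> r"
    using eventually_happens'[OF sequentially_bot] by blast
  from HN_far[OF dy_pos[of r]] obtain C2 where C2: "0 \<le> C2" "\<forall>k0 m M x y \<delta>. dy k0 \<le> \<eta>0 \<longrightarrow> k0 \<le> m \<longrightarrow> m \<le> M \<longrightarrow> x \<in> K \<longrightarrow> y \<in> K \<longrightarrow> dy r \<le> norm (x - y) \<longrightarrow> 0 < \<delta> \<longrightarrow>
     (\<forall>\<^sub>F N in sequentially. \<bar>HN N k0 M x y\<bar> < C2 * q ^ m + \<bar>cmb k0 m M x y\<bar> + \<delta>)" by (elim exE conjE)
  define F2 where "F2 = (\<integral>p. ff p \<partial>P2)"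
  have fint: "integrable P2 (\<lambda>p. ff p * c)" for c :: real
    by (rule ff_integrable[OF K2_integrable[of "\<bar>c\<bar>"]]) simp_all
  have "(\<lambda>m. q ^ m * (C2 * F2)) \<longlonglongrightarrow> 0 * (C2 * F2)" by (intro tendsto_mult tendsto_const LIMSEQ_realpow_zero less_imp_le q01)
  then have "\<forall>\<^sub>F m in sequentially. q ^ m * (C2 * F2) < \<delta> / 5" by (rule order_tendstoD) (use d5 in simp)
  then have "\<forall>\<^sub>F m in sequentially. q ^ m * (C2 * F2) < \<delta> / 5 \<and> k0 \<le> m"
    by (rule eventually_conj) (rule eventually_ge_at_top)
  then obtain m where m: "q ^ m * (C2 * F2) < \<delta> / 5" "k0 \<le> m"
    using eventually_happens'[OF sequentially_bot] by blast
  define E where "E = 4 * exp (\<gamma>\<^sup>2 * (ln (1 / dy r) + cK))"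
  define hc where "hc M p = (if p \<in> K \<times> K \<and> \<not> ?n p < dy r then \<bar>cmb k0 m M (fst p) (snd p)\<bar> else 0)" for M p
  have dyM: "dy M \<le> \<eta>0" if "k0 \<le> M" for M using dy_mono[OF that] k0 by linarith
  have ne: "fst p \<noteq> snd p" if "\<not> ?n p < dy r" for p using that dy_pos[of r] by auto
  have hcb: "0 \<le> hc M p" "hc M p \<le> E" if "k0 \<le> M" for M p
  proof -
    show "0 \<le> hc M p" by (simp add: hc_def)
    show "hc M p \<le> E"
    proof (cases "p \<in> K \<times> K \<and> \<not> ?n p < dy r")
      case True
      then have "fst p \<in> K" "snd p \<in> K" "dy r \<le> ?n p" by (simp_all add: mem_Times_iff)
      then show ?thesis unfolding hc_def E_def using True cmb_bound[OF k0 m(2) dy_pos _ _ _ dyM[OF that]] by simp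
    next
      case False
      then show ?thesis unfolding hc_def E_def by (simp only: if_False) simp
    qed
  qed
  \<comment> \<open>Measurability of \<open>cmb\<close> in the pair comes from its being a limit of
    the measurable \<open>JC\<close>.\<close>
  have hcm: "hc M \<in> borel_measurable P2" if M: "k0 \<le> M" for M
  proof (rule borel_measurable_LIMSEQ_real[where u="\<lambda>N p. if p \<in> K \<times> K \<and> \<not> ?n p < dy r then \<bar>JC N k0 m M (fst p) (snd p)\<bar> else 0"])
    show "(\<lambda>p. if p \<in> K \<times> K \<and> \<not> ?n p < dy r then \<bar>JC N k0 m M (fst p) (snd p)\<bar> else 0) \<in> borel_measurable P2" for N
      unfolding JC_def by measurable
    fix p
    show "(\<lambda>N. if p \<in> K \<times> K \<and> \<not> ?n p < dy r then \<bar>JC N k0 m M (fst p) (snd p)\<bar> else 0) \<longlonglongrightarrow> hc M p"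
    proof (cases "p \<in> K \<times> K \<and> \<not> ?n p < dy r")
      case True
      then have xy: "fst p \<in> K" "snd p \<in> K" by (simp_all add: mem_Times_iff)
      have "(\<lambda>N. \<bar>JC N k0 m M (fst p) (snd p)\<bar>) \<longlonglongrightarrow> \<bar>cmb k0 m M (fst p) (snd p)\<bar>"
        by (intro tendsto_rabs JC_tendsto k0 m dyM M xy ne) (use True in simp)
      then show ?thesis unfolding hc_def using True by simp
    next
      case False
      then show ?thesis unfolding hc_def by (simp only: if_False tendsto_const)
    qed
  qed
  have hci: "integrable P2 (\<lambda>p. ff p * hc M p)" if M: "k0 \<le> M" for M
    by (rule ff_integrable[OF K2_integrable[of E] hcm[OF M]]) (use hcb[OF M] in \<open>simp only: abs_of_nonneg\<close>)
  \<comment> \<open>The shift by k0 keeps \<open>dy\<close> of the index below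
    \<open>\<eta>0\<close>, where the bounds on \<open>hc\<close> hold.\<close>
  have "(\<lambda>M. \<integral>p. ff p * hc (M + k0) p \<partial>P2) \<longlonglongrightarrow> integral\<^sup>L P2 (\<lambda>p::'a \<times> 'a. 0)"
  proof (rule integral_dominated_convergence[where w="\<lambda>p. ff p * E"])
    show "integrable P2 (\<lambda>p. ff p * E)" by (rule fint)
    show "(\<lambda>p. ff p * hc (M + k0) p) \<in> borel_measurable P2" for M by (rule borel_measurable_integrable[OF hci]) simp
    show "AE p in P2. norm (ff p * hc (M + k0) p) \<le> ff p * E" for M
    proof (rule AE_I2)
      fix p
      have "ff p * hc (M + k0) p \<le> ff p * E" by (rule mult_left_mono[OF hcb(2) ff_nonneg]) simp
      then show "norm (ff p * hc (M + k0) p) \<le> ff p * E" using ff_nonneg[of p] hcb(1)[of "M + k0" p] by simp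
    qed
    show "AE p in P2. (\<lambda>M. ff p * hc (M + k0) p) \<longlonglongrightarrow> 0"
    proof (rule AE_I2)
      fix p
      show "(\<lambda>M. ff p * hc (M + k0) p) \<longlonglongrightarrow> 0"
      proof (cases "p \<in> K \<times> K \<and> \<not> ?n p < dy r")
        case True
        then have xy: "fst p \<in> K" "snd p \<in> K" "fst p \<noteq> snd p" using ne by (simp_all add: mem_Times_iff)
        let ?j = "\<lambda>e e'. jm k0 m e e' (fst p) (snd p)"
        have "(\<lambda>M. ?j 0 0 - ?j 0 (dy M) - ?j (dy M) 0 + ?j (dy M) (dy M)) \<longlonglongrightarrow> ?j 0 0 - ?j 0 0 - ?j 0 0 + ?j 0 0"
          by (intro tendsto_add tendsto_diff tendsto_const jm_limit[OF k0 xy, of "\<lambda>_. 0" dy] jm_limit[OF k0 xy, of dy "\<lambda>_. 0"] jm_limit[OF k0 xy, of dy dy]) simp_all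
        then have "(\<lambda>M. cmb k0 m M (fst p) (snd p)) \<longlonglongrightarrow> 0" unfolding cmb_def by simp
        then have "(\<lambda>M. cmb k0 m (M + k0) (fst p) (snd p)) \<longlonglongrightarrow> 0" by (rule LIMSEQ_ignore_initial_segment)
        then have "(\<lambda>M. ff p * \<bar>cmb k0 m (M + k0) (fst p) (snd p)\<bar>) \<longlonglongrightarrow> ff p * \<bar>0\<bar>"
          by (intro tendsto_mult tendsto_const tendsto_rabs)
        then show ?thesis unfolding hc_def using True by simp
      next
        case False
        then show ?thesis unfolding hc_def by (simp only: if_False mult_zero_right tendsto_const)
      qed
    qed
  qed simp
  then have "\<forall>\<^sub>F M in sequentially. (\<integral>p. ff p * hc (M + k0) p \<partial>P2) < \<delta> / 5" by (rule order_tendstoD) (use d5 in simp)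
  then obtain M1 where M1: "\<And>M. M1 \<le> M \<Longrightarrow> (\<integral>p. ff p * hc (M + k0) p \<partial>P2) < \<delta> / 5"
    unfolding eventually_sequentially by blast
  have main: "\<forall>\<^sub>F N in sequentially. (\<integral>p. ff p * \<bar>HN N k0 M (fst p) (snd p)\<bar> \<partial>P2) < \<delta>" if M: "M1 + k0 + m \<le> M" for M
  proof -
    have kM: "k0 \<le> M" and mM: "m \<le> M" using M by auto
    have hcM: "(\<integral>p. ff p * hc M p \<partial>P2) < \<delta> / 5" using M1[of "M - k0"] M by simp
    have dM: "dy M \<le> \<eta>0" by (rule dyM[OF kM])
    have e: "0 \<le> (0::real)" "0 \<le> \<eta>0" "0 \<le> dy M" using eta0 dy_pos[of M] by auto
    obtain B where B: "0 \<le> B" "\<And>N x y. x \<in> K \<Longrightarrow> y \<in> K \<Longrightarrow> W N 0 (dy M) x y \<le> B" "\<And>N x y. x \<in> K \<Longrightarrow> y \<in> K \<Longrightarrow> W N (dy M) 0 x y \<le> B"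
      "\<And>N x y. x \<in> K \<Longrightarrow> y \<in> K \<Longrightarrow> W N (dy M) (dy M) x y \<le> B"
      by (rule W_mollified_bounded[OF dy_pos dM]) (rule that)
    have KK: "compact (K \<times> K)" "K \<times> K \<subseteq> \<Omega> \<times> \<Omega>" using K_compact K_Om by (auto intro: compact_Times)
    obtain C3 where C3: "\<forall>\<^sub>F N in sequentially. \<forall>(x,y)\<in>K \<times> K. dist x y \<ge> \<epsilon>N N \<longrightarrow>
         0 \<le> W N 0 0 x y \<and> W N 0 0 x y \<le> C3 * dist x y powr (-(\<gamma>^2))"
      using a3[unfolded A3_def, THEN spec[of _ "K \<times> K"], THEN mp, OF conjI[OF KK]] by (elim exE)
    from near_unmollified obtain C4 where C4: "0 \<le> C4" "\<forall>k0. dy k0 \<le> \<eta>0 \<longrightarrow> (\<forall>\<^sub>F N in sequentially. \<forall>x y. x \<in> K \<longrightarrow> y \<in> K \<longrightarrow>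
       (\<epsilon>N N \<le> norm (x - y) \<longrightarrow> norm (x - y) \<le> dy k0 \<longrightarrow> J N k0 0 (KN N) 0 (KN N) x y \<le> C4 * norm (x - y) powr (- s)) \<and>
       (norm (x - y) \<le> \<epsilon>N N \<longrightarrow> J N k0 0 (KN N) 0 (KN N) x y \<le> C4 * \<epsilon>N N powr (be\<^sup>2 / 2) * W N 0 0 x y))" by (elim exE conjE)
    define Jr where "Jr N p = J N k0 0 (KN N) (dy M) M (fst p) (snd p) + J N k0 (dy M) M 0 (KN N) (fst p) (snd p) + J N k0 (dy M) M (dy M) M (fst p) (snd p)" for N p
    have Jr0: "0 \<le> Jr N p" for N p unfolding Jr_def by (intro add_nonneg_nonneg J_nonneg)
    have JrB: "Jr N p \<le> 3 * B" if "p \<in> K \<times> K" for N p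
    proof -
      have xy: "fst p \<in> K" "snd p \<in> K" using that by (simp_all add: mem_Times_iff)
      show ?thesis unfolding Jr_def using J_le_W[OF xy e(1,2) e(3) dM, of N k0 "KN N" M] J_le_W[OF xy e(3) dM e(1,2), of N k0 M "KN N"]
          J_le_W[OF xy e(3) dM e(3) dM, of N k0 M M] B(2-4)[OF xy, of N] by linarith
    qed
    \<comment> \<open>Below \<open>\<epsilon>N N\<close> the unmollified term has no majorant
      uniform in N. It is left out of u and returns as v, to which
      \<open>near_diagonal_vanishes\<close> applies.\<close>
    define u where "u N p = ff p * (if ?n p < \<epsilon>N N then Jr N p else \<bar>HN N k0 M (fst p) (snd p)\<bar>)" for N p
    \<comment> \<open>The first summand bounds W at distances above \<open>dy k0\<close> by (A3),
      the second the three terms with a mollified factor by (A2).\<close>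
    define Cw where "Cw = \<bar>C3\<bar> * dy k0 powr (-(\<gamma>\<^sup>2)) + 3 * B"
    define L where "L p = ff p * near r p + ff p * (C2 * q ^ m) + ff p * hc M p" for p
    have Cw: "3 * B \<le> Cw" unfolding Cw_def by simp
    have um: "u N \<in> borel_measurable P2" for N unfolding u_def Jr_def by measurable
    have wi: "integrable P2 (\<lambda>p. ff p * (Cw + C4 * ?n p powr (- s)))"
      by (rule ff_integrable[OF kernel_integrable[of Cw C4]]) (use Cw B(1) C4(1) in simp_all)
    have Li: "integrable P2 L" unfolding L_def by (intro Bochner_Integration.integrable_add nint fint hci kM)
    have L0: "0 \<le> L p" for p unfolding L_def
      by (intro add_nonneg_nonneg mult_nonneg_nonneg ff_nonneg near0 hcb(1) kM C2(1) zero_le_power less_imp_le[OF q01(1)])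
    have uL: "\<forall>\<^sub>F N in sequentially. (\<integral>p. u N p \<partial>P2) < (\<integral>p. L p \<partial>P2) + \<delta> / 5"
    proof (rule limsup_integral_le[OF um wi Li _ L0 _ d5])
      show "\<forall>\<^sub>F N in sequentially. \<forall>p\<in>space P2. 0 \<le> u N p \<and> u N p \<le> ff p * (Cw + C4 * ?n p powr (- s))"
        using C3 C4(2)[rule_format, OF k0]
      proof eventually_elim
        case (elim N)
        show ?case
        proof (intro ballI conjI)
          fix p
          show "0 \<le> u N p" unfolding u_def using ff_nonneg[of p] Jr0[of N p] by simp
          show "u N p \<le> ff p * (Cw + C4 * ?n p powr (- s))"
          proof (cases "p \<in> K \<times> K")
            case True
            then have xy: "fst p \<in> K" "snd p \<in> K" by (simp_all add: mem_Times_iff)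
            have pw: "0 \<le> C4 * ?n p powr (- s)" using C4(1) by simp
            have "(if ?n p < \<epsilon>N N then Jr N p else \<bar>HN N k0 M (fst p) (snd p)\<bar>) \<le> Cw + C4 * ?n p powr (- s)"
            proof (cases "?n p < \<epsilon>N N")
              case False
              have H: "\<bar>HN N k0 M (fst p) (snd p)\<bar> \<le> J N k0 0 (KN N) 0 (KN N) (fst p) (snd p) + Jr N p"
                unfolding Jr_def by (rule HN_abs_le)
              have d: "\<epsilon>N N \<le> ?n p" using False by simp
              have J: "J N k0 0 (KN N) 0 (KN N) (fst p) (snd p) \<le> \<bar>C3\<bar> * dy k0 powr (-(\<gamma>\<^sup>2)) + C4 * ?n p powr (- s)"
              proof (cases "?n p \<le> dy k0")
                case True
                have "J N k0 0 (KN N) 0 (KN N) (fst p) (snd p) \<le> C4 * ?n p powr (- s)"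
                  by (rule elim(2)[THEN spec[of _ "fst p"], THEN spec[of _ "snd p"], THEN mp, OF xy(1), THEN mp, OF xy(2), THEN conjunct1, THEN mp, OF d, THEN mp, OF True])
                moreover have "0 \<le> \<bar>C3\<bar> * dy k0 powr (-(\<gamma>\<^sup>2))" by simp
                ultimately show ?thesis by linarith
              next
                case False
                have "J N k0 0 (KN N) 0 (KN N) (fst p) (snd p) \<le> W N 0 0 (fst p) (snd p)" by (rule J_le_W[OF xy e(1,2) e(1,2)])
                also have "\<dots> \<le> C3 * ?n p powr (-(\<gamma>\<^sup>2))"
                  using bspec[OF elim(1) True] d by (simp add: case_prod_beta dist_norm)
                also have "\<dots> \<le> \<bar>C3\<bar> * ?n p powr (-(\<gamma>\<^sup>2))" by (intro mult_right_mono) auto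
                also have "\<dots> \<le> \<bar>C3\<bar> * dy k0 powr (-(\<gamma>\<^sup>2))" using False dy_pos[of k0] by (intro mult_left_mono powr_mono2') auto
                finally show ?thesis using pw by linarith
              qed
              show ?thesis unfolding if_not_P[OF False] Cw_def using H J JrB[OF True, of N] by linarith
            next
              case less: True
              show ?thesis unfolding if_P[OF less] using JrB[OF True, of N] Cw pw by linarith
            qed
            then show ?thesis unfolding u_def by (rule mult_left_mono[OF _ ff_nonneg])
          qed (simp add: u_def ff_zero)
        qed
      qed
      show "AE p in P2. \<forall>\<delta>>0. \<forall>\<^sub>F N in sequentially. u N p < L p + \<delta>"
        using off_diagonal_AE
      proof eventually_elim
        case (elim p)
        show ?case
        proof (intro allI impI)
          fix \<delta>' :: real assume \<delta>': "0 < \<delta>'"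
          show "\<forall>\<^sub>F N in sequentially. u N p < L p + \<delta>'"
          proof (cases "p \<in> K \<times> K")
            case True
            then have xy: "fst p \<in> K" "snd p \<in> K" by (simp_all add: mem_Times_iff)
            have "0 < ?n p" using elim by simp
            then have ev: "\<forall>\<^sub>F N in sequentially. \<epsilon>N N < ?n p" by (rule order_tendstoD(2)[OF epsN(2)])
            have lim: "\<forall>\<^sub>F N in sequentially. \<bar>HN N k0 M (fst p) (snd p)\<bar> < (near r p + C2 * q ^ m + hc M p) + t" if t: "0 < t" for t
            proof (cases "?n p < dy r")
              case less: True
              have nk: "?n p \<le> dy k0" using less dy_mono[OF r(2)] by linarith
              have c: "0 \<le> C2 * q ^ m" using C2(1) q01 by simp
              have "\<forall>\<^sub>F N in sequentially. \<bar>HN N k0 M (fst p) (snd p)\<bar> < C1 * ?n p powr (- s) + t"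
                by (rule C1(2)[rule_format, OF k0 kM xy elim nk t])
              then show ?thesis
              proof eventually_elim
                case (elim N)
                then show ?case using c hcb(1)[OF kM, of p] less by (simp add: near_def)
              qed
            next
              case False
              then have nk: "dy r \<le> ?n p" by simp
              have "\<forall>\<^sub>F N in sequentially. \<bar>HN N k0 M (fst p) (snd p)\<bar> < C2 * q ^ m + \<bar>cmb k0 m M (fst p) (snd p)\<bar> + t"
                by (rule C2(2)[rule_format, OF k0 m(2) mM xy nk t])
              then show ?thesis
              proof eventually_elim
                case (elim N)
                then show ?case using False True by (simp add: near_def hc_def)
              qed
            qed
            have "\<forall>\<^sub>F N in sequentially. ff p * \<bar>HN N k0 M (fst p) (snd p)\<bar> < ff p * (near r p + C2 * q ^ m + hc M p) + \<delta>'"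
              by (rule eventually_scaled_less[OF ff_nonneg lim \<delta>'])
            then show ?thesis using ev
            proof eventually_elim
              case (elim N)
              then show ?case unfolding u_def L_def by (simp add: distrib_left)
            qed
          next
            case False
            then show ?thesis unfolding u_def L_def using \<delta>' by (simp add: ff_zero)
          qed
        qed
      qed
    qed
    have "(\<integral>p. L p \<partial>P2) = (\<integral>p. ff p * near r p \<partial>P2) + (\<integral>p. ff p * (C2 * q ^ m) \<partial>P2) + (\<integral>p. ff p * hc M p \<partial>P2)"
      unfolding L_def Bochner_Integration.integral_add[OF Bochner_Integration.integrable_add[OF nint fint] hci[OF kM]] Bochner_Integration.integral_add[OF nint fint] ..
    also have "(\<integral>p. ff p * (C2 * q ^ m) \<partial>P2) = q ^ m * (C2 * F2)" unfolding F2_def by simp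
    finally have L: "(\<integral>p. L p \<partial>P2) < 3 * (\<delta> / 5)" using r(1) m(1) hcM by linarith
    show ?thesis
      using uL near_diagonal_vanishes[OF k0 d5] W00_integrable C3 C4(2)[rule_format, OF k0]
    proof eventually_elim
      case (elim N)
      define v where "v p = ff p * (if ?n p < \<epsilon>N N then J N k0 0 (KN N) 0 (KN N) (fst p) (snd p) else 0)" for p
      have vi: "integrable P2 v" unfolding v_def
      proof (rule ff_integrable[OF elim(3)])
        fix p assume "p \<in> K \<times> K"
        then have xy: "fst p \<in> K" "snd p \<in> K" by (simp_all add: mem_Times_iff)
        show "\<bar>if ?n p < \<epsilon>N N then J N k0 0 (KN N) 0 (KN N) (fst p) (snd p) else 0\<bar> \<le> W N 0 0 (fst p) (snd p)"
          using J_le_W[OF xy e(1,2) e(1,2), of N k0 "KN N" "KN N"] J_nonneg[of N k0 0 "KN N" 0 "KN N" "fst p" "snd p"] W_nonneg[OF xy e(1,2) e(1,2), of N]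
          by (simp only: abs_of_nonneg split: if_split) simp
      qed measurable
      have hi: "integrable P2 (\<lambda>p. ff p * \<bar>HN N k0 M (fst p) (snd p)\<bar>)" by (rule second_moment(2)[OF dM elim(3)])
      have ui: "integrable P2 (u N)"
      proof -
        have J3: "integrable P2 (\<lambda>p. ff p * (3 * B))" by (rule fint)
        have "integrable P2 (\<lambda>p. ff p * \<bar>HN N k0 M (fst p) (snd p)\<bar> + ff p * (3 * B))" by (rule Bochner_Integration.integrable_add[OF hi J3])
        then show ?thesis
        proof (rule Bochner_Integration.integrable_bound[OF _ um], intro AE_I2)
          fix p
          have a: "0 \<le> ff p * \<bar>HN N k0 M (fst p) (snd p)\<bar>" "0 \<le> ff p * (3 * B)" using ff_nonneg[of p] B(1) by simp_all
          have "u N p \<le> ff p * \<bar>HN N k0 M (fst p) (snd p)\<bar> + ff p * (3 * B)"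
          proof (cases "p \<in> K \<times> K")
            case True
            have "ff p * Jr N p \<le> ff p * (3 * B)" by (rule mult_left_mono[OF JrB[OF True] ff_nonneg])
            then show ?thesis using a unfolding u_def by (simp only: split: if_split) linarith
          qed (simp add: u_def ff_zero)
          moreover have "0 \<le> u N p" unfolding u_def using ff_nonneg[of p] Jr0[of N p] by simp
          ultimately show "norm (u N p) \<le> norm (ff p * \<bar>HN N k0 M (fst p) (snd p)\<bar> + ff p * (3 * B))" unfolding real_norm_def by linarith
        qed
      qed
      have "(\<integral>p. ff p * \<bar>HN N k0 M (fst p) (snd p)\<bar> \<partial>P2) \<le> (\<integral>p. u N p + v p \<partial>P2)"
      proof (rule integral_mono[OF hi Bochner_Integration.integrable_add[OF ui vi]])
        fix p
        have "\<bar>HN N k0 M (fst p) (snd p)\<bar> \<le> (if ?n p < \<epsilon>N N then Jr N p else \<bar>HN N k0 M (fst p) (snd p)\<bar>) + (if ?n p < \<epsilon>N N then J N k0 0 (KN N) 0 (KN N) (fst p) (snd p) else 0)"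
          using HN_abs_le[of N k0 M "fst p" "snd p"] unfolding Jr_def by (simp only: split: if_split) linarith
        then have "ff p * \<bar>HN N k0 M (fst p) (snd p)\<bar> \<le> ff p * ((if ?n p < \<epsilon>N N then Jr N p else \<bar>HN N k0 M (fst p) (snd p)\<bar>) + (if ?n p < \<epsilon>N N then J N k0 0 (KN N) 0 (KN N) (fst p) (snd p) else 0))"
          by (rule mult_left_mono[OF _ ff_nonneg])
        then show "ff p * \<bar>HN N k0 M (fst p) (snd p)\<bar> \<le> u N p + v p" unfolding u_def v_def distrib_left .
      qed
      also have "\<dots> = (\<integral>p. u N p \<partial>P2) + (\<integral>p. v p \<partial>P2)" by (rule Bochner_Integration.integral_add[OF ui vi])
      finally show ?case using elim(1,2) L unfolding v_def by linarith
    qed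
  qed
  show ?thesis by (rule exI[of _ "M1 + k0 + m"]) (use main in simp)
qed

end

section \<open>Convergence in law\<close>

context gmc_convergence
begin

lemma defect_bound:
  assumes x: "x \<in> K" and e: "0 \<le> e" "e \<le> \<eta>0" and k0: "dy k0 \<le> \<eta>0"
  shows "(\<integral>\<^sup>+w. ennreal \<bar>V N e w x - U N k0 e k1 w x\<bar> \<partial>PN N) = ennreal (\<integral>w. V N e w x - U N k0 e k1 w x \<partial>PN N)"
proof -
  have 0: "0 \<le> V N e w x - U N k0 e k1 w x" for w using U_bounds(2)[of N k0 e k1 w x] by simp
  show ?thesis unfolding abs_of_nonneg[OF 0] by (rule nn_integral_eq_integral[OF V_defect_le(1)[OF x e k0] AE_I2[OF 0]])
qed

text \<open>\<open>first_moment_mollified\<close> is pointwise in x. The defect is at most 1, so |f|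
  is a majorant for the reverse Fatou lemma.\<close>

lemma mollified_defect_integral:
  "\<exists>C\<ge>0. \<forall>k0 M \<delta>. dy k0 \<le> \<eta>0 \<longrightarrow> k0 \<le> M \<longrightarrow> 0 < \<delta> \<longrightarrow> (\<forall>\<^sub>F N in sequentially.
     integrable lborel (\<lambda>x. \<bar>f x\<bar> * (\<integral>w. V N (dy M) w x - U N k0 (dy M) M w x \<partial>PN N)) \<and>
     (\<integral>x. \<bar>f x\<bar> * (\<integral>w. V N (dy M) w x - U N k0 (dy M) M w x \<partial>PN N) \<partial>lborel) < F1 * (C * q ^ k0) + \<delta>)"
proof -
  from first_moment_mollified obtain C where C: "0 \<le> C" "\<forall>k0 M x \<delta>. dy k0 \<le> \<eta>0 \<longrightarrow> k0 \<le> M \<longrightarrow> x \<in> K \<longrightarrow> 0 < \<delta> \<longrightarrow>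
     (\<forall>\<^sub>F N in sequentially. (\<integral>w. V N (dy M) w x - U N k0 (dy M) M w x \<partial>PN N) < C * q ^ k0 + \<delta>)" by (elim exE conjE)
  have "\<forall>\<^sub>F N in sequentially. integrable lborel (\<lambda>x. \<bar>f x\<bar> * (\<integral>w. V N (dy M) w x - U N k0 (dy M) M w x \<partial>PN N)) \<and>
     (\<integral>x. \<bar>f x\<bar> * (\<integral>w. V N (dy M) w x - U N k0 (dy M) M w x \<partial>PN N) \<partial>lborel) < F1 * (C * q ^ k0) + \<delta>"
    if k0: "dy k0 \<le> \<eta>0" and M: "k0 \<le> M" and \<delta>: "0 < \<delta>" for k0 M \<delta>
  proof -
    have dM: "0 \<le> dy M" "dy M \<le> \<eta>0" using dy_mono[OF M] k0 dy_pos[of M] by auto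
    define b where "b N x = (\<integral>w. V N (dy M) w x - U N k0 (dy M) M w x \<partial>PN N)" for N x
    have bm: "b N \<in> borel_measurable borel" for N
    proof -
      interpret prob_space "PN N" by (rule PN_prob)
      show ?thesis unfolding b_def by measurable
    qed
    have b0: "0 \<le> b N x" for N x unfolding b_def by (rule integral_nonneg_AE) (use U_bounds(2) in simp)
    have b1: "b N x \<le> 1" if "x \<in> K" for N x unfolding b_def by (rule V_defect_le(3)[OF that dM k0])
    have fb: "\<bar>f x\<bar> * b N x \<le> \<bar>f x\<bar>" for N x
      using mult_left_mono[OF b1, of x "\<bar>f x\<bar>" N] by (cases "x \<in> K") (simp_all add: f_zero)
    have fm: "(\<lambda>x. \<bar>f x\<bar> * b N x) \<in> borel_measurable lborel" for N using bm[of N] by simp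
    have fa: "integrable lborel (\<lambda>x. \<bar>f x\<bar>)" by (rule integrable_abs[OF f_integrable])
    have int: "integrable lborel (\<lambda>x. \<bar>f x\<bar> * b N x)" for N
      by (rule Bochner_Integration.integrable_bound[OF fa fm]) (use fb b0 in \<open>simp add: abs_mult\<close>)
    have "\<forall>\<^sub>F N in sequentially. (\<integral>x. \<bar>f x\<bar> * b N x \<partial>lborel) < (\<integral>x. \<bar>f x\<bar> * (C * q ^ k0) \<partial>lborel) + \<delta>"
    proof (rule limsup_integral_le[OF fm fa integrable_mult_left[OF fa] _ _ _ \<delta>])
      show "\<forall>\<^sub>F N in sequentially. \<forall>x\<in>space lborel. 0 \<le> \<bar>f x\<bar> * b N x \<and> \<bar>f x\<bar> * b N x \<le> \<bar>f x\<bar>"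
        using fb b0 by simp
      show "0 \<le> \<bar>f x\<bar> * (C * q ^ k0)" for x using C(1) q01 by simp
      show "AE x in lborel. \<forall>\<delta>>0. \<forall>\<^sub>F N in sequentially. \<bar>f x\<bar> * b N x < \<bar>f x\<bar> * (C * q ^ k0) + \<delta>"
      proof (intro AE_I2 allI impI)
        fix x and t :: real assume t: "0 < t"
        show "\<forall>\<^sub>F N in sequentially. \<bar>f x\<bar> * b N x < \<bar>f x\<bar> * (C * q ^ k0) + t"
        proof (cases "x \<in> K")
          case True
          show ?thesis by (rule eventually_scaled_less[OF abs_ge_zero _ t]) (unfold b_def, rule C(2)[rule_format, OF k0 M True])
        next
          case False
          then show ?thesis using t by (simp add: f_zero)
        qed
      qed
    qed
    moreover have "(\<integral>x. \<bar>f x\<bar> * (C * q ^ k0) \<partial>lborel) = F1 * (C * q ^ k0)" unfolding F1_def by (rule integral_mult_left_zero)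
    ultimately have "\<forall>\<^sub>F N in sequentially. (\<integral>x. \<bar>f x\<bar> * b N x \<partial>lborel) < F1 * (C * q ^ k0) + \<delta>" by (simp only:)
    then show ?thesis using int unfolding b_def by simp
  qed
  then show ?thesis using C(1) by (intro exI[of _ C]) simp
qed

text \<open>The difference is A + D - B, with truncation defects A, B and truncated difference D. Of
  the four shares \<kappa> = \<delta> / 4, A takes one and B two; a second moment below \<kappa>^2
  bounds E |D| by \<kappa>, through |a| <= (\<kappa> + a^2 / \<kappa>) / 2. The starting scale k0 is
  fixed by the defects before M0 is chosen.\<close>

lemma mollified_approximation:
  assumes \<delta>: "0 < \<delta>"
  shows "\<exists>M0. \<forall>M\<ge>M0. dy M \<le> \<eta>0 \<and> (\<forall>\<^sub>F N in sequentially. (\<integral>\<^sup>+w. ennreal \<bar>IN N 0 w - IN N (dy M) w\<bar> \<partial>PN N) \<le> ennreal \<delta>)"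
proof -
  define \<kappa> where "\<kappa> = \<delta> / 4"
  have \<kappa>: "0 < \<kappa>" using \<delta> by (simp add: \<kappa>_def)
  from first_moment_unmollified obtain C1 where C1: "0 \<le> C1" "\<forall>k0. dy k0 \<le> \<eta>0 \<longrightarrow> (\<forall>\<^sub>F N in sequentially. \<forall>x\<in>K. (\<integral>w. V N 0 w x - U N k0 0 (KN N) w x \<partial>PN N) \<le> C1 * q ^ k0)"
    by (elim exE conjE)
  from mollified_defect_integral obtain C2 where C2: "0 \<le> C2" "\<forall>k0 M \<delta>. dy k0 \<le> \<eta>0 \<longrightarrow> k0 \<le> M \<longrightarrow> 0 < \<delta> \<longrightarrow> (\<forall>\<^sub>F N in sequentially.
     integrable lborel (\<lambda>x. \<bar>f x\<bar> * (\<integral>w. V N (dy M) w x - U N k0 (dy M) M w x \<partial>PN N)) \<and>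
     (\<integral>x. \<bar>f x\<bar> * (\<integral>w. V N (dy M) w x - U N k0 (dy M) M w x \<partial>PN N) \<partial>lborel) < F1 * (C2 * q ^ k0) + \<delta>)" by (elim exE conjE)
  have qlim: "\<forall>\<^sub>F k in sequentially. F1 * (C * q ^ k) < \<kappa>" for C
  proof -
    have "(\<lambda>k. F1 * (C * q ^ k)) \<longlonglongrightarrow> F1 * (C * 0)" by (intro tendsto_mult tendsto_const LIMSEQ_realpow_zero less_imp_le q01)
    then show ?thesis by (rule order_tendstoD) (use \<kappa> in simp)
  qed
  have "\<forall>\<^sub>F k in sequentially. F1 * (C1 * q ^ k) < \<kappa> \<and> F1 * (C2 * q ^ k) < \<kappa> \<and> dy k < \<eta>0"
    by (intro eventually_conj qlim order_tendstoD(2)[OF dy_tendsto eta0(1)])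
  then obtain k0 where k0: "F1 * (C1 * q ^ k0) < \<kappa>" "F1 * (C2 * q ^ k0) < \<kappa>" "dy k0 < \<eta>0"
    using eventually_happens'[OF sequentially_bot] by blast
  have dk0: "dy k0 \<le> \<eta>0" using k0(3) by simp
  have "0 < \<kappa> * \<kappa>" using \<kappa> by simp
  from second_moment_limit[OF dk0 this] obtain M0 where M0: "k0 \<le> M0" "\<forall>M\<ge>M0. \<forall>\<^sub>F N in sequentially. (\<integral>p. ff p * \<bar>HN N k0 M (fst p) (snd p)\<bar> \<partial>P2) < \<kappa> * \<kappa>"
    by (elim exE conjE)
  have "dy M \<le> \<eta>0 \<and> (\<forall>\<^sub>F N in sequentially. (\<integral>\<^sup>+w. ennreal \<bar>IN N 0 w - IN N (dy M) w\<bar> \<partial>PN N) \<le> ennreal \<delta>)" if M: "M0 \<le> M" for M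
  proof -
    have kM: "k0 \<le> M" using M M0(1) by simp
    have dM: "dy M \<le> \<eta>0" using dy_mono[OF kM] dk0 by linarith
    have e: "0 \<le> (0::real)" "0 \<le> \<eta>0" "0 \<le> dy M" using eta0 dy_pos[of M] by auto
    have d4: "0 < \<delta> / 4" using \<delta> by simp
    have "\<forall>\<^sub>F N in sequentially. (\<integral>\<^sup>+w. ennreal \<bar>IN N 0 w - IN N (dy M) w\<bar> \<partial>PN N) \<le> ennreal \<delta>"
      using C1(2)[rule_format, OF dk0] C2(2)[rule_format, OF dk0 kM d4] M0(2)[rule_format, OF M] W00_integrable
    proof eventually_elim
      case (elim N)
      interpret prob_space "PN N" by (rule PN_prob)
      define A where "A w = (\<integral>x. f x * (V N 0 w x - U N k0 0 (KN N) w x) \<partial>lborel)" for w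
      define D where "D w = (\<integral>x. f x * Df N k0 M w x \<partial>lborel)" for w
      define B where "B w = (\<integral>x. f x * (V N (dy M) w x - U N k0 (dy M) M w x) \<partial>lborel)" for w
      have am: "(\<lambda>(w, x). V N 0 w x - U N k0 0 (KN N) w x) \<in> borel_measurable (PN N \<Otimes>\<^sub>M borel)" by measurable
      have bm: "(\<lambda>(w, x). V N (dy M) w x - U N k0 (dy M) M w x) \<in> borel_measurable (PN N \<Otimes>\<^sub>M borel)" by measurable
      have ab: "(\<integral>\<^sup>+w. ennreal \<bar>V N 0 w x - U N k0 0 (KN N) w x\<bar> \<partial>PN N) \<le> ennreal (C1 * q ^ k0)" if "x \<in> K" for x
        unfolding defect_bound[OF that e(1,2) dk0] by (rule ennreal_leI) (rule elim(1)[rule_format, OF that])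
      have bb: "(\<integral>\<^sup>+w. ennreal \<bar>V N (dy M) w x - U N k0 (dy M) M w x\<bar> \<partial>PN N) \<le> ennreal (\<integral>w. V N (dy M) w x - U N k0 (dy M) M w x \<partial>PN N)" if "x \<in> K" for x
        unfolding defect_bound[OF that e(3) dM dk0] by (rule order_refl)
      have b0: "0 \<le> (\<integral>w. V N (dy M) w x - U N k0 (dy M) M w x \<partial>PN N)" for x
        by (rule integral_nonneg_AE) (use U_bounds(2) in simp)
      have a0: "0 \<le> C1 * q ^ k0" using C1(1) q01 by simp
      have ai: "integrable lborel (\<lambda>x. \<bar>f x\<bar> * (C1 * q ^ k0))" by (rule integrable_mult_left[OF integrable_abs[OF f_integrable]])
      have a1: "(\<integral>\<^sup>+w. ennreal \<bar>A w\<bar> \<partial>PN N) \<le> ennreal (\<integral>x. \<bar>f x\<bar> * (C1 * q ^ k0) \<partial>lborel)"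
        unfolding A_def by (rule expectation_abs_integral_le(1)[OF am ab a0 ai])
      have b1: "(\<integral>\<^sup>+w. ennreal \<bar>B w\<bar> \<partial>PN N) \<le> ennreal (\<integral>x. \<bar>f x\<bar> * (\<integral>w. V N (dy M) w x - U N k0 (dy M) M w x \<partial>PN N) \<partial>lborel)"
        unfolding B_def by (rule expectation_abs_integral_le(1)[OF bm bb b0 conjunct1[OF elim(2)]])
      have a3: "AE w in PN N. integrable lborel (\<lambda>x. f x * (V N 0 w x - U N k0 0 (KN N) w x))"
        by (rule expectation_abs_integral_le(3)[OF am ab a0 ai])
      have b3: "AE w in PN N. integrable lborel (\<lambda>x. f x * (V N (dy M) w x - U N k0 (dy M) M w x))"
        by (rule expectation_abs_integral_le(3)[OF bm bb b0 conjunct1[OF elim(2)]])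
      have ale: "(\<integral>\<^sup>+w. ennreal \<bar>A w\<bar> \<partial>PN N) \<le> ennreal \<kappa>"
      proof (rule order_trans[OF a1], rule ennreal_leI)
        show "(\<integral>x. \<bar>f x\<bar> * (C1 * q ^ k0) \<partial>lborel) \<le> \<kappa>" unfolding integral_mult_left_zero F1_def[symmetric] using k0(1) by simp
      qed
      have ble: "(\<integral>\<^sup>+w. ennreal \<bar>B w\<bar> \<partial>PN N) \<le> ennreal (2 * \<kappa>)"
        by (rule order_trans[OF b1], rule ennreal_leI) (use conjunct2[OF elim(2)] k0(2) in \<open>simp add: \<kappa>_def\<close>)
      note S = second_moment(1,3)[OF dM elim(4), of k0, folded D_def]
      have Dm: "D \<in> borel_measurable (PN N)" unfolding D_def by measurable
      have dle: "(\<integral>\<^sup>+w. ennreal \<bar>D w\<bar> \<partial>PN N) \<le> ennreal \<kappa>"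
      proof -
        have ki: "integrable (PN N) (\<lambda>w. (\<kappa> + (D w)\<^sup>2 / \<kappa>) / 2)"
          by (intro integrable_divide Bochner_Integration.integrable_add integrable_const S(1))
        have "(\<integral>\<^sup>+w. ennreal \<bar>D w\<bar> \<partial>PN N) \<le> (\<integral>\<^sup>+w. ennreal ((\<kappa> + (D w)\<^sup>2 / \<kappa>) / 2) \<partial>PN N)"
          by (intro nn_integral_mono ennreal_leI abs_le_weighted_square \<kappa>)
        also have "\<dots> = ennreal (\<integral>w. (\<kappa> + (D w)\<^sup>2 / \<kappa>) / 2 \<partial>PN N)"
          by (rule nn_integral_eq_integral[OF ki]) (use \<kappa> in simp)
        also have "(\<integral>w. (\<kappa> + (D w)\<^sup>2 / \<kappa>) / 2 \<partial>PN N) = (\<kappa> + (\<integral>w. (D w)\<^sup>2 \<partial>PN N) / \<kappa>) / 2"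
          using S(1) by (simp add: prob_space)
        also have "ennreal \<dots> \<le> ennreal \<kappa>"
        proof (rule ennreal_leI)
          have "(\<integral>w. (D w)\<^sup>2 \<partial>PN N) \<le> \<kappa> * \<kappa>" using S(2) elim(3) by linarith
          then have "(\<integral>w. (D w)\<^sup>2 \<partial>PN N) / \<kappa> \<le> \<kappa>" using \<kappa> by (simp add: pos_divide_le_eq)
          then show "(\<kappa> + (\<integral>w. (D w)\<^sup>2 \<partial>PN N) / \<kappa>) / 2 \<le> \<kappa>" by simp
        qed
        finally show ?thesis .
      qed
      have eq: "AE w in PN N. IN N 0 w - IN N (dy M) w = A w + D w - B w"
        using V_AE_integrable[OF e(1,2), of N] V_AE_integrable[OF e(3) dM, of N]
 a3 b3
      proof eventually_elim
        case (elim w)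
        have i: "integrable lborel (\<lambda>x. f x * V N 0 w x - f x * (V N 0 w x - U N k0 0 (KN N) w x))"
          "integrable lborel (\<lambda>x. f x * V N (dy M) w x - f x * (V N (dy M) w x - U N k0 (dy M) M w x))"
          by (rule Bochner_Integration.integrable_diff[OF elim(1,3)], rule Bochner_Integration.integrable_diff[OF elim(2,4)])
        have "f x * Df N k0 M w x = (f x * V N 0 w x - f x * (V N 0 w x - U N k0 0 (KN N) w x)) - (f x * V N (dy M) w x - f x * (V N (dy M) w x - U N k0 (dy M) M w x))" for x
          unfolding Df_def by (simp add: right_diff_distrib)
        then have "D w = (\<integral>x. f x * V N 0 w x - f x * (V N 0 w x - U N k0 0 (KN N) w x) \<partial>lborel) - (\<integral>x. f x * V N (dy M) w x - f x * (V N (dy M) w x - U N k0 (dy M) M w x) \<partial>lborel)"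
          unfolding D_def by (simp only: Bochner_Integration.integral_diff[OF i])
        also have "\<dots> = (IN N 0 w - A w) - (IN N (dy M) w - B w)"
          unfolding Bochner_Integration.integral_diff[OF elim(1,3)] Bochner_Integration.integral_diff[OF elim(2,4)] IN_def A_def B_def ..
        finally show ?case by simp
      qed
      have "(\<integral>\<^sup>+w. ennreal \<bar>IN N 0 w - IN N (dy M) w\<bar> \<partial>PN N) \<le> (\<integral>\<^sup>+w. (ennreal \<bar>A w\<bar> + ennreal \<bar>D w\<bar>) + ennreal \<bar>B w\<bar> \<partial>PN N)"
      proof (rule nn_integral_mono_AE)
        show "AE w in PN N. ennreal \<bar>IN N 0 w - IN N (dy M) w\<bar> \<le> (ennreal \<bar>A w\<bar> + ennreal \<bar>D w\<bar>) + ennreal \<bar>B w\<bar>"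
          using eq
        proof eventually_elim
          case (elim w)
          have "\<bar>A w + D w - B w\<bar> \<le> \<bar>A w\<bar> + \<bar>D w\<bar> + \<bar>B w\<bar>" by linarith
          then have "ennreal \<bar>A w + D w - B w\<bar> \<le> ennreal (\<bar>A w\<bar> + \<bar>D w\<bar> + \<bar>B w\<bar>)" by (rule ennreal_leI)
          then show ?case unfolding elim by simp
        qed
      qed
      also have "\<dots> = (\<integral>\<^sup>+w. ennreal \<bar>A w\<bar> \<partial>PN N) + (\<integral>\<^sup>+w. ennreal \<bar>D w\<bar> \<partial>PN N) + (\<integral>\<^sup>+w. ennreal \<bar>B w\<bar> \<partial>PN N)"
      proof -
        have Am: "A \<in> borel_measurable (PN N)" "B \<in> borel_measurable (PN N)" unfolding A_def B_def by measurable
        then show ?thesis using Dm by (simp add: nn_integral_add)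
      qed
      also have "\<dots> \<le> ennreal \<kappa> + ennreal \<kappa> + ennreal (2 * \<kappa>)" by (intro add_mono ale dle ble)
      also have "\<dots> = ennreal \<delta>" using \<kappa> by (simp add: ennreal_plus[symmetric] \<kappa>_def del: ennreal_plus)
      finally show ?case .
    qed
    then show ?thesis using dM by simp
  qed
  then show ?thesis by (intro exI[of _ M0]) simp
qed

lemma char_limit:
  assumes Zm: "Z \<in> borel_measurable Pm"
    and Z: "((\<lambda>e. \<integral>\<^sup>+w. ennreal \<bar>IP e w - Z w\<bar> \<partial>Pm) \<longlongrightarrow> 0) (at_right 0)"
  shows "(\<lambda>N. \<integral>w. iexp (t * IN N 0 w) \<partial>PN N) \<longlonglongrightarrow> (\<integral>w. iexp (t * Z w) \<partial>Pm)"
proof (rule tendstoI)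
  fix \<epsilon> :: real assume \<epsilon>: "0 < \<epsilon>"
  define \<delta> where "\<delta> = \<epsilon> / 4 / (\<bar>t\<bar> + 1)"
  have \<delta>: "0 < \<delta>" using \<epsilon> by (simp add: \<delta>_def)
  have td: "\<bar>t\<bar> * \<delta> \<le> \<epsilon> / 4"
  proof -
    have "\<bar>t\<bar> * \<delta> \<le> (\<bar>t\<bar> + 1) * \<delta>" using \<delta> by (intro mult_right_mono) auto
    also have "\<dots> = \<epsilon> / 4" unfolding \<delta>_def by (rule nonzero_mult_div_cancel_left[of "\<bar>t\<bar> + 1", unfolded times_divide_eq_right[symmetric]]) simp
    finally show ?thesis .
  qed
  from mollified_approximation[OF \<delta>] obtain M0 where M0: "\<forall>M\<ge>M0. dy M \<le> \<eta>0 \<and> (\<forall>\<^sub>F N in sequentially. (\<integral>\<^sup>+w. ennreal \<bar>IN N 0 w - IN N (dy M) w\<bar> \<partial>PN N) \<le> ennreal \<delta>)"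
    by (elim exE)
  have "filterlim dy (at_right 0) sequentially"
    unfolding filterlim_at using dy_tendsto dy_pos by (simp add: less_imp_neq[symmetric])
  then have "(\<lambda>M. \<integral>\<^sup>+w. ennreal \<bar>IP (dy M) w - Z w\<bar> \<partial>Pm) \<longlonglongrightarrow> 0" by (rule filterlim_compose[OF Z])
  then have "\<forall>\<^sub>F M in sequentially. (\<integral>\<^sup>+w. ennreal \<bar>IP (dy M) w - Z w\<bar> \<partial>Pm) < ennreal \<delta>"
    by (rule order_tendstoD) (use \<delta> in simp)
  then have "\<forall>\<^sub>F M in sequentially. (\<integral>\<^sup>+w. ennreal \<bar>IP (dy M) w - Z w\<bar> \<partial>Pm) < ennreal \<delta> \<and> M0 \<le> M"
    by (rule eventually_conj) (rule eventually_ge_at_top)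
  then obtain M where M: "(\<integral>\<^sup>+w. ennreal \<bar>IP (dy M) w - Z w\<bar> \<partial>Pm) < ennreal \<delta>" "M0 \<le> M"
    using eventually_happens'[OF sequentially_bot] by blast
  have dM: "dy M \<le> \<eta>0" and ap: "\<forall>\<^sub>F N in sequentially. (\<integral>\<^sup>+w. ennreal \<bar>IN N 0 w - IN N (dy M) w\<bar> \<partial>PN N) \<le> ennreal \<delta>"
    using M0[rule_format, OF M(2)] by (rule conjunct1, rule conjunct2)
  interpret P: prob_space Pm by (rule P_prob)
  have z: "cmod ((\<integral>w. iexp (t * IP (dy M) w) \<partial>Pm) - (\<integral>w. iexp (t * Z w) \<partial>Pm)) \<le> \<bar>t\<bar> * \<delta>"
    by (rule P.iexp_expectation_diff_le[OF mollified_integral_law(1)[OF dy_pos dM] Zm less_imp_le[OF M(1)] less_imp_le[OF \<delta>]])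
  have "0 < \<epsilon> / 4" using \<epsilon> by simp
  from tendstoD[OF mollified_integral_law(2)[OF dy_pos dM, of t] this] ap
  show "\<forall>\<^sub>F N in sequentially. dist (\<integral>w. iexp (t * IN N 0 w) \<partial>PN N) (\<integral>w. iexp (t * Z w) \<partial>Pm) < \<epsilon>"
  proof eventually_elim
    case (elim N)
    interpret prob_space "PN N" by (rule PN_prob)
    have "cmod ((\<integral>w. iexp (t * IN N 0 w) \<partial>PN N) - (\<integral>w. iexp (t * IN N (dy M) w) \<partial>PN N)) \<le> \<bar>t\<bar> * \<delta>"
      by (rule iexp_expectation_diff_le[OF IN_measurable IN_measurable elim(2) less_imp_le[OF \<delta>]])
    then have "dist (\<integral>w. iexp (t * IN N 0 w) \<partial>PN N) (\<integral>w. iexp (t * IN N (dy M) w) \<partial>PN N) \<le> \<epsilon> / 4"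
      unfolding dist_norm using td by linarith
    moreover have "dist (\<integral>w. iexp (t * IP (dy M) w) \<partial>Pm) (\<integral>w. iexp (t * Z w) \<partial>Pm) \<le> \<epsilon> / 4"
      unfolding dist_norm using z td by linarith
    moreover note elim(1)
    ultimately show ?case using \<epsilon>
      dist_triangle[of "\<integral>w. iexp (t * IN N 0 w) \<partial>PN N" "\<integral>w. iexp (t * Z w) \<partial>Pm" "\<integral>w. iexp (t * IN N (dy M) w) \<partial>PN N"]
      dist_triangle[of "\<integral>w. iexp (t * IN N (dy M) w) \<partial>PN N" "\<integral>w. iexp (t * Z w) \<partial>Pm" "\<integral>w. iexp (t * IP (dy M) w) \<partial>Pm"]
      by linarith
  qed
qed

end

theorem theorem2p6:
  fixes \<Omega> :: "'a::euclidean_space set"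
    and g :: "'a \<Rightarrow> 'a \<Rightarrow> real"
    and \<phi> :: "'a \<Rightarrow> real"
    and Pm :: "'w measure" and Xg :: "'w \<Rightarrow> ('a \<Rightarrow> real) \<Rightarrow> real"
    and PN :: "nat \<Rightarrow> 'b measure" and XN :: "nat \<Rightarrow> 'b \<Rightarrow> 'a \<Rightarrow> real"
    and \<epsilon>N :: "nat \<Rightarrow> real" and \<gamma> :: real
    and f :: "'a \<Rightarrow> real" and Z :: "'w \<Rightarrow> real"
  (* the domain *)
  assumes dom: "open \<Omega>" "bounded \<Omega>" "simply_connected \<Omega>" "smooth_boundary \<Omega>"
  (* the covariance Sigma = log|x-y|^{-1} + g *)
    and g_cont: "continuous_on (\<Omega> \<times> \<Omega>) (\<lambda>(x,y). g x y)"
    and g_bdd_above: "\<exists>B. \<forall>x\<in>\<Omega>. \<forall>y\<in>\<Omega>. g x y \<le> B"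
    and g_L2: "set_integrable lborel (\<Omega> \<times> \<Omega>) (\<lambda>(x,y). (g x y)^2)"
    and Sig_sym: "\<forall>x\<in>\<Omega>. \<forall>y\<in>\<Omega>. Sig g x y = Sig g y x"
    and Sig_posdef: "\<forall>h. Cc_inf \<Omega> h \<and> h \<noteq> (\<lambda>_. 0) \<longrightarrow> field_cov \<Omega> g h h > 0"
  (* the mollifier *)
    and phi: "C_inf UNIV \<phi>" "\<forall>x. 0 \<le> \<phi> x" "\<forall>x y. norm x = norm y \<longrightarrow> \<phi> x = \<phi> y"
      "compact (supp \<phi>)" "integral\<^sup>L lborel \<phi> = 1"
  (* P: law of the centered Gaussian log-correlated field with covariance Sigma;
     Xg \<omega> h stands for the pairing <h, X> *)
    and P_prob: "prob_space Pm"
    and P_meas: "\<forall>h. Cc_inf UNIV h \<longrightarrow> (\<lambda>\<omega>. Xg \<omega> h) \<in> borel_measurable Pm"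
    and P_lin: "\<forall>\<omega> h k (a::real) b. Cc_inf UNIV h \<and> Cc_inf UNIV k \<longrightarrow>
                  Xg \<omega> (\<lambda>u. a * h u + b * k u) = a * Xg \<omega> h + b * Xg \<omega> k"
    and P_gauss: "\<forall>h. Cc_inf UNIV h \<longrightarrow> (\<forall>t. char (distr Pm borel (\<lambda>\<omega>. Xg \<omega> h)) t
                     = complex_of_real (exp (- (t^2 * field_cov \<Omega> g h h) / 2)))"
    and P_cont: "\<forall>\<omega>. \<forall>e>0. continuous_on UNIV (\<lambda>x. Xg \<omega> (\<lambda>u. phi_eps \<phi> e (x - u)))"
  (* the measures P_N *)
    and PN_prob: "\<forall>N. prob_space (PN N)"
    and XN_meas: "\<forall>N. (\<lambda>(\<omega>,x). XN N \<omega> x) \<in> borel_measurable (PN N \<Otimes>\<^sub>M lborel)"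
    and XN_int: "\<forall>N \<omega>. set_integrable lborel \<Omega> (XN N \<omega>)"
    and XN_bdd: "\<forall>N \<omega>. \<exists>B. \<forall>x\<in>\<Omega>. XN N \<omega> x \<le> B"
    and XN_usc: "\<forall>N \<omega>. usc_on \<Omega> (XN N \<omega>)"
    and XN_expmom: "\<forall>N (\<alpha>::real) x. \<alpha> > 0 \<and> x \<in> \<Omega> \<longrightarrow> integrable (PN N) (\<lambda>\<omega>. exp (\<alpha> * XN N \<omega> x))"
    and XN_expint: "\<forall>N h. Cc_inf \<Omega> h \<longrightarrow>
                     integrable (PN N) (\<lambda>\<omega>. exp (LINT u:\<Omega>|lborel. h u * XN N \<omega> u))"
    and XN_law: "\<forall>h. Cc_inf \<Omega> h \<longrightarrow>
                  weak_conv_m (\<lambda>N. distr (PN N) borel (\<lambda>\<omega>. LINT u:\<Omega>|lborel. h u * XN N \<omega> u))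
                              (distr Pm borel (\<lambda>\<omega>. Xg \<omega> h))"
  (* gamma and the sequence epsilon_N *)
    and gamma: "0 < \<gamma>" "\<gamma> < sqrt (2 * real DIM('a))"
    and epsN: "\<forall>N. 0 < \<epsilon>N N" "\<epsilon>N \<longlonglongrightarrow> 0"
  (* conditions (A1)-(A8) *)
    and "A1 \<Omega> g \<phi> PN XN \<gamma>" "A2 \<Omega> \<phi> PN XN \<gamma>" "A3 \<Omega> \<phi> PN XN \<gamma> \<epsilon>N"
        "A4 \<Omega> g \<phi> PN XN \<gamma> \<epsilon>N" "A5 \<Omega> \<phi> PN XN \<gamma> \<epsilon>N" "A6 \<Omega> g \<phi> PN XN \<gamma>"
        "A7 \<Omega> g \<phi> PN XN \<gamma> \<epsilon>N" "A8 \<Omega> \<phi> PN XN \<gamma> \<epsilon>N"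
  (* f in C_c(Omega), and Z = int f d mu^gamma, the L^1(P) limit of the mollified chaos integrals *)
    and f: "Cc \<Omega> f"
    and Z_meas: "Z \<in> borel_measurable Pm"
    and Z_lim: "((\<lambda>e. \<integral>\<^sup>+ \<omega>. ennreal \<bar>(LINT x|lborel. f x *
                     exp (\<gamma> * Xg \<omega> (\<lambda>u. phi_eps \<phi> e (x - u)) - \<gamma>^2 / 2 * cov \<Omega> g \<phi> e x e x))
                   - Z \<omega>\<bar> \<partial>Pm) \<longlongrightarrow> 0) (at_right 0)"
  shows "weak_conv_m
           (\<lambda>N. distr (PN N) borel
                  (\<lambda>\<omega>. LINT x:\<Omega>|lborel. f x * exp (\<gamma> * XN N \<omega> x) / EN PN N (\<lambda>\<omega>'. exp (\<gamma> * XN N \<omega>' x))))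
           (distr Pm borel Z)"
proof -
  note A1 = \<open>A1 \<Omega> g \<phi> PN XN \<gamma>\<close> and A2 = \<open>A2 \<Omega> \<phi> PN XN \<gamma>\<close> and A3 = \<open>A3 \<Omega> \<phi> PN XN \<gamma> \<epsilon>N\<close>
    and A4 = \<open>A4 \<Omega> g \<phi> PN XN \<gamma> \<epsilon>N\<close> and A5 = \<open>A5 \<Omega> \<phi> PN XN \<gamma> \<epsilon>N\<close> and A6 = \<open>A6 \<Omega> g \<phi> PN XN \<gamma>\<close>
    and A7 = \<open>A7 \<Omega> g \<phi> PN XN \<gamma> \<epsilon>N\<close> and A8 = \<open>A8 \<Omega> \<phi> PN XN \<gamma> \<epsilon>N\<close>
  define K where "K = supp f"
  have K: "compact K" "K \<subseteq> \<Omega>" using f by (simp_all add: K_def Cc_def)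
  have f_zero: "f x = 0" if "x \<notin> K" for x using that closure_subset[of "{x. f x \<noteq> 0}"] by (auto simp: K_def supp_def)
  obtain R0 where R0: "\<And>x. x \<in> supp \<phi> \<Longrightarrow> norm x \<le> R0"
    using compact_imp_bounded[OF phi(4)] unfolding bounded_iff by blast
  define R where "R = max 1 R0"
  have R: "supp \<phi> \<subseteq> cball 0 R" "1 \<le> R" using R0 by (auto simp: R_def le_max_iff_disj)
  obtain r where r: "0 < r" "(\<Union>x\<in>K. cball x r) \<subseteq> \<Omega>"
    by (rule compact_subset_open_imp_cball_epsilon_subset[OF K(1) dom(1) K(2)])
  \<comment> \<open>Gives R * \<eta>0 <= r, so that the mollifiers centred in K stay in \<Omega>;
    the cap at 1 is the range of scales in (A4).\<close>
  define \<eta>0 where "\<eta>0 = min 1 (r / R)"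
  have \<eta>0: "0 < \<eta>0" "\<eta>0 \<le> 1" using r R by (simp_all add: \<eta>0_def)
  have "R * \<eta>0 \<le> R * (r / R)" using R by (intro mult_left_mono) (simp_all add: \<eta>0_def)
  then have "R * \<eta>0 \<le> r" using R by simp
  then have nb: "cball x (R * \<eta>0) \<subseteq> \<Omega>" if "x \<in> K" for x
    using r(2) that subset_cball[of "R * \<eta>0" r x] by blast
  have g2: "\<gamma>\<^sup>2 < 2 * real DIM('a)"
  proof -
    have "\<gamma>\<^sup>2 < (sqrt (2 * real DIM('a)))\<^sup>2" using gamma by (intro power_strict_mono) auto
    then show ?thesis by simp
  qed
  from A8 obtain \<tau> where \<tau>: "0 < \<tau>" "\<tau> < min ((real DIM('a) - \<gamma>^2 / 2)^2 / (4 * real DIM('a))) (\<gamma>^2 / 2)"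
    and t8: "\<forall>A::('a \<times> 'a) set. compact A \<and> A \<subseteq> \<Omega> \<times> \<Omega> \<longrightarrow> (\<exists>C. \<forall>\<^sub>F N in sequentially.
        (\<integral>\<^sup>+ p. indicator A p * indicator {p. dist (fst p) (snd p) \<le> \<epsilon>N N} p *
                 ennreal (WN \<Omega> \<phi> PN XN \<gamma> N 0 0 (fst p) (snd p)) \<partial>lborel)
        \<le> ennreal (C * \<epsilon>N N powr (- max (\<gamma>^2 - real DIM('a)) 0 - \<tau>)))"
    unfolding A8_def by (elim exE conjE)
  define \<theta> where "\<theta> = max (\<gamma>\<^sup>2 - real DIM('a)) 0 + \<tau>"
  \<comment> \<open>If \<gamma>^2 > d, then \<theta> < \<gamma>^2 / 2 amounts to \<tau> < u = d -
    \<gamma>^2 / 2, and the first bound on \<tau> gives \<tau> < u^2 / (4d) <= u. Otherwise \<theta>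
    = \<tau>, and the second bound applies.\<close>
  have \<theta>: "0 < \<theta>" "\<gamma>\<^sup>2 - real DIM('a) < \<theta>" "\<theta> < \<gamma>\<^sup>2 / 2"
  proof -
    define u where "u = real DIM('a) - \<gamma>\<^sup>2 / 2"
    have u: "0 < u" "u \<le> real DIM('a)" using g2 by (simp_all add: u_def)
    have "u\<^sup>2 \<le> u * real DIM('a)" unfolding power2_eq_square using u by (intro mult_left_mono) auto
    then have "u\<^sup>2 / (4 * real DIM('a)) \<le> u * real DIM('a) / (4 * real DIM('a))" by (intro divide_right_mono) auto
    also have "\<dots> \<le> u" using u by simp
    finally have "\<tau> < u" using \<tau>(2) unfolding u_def[symmetric] by simp
    then show "0 < \<theta>" "\<gamma>\<^sup>2 - real DIM('a) < \<theta>" "\<theta> < \<gamma>\<^sup>2 / 2" using \<tau> unfolding \<theta>_def u_def by (auto simp: max_def)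
  qed
  obtain C where C: "\<forall>\<^sub>F N in sequentially. (\<integral>\<^sup>+ p. indicator (K \<times> K) p * indicator {p. dist (fst p) (snd p) \<le> \<epsilon>N N} p *
                 ennreal (WN \<Omega> \<phi> PN XN \<gamma> N 0 0 (fst p) (snd p)) \<partial>lborel)
        \<le> ennreal (C * \<epsilon>N N powr (- max (\<gamma>^2 - real DIM('a)) 0 - \<tau>))"
    using t8[THEN spec[of _ "K \<times> K"], THEN mp] K by (auto intro: compact_Times)
  \<comment> \<open>This is \<open>be\<close> for \<alpha> = 2\<gamma> - b. Its square is the
    midpoint of 2\<theta> and \<gamma>^2: b^2 > 2\<theta> beats (A8), b < \<gamma> gives \<alpha> >
    \<gamma>, and s = \<gamma>^2 - b^2 / 2 < d follows from \<theta> > \<gamma>^2 - d and \<gamma>^2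
    < 2d.\<close>
  define b where "b = sqrt (\<theta> + \<gamma>\<^sup>2 / 2)"
  have b2: "b\<^sup>2 = \<theta> + \<gamma>\<^sup>2 / 2" using \<theta>(1) by (simp add: b_def)
  have b: "0 < b" "b < \<gamma>"
  proof -
    have "0 < \<theta> + \<gamma>\<^sup>2 / 2" using \<theta>(1) by (intro add_pos_nonneg) simp_all
    then show "0 < b" unfolding b_def by simp
    have "b\<^sup>2 < \<gamma>\<^sup>2" unfolding b2 using \<theta>(3) by simp
    then show "b < \<gamma>" by (rule power2_less_imp_less) (use gamma in simp)
  qed
  have fc: "continuous_on UNIV f" using f by (simp add: Cc_def)
  have al: "\<gamma> < 2 * \<gamma> - b" "2 * \<gamma> - b < 2 * \<gamma>" using b by simp_all
  interpret T: gmc_thick \<phi> R \<Omega> g K \<eta>0 Pm Xg PN XN \<epsilon>N \<gamma> f "2 * \<gamma> - b"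
    by (intro gmc_thick.intro gmc_test.intro gmc_approximation.intro log_kernel.intro mollifier.intro log_kernel_axioms.intro
        gmc_approximation_axioms.intro gmc_test_axioms.intro gmc_thick_axioms.intro)
      (rule phi(1,5) phi(2)[rule_format] R dom(1) g_cont Sig_sym[rule_format] K(1) \<eta>0 nb P_prob P_meas[rule_format] P_lin[rule_format, OF conjI]
        P_gauss[rule_format] P_cont[rule_format] PN_prob[rule_format] XN_meas[rule_format] XN_int[rule_format] XN_expmom[rule_format, OF conjI]
        XN_expint[rule_format] XN_law[rule_format] gamma(1) g2 epsN(1)[rule_format] epsN(2) A1 A2 A3 A4 A5 A6 A7 A8 fc f_zero al; assumption)+
  have key: "x - (t + x / 2) / 2 < d" if "x - d < t" "x < 2 * d" for x d t :: real
    using that by (simp add: field_simps)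
  have key2: "t < (t + x / 2) / 2" if "t < x / 2" for x t :: real
    using that by (simp add: field_simps)
  have bb: "2 * \<gamma> - (2 * \<gamma> - b) = b" by simp
  interpret T: gmc_convergence \<phi> R \<Omega> g K \<eta>0 Pm Xg PN XN \<epsilon>N \<gamma> f "2 * \<gamma> - b" "max C 0" \<theta>
  proof
    show "T.s < real DIM('a)" unfolding T.s_def T.be_def bb b2 by (rule key[OF \<theta>(2) g2])
    show "\<theta> < T.be\<^sup>2 / 2" unfolding T.be_def bb b2 by (rule key2[OF \<theta>(3)])
    show "\<forall>\<^sub>F N in sequentially. (\<integral>\<^sup>+p. indicator (K \<times> K) p * indicator {p. dist (fst p) (snd p) \<le> \<epsilon>N N} p
        * ennreal (WN \<Omega> \<phi> PN XN \<gamma> N 0 0 (fst p) (snd p)) \<partial>(lborel \<Otimes>\<^sub>M lborel)) \<le> ennreal (max C 0 * \<epsilon>N N powr (- \<theta>))"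
      using C
    proof eventually_elim
      case (elim N)
      have "C * \<epsilon>N N powr (- max (\<gamma>^2 - real DIM('a)) 0 - \<tau>) \<le> max C 0 * \<epsilon>N N powr (- \<theta>)"
        unfolding \<theta>_def minus_add_distrib diff_conv_add_uminus by (intro mult_right_mono) auto
      then show ?case unfolding lborel_prod by (rule order_trans[OF elim ennreal_leI])
    qed
  qed simp
  have eq: "(LINT x:\<Omega>|lborel. f x * exp (\<gamma> * XN N w x) / EN PN N (\<lambda>w'. exp (\<gamma> * XN N w' x))) = T.IN N 0 w" for N w
    unfolding set_lebesgue_integral_def T.IN_def T.V_def T.mN_def T.X_zero EN_def
  proof (intro Bochner_Integration.integral_cong refl)
    fix x
    show "indicat_real \<Omega> x *\<^sub>R (f x * exp (\<gamma> * XN N w x) / (\<integral>w'. exp (\<gamma> * XN N w' x) \<partial>PN N)) = f x * (exp (\<gamma> * XN N w x) / (\<integral>w. exp (\<gamma> * XN N w x) \<partial>PN N))"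
      using f_zero[of x] K(2) by (cases "x \<in> K") auto
  qed
  have Z0: "((\<lambda>e. \<integral>\<^sup>+ w. ennreal \<bar>T.IP e w - Z w\<bar> \<partial>Pm) \<longlongrightarrow> 0) (at_right 0)"
    unfolding T.IP_def T.VP_def by (rule Z_lim)
  show ?thesis unfolding eq
  proof (rule levy_continuity)
    interpret P: prob_space Pm by (rule P_prob)
    show "real_distribution (distr Pm borel Z)" by (rule P.real_distribution_distr[OF Z_meas])
    fix N
    interpret Q: prob_space "PN N" by (rule T.PN_prob)
    show "real_distribution (distr (PN N) borel (T.IN N 0))" by (rule Q.real_distribution_distr[OF T.IN_measurable])
  next
    fix t
    show "(\<lambda>N. char (distr (PN N) borel (T.IN N 0)) t) \<longlonglongrightarrow> char (distr Pm borel Z) t"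
      using T.char_limit[OF Z_meas Z0, of t] unfolding char_def
      by (simp add: integral_distr Z_meas)
  qed
qed

end
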